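(* (1) For every $m\ge1$ the map $\mathsf q_{(m)}:\mathbb Q_{q,t}[Y^{\pm1}]_{(m)}\to\mathbb Q_{q,t}[X^{\pm1}]_{(m)}$, $\mathsf q_{(m)}(F(Y))=F(Y)\bullet 1$, is an isomorphism of $\mathbb Q_{q,t}$-vector spaces, and for any $0<m'<m$ and $F(Y)\in\mathbb Q_{q,t}[Y]_{(m)}$, $$\mathsf q_{(m')}(\pi_{m,m'}(F(Y)))=\pi_{m,m'}(\mathsf q_{(m)}(F(Y))).$$ In particular one obtains a well-defined linear isomorphism $\mathsf q:\mathbb Q_{q,t}[Y]_{(\infty)}\xrightarrow{\sim}\mathbb Q_{q,t}[X]_{(\infty)}$. (2) Define a commutative associative multiplication $\star$ on $\mathbb Q_{q,t}[X]_{(\infty)}$ by $F\star G:=\mathsf q\big(\mathsf q^{-1}(F)\cdot\mathsf q^{-1}(G)\big)$, where $\cdot$ is the usual multiplication on $\mathbb Q_{q,t}[Y]_{(\infty)}$. This multiplication preserves the subspace $\Lambda_{q,t}\subset\mathbb Q_{q,t}[X]_{(\infty)}$, and it reduces to the usual multiplication at $q=1$ if one of $F$ or $G$ is in $\Lambda_{q,t}$; that is, if $F,G$ have all coefficients regular at $q=1$ and one of them lies in $\Lambda_{q,t}$, then $F\star G$ has all coefficients regular at $q=1$ and $(F\star G)|_{q=1}=F|_{q=1}\cdot G|_{q=1}$. (3) For any unit interval graph $\Gamma$, $$\mathbf X_\Gamma(q,t)=\mathsf q(\mathbf Y_\Gamma(t)),$$ where $\mathbf Y_\Gamma(t)\in\mathbb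 Q_{q,t}[Y]_{(\infty)}$ is the chromatic quasisymmetric function of $\Gamma$ written in the $Y$-variables. (4) For any partition $\lambda=(\lambda_1,\dots,\lambda_l)$, $$\mathsf q(e_\lambda(Y))=t^{\sum_i\lambda_i(\lambda_i-1)/2}\,e^{(q,t)}_\lambda(X),\qquad\text{where } e^{(q,t)}_\lambda(X):=e_{\lambda_1}(X)\star\cdots\star e_{\lambda_l}(X)\in\Lambda_{q,t}.$$
   Context: Let $q,t$ be indeterminates and $\mathbb Q_{q,t}=\mathbb Q(q,t)$. For $m\ge1$ put $\mathbb Q_{q,t}[X]_{(m)}=\mathbb Q_{q,t}[X_1,\dots,X_m]\subset\mathbb Q_{q,t}[X^{\pm1}]_{(m)}=\mathbb Q_{q,t}[X_1^{\pm1},\dots,X_m^{\pm1}]$, with the convention $X_{i+km}=q^{-k}X_i$ for $1\le i\le m$, $k\in\mathbb Z$ (so $X_0=qX_m$, $X_{m+1}=q^{-1}X_1$). Affine Hecke algebra: $\mathscr H_m$ is the $\mathbb Q_{q,t}$-algebra generated by $T_i$ ($i\in\mathbb Z/m\mathbb Z$) and $\Pi^{\pm1}$ with relations $(T_i-t)(T_i+1)=0$; $T_iT_{i+1}T_i=T_{i+1}T_iT_{i+1}$ if $m>2$; $T_iT_j=T_jT_i$ if $j\ne i\pm1$; $\Pi T_i=T_{i+1}\Pi$. (For $m=1$ no $T_i$ are present: $\mathscr H_1$ is generated by $\Pi^{\pm1}$.) It acts (action denoted $\bullet$) on $\mathbb Q_{q,t}[X^{\pm1}]_{(m)}$ by $$T_i\bullet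 F=t\,s_i(F)+(t-1)\frac{F-s_i(F)}{1-X_iX_{i+1}^{-1}},\qquad \Pi\bullet F=X_1F(X_2,\dots,X_m,X_{m+1}),$$ where for $1\le i\le m-1$ $s_i$ swaps $X_i$ and $X_{i+1}$, and $s_0(F)=X_1X_0^{-1}F(X_0,X_2,\dots,X_{m-1},X_{m+1})$. For $1\le i\le m$, $Y_i:=t^{m-i}T_{i-1}T_{i-2}\cdots T_1\,\Pi\,T_{m-1}^{-1}T_{m-2}^{-1}\cdots T_i^{-1}\in\mathscr H_m$. It is well known that these commute and generate a Laurent polynomial subalgebra $\mathbb Q_{q,t}[Y^{\pm1}]_{(m)}\subset\mathscr H_m$; $\mathbb Q_{q,t}[Y]_{(m)}$ is the polynomial part. $\pi_{m,m'}$ (for $m'<m$) is the truncation map setting the last $m-m'$ variables (numbered $m'+1,\dots,m$) to $0$, both for $X$- and $Y$-polynomials. $\mathbb Q_{q,t}[X]_{(\infty)}=\bigoplus_{d\ge0}\varprojlim_m(\mathbb Q_{q,t}[X]_{(m)})_d$ ($d$ = degree, limit along $\pi_{m,m'}$), with its natural ring structure; similarly $\mathbb Q_{q,t}[Y]_{(\infty)}$. $\Lambda_{q,t}=\bigoplus_{d\ge0}\varprojlim_m(\mathbb Q_{q,t}[X]_{(m)})_d^{\mathfrak S_m}\subset\mathbb Q_{q,t}[X]_{(\infty)}$ is the ring of symmetric functions. $e_r$ is the $r$-th elementary symmetric function, $e_\lambda=\prod_ie_{\lambda_i}$. "Regular at $q=1$" means: lies in the subring of $\mathbb Q(t)(q)$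 of rational functions of $q$ over $\mathbb Q(t)$ without pole at $q=1$. $\mathbb E_n=\{\mathsf e:\{1,\dots,n\}\to\mathbb Z\mid 0\le\mathsf e(i)<i,\ \mathsf e(i)\le\mathsf e(i+1)\}$. The unit interval graph $\Gamma_{\mathsf e}$ ($\mathsf e\in\mathbb E_n$) has vertex set $\{1,\dots,n\}$ and an oriented edge $j\to i$ exactly when $\mathsf e(i)<j<i$; unit interval graphs are the graphs of this form. The chromatic quasisymmetric function of an oriented graph $\Gamma$ is $\sum_\kappa t^{\mathrm{asc}(\kappa)}\prod_{v}X_{\kappa(v)}$, the sum over proper colorings $\kappa$ from vertices to $\mathbb Z_{>0}$ ($\kappa(v)\ne\kappa(w)$ for every edge $v\to w$), with $\mathrm{asc}(\kappa)$ the number of edges $v\to w$ with $\kappa(v)<\kappa(w)$; $\mathbf Y_\Gamma(t)$ is the same series with $Y_{\kappa(v)}$ in place of $X_{\kappa(v)}$. It is symmetric for unit interval graphs. For integers $i,e$ with $e<i$, $\mathsf S^{(m)}_{i,e}:=1+T_i^{-1}+T_{i+1}^{-1}T_i^{-1}+\cdots+T_{m+e-1}^{-1}\cdots T_i^{-1}\in\mathscr H_m$ if $e\ge i-m$ ($m+e-i+1$ terms, indices modulo $m$), and $\mathsf S^{(m)}_{i,e}:=0$ if $e<i-m$. For $\Gamma=\Gamma_{\mathsf e}$, $\mathbf X_\Gamma^{(m)}(q,t):=t^{n(m-1)}\mathsf S^{(m)}_{1,\mathsf e(1)}\cdots\mathsf S^{(m)}_{n,\mathsf e(n)}\Pi^n\bullet1$.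 These are symmetric polynomials in $X_1,\dots,X_m$ compatible under $\pi_{m,m'}$, and $\mathbf X_\Gamma(q,t)\in\Lambda_{q,t}$ denotes the symmetric function whose $m$-variable truncation is $\mathbf X_\Gamma^{(m)}(q,t)$ for all $m\ge1$. *)

theory Defs
  imports
    "HOL-Computational_Algebra.Polynomial"
    "HOL-Computational_Algebra.Fraction_Field"
    "HOL-Combinatorics.Permutations"
    "HOL-Library.Poly_Mapping"
    "HOL-Library.Function_Algebras"
    "HOL-Library.FuncSet"
    "HOL-Algebra.QuotRing"
begin

section \<open>The coefficient field\<close>

type_synonym Qt = "rat poly fract"

text \<open>The field of rational functions in $q, t$ is realised as $\mathbb{Q}(t)(q)$.\<close>

type_synonym Qqt = "Qt poly fract"

definition tvar :: Qqt where
  "tvar = Fract [:Fract [:0, 1:] 1:] 1"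

definition qvar :: Qqt where
  "qvar = Fract [:0, 1:] 1"

definition regular_at_q1 :: "Qqt \<Rightarrow> bool" where
  "regular_at_q1 x \<longleftrightarrow> (\<exists>f g. poly g 1 \<noteq> 0 \<and> x = Fract f g)"

definition at_q1 :: "Qqt \<Rightarrow> Qt" where
  "at_q1 x = (THE c. \<exists>f g. poly g 1 \<noteq> 0 \<and> x = Fract f g \<and> c = poly f 1 / poly g 1)"


section \<open>Laurent polynomials\<close>

text \<open>An exponent vector is a finitely supported function from variable indices to integers;
  Laurent polynomials in $m$ variables only involve the indices $1, \dots, m$. The same rings
  serve for the $X$- and for the $Y$-variables.\<close>

type_synonym mono = "nat \<Rightarrow>\<^sub>0 int"

type_synonym 'k lpoly = "mono \<Rightarrow>\<^sub>0 'k"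

definition const :: "'k::comm_ring_1 \<Rightarrow> 'k lpoly" where
  "const c = Poly_Mapping.single 0 c"

definition var :: "nat \<Rightarrow> Qqt lpoly" where
  "var i = Poly_Mapping.single (Poly_Mapping.single i 1) 1"

definition laurent :: "nat \<Rightarrow> Qqt lpoly set" where
  "laurent m = {F. \<forall>a\<in>Poly_Mapping.keys F. Poly_Mapping.keys a \<subseteq> {1..m}}"

definition polys :: "nat \<Rightarrow> Qqt lpoly set" where
  "polys m = {F \<in> laurent m. \<forall>a\<in>Poly_Mapping.keys F. \<forall>i. 0 \<le> Poly_Mapping.lookup a i}"

definition homogeneous :: "nat \<Rightarrow> nat \<Rightarrow> Qqt lpoly \<Rightarrow> bool" where
  "homogeneous m d F \<longleftrightarrow> (\<forall>a\<in>Poly_Mapping.keys F. (\<Sum>i = 1..m. Poly_Mapping.lookup a i) = int d)"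

text \<open>For polynomials, setting all variables of index above \<open>m'\<close> to zero amounts to
  discarding the monomials in which such a variable occurs.\<close>

definition trunc :: "nat \<Rightarrow> Qqt lpoly \<Rightarrow> Qqt lpoly" where
  "trunc m' F =
    (\<Sum>a | a \<in> Poly_Mapping.keys F \<and> Poly_Mapping.keys a \<subseteq> {1..m'}.
        Poly_Mapping.single a (Poly_Mapping.lookup F a))"

text \<open>\<open>Xpow m k e\<close> is $X_k^e$ for arbitrary integers $k, e$, where $X_{i+jm} = q^{-j} X_i$ for
  $1 \le i \le m$.\<close>

definition Xpow :: "nat \<Rightarrow> int \<Rightarrow> int \<Rightarrow> Qqt lpoly" where
  "Xpow m k e =
    Poly_Mapping.single
      (Poly_Mapping.single (nat ((k - 1) mod int m + 1)) e)
      (qvar powi (- ((k - 1) div int m) * e))"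

text \<open>\<open>subst m f F\<close> is $F(X_{f(1)}, \dots, X_{f(m)})$.\<close>

definition subst :: "nat \<Rightarrow> (nat \<Rightarrow> int) \<Rightarrow> Qqt lpoly \<Rightarrow> Qqt lpoly" where
  "subst m f F =
    (\<Sum>a\<in>Poly_Mapping.keys F.
        const (Poly_Mapping.lookup F a) *
        (\<Prod>i = 1..m. Xpow m (f i) (Poly_Mapping.lookup a i)))"

definition sym_polys :: "nat \<Rightarrow> Qqt lpoly set" where
  "sym_polys m = {F \<in> polys m. \<forall>\<sigma>. \<sigma> permutes {1..m} \<longrightarrow> subst m (\<lambda>i. int (\<sigma> i)) F = F}"


section \<open>The operators on Laurent polynomials\<close>

definition s_op :: "nat \<Rightarrow> nat \<Rightarrow> Qqt lpoly \<Rightarrow> Qqt lpoly" where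
  "s_op m i F =
    (if i = 0
     then Xpow m 1 1 * Xpow m 0 (- 1) *
            subst m (\<lambda>j. if j = 1 then 0 else if j = m then int m + 1 else int j) F
     else subst m (\<lambda>j. if j = i then int i + 1 else if j = i + 1 then int i else int j) F)"

text \<open>The quotient in the Demazure--Lusztig operator is an exact division in the integral
  domain of Laurent polynomials.\<close>

definition T_op :: "nat \<Rightarrow> nat \<Rightarrow> Qqt lpoly \<Rightarrow> Qqt lpoly" where
  "T_op m i F =
    const tvar * s_op m i F +
    const (tvar - 1) *
      (THE G. G * (1 - Xpow m (int i) 1 * Xpow m (int i + 1) (- 1)) = F - s_op m i F)"

definition Pi_op :: "nat \<Rightarrow> Qqt lpoly \<Rightarrow> Qqt lpoly" where
  "Pi_op m F = Xpow m 1 1 * subst m (\<lambda>j. int j + 1) F"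


section \<open>The affine Hecke algebra\<close>

datatype hgen = Gen_T nat | Gen_Pi | Gen_Pi_inv

datatype hword = Word (letters: "hgen list")

text \<open>The free monoid, written additively so that finitely supported functions on it form the
  free associative algebra.\<close>

instantiation hword :: monoid_add
begin

definition zero_hword :: hword where
  "0 = Word []"

definition plus_hword :: "hword \<Rightarrow> hword \<Rightarrow> hword" where
  "u + v = Word (letters u @ letters v)"

instance
  by standard (simp_all add: zero_hword_def plus_hword_def)

end

type_synonym free_elt = "hword \<Rightarrow>\<^sub>0 Qqt"

definition hgens :: "nat \<Rightarrow> hgen set" where
  "hgens m = {Gen_Pi, Gen_Pi_inv} \<union> (if m \<ge> 2 then Gen_T ` {..<m} else {})"

definition free_alg :: "nat \<Rightarrow> free_elt ring" where
  "free_alg m =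
    \<lparr>carrier = {w. \<forall>u\<in>Poly_Mapping.keys w. set (letters u) \<subseteq> hgens m},
     mult = (*), one = 1, zero = 0, add = (+)\<rparr>"

definition free_const :: "Qqt \<Rightarrow> free_elt" where
  "free_const c = Poly_Mapping.single 0 c"

definition free_gen :: "hgen \<Rightarrow> free_elt" where
  "free_gen g = Poly_Mapping.single (Word [g]) 1"

text \<open>The index of $T_i$ is read modulo $m$.\<close>

definition free_T :: "nat \<Rightarrow> int \<Rightarrow> free_elt" where
  "free_T m i = free_gen (Gen_T (nat (i mod int m)))"

abbreviation free_Pi :: free_elt where
  "free_Pi \<equiv> free_gen Gen_Pi"

abbreviation free_Pi_inv :: free_elt where
  "free_Pi_inv \<equiv> free_gen Gen_Pi_inv"

definition hecke_rels :: "nat \<Rightarrow> free_elt set" where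
  "hecke_rels m =
    {free_Pi * free_Pi_inv - 1, free_Pi_inv * free_Pi - 1} \<union>
    (if m \<ge> 2 then
      {(free_T m i - free_const tvar) * (free_T m i + 1) | i. True} \<union>
      {free_T m i * free_T m (i + 1) * free_T m i
        - free_T m (i + 1) * free_T m i * free_T m (i + 1) | i. m > 2} \<union>
      {free_T m i * free_T m j - free_T m j * free_T m i | i j.
        j mod int m \<noteq> (i + 1) mod int m \<and> j mod int m \<noteq> (i - 1) mod int m} \<union>
      {free_Pi * free_T m i - free_T m (i + 1) * free_Pi | i. True}
     else {})"

definition hecke_ideal :: "nat \<Rightarrow> free_elt set" where
  "hecke_ideal m = genideal (free_alg m) (hecke_rels m)"

definition hecke :: "nat \<Rightarrow> free_elt set ring" where
  "hecke m = free_alg m Quot hecke_ideal m"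

definition hclass :: "nat \<Rightarrow> free_elt \<Rightarrow> free_elt set" where
  "hclass m w = hecke_ideal m +>\<^bsub>free_alg m\<^esub> w"

definition hconst :: "nat \<Rightarrow> Qqt \<Rightarrow> free_elt set" where
  "hconst m c = hclass m (free_const c)"

definition hT :: "nat \<Rightarrow> int \<Rightarrow> free_elt set" where
  "hT m i = hclass m (free_T m i)"

definition hT_inv :: "nat \<Rightarrow> int \<Rightarrow> free_elt set" where
  "hT_inv m i = inv\<^bsub>hecke m\<^esub> (hT m i)"

definition hPi :: "nat \<Rightarrow> free_elt set" where
  "hPi m = hclass m free_Pi"

definition hprod :: "nat \<Rightarrow> free_elt set list \<Rightarrow> free_elt set" where
  "hprod m hs = foldr (\<lambda>g h. g \<otimes>\<^bsub>hecke m\<^esub> h) hs \<one>\<^bsub>hecke m\<^esub>"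


subsection \<open>The action on Laurent polynomials\<close>

fun gen_act :: "nat \<Rightarrow> hgen \<Rightarrow> Qqt lpoly \<Rightarrow> Qqt lpoly" where
  "gen_act m (Gen_T i) F = T_op m i F"
| "gen_act m Gen_Pi F = Pi_op m F"
| "gen_act m Gen_Pi_inv F = inv_into (laurent m) (Pi_op m) F"

definition free_act :: "nat \<Rightarrow> free_elt \<Rightarrow> Qqt lpoly \<Rightarrow> Qqt lpoly" where
  "free_act m w F =
    (\<Sum>u\<in>Poly_Mapping.keys w.
        const (Poly_Mapping.lookup w u) * foldr (gen_act m) (letters u) F)"

text \<open>The operators satisfy the defining relations, so all representatives of a class act on
  \<open>laurent m\<close> in the same way.\<close>

definition hact :: "nat \<Rightarrow> free_elt set \<Rightarrow> Qqt lpoly \<Rightarrow> Qqt lpoly" where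
  "hact m h F = the_elem ((\<lambda>w. free_act m w F) ` h)"


subsection \<open>The commuting elements and the evaluation map\<close>

definition hY :: "nat \<Rightarrow> nat \<Rightarrow> free_elt set" where
  "hY m i = hprod m
    ([hconst m (tvar ^ (m - i))] @
     map (\<lambda>j. hT m (int j)) (rev [1..<i]) @
     [hPi m] @
     map (\<lambda>j. hT_inv m (int j)) (rev [i..<m]))"

text \<open>\<open>eval_Y m F\<close> is the element $F(Y_1, \dots, Y_m)$ of the affine Hecke algebra; via this map
  Laurent polynomials are identified with the subalgebra generated by the $Y_i^{\pm 1}$.\<close>

definition eval_Y :: "nat \<Rightarrow> Qqt lpoly \<Rightarrow> free_elt set" where
  "eval_Y m F =
    (\<Oplus>\<^bsub>hecke m\<^esub>a\<in>Poly_Mapping.keys F.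
        hconst m (Poly_Mapping.lookup F a) \<otimes>\<^bsub>hecke m\<^esub>
        hprod m (map (\<lambda>i. hY m i [^]\<^bsub>hecke m\<^esub> (Poly_Mapping.lookup a i)) [1..<Suc m]))"

definition q_map :: "nat \<Rightarrow> Qqt lpoly \<Rightarrow> Qqt lpoly" where
  "q_map m F = hact m (eval_Y m F) 1"


section \<open>Graded inverse limits\<close>

text \<open>An element of an inverse limit is a compatible family indexed by $m \ge 1$; families are
  functions on all natural numbers whose (meaningless) value at $0$ is $0$. Ring operations are
  pointwise. The direct sum over the degree is formed inside the space of all families.\<close>

type_synonym 'k family = "nat \<Rightarrow> 'k lpoly"

definition mk_family :: "(nat \<Rightarrow> 'k lpoly) \<Rightarrow> 'k::zero family" where
  "mk_family f = (\<lambda>m. if m = 0 then 0 else f m)"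

definition inv_limit :: "(nat \<Rightarrow> Qqt lpoly set) \<Rightarrow> nat \<Rightarrow> Qqt family set" where
  "inv_limit R d =
    {F. F 0 = 0 \<and> (\<forall>m\<ge>1. F m \<in> R m \<and> homogeneous m d (F m)) \<and>
        (\<forall>m m'. 0 < m' \<and> m' < m \<longrightarrow> trunc m' (F m) = F m')}"

definition graded_limit :: "(nat \<Rightarrow> Qqt lpoly set) \<Rightarrow> Qqt family set" where
  "graded_limit R = {F. \<exists>D f. (\<forall>d\<le>D. f d \<in> inv_limit R d) \<and> F = (\<Sum>d\<le>D. f d)}"

definition polys_inf :: "Qqt family set" where
  "polys_inf = graded_limit polys"

definition Lambda_qt :: "Qqt family set" where
  "Lambda_qt = graded_limit sym_polys"

definition q_inf :: "Qqt family \<Rightarrow> Qqt family" where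
  "q_inf F = mk_family (\<lambda>m. q_map m (F m))"

definition star :: "Qqt family \<Rightarrow> Qqt family \<Rightarrow> Qqt family" (infixl "\<star>" 70) where
  "F \<star> G = q_inf (inv_into polys_inf q_inf F * inv_into polys_inf q_inf G)"

definition regular_family :: "Qqt family \<Rightarrow> bool" where
  "regular_family F \<longleftrightarrow> (\<forall>m a. regular_at_q1 (Poly_Mapping.lookup (F m) a))"

definition family_at_q1 :: "Qqt family \<Rightarrow> Qt family" where
  "family_at_q1 F = (\<lambda>m. Poly_Mapping.map at_q1 (F m))"

definition scale :: "Qqt \<Rightarrow> Qqt lpoly \<Rightarrow> Qqt lpoly" where
  "scale c F = const c * F"

definition scale_family :: "Qqt \<Rightarrow> Qqt family \<Rightarrow> Qqt family" where
  "scale_family c F = (\<lambda>m. scale c (F m))"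

definition linear_iso ::
  "(Qqt \<Rightarrow> 'v \<Rightarrow> 'v) \<Rightarrow> 'v set \<Rightarrow> 'v set \<Rightarrow> ('v::ab_group_add \<Rightarrow> 'v) \<Rightarrow> bool" where
  "linear_iso sc V W f \<longleftrightarrow>
    (\<forall>x\<in>V. \<forall>y\<in>V. f (x + y) = f x + f y) \<and>
    (\<forall>c. \<forall>x\<in>V. f (sc c x) = sc c (f x)) \<and>
    bij_betw f V W"


section \<open>Elementary symmetric functions\<close>

definition elem_sym :: "nat \<Rightarrow> Qqt family" where
  "elem_sym r = mk_family (\<lambda>m. \<Sum>S | S \<subseteq> {1..m} \<and> card S = r. \<Prod>i\<in>S. var i)"

definition one_family :: "Qqt family" where
  "one_family = mk_family (\<lambda>m. 1)"

definition elem_sym_list :: "nat list \<Rightarrow> Qqt family" where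
  "elem_sym_list \<nu> = foldr (\<lambda>r F. elem_sym r * F) \<nu> one_family"

definition elem_sym_qt :: "nat list \<Rightarrow> Qqt family" where
  "elem_sym_qt \<nu> = foldr (\<lambda>r F. elem_sym r \<star> F) \<nu> one_family"

definition is_partition :: "nat list \<Rightarrow> bool" where
  "is_partition \<nu> \<longleftrightarrow> sorted_wrt (\<ge>) \<nu> \<and> (\<forall>r\<in>set \<nu>. 0 < r)"


section \<open>Unit interval graphs and chromatic quasisymmetric functions\<close>

definition EE :: "nat \<Rightarrow> (nat \<Rightarrow> int) set" where
  "EE n = {e. (\<forall>i\<in>{1..n}. 0 \<le> e i \<and> e i < int i) \<and> (\<forall>i. 1 \<le> i \<and> i < n \<longrightarrow> e i \<le> e (i + 1))}"

text \<open>The pair \<open>(j, i)\<close> is the oriented edge $j \to i$.\<close>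

definition ui_edges :: "nat \<Rightarrow> (nat \<Rightarrow> int) \<Rightarrow> (nat \<times> nat) set" where
  "ui_edges n e = {(j, i). i \<in> {1..n} \<and> j \<in> {1..n} \<and> e i < int j \<and> j < i}"

definition proper_colorings :: "nat \<Rightarrow> nat set \<Rightarrow> (nat \<times> nat) set \<Rightarrow> (nat \<Rightarrow> nat) set" where
  "proper_colorings m V E = {\<kappa> \<in> V \<rightarrow>\<^sub>E {1..m}. \<forall>(v, w)\<in>E. \<kappa> v \<noteq> \<kappa> w}"

definition asc :: "(nat \<times> nat) set \<Rightarrow> (nat \<Rightarrow> nat) \<Rightarrow> nat" where
  "asc E \<kappa> = card {(v, w) \<in> E. \<kappa> v < \<kappa> w}"

text \<open>The truncation to $m$ variables of the chromatic quasisymmetric function is the sum over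
  the colorings with colors in $\{1, \dots, m\}$.\<close>

definition chromatic :: "nat set \<Rightarrow> (nat \<times> nat) set \<Rightarrow> Qqt family" where
  "chromatic V E = mk_family (\<lambda>m.
    \<Sum>\<kappa>\<in>proper_colorings m V E. const (tvar ^ asc E \<kappa>) * (\<Prod>v\<in>V. var (\<kappa> v)))"

definition hS :: "nat \<Rightarrow> int \<Rightarrow> int \<Rightarrow> free_elt set" where
  "hS m i e =
    (if e \<ge> i - int m
     then (\<Oplus>\<^bsub>hecke m\<^esub>k\<in>{0..nat (int m + e - i)}. hprod m (map (hT_inv m) (rev [i..i + int k - 1])))
     else \<zero>\<^bsub>hecke m\<^esub>)"

definition X_graph_trunc :: "nat \<Rightarrow> nat \<Rightarrow> (nat \<Rightarrow> int) \<Rightarrow> Qqt lpoly" where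
  "X_graph_trunc n m e =
    scale (tvar ^ (n * (m - 1)))
      (hact m
        (hprod m (map (\<lambda>i. hS m (int i) (e i)) [1..<Suc n]) \<otimes>\<^bsub>hecke m\<^esub> hPi m [^]\<^bsub>hecke m\<^esub> n) 1)"

definition X_graph :: "nat \<Rightarrow> (nat \<Rightarrow> int) \<Rightarrow> Qqt family" where
  "X_graph n e = mk_family (\<lambda>m. X_graph_trunc n m e)"

end

theory Submission
  imports Defs
begin

section \<open>Additive endomorphisms as a noncommutative ring of operators\<close>

section \<open>Additive endomorphisms\<close>

text \<open>The central observation is that Y_1, ..., Y_m satisfy the same cross relations with T_1,
  ..., T_{m-1} as the operators of multiplication by X_1, ..., X_m: compare \<open>DL_var\<close>
  and \<open>DL_var_Suc\<close> with \<open>Td_YE\<close> and \<open>Td_YE_Suc\<close>. Since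
  moreover T_j 1 = t, the map q: F(Y) -> F(Y) 1 intertwines the Demazure-Lusztig action of T_j on
  polynomials in the Y_i with the action of T_j on polynomials in the X_i (\<open>q_Td\<close>).
  Most of the theorem is drawn from this and from q(X_i F) = Y_i q(F) (\<open>q_var\<close>).

  To get there, the operators are shown to satisfy the relations of the affine Hecke algebra, so
  that the presented algebra acts and q can be computed with operators alone
  (\<open>q_map_eq\<close>). The braid relation is proved by moving variables through its defect
  (\<open>DL_braid\<close>), T_0 is treated as the conjugate of T_{m-1} by Pi, and the commutativity
  of the Y_i is derived in an abstract monoid (\<open>Y_commute\<close>).

  (1) Solving the definition of Y_1 for Pi shows that the image of q is stable under Pi; by
  \<open>q_Td\<close> it is stable under the T_j. As Pi produces the multiples of X_1 and T_i leads
  from X_i to X_{i+1}, induction on the degree gives surjectivity on polynomials, even on those with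
  coefficients regular at q = 1 (\<open>monomial_q_image\<close>, \<open>q_surj_regular\<close>).
  Since q preserves the degree, counting dimensions gives injectivity
  (\<open>q_inj_homogeneous\<close>). For Laurent polynomials, the kernel is stable under
  multiplication by variables, and some power of Pi makes any Laurent polynomial a polynomial
  (\<open>q_inj_laurent\<close>, \<open>q_surj_laurent\<close>). On truncation from n + 1 to n
  variables, Y_i becomes Y_i for i <= n, and Y_{n+1} becomes 0 (\<open>trunc_YE\<close>,
  \<open>trunc_YE_last\<close>); the essential computation is \<open>trunc_Pi\<close>. Injectivity
  at each level makes preimages fit together in the limit (\<open>q_inf_surj\<close>).

  (2) Symmetric polynomials are the common eigenvectors of the T_j with eigenvalue t
  (\<open>sym_polys_iff\<close>), so q preserves and reflects symmetry (\<open>q_sym_iff\<close>).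
  Modulo q - 1 the shift of indices in Pi is a cyclic permutation of the variables; hence
  multiplication by a symmetric polynomial commutes with Pi, and so with every Y_i
  (\<open>YE_sym_mult\<close>). Taking the variables of g one by one out of q(g f), with f
  symmetric, gives q(f) q(g) modulo q - 1 (\<open>q_mult_cong\<close>). Preimages of regular
  families are regular by \<open>q_surj_regular\<close>.

  (3) A unit interval graph is recorded by its list of in-degrees, a vertex of in-degree k being
  joined to the last k vertices before it; \<open>chr\<close> is the generating polynomial of the
  continuations of a partial colouring. On its image under q, T_a acts by exchanging the colours a
  and a + 1 (\<open>Td_chr\<close>). Therefore S_{1,-k} Pi, up to a power of t, puts a vertex of
  in-degree k in front of the list (\<open>chr_step\<close>), and moving the powers of Pi through
  the S_{i,e(i)} shows that the graph polynomial is an iteration of such operators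
  (\<open>SE_prod\<close>). This recursion counts descents; symmetry and reversal of the colours
  turn them into ascents (\<open>chr_des_eq\<close>).

  (4) A squarefree monomial of degree r is multiplied by t^(r(r-1)/2) under q
  (\<open>q_sqfree\<close>): the T_i move squarefree monomials into one another on both sides, and
  on X_1 ... X_{i-1} all factors T_j and T_j^{-1} of Y_i act by scalars (\<open>YE_initial\<close>).
  Finally q turns ordinary products into star products.\<close>

typedef (overloaded) 'a endo = "{f :: 'a::ab_group_add \<Rightarrow> 'a. \<forall>x y. f (x + y) = f x + f y}"
  morphisms app Endo
  by (rule exI[of _ "\<lambda>x. x"]) simp

setup_lifting type_definition_endo

instantiation endo :: (comm_ring_1) ring_1
begin

lift_definition zero_endo :: "'a endo" is "\<lambda>x. 0" by simp
lift_definition one_endo :: "'a endo" is "\<lambda>x. x" by simp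
lift_definition plus_endo :: "'a endo \<Rightarrow> 'a endo \<Rightarrow> 'a endo" is "\<lambda>f g x. f x + g x"
  by (simp add: algebra_simps)
lift_definition uminus_endo :: "'a endo \<Rightarrow> 'a endo" is "\<lambda>f x. - f x" by simp
lift_definition minus_endo :: "'a endo \<Rightarrow> 'a endo \<Rightarrow> 'a endo" is "\<lambda>f g x. f x - g x"
  by (simp add: algebra_simps)
lift_definition times_endo :: "'a endo \<Rightarrow> 'a endo \<Rightarrow> 'a endo" is "\<lambda>f g x. f (g x)" by simp

instance
proof
  fix a b c :: "'a endo"
  show "a + b + c = a + (b + c)" "a + b = b + a" "0 + a = a" "- a + a = 0" "a - b = a + - b"
    "a * b * c = a * (b * c)" "1 * a = a" "a * 1 = a" "(a + b) * c = a * c + b * c"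
    "a * (b + c) = a * b + a * c"
    by (transfer; simp add: algebra_simps)+
  show "(0::'a endo) \<noteq> 1"
  proof (transfer, rule notI)
    assume "(\<lambda>x::'a. 0) = (\<lambda>x. x)"
    from fun_cong[OF this, of 1] show False by simp
  qed
qed

end

lemma app_simps [simp]:
  "app 0 x = 0" "app 1 x = x" "app (A + B) x = app A x + app B x" "app (A - B) x = app A x - app B x"
  "app (- A) x = - app A x" "app (A * B) x = app A (app B x)"
  by (transfer; simp)+

lemma app_add: "app A (x + y) = app A x + app A y"
  by transfer simp

lemma app_zero [simp]: "app A 0 = 0"
  using app_add[of A 0 0] by simp

lemma app_minus: "app A (- x) = - app A x"
  using app_add[of A x "- x"] by (simp add: eq_neg_iff_add_eq_0 add.commute)

lemma app_diff: "app A (x - y) = app A x - app A y"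
  using app_add[of A x "- y"] by (simp add: app_minus)

lemma app_sum: "app A (sum f S) = (\<Sum>x\<in>S. app A (f x))"
  by (induction S rule: infinite_finite_induct) (simp_all add: app_add)

lemma app_sum_left: "app (sum A S) x = (\<Sum>i\<in>S. app (A i) x)"
  by (induction S rule: infinite_finite_induct) simp_all

lemma endo_eqI: "(\<And>x. app A x = app B x) \<Longrightarrow> A = B"
  by transfer auto

text \<open>Only additivity is built into the type \<open>endo\<close>. Scalars enter as
  \<open>mul (const c)\<close>, and linearity of an operator over the coefficient field is expressed
  by its commuting with them.\<close>

lift_definition mul :: "'a::comm_ring_1 \<Rightarrow> 'a endo" is "\<lambda>a x. a * x" by (simp add: algebra_simps)

lemma app_mul [simp]: "app (mul a) x = a * x"
  by transfer simp

lemma mul_mult: "mul (a * b) = mul a * mul b"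
  and mul_add: "mul (a + b) = mul a + mul b"
  and mul_diff: "mul (a - b) = mul a - mul b"
  and mul_minus: "mul (- a) = - mul a"
  and mul_one: "mul 1 = 1"
  and mul_zero: "mul 0 = 0"
  by (rule endo_eqI; simp add: algebra_simps)+


section \<open>Laurent polynomials and linear extension from monomials\<close>

section \<open>Laurent polynomials\<close>

type_synonym lp = "Qqt lpoly"

lemma const_simps:
  "const (c * d) = const c * const d" "const (c + d) = const c + const d"
  "const (c - d) = const c - const d" "const (- c) = - const c" "const 0 = 0" "const 1 = 1"
  by (simp_all add: const_def mult_single single_add single_diff single_uminus)

lemma const_power: "const (c ^ n) = const c ^ n"
  by (induction n) (simp_all add: const_simps)

lemma const_inverse:
  fixes c :: "'a::field" assumes "c \<noteq> 0"
  shows "const c * const (inverse c) = 1" "const (inverse c) * const c = 1"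
  using assms by (simp_all flip: const_simps)

lemma lookup_const_mult [simp]: "Poly_Mapping.lookup (const c * F) a = c * Poly_Mapping.lookup F a"
  for F :: "'a::comm_ring_1 lpoly"
proof -
  have "const c * F = Poly_Mapping.map ((*) c) F"
    by (simp add: const_def mult_map_scale_conv_mult)
  then show ?thesis
    by (simp add: Poly_Mapping.map.rep_eq when_def)
qed

lemma keys_const_mult: "Poly_Mapping.keys (const c * F) \<subseteq> Poly_Mapping.keys F"
  for F :: "'a::comm_ring_1 lpoly"
  by (auto simp: in_keys_iff)

lemma lpoly_expansion:
  fixes F :: "'a::comm_ring_1 lpoly"
  assumes "finite A" "Poly_Mapping.keys F \<subseteq> A"
  shows "F = (\<Sum>a\<in>A. const (Poly_Mapping.lookup F a) * Poly_Mapping.single a 1)"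
proof (rule poly_mapping_eqI)
  fix b
  have "Poly_Mapping.lookup (\<Sum>a\<in>A. const (Poly_Mapping.lookup F a) * Poly_Mapping.single a 1) b
      = (\<Sum>a\<in>A. if a = b then Poly_Mapping.lookup F a else 0)"
    unfolding lookup_sum by (rule sum.cong) (auto simp: lookup_single when_def)
  also have "\<dots> = Poly_Mapping.lookup F b"
    using assms by (auto simp: sum.delta in_keys_iff)
  finally show "Poly_Mapping.lookup F b
      = Poly_Mapping.lookup (\<Sum>a\<in>A. const (Poly_Mapping.lookup F a) * Poly_Mapping.single a 1) b" ..
qed

text \<open>The linear extension of a map \<open>U\<close> given on monomials. Substitution,
  truncation, homogeneous components and \<open>q_map\<close> are all brought to this form.\<close>

definition lin :: "(mono \<Rightarrow> lp) \<Rightarrow> lp \<Rightarrow> lp" where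
  "lin U F = (\<Sum>a\<in>Poly_Mapping.keys F. const (Poly_Mapping.lookup F a) * U a)"

lemma lin_superset:
  assumes "finite A" "Poly_Mapping.keys F \<subseteq> A"
  shows "lin U F = (\<Sum>a\<in>A. const (Poly_Mapping.lookup F a) * U a)"
  unfolding lin_def
  by (rule sum.mono_neutral_left) (use assms in \<open>auto simp: in_keys_iff const_simps\<close>)

lemma lin_add: "lin U (F + G) = lin U F + lin U G"
proof -
  let ?A = "Poly_Mapping.keys F \<union> Poly_Mapping.keys G"
  have "lin U H = (\<Sum>a\<in>?A. const (Poly_Mapping.lookup H a) * U a)"
    if "Poly_Mapping.keys H \<subseteq> ?A" for H
    using that by (intro lin_superset) auto
  then show ?thesis
    using keys_add[of F G] by (simp add: lookup_add const_simps distrib_right sum.distrib)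
qed

lemma lin_const_mult: "lin U (const c * F) = const c * lin U F"
proof -
  have "lin U (const c * F)
      = (\<Sum>a\<in>Poly_Mapping.keys F. const (Poly_Mapping.lookup (const c * F) a) * U a)"
    by (rule lin_superset) (auto intro: keys_const_mult[THEN subsetD])
  then show ?thesis
    by (simp add: lin_def const_simps sum_distrib_left mult.assoc)
qed

lemma lin_single: "lin U (Poly_Mapping.single a c) = const c * U a"
  by (simp add: lin_def const_simps)

lemma lin_zero [simp]: "lin U 0 = 0"
  by (simp add: lin_def)

lemma lin_sum: "lin U (sum f S) = (\<Sum>x\<in>S. lin U (f x))"
  by (induction S rule: infinite_finite_induct) (simp_all add: lin_add)

lemma lin_minus: "lin U (- F) = - lin U F"
  using lin_const_mult[of U "-1" F] by (simp add: const_simps)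

lemma lin_diff: "lin U (F - G) = lin U F - lin U G"
  using lin_add[of U F "- G"] by (simp add: lin_minus)

lemma lpoly_induct [case_names mono add scale]:
  fixes F :: "'a::comm_ring_1 lpoly"
  assumes "\<And>a. a \<in> Poly_Mapping.keys F \<Longrightarrow> P (Poly_Mapping.single a 1)"
    and "\<And>F G. P F \<Longrightarrow> P G \<Longrightarrow> P (F + G)" and "\<And>c F. P F \<Longrightarrow> P (const c * F)" and "P 0"
  shows "P F"
proof -
  have "P (\<Sum>a\<in>A. const (Poly_Mapping.lookup F a) * Poly_Mapping.single a 1)"
    if "finite A" "A \<subseteq> Poly_Mapping.keys F" for A
    using that by (induction A) (use assms in auto)
  from this[of "Poly_Mapping.keys F"] show ?thesis
    using lpoly_expansion[of "Poly_Mapping.keys F" F] by simp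
qed

lemma single_mult_single_one:
  "Poly_Mapping.single a (1::'a::comm_ring_1) * Poly_Mapping.single b 1 = Poly_Mapping.single (a + b) 1"
  for a b :: mono
  by (simp add: mult_single)

lemma lin_mult:
  assumes U: "\<And>a b. U (a + b) = U a * U b"
  shows "lin U (F * G) = lin U F * lin U G"
proof (induction F rule: lpoly_induct)
  case (mono a)
  show ?case
  proof (induction G rule: lpoly_induct)
    case (mono b)
    show ?case by (simp add: single_mult_single_one lin_single U const_simps)
  next
    case (scale c G)
    then show ?case by (simp add: lin_const_mult mult.left_commute)
  qed (simp_all add: lin_add distrib_left)
next
  case (scale c F)
  then show ?case by (simp add: lin_const_mult mult.assoc)
qed (simp_all add: lin_add distrib_right)

lemma lin_one: "U 0 = 1 \<Longrightarrow> lin U 1 = 1"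
  using lin_single[of U 0 1] by (simp add: const_simps)

lemma lin_const: "U 0 = 1 \<Longrightarrow> lin U (const c) = const c"
  using lin_const_mult[of U c 1] by (simp add: lin_one)

section \<open>Induction principles by generation from the variables\<close>

subsection \<open>Generation by the variables\<close>

text \<open>A power of a variable whose index is taken literally, in contrast to
  \<open>Xpow\<close>, which reads it modulo m up to a power of q.\<close>

definition vpow :: "nat \<Rightarrow> int \<Rightarrow> lp" where
  "vpow i e = Poly_Mapping.single (Poly_Mapping.single i e) 1"

lemma vpow_add: "vpow i (d + e) = vpow i d * vpow i e"
  by (simp add: vpow_def single_mult_single_one single_add)

lemma vpow_0 [simp]: "vpow i 0 = 1"
  by (simp add: vpow_def)

lemma vpow_1: "vpow i 1 = var i"
  by (simp add: vpow_def var_def)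

lemma vpow_inverse: "var i * vpow i (-1) = 1" "vpow i (-1) * var i = 1"
  by (simp_all flip: vpow_1 vpow_add)

lemma sum_single_keys:
  assumes "finite A" "Poly_Mapping.keys a \<subseteq> A"
  shows "a = (\<Sum>i\<in>A. Poly_Mapping.single i (Poly_Mapping.lookup a i))"
proof (rule poly_mapping_eqI)
  fix j
  have "Poly_Mapping.lookup (\<Sum>i\<in>A. Poly_Mapping.single i (Poly_Mapping.lookup a i)) j
      = (\<Sum>i\<in>A. if i = j then Poly_Mapping.lookup a i else 0)"
    unfolding lookup_sum by (rule sum.cong) (auto simp: lookup_single when_def)
  also have "\<dots> = Poly_Mapping.lookup a j"
    using assms by (auto simp: sum.delta in_keys_iff)
  finally show "Poly_Mapping.lookup a j
      = Poly_Mapping.lookup (\<Sum>i\<in>A. Poly_Mapping.single i (Poly_Mapping.lookup a i)) j" ..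
qed

lemma single_sum_prod: "finite A \<Longrightarrow>
  Poly_Mapping.single (\<Sum>i\<in>A. f i) (1::'a::comm_ring_1) = (\<Prod>i\<in>A. Poly_Mapping.single (f i :: mono) 1)"
  by (induction A rule: finite_induct) (simp_all add: single_mult_single_one[symmetric])

lemma mono_eq_prod:
  assumes "finite A" "Poly_Mapping.keys a \<subseteq> A"
  shows "Poly_Mapping.single a 1 = (\<Prod>i\<in>A. vpow i (Poly_Mapping.lookup a i))"
  by (subst sum_single_keys[OF assms]) (simp only: single_sum_prod[OF assms(1)] vpow_def)

lemma vpow_induct:
  assumes "P F" and "\<And>F. P F \<Longrightarrow> P (var i * F)" and "e < 0 \<Longrightarrow> (\<And>F. P F \<Longrightarrow> P (vpow i (-1) * F))"
  shows "P (vpow i e * F)"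
proof (cases "e \<ge> 0")
  case True
  then show ?thesis
  proof (induction e rule: int_ge_induct)
    case (step e)
    then show ?case
      using assms(2)[of "vpow i e * F"] by (simp add: vpow_add vpow_1 mult_ac)
  qed (use assms(1) in simp)
next
  case False
  have "P (vpow i (- int n) * F)" for n
  proof (induction n)
    case (Suc n)
    have "vpow i (- int (Suc n)) = vpow i (- 1) * vpow i (- int n)"
      by (subst vpow_add[symmetric]) simp
    then have eq: "vpow i (- int (Suc n)) * F = vpow i (- 1) * (vpow i (- int n) * F)"
      by (simp only: mult.assoc)
    show ?case
      unfolding eq using Suc False by (intro assms(3)) auto
  qed (use assms(1) in simp)
  from this[of "nat (- e)"] False show ?thesis by simp
qed

text \<open>One induction serves polynomials and Laurent polynomials: division by a variable occurs
  only when some exponent is negative. \<open>F'\<close> is a second name for the outer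
  \<open>F\<close>, which is shadowed inside \<open>inv\<close>.\<close>

lemma generated_induct:
  assumes F: "\<forall>a\<in>Poly_Mapping.keys F. Poly_Mapping.keys a \<subseteq> V"
    and 1: "P 1" and add: "\<And>F G. P F \<Longrightarrow> P G \<Longrightarrow> P (F + G)" and scale: "\<And>c F. P F \<Longrightarrow> P (const c * F)"
    and var: "\<And>i F. i \<in> V \<Longrightarrow> P F \<Longrightarrow> P (var i * F)"
    and inv: "\<And>a i F. a \<in> Poly_Mapping.keys F' \<Longrightarrow> Poly_Mapping.lookup a i < 0 \<Longrightarrow> i \<in> V \<Longrightarrow> P F \<Longrightarrow> P (vpow i (-1) * F)"
    and "F' = F"
  shows "P F"
proof (induction F rule: lpoly_induct)
  case (mono a)
  then have a: "Poly_Mapping.keys a \<subseteq> V" using F by auto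
  have "P (\<Prod>i\<in>A. vpow i (Poly_Mapping.lookup a i))" if "finite A" "A \<subseteq> Poly_Mapping.keys a" for A
    using that
  proof (induction A rule: finite_induct)
    case (insert i A)
    then show ?case
      using vpow_induct[of P "\<Prod>i\<in>A. vpow i (Poly_Mapping.lookup a i)" i "Poly_Mapping.lookup a i"]
        var[of i] inv[of a i] mono a \<open>F' = F\<close> by auto
  qed (simp add: 1)
  from this[of "Poly_Mapping.keys a"] show ?case
    by (simp add: mono_eq_prod[of "Poly_Mapping.keys a"])
next
  show "P 0" using scale[OF 1, of 0] by (simp add: const_simps)
qed (use add scale in auto)

lemma lpoly_var_induct [case_names one add scale var inv]:
  assumes "P 1" and "\<And>F G. P F \<Longrightarrow> P G \<Longrightarrow> P (F + G)" and "\<And>c F. P F \<Longrightarrow> P (const c * F)"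
    and "\<And>i F. P F \<Longrightarrow> P (var i * F)" and "\<And>i F. P F \<Longrightarrow> P (vpow i (-1) * F)"
  shows "P F"
  by (rule generated_induct[of F UNIV P F]) (use assms in auto)

lemma laurent_closed [simp]:
  "0 \<in> laurent m" "1 \<in> laurent m" "const c \<in> laurent m"
  "F \<in> laurent m \<Longrightarrow> G \<in> laurent m \<Longrightarrow> F + G \<in> laurent m"
  "F \<in> laurent m \<Longrightarrow> - F \<in> laurent m"
  "F \<in> laurent m \<Longrightarrow> G \<in> laurent m \<Longrightarrow> F - G \<in> laurent m"
  "F \<in> laurent m \<Longrightarrow> G \<in> laurent m \<Longrightarrow> F * G \<in> laurent m"
  "1 \<le> i \<Longrightarrow> i \<le> m \<Longrightarrow> vpow i e \<in> laurent m" "1 \<le> i \<Longrightarrow> i \<le> m \<Longrightarrow> var i \<in> laurent m"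
proof -
  show add: "F \<in> laurent m \<Longrightarrow> G \<in> laurent m \<Longrightarrow> F + G \<in> laurent m" for F G
    using keys_add[of F G] by (auto simp: laurent_def)
  show neg: "F \<in> laurent m \<Longrightarrow> - F \<in> laurent m" for F
    by (auto simp: laurent_def in_keys_iff)
  show "F \<in> laurent m \<Longrightarrow> G \<in> laurent m \<Longrightarrow> F - G \<in> laurent m"
    using add[OF _ neg] by simp
  show "F \<in> laurent m \<Longrightarrow> G \<in> laurent m \<Longrightarrow> F * G \<in> laurent m"
    by (auto simp: laurent_def dest!: keys_mult[THEN subsetD] keys_add[THEN subsetD])
qed (auto simp: laurent_def const_def vpow_def var_def)

lemma polys_closed [simp]:
  "0 \<in> polys m" "1 \<in> polys m" "const c \<in> polys m"
  "F \<in> polys m \<Longrightarrow> G \<in> polys m \<Longrightarrow> F + G \<in> polys m"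
  "F \<in> polys m \<Longrightarrow> - F \<in> polys m"
  "F \<in> polys m \<Longrightarrow> G \<in> polys m \<Longrightarrow> F - G \<in> polys m"
  "F \<in> polys m \<Longrightarrow> G \<in> polys m \<Longrightarrow> F * G \<in> polys m"
  "1 \<le> i \<Longrightarrow> i \<le> m \<Longrightarrow> 0 \<le> e \<Longrightarrow> vpow i e \<in> polys m" "1 \<le> i \<Longrightarrow> i \<le> m \<Longrightarrow> var i \<in> polys m"
proof -
  show add: "F \<in> polys m \<Longrightarrow> G \<in> polys m \<Longrightarrow> F + G \<in> polys m" for F G
    using keys_add[of F G] by (auto simp: polys_def)
  show neg: "F \<in> polys m \<Longrightarrow> - F \<in> polys m" for F
    by (auto simp: polys_def laurent_def in_keys_iff)
  show "F \<in> polys m \<Longrightarrow> G \<in> polys m \<Longrightarrow> F - G \<in> polys m"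
    using add[OF _ neg] by simp
  have "F \<in> laurent m \<Longrightarrow> G \<in> laurent m \<Longrightarrow> F * G \<in> laurent m"
    by simp
  then show "F \<in> polys m \<Longrightarrow> G \<in> polys m \<Longrightarrow> F * G \<in> polys m"
    by (auto simp: polys_def lookup_add dest!: keys_mult[THEN subsetD] intro!: add_nonneg_nonneg)
qed (auto simp: polys_def laurent_def const_def vpow_def var_def lookup_single when_def)

lemma laurent_induct [consumes 1, case_names one add scale var inv]:
  assumes "F \<in> laurent m" and "P 1"
    and "\<And>F G. F \<in> laurent m \<Longrightarrow> G \<in> laurent m \<Longrightarrow> P F \<Longrightarrow> P G \<Longrightarrow> P (F + G)"
    and "\<And>c F. F \<in> laurent m \<Longrightarrow> P F \<Longrightarrow> P (const c * F)"
    and "\<And>i F. 1 \<le> i \<Longrightarrow> i \<le> m \<Longrightarrow> F \<in> laurent m \<Longrightarrow> P F \<Longrightarrow> P (var i * F)"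
    and "\<And>i F. 1 \<le> i \<Longrightarrow> i \<le> m \<Longrightarrow> F \<in> laurent m \<Longrightarrow> P F \<Longrightarrow> P (vpow i (-1) * F)"
  shows "P F"
proof -
  have "\<forall>a\<in>Poly_Mapping.keys F. Poly_Mapping.keys a \<subseteq> {1..m}"
    using assms(1) by (auto simp: laurent_def)
  then have "F \<in> laurent m \<and> P F"
    by (intro generated_induct[of F "{1..m}" "\<lambda>F. F \<in> laurent m \<and> P F" F]) (use assms in auto)
  then show ?thesis ..
qed

lemma polys_induct [consumes 1, case_names one add scale var]:
  assumes "F \<in> polys m" and "P 1"
    and "\<And>F G. F \<in> polys m \<Longrightarrow> G \<in> polys m \<Longrightarrow> P F \<Longrightarrow> P G \<Longrightarrow> P (F + G)"
    and "\<And>c F. F \<in> polys m \<Longrightarrow> P F \<Longrightarrow> P (const c * F)"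
    and "\<And>i F. 1 \<le> i \<Longrightarrow> i \<le> m \<Longrightarrow> F \<in> polys m \<Longrightarrow> P F \<Longrightarrow> P (var i * F)"
  shows "P F"
proof -
  have "\<forall>a\<in>Poly_Mapping.keys F. Poly_Mapping.keys a \<subseteq> {1..m}"
    "\<forall>a\<in>Poly_Mapping.keys F. \<forall>i. 0 \<le> Poly_Mapping.lookup a i"
    using assms(1) by (auto simp: polys_def laurent_def)
  then have "F \<in> polys m \<and> P F"
    by (intro generated_induct[of F "{1..m}" "\<lambda>F. F \<in> polys m \<and> P F" F]) (use assms in \<open>auto simp: not_less[symmetric]\<close>)
  then show ?thesis ..
qed

lemma polys_laurent: "F \<in> polys m \<Longrightarrow> F \<in> laurent m"
  by (simp add: polys_def)

lemma laurent_sum: "(\<And>x. x \<in> A \<Longrightarrow> f x \<in> laurent m) \<Longrightarrow> sum f A \<in> laurent m"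
  and laurent_prod: "(\<And>x. x \<in> A \<Longrightarrow> f x \<in> laurent m) \<Longrightarrow> prod f A \<in> laurent m"
  and polys_sum: "(\<And>x. x \<in> A \<Longrightarrow> f x \<in> polys m) \<Longrightarrow> sum f A \<in> polys m"
  and polys_prod: "(\<And>x. x \<in> A \<Longrightarrow> f x \<in> polys m) \<Longrightarrow> prod f A \<in> polys m"
  by (induction A rule: infinite_finite_induct; simp)+

section \<open>Substitutions of variables with the convention X_{k+m} = q^{-1} X_k\<close>

section \<open>Automorphisms of the Laurent polynomial ring\<close>

lemma Fract_eq_0_iff: "b \<noteq> 0 \<Longrightarrow> Fract a b = 0 \<longleftrightarrow> a = 0"
  by (simp add: Zero_fract_def eq_fract)

lemma qvar_nonzero [simp]: "qvar \<noteq> 0"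
  unfolding qvar_def by (subst Fract_eq_0_iff) auto

lemma tvar_nonzero [simp]: "tvar \<noteq> 0"
  unfolding tvar_def by (simp add: Fract_eq_0_iff)

lemma Xpow_add: "Xpow m k (d + e) = Xpow m k d * Xpow m k e"
  by (simp add: Xpow_def mult_single single_add power_int_add[symmetric] algebra_simps)

lemma Xpow_0 [simp]: "Xpow m k 0 = 1"
  by (simp add: Xpow_def)

lemma Xpow_inverse: "Xpow m k 1 * Xpow m k (-1) = 1" "Xpow m k (-1) * Xpow m k 1 = 1"
  by (simp_all flip: Xpow_add)

lemma Xpow_nonzero [simp]: "Xpow m k 1 \<noteq> 0"
  using Xpow_inverse(1)[of m k] by (metis mult_zero_left zero_neq_one)

lemma Xpow_vpow: "1 \<le> i \<Longrightarrow> i \<le> m \<Longrightarrow> Xpow m (int i) e = vpow i e"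
  by (simp add: Xpow_def vpow_def)

lemma Xpow_shift:
  assumes "m \<ge> 1"
  shows "Xpow m (k + int m * l) e = const (qvar powi (- l * e)) * Xpow m k e"
proof -
  have eq: "k + int m * l - 1 = (k - 1) + l * int m" by simp
  have "(k + int m * l - 1) mod int m = (k - 1) mod int m"
    and "(k + int m * l - 1) div int m = (k - 1) div int m + l"
    using assms unfolding eq by (simp_all del: add_diff_eq)
  then show ?thesis
    by (simp add: Xpow_def const_def mult_single power_int_add[symmetric] algebra_simps)
qed

lemma residue_range:
  assumes "m \<ge> 1"
  shows "1 \<le> nat ((k - 1) mod int m + 1)" "nat ((k - 1) mod int m + 1) \<le> m"
    "int (nat ((k - 1) mod int m + 1)) = (k - 1) mod int m + 1"
  using assms pos_mod_bound[of "int m" "k - 1"] pos_mod_sign[of "int m" "k - 1"] by linarith+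

lemma Xpow_laurent [simp]: "m \<ge> 1 \<Longrightarrow> Xpow m k e \<in> laurent m"
  using residue_range[of m k] by (auto simp: Xpow_def laurent_def)

text \<open>The condition under which X_k -> X_{f(k)} is compatible with X_{k+m} = q^{-1} X_k. It
  makes \<open>sub m f\<close> act by \<open>f\<close> on all integer indices
  (\<open>sub_Xpow\<close>) and gives the composition rule \<open>sub_comp\<close>.\<close>

definition periodic :: "nat \<Rightarrow> (int \<Rightarrow> int) \<Rightarrow> bool" where
  "periodic m f \<longleftrightarrow> (\<forall>k. f (k + int m) = f k + int m)"

lemma periodic_mult:
  assumes "periodic m f" shows "f (k + int m * l) = f k + int m * l"
proof (induction l rule: int_induct[where k = 0])
  case (step1 l)
  then show ?case
    using assms[unfolded periodic_def, rule_format, of "k + int m * l"] by (simp add: algebra_simps)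
next
  case (step2 l)
  then show ?case
    using assms[unfolded periodic_def, rule_format, of "k + int m * (l - 1)"] by (simp add: algebra_simps)
qed simp

text \<open>Variables outside 1, ..., m are fixed, which makes \<open>sub m f\<close> a ring
  endomorphism of the whole type.\<close>

definition xp :: "nat \<Rightarrow> (int \<Rightarrow> int) \<Rightarrow> nat \<Rightarrow> int \<Rightarrow> lp" where
  "xp m f i e = (if 1 \<le> i \<and> i \<le> m then Xpow m (f (int i)) e else vpow i e)"

definition sub :: "nat \<Rightarrow> (int \<Rightarrow> int) \<Rightarrow> lp \<Rightarrow> lp" where
  "sub m f = lin (\<lambda>a. \<Prod>i\<in>Poly_Mapping.keys a. xp m f i (Poly_Mapping.lookup a i))"

lemma xp_add: "xp m f i (d + e) = xp m f i d * xp m f i e"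
  and xp_0 [simp]: "xp m f i 0 = 1"
  by (simp_all add: xp_def Xpow_add vpow_add)

lemma prod_xp_superset:
  assumes "finite A" "Poly_Mapping.keys a \<subseteq> A"
  shows "(\<Prod>i\<in>Poly_Mapping.keys a. xp m f i (Poly_Mapping.lookup a i)) = (\<Prod>i\<in>A. xp m f i (Poly_Mapping.lookup a i))"
  by (rule prod.mono_neutral_left) (use assms in \<open>auto simp: in_keys_iff\<close>)

lemma prod_xp_add:
  "(\<Prod>i\<in>Poly_Mapping.keys (a + b). xp m f i (Poly_Mapping.lookup (a + b) i)) =
   (\<Prod>i\<in>Poly_Mapping.keys a. xp m f i (Poly_Mapping.lookup a i)) * (\<Prod>i\<in>Poly_Mapping.keys b. xp m f i (Poly_Mapping.lookup b i))"
proof -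
  let ?A = "Poly_Mapping.keys a \<union> Poly_Mapping.keys b"
  have "(\<Prod>i\<in>Poly_Mapping.keys c. xp m f i (Poly_Mapping.lookup c i)) = (\<Prod>i\<in>?A. xp m f i (Poly_Mapping.lookup c i))"
    if "Poly_Mapping.keys c \<subseteq> ?A" for c
    by (rule prod_xp_superset) (use that in auto)
  note eq = this[OF keys_add] this[OF Un_upper1] this[OF Un_upper2]
  show ?thesis
    unfolding eq by (simp add: lookup_add xp_add prod.distrib)
qed

lemma sub_simps:
  "sub m f (F + G) = sub m f F + sub m f G" "sub m f (F - G) = sub m f F - sub m f G"
  "sub m f (- F) = - sub m f F" "sub m f 0 = 0" "sub m f 1 = 1" "sub m f (const c) = const c"
  "sub m f (F * G) = sub m f F * sub m f G"
  unfolding sub_def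
  by (simp_all add: lin_add lin_diff lin_minus lin_mult prod_xp_add lin_one lin_const)

lemma sub_vpow: "sub m f (vpow i e) = xp m f i e"
  unfolding sub_def by (cases "e = 0") (simp_all add: vpow_def lin_single lin_one const_simps)

lemma sub_var: "sub m f (var i) = xp m f i 1"
  using sub_vpow[of m f i 1] by (simp add: vpow_1)

lemma sub_Xpow:
  assumes "periodic m f" "m \<ge> 1"
  shows "sub m f (Xpow m k e) = Xpow m (f k) e"
proof -
  define i where "i = nat ((k - 1) mod int m + 1)"
  define l where "l = (k - 1) div int m"
  have i: "int i = (k - 1) mod int m + 1" "1 \<le> i" "i \<le> m"
    using residue_range[OF assms(2), of k] by (auto simp: i_def)
  have k: "k = int i + int m * l"
    unfolding i l_def by simp
  show ?thesis
    unfolding k using assms i(2,3)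
    by (simp add: Xpow_shift periodic_mult sub_simps Xpow_vpow sub_vpow xp_def)
qed

lemma sub_comp:
  assumes "periodic m f"
  shows "sub m f (sub m g F) = sub m (\<lambda>k. f (g k)) F"
proof -
  have v: "sub m f (sub m g (vpow i e)) = sub m (\<lambda>k. f (g k)) (vpow i e)" for i e
    using assms by (cases "1 \<le> i \<and> i \<le> m") (auto simp: sub_vpow xp_def sub_Xpow)
  show ?thesis
    by (induction F rule: lpoly_var_induct) (use v in \<open>simp_all add: sub_simps flip: vpow_1\<close>)
qed

lemma sub_cong: "(\<And>i. 1 \<le> i \<Longrightarrow> i \<le> m \<Longrightarrow> f (int i) = g (int i)) \<Longrightarrow> sub m f F = sub m g F"
proof -
  assume "\<And>i. 1 \<le> i \<Longrightarrow> i \<le> m \<Longrightarrow> f (int i) = g (int i)"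
  then have "xp m f = xp m g"
    by (intro ext) (simp add: xp_def)
  then show ?thesis by (simp add: sub_def)
qed

lemma sub_id [simp]: "sub m (\<lambda>k. k) F = F"
proof -
  have v: "sub m (\<lambda>k. k) (vpow i e) = vpow i e" for i e
    by (auto simp: sub_vpow xp_def Xpow_vpow)
  show ?thesis
    by (induction F rule: lpoly_var_induct) (use v in \<open>simp_all add: sub_simps flip: vpow_1\<close>)
qed

lemma subst_eq_sub:
  assumes "F \<in> laurent m" "\<And>i. 1 \<le> i \<Longrightarrow> i \<le> m \<Longrightarrow> g i = f (int i)"
  shows "subst m g F = sub m f F"
  unfolding subst_def sub_def lin_def
proof (rule sum.cong)
  fix a assume "a \<in> Poly_Mapping.keys F"
  then have "Poly_Mapping.keys a \<subseteq> {1..m}" using assms(1) by (auto simp: laurent_def)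
  then have "(\<Prod>i\<in>Poly_Mapping.keys a. xp m f i (Poly_Mapping.lookup a i)) = (\<Prod>i\<in>{1..m}. xp m f i (Poly_Mapping.lookup a i))"
    by (intro prod_xp_superset) auto
  also have "\<dots> = (\<Prod>i = 1..m. Xpow m (g i) (Poly_Mapping.lookup a i))"
    by (rule prod.cong) (use assms(2) in \<open>auto simp: xp_def\<close>)
  finally show "const (Poly_Mapping.lookup F a) * (\<Prod>i = 1..m. Xpow m (g i) (Poly_Mapping.lookup a i))
     = const (Poly_Mapping.lookup F a) * (\<Prod>i\<in>Poly_Mapping.keys a. xp m f i (Poly_Mapping.lookup a i))" by simp
qed simp

lemma sub_laurent [simp]:
  assumes "m \<ge> 1" "F \<in> laurent m" shows "sub m f F \<in> laurent m"
  using assms(2)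
  by (induction F rule: laurent_induct)
    (use assms(1) in \<open>auto simp: sub_simps sub_var sub_vpow xp_def\<close>)


section \<open>Affine simple reflections and exact division by 1 - X_i / X_{i+1}\<close>

subsection \<open>Affine reflections and divided differences\<close>

text \<open>The simple reflection s_i of the affine symmetric group, acting on the integers.\<close>

definition arefl :: "nat \<Rightarrow> int \<Rightarrow> int \<Rightarrow> int" where
  "arefl m i k = (if int m dvd k - i then k + 1 else if int m dvd k - i - 1 then k - 1 else k)"

lemma dvd_shift: "int m dvd k + int m \<longleftrightarrow> int m dvd k"
  by simp

lemma periodic_arefl [simp]: "periodic m (arefl m i)"
proof -
  have "int m dvd k + int m - i \<longleftrightarrow> int m dvd k - i"
    "int m dvd k + int m - i - 1 \<longleftrightarrow> int m dvd k - i - 1" for k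
    using dvd_shift[of m "k - i"] dvd_shift[of m "k - i - 1"] by (simp_all add: algebra_simps)
  then show ?thesis by (simp add: periodic_def arefl_def)
qed

lemma periodic_shift [simp]: "periodic m (\<lambda>k. k + c)" "periodic m (\<lambda>k. k - c)"
  by (simp_all add: periodic_def)

lemma not_dvd_diff_one:
  assumes "m \<ge> 2" "int m dvd k" shows "\<not> int m dvd k + 1" "\<not> int m dvd k - 1"
proof -
  have "\<not> int m dvd 1" using assms(1) by auto
  then show "\<not> int m dvd k + 1" "\<not> int m dvd k - 1"
    using assms(2) by (auto simp: dvd_add_right_iff dvd_diff_right_iff)
qed

lemma arefl_arefl: "m \<ge> 2 \<Longrightarrow> arefl m i (arefl m i k) = k"
  using not_dvd_diff_one[of m "k - i"] not_dvd_diff_one[of m "k - i - 1"]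
  by (auto simp: arefl_def algebra_simps)

lemma arefl_shift: "arefl m (i + c) (k + c) = arefl m i k + c"
  by (simp add: arefl_def)

lemma arefl_cong: "int m dvd i - j \<Longrightarrow> arefl m i = arefl m j"
proof
  fix k assume d: "int m dvd i - j"
  have "int m dvd k - i \<longleftrightarrow> int m dvd k - j"
    using dvd_add_left_iff[OF d, of "k - i"] by simp
  moreover have "int m dvd k - i - 1 \<longleftrightarrow> int m dvd k - j - 1"
    using dvd_add_left_iff[OF d, of "k - i - 1"] by (simp add: algebra_simps)
  ultimately show "arefl m i k = arefl m j k" by (simp add: arefl_def)
qed

text \<open>The ratio X_i / X_{i+1} from the denominator of T_i. It depends on i modulo m only,
  since the powers of q cancel (\<open>zq_cong\<close>).\<close>

definition zq :: "nat \<Rightarrow> int \<Rightarrow> lp" where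
  "zq m i = Xpow m i 1 * Xpow m (i + 1) (-1)"

lemma zq_cong: "m \<ge> 1 \<Longrightarrow> int m dvd i - j \<Longrightarrow> zq m i = zq m j"
proof -
  assume m: "m \<ge> 1" and "int m dvd i - j"
  then obtain l where l: "i - j = int m * l" by (auto simp: dvd_def)
  then have i: "i = j + int m * l" "i + 1 = (j + 1) + int m * l" by simp_all
  have "zq m i = const (qvar powi (-l) * qvar powi l) * zq m j"
    unfolding zq_def i(2) unfolding i(1) Xpow_shift[OF m] by (simp add: const_simps mult_ac)
  then show ?thesis by (simp add: power_int_add[symmetric] const_simps)
qed

lemma sub_zq: "periodic m f \<Longrightarrow> m \<ge> 1 \<Longrightarrow> sub m f (zq m i) = Xpow m (f i) 1 * Xpow m (f (i + 1)) (-1)"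
  by (simp add: zq_def sub_simps sub_Xpow)

lemma mod_int_eq_iff: "(a::int) mod m = b mod m \<longleftrightarrow> m dvd a - b"
  by (simp add: mod_eq_dvd_iff)

lemma one_minus_zq_nonzero [simp]: "m \<ge> 2 \<Longrightarrow> 1 - zq m i \<noteq> 0"
proof
  assume m: "m \<ge> 2" and 0: "1 - zq m i = 0"
  define p r where "p = nat ((i - 1) mod int m + 1)" and "r = nat (i mod int m + 1)"
  have "\<not> int m dvd i - (i - 1)" using m by auto
  then have "i mod int m \<noteq> (i - 1) mod int m"
    unfolding mod_eq_dvd_iff .
  then have "p \<noteq> r" using m by (auto simp: p_def r_def nat_eq_iff)
  have "\<exists>c. zq m i = Poly_Mapping.single (Poly_Mapping.single p 1 + Poly_Mapping.single r (-1)) c"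
    by (auto simp: zq_def Xpow_def mult_single p_def r_def)
  moreover have "Poly_Mapping.single p 1 + Poly_Mapping.single r (-1) \<noteq> (0::mono)"
  proof
    assume "Poly_Mapping.single p 1 + Poly_Mapping.single r (-1) = (0::mono)"
    from arg_cong[OF this, of "\<lambda>a. Poly_Mapping.lookup a p"] \<open>p \<noteq> r\<close> show False
      by (simp add: lookup_add lookup_single)
  qed
  ultimately have "Poly_Mapping.lookup (1 - zq m i) 0 = 1"
    by (auto simp: lookup_minus lookup_single when_def)
  then show False using 0 by simp
qed

lemma Xpow_zq: "Xpow m (i + 1) 1 * zq m i = Xpow m i 1" "Xpow m i (-1) * zq m i = Xpow m (i + 1) (-1)"
  using Xpow_inverse[of m "i + 1"] Xpow_inverse[of m i]
  by (simp_all add: zq_def mult_ac)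

lemma Xpow_diff:
  "Xpow m i 1 - Xpow m (i + 1) 1 = - Xpow m (i + 1) 1 * (1 - zq m i)"
  "Xpow m i (-1) - Xpow m (i + 1) (-1) = Xpow m i (-1) * (1 - zq m i)"
  by (simp_all add: right_diff_distrib Xpow_zq)

lemma vpow_arefl_divides:
  assumes "m \<ge> 2" "e = 1 \<or> e = -1"
  shows "\<exists>G. G * (1 - zq m i) = vpow j e - sub m (arefl m i) (vpow j e)"
proof (cases "1 \<le> j \<and> j \<le> m")
  case False
  then have "sub m (arefl m i) (vpow j e) = vpow j e" by (auto simp: sub_vpow xp_def)
  then show ?thesis by (intro exI[of _ 0]) simp
next
  case True
  then have v: "vpow j e = Xpow m (int j) e" by (simp add: Xpow_vpow)
  have s: "sub m (arefl m i) (vpow j e) = Xpow m (arefl m i (int j)) e"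
    using True by (auto simp: sub_vpow xp_def)
  consider "int m dvd int j - i" | "\<not> int m dvd int j - i" "int m dvd int j - i - 1" | "arefl m i (int j) = int j"
    by (cases "int m dvd int j - i"; cases "int m dvd int j - i - 1") (auto simp: arefl_def)
  then show ?thesis
  proof cases
    case 1
    then have "zq m i = zq m (int j)" "arefl m i (int j) = int j + 1"
      using assms(1) zq_cong[of m "int j" i] by (auto simp: arefl_def)
    then show ?thesis
      unfolding s unfolding v using assms(2) Xpow_diff[of m "int j"] by metis
  next
    case 2
    then have z: "zq m i = zq m (int j - 1)" "arefl m i (int j) = int j - 1"
      using assms(1) zq_cong[of m "int j - 1" i] by (auto simp: arefl_def algebra_simps)
    have "\<exists>G. G * (1 - zq m (int j - 1)) = Xpow m (int j - 1) e - Xpow m (int j) e"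
      using assms(2) Xpow_diff[of m "int j - 1", unfolded diff_add_cancel] by metis
    then obtain G where "G * (1 - zq m (int j - 1)) = Xpow m (int j - 1) e - Xpow m (int j) e" ..
    then have "(- G) * (1 - zq m (int j - 1)) = Xpow m (int j) e - Xpow m (int j - 1) e"
      by (simp add: algebra_simps)
    then show ?thesis unfolding s unfolding v z by blast
  next
    case 3
    then show ?thesis unfolding s unfolding v by (intro exI[of _ 0]) simp
  qed
qed

text \<open>Divisibility passes from the variables and their inverses to products by the twisted
  Leibniz rule v F - s(v F) = (v - s v) F + s v (F - s F).\<close>

lemma arefl_divides:
  assumes "m \<ge> 2"
  shows "\<exists>G. G * (1 - zq m i) = F - sub m (arefl m i) F"
proof -
  have mult: "\<exists>G. G * (1 - zq m i) = v * F - sub m (arefl m i) (v * F)"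
    if "\<exists>G. G * (1 - zq m i) = v - sub m (arefl m i) v"
      and "\<exists>G. G * (1 - zq m i) = F - sub m (arefl m i) F" for v F
  proof -
    from that(1) obtain G where G: "G * (1 - zq m i) = v - sub m (arefl m i) v" ..
    from that(2) obtain H where H: "H * (1 - zq m i) = F - sub m (arefl m i) F" ..
    have "(G * F + sub m (arefl m i) v * H) * (1 - zq m i)
        = (G * (1 - zq m i)) * F + sub m (arefl m i) v * (H * (1 - zq m i))"
      by (simp add: algebra_simps)
    also have "\<dots> = (v - sub m (arefl m i) v) * F + sub m (arefl m i) v * (F - sub m (arefl m i) F)"
      unfolding G H ..
    finally show ?thesis by (intro exI[of _ "G * F + sub m (arefl m i) v * H"]) (simp add: sub_simps left_diff_distrib right_diff_distrib)
  qed
  show ?thesis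
  proof (induction F rule: lpoly_var_induct)
    case one
    show ?case by (intro exI[of _ 0]) (simp add: sub_simps)
  next
    case (add F G)
    then obtain H K where "H * (1 - zq m i) = F - sub m (arefl m i) F" "K * (1 - zq m i) = G - sub m (arefl m i) G"
      by auto
    then show ?case by (intro exI[of _ "H + K"]) (simp add: sub_simps distrib_right)
  next
    case (scale c F)
    show ?case by (rule mult[OF _ scale]) (intro exI[of _ 0], simp add: sub_simps)
  next
    case (var j F)
    show ?case by (rule mult[OF _ var]) (use vpow_arefl_divides[OF assms, of 1 i j] in \<open>simp add: vpow_1\<close>)
  next
    case (inv j F)
    show ?case by (rule mult[OF _ inv]) (use vpow_arefl_divides[OF assms, of "-1" i j] in simp)
  qed
qed

definition delta :: "nat \<Rightarrow> int \<Rightarrow> lp \<Rightarrow> lp" where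
  "delta m i F = (THE G. G * (1 - zq m i) = F - sub m (arefl m i) F)"

lemma the_quotient:
  "m \<ge> 2 \<Longrightarrow> G * (1 - zq m i) = F \<Longrightarrow> (THE G. G * (1 - zq m i) = F) = G"
  by (rule the_equality) (use one_minus_zq_nonzero mult_cancel_right in metis)+

lemma delta_mult: "m \<ge> 2 \<Longrightarrow> delta m i F * (1 - zq m i) = F - sub m (arefl m i) F"
  using arefl_divides[of m i F] the_quotient[of m _ i] unfolding delta_def by metis

lemma delta_eqI: "m \<ge> 2 \<Longrightarrow> G * (1 - zq m i) = F - sub m (arefl m i) F \<Longrightarrow> delta m i F = G"
  using the_quotient unfolding delta_def by metis

section \<open>Demazure-Lusztig operators: quadratic, braid and Bernstein relations\<close>

section \<open>Demazure--Lusztig operators\<close>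

abbreviation tc :: lp where "tc \<equiv> const tvar"

lemma app_Endo: "(\<And>x y. f (x + y) = f x + f y) \<Longrightarrow> app (Endo f) = f"
  by (simp add: Endo_inverse)

definition Sub :: "nat \<Rightarrow> (int \<Rightarrow> int) \<Rightarrow> lp endo" where
  "Sub m f = Endo (sub m f)"

lemma app_Sub [simp]: "app (Sub m f) = sub m f"
  unfolding Sub_def by (rule app_Endo) (rule sub_simps)

text \<open>For \<open>1 \<le> i < m\<close> this is $T_i$. For $i$ divisible by $m$ it differs from $T_i$, which involves
  the additional factor $X_1 X_0^{-1}$; but the family is shifted by the automorphism
  $X_k \mapsto X_{k+1}$ for all $i$.\<close>

definition DL :: "nat \<Rightarrow> int \<Rightarrow> lp endo" where
  "DL m i = Endo (\<lambda>F. tc * sub m (arefl m i) F + (tc - 1) * delta m i F)"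

lemma delta_add:
  assumes "m \<ge> 2" shows "delta m i (F + G) = delta m i F + delta m i G"
  by (rule delta_eqI[OF assms]) (simp add: distrib_right delta_mult[OF assms] sub_simps)

lemma app_DL: "m \<ge> 2 \<Longrightarrow> app (DL m i) F = tc * sub m (arefl m i) F + (tc - 1) * delta m i F"
  unfolding DL_def by (subst app_Endo) (simp_all add: delta_add sub_simps distrib_left)

text \<open>The defining formula with its denominator cleared. Because 1 - z is not a zero divisor,
  it characterises the operator (\<open>DL_eqI\<close>), and further identities are verified in this
  form without dividing.\<close>

lemma DL_mult:
  assumes "m \<ge> 2"
  shows "(1 - zq m i) * app (DL m i) F = (tc - 1) * F + (1 - tc * zq m i) * sub m (arefl m i) F"
proof -
  have "(1 - zq m i) * app (DL m i) F
      = tc * (1 - zq m i) * sub m (arefl m i) F + (tc - 1) * (delta m i F * (1 - zq m i))"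
    by (simp add: app_DL[OF assms] algebra_simps)
  also have "\<dots> = (tc - 1) * F + (1 - tc * zq m i) * sub m (arefl m i) F"
    unfolding delta_mult[OF assms] by (simp add: algebra_simps)
  finally show ?thesis .
qed

lemma DL_eqI:
  assumes "m \<ge> 2" "(1 - zq m i) * G = (tc - 1) * F + (1 - tc * zq m i) * sub m (arefl m i) F"
  shows "app (DL m i) F = G"
proof -
  have "(1 - zq m i) * app (DL m i) F = (1 - zq m i) * G"
    using assms by (simp add: DL_mult)
  then show ?thesis using assms(1) one_minus_zq_nonzero mult_left_cancel by metis
qed

lemma DL_cong: "m \<ge> 1 \<Longrightarrow> int m dvd i - j \<Longrightarrow> DL m i = DL m j"
  using zq_cong[of m i j] arefl_cong[of m i j] by (simp add: DL_def delta_def)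

lemma DL_one: "m \<ge> 2 \<Longrightarrow> app (DL m i) 1 = tc"
  by (rule DL_eqI) (simp_all add: sub_simps algebra_simps)

lemma DL_invariant_mult:
  assumes "m \<ge> 2" "sub m (arefl m i) f = f"
  shows "app (DL m i) (f * F) = f * app (DL m i) F"
  by (rule DL_eqI[OF assms(1)])
    (simp add: sub_simps assms mult.left_commute[of "1 - zq m i"] DL_mult, simp add: algebra_simps)

lemma DL_const: "m \<ge> 2 \<Longrightarrow> app (DL m i) (const c * F) = const c * app (DL m i) F"
  by (rule DL_invariant_mult) (simp_all add: sub_simps)

lemma arefl_self: "arefl m i i = i + 1" "m \<ge> 2 \<Longrightarrow> arefl m i (i + 1) = i"
  using not_dvd_diff_one[of m 0] by (auto simp: arefl_def)

lemma sub_arefl_zq: "m \<ge> 2 \<Longrightarrow> sub m (arefl m i) (zq m i) * zq m i = 1"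
  using Xpow_inverse[of m i] Xpow_inverse[of m "i + 1"]
  by (simp add: sub_zq arefl_self) (simp add: zq_def mult_ac)

text \<open>A Bernstein relation: T_i + 1 - t equals t T_i^{-1}, so this says T_i X_i = t X_{i+1}
  T_i^{-1}. Together with \<open>DL_X_Suc\<close> it is the pattern that the Y_i reproduce
  later.\<close>

lemma DL_X:
  assumes "m \<ge> 2"
  shows "app (DL m i) (Xpow m i 1 * F) = Xpow m (i + 1) 1 * (app (DL m i) F + (1 - tc) * F)"
proof (rule DL_eqI[OF assms])
  have "(1 - zq m i) * (Xpow m (i + 1) 1 * (app (DL m i) F + (1 - tc) * F))
      = Xpow m (i + 1) 1 * ((1 - zq m i) * app (DL m i) F + (1 - zq m i) * (1 - tc) * F)"
    by (simp add: algebra_simps)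
  also have "\<dots> = Xpow m (i + 1) 1 * zq m i * ((tc - 1) * F)
      + (1 - tc * zq m i) * (Xpow m (i + 1) 1 * sub m (arefl m i) F)"
    unfolding DL_mult[OF assms] by (simp add: algebra_simps)
  also have "\<dots> = (tc - 1) * (Xpow m i 1 * F) + (1 - tc * zq m i) * sub m (arefl m i) (Xpow m i 1 * F)"
    unfolding Xpow_zq using assms by (simp add: sub_simps sub_Xpow arefl_self mult_ac)
  finally show "(1 - zq m i) * (Xpow m (i + 1) 1 * (app (DL m i) F + (1 - tc) * F))
      = (tc - 1) * (Xpow m i 1 * F) + (1 - tc * zq m i) * sub m (arefl m i) (Xpow m i 1 * F)" .
qed

lemma DL_X_Suc:
  assumes "m \<ge> 2"
  shows "app (DL m i) (Xpow m (i + 1) 1 * F) = Xpow m i 1 * app (DL m i) F + (tc - 1) * (Xpow m (i + 1) 1 * F)"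
proof (rule DL_eqI[OF assms])
  have "(1 - zq m i) * (Xpow m i 1 * app (DL m i) F + (tc - 1) * (Xpow m (i + 1) 1 * F))
      = Xpow m i 1 * ((1 - zq m i) * app (DL m i) F) + (Xpow m (i + 1) 1 - Xpow m (i + 1) 1 * zq m i) * ((tc - 1) * F)"
    by (simp add: algebra_simps)
  also have "\<dots> = (tc - 1) * (Xpow m (i + 1) 1 * F) + (1 - tc * zq m i) * (Xpow m i 1 * sub m (arefl m i) F)"
    unfolding DL_mult[OF assms] Xpow_zq by (simp add: algebra_simps)
  finally show "(1 - zq m i) * (Xpow m i 1 * app (DL m i) F + (tc - 1) * (Xpow m (i + 1) 1 * F))
      = (tc - 1) * (Xpow m (i + 1) 1 * F) + (1 - tc * zq m i) * sub m (arefl m i) (Xpow m (i + 1) 1 * F)"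
    using assms by (simp add: sub_simps sub_Xpow arefl_self)
qed

lemma arefl_other: "\<not> int m dvd k - i \<Longrightarrow> \<not> int m dvd k - i - 1 \<Longrightarrow> arefl m i k = k"
  by (simp add: arefl_def)

lemma DL_X_other:
  assumes "m \<ge> 2" "\<not> int m dvd k - i" "\<not> int m dvd k - i - 1"
  shows "app (DL m i) (Xpow m k 1 * F) = Xpow m k 1 * app (DL m i) F"
  by (rule DL_invariant_mult) (use assms in \<open>simp_all add: sub_Xpow arefl_other\<close>)

lemma DL_quadratic:
  assumes "m \<ge> 2"
  shows "DL m i * DL m i = mul (tc - 1) * DL m i + mul tc"
proof (rule endo_eqI)
  fix F
  let ?z = "zq m i" and ?s = "sub m (arefl m i)" and ?T = "app (DL m i)"
  have ss: "?s (?s F) = F" using assms by (simp add: sub_comp arefl_arefl)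
  have sz: "?s ?z * ?z = 1" by (rule sub_arefl_zq[OF assms])
  \<comment> \<open>Applying s to \<open>DL_mult\<close> and using s(z) = 1/z expresses s(T F)
    through F and s F. Inserting this into \<open>DL_mult\<close> for the argument T F leaves a
    polynomial identity.\<close>
  have "?s ((1 - ?z) * ?T F) = ?s ((tc - 1) * F + (1 - tc * ?z) * ?s F)"
    by (simp add: DL_mult[OF assms])
  then have "?z * ((1 - ?s ?z) * ?s (?T F)) = ?z * ((tc - 1) * ?s F + (1 - tc * ?s ?z) * F)"
    by (simp add: sub_simps ss)
  then have "(?z - ?s ?z * ?z) * ?s (?T F) = (tc - 1) * ?z * ?s F + (?z - tc * (?s ?z * ?z)) * F"
    by (simp add: algebra_simps)
  then have sT: "(?z - 1) * ?s (?T F) = (tc - 1) * ?z * ?s F + (?z - tc) * F"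
    unfolding sz by simp
  have "(1 - ?z) * ((1 - ?z) * ((tc - 1) * ?T F + tc * F)) =
      (1 - ?z) * ((tc - 1) * ?T F + (1 - tc * ?z) * ?s (?T F))"
  proof -
    have "(1 - ?z) * ((1 - tc * ?z) * ?s (?T F)) = - ((1 - tc * ?z) * ((?z - 1) * ?s (?T F)))"
      by (simp add: algebra_simps)
    also have "\<dots> = - ((1 - tc * ?z) * ((tc - 1) * ?z * ?s F + (?z - tc) * F))"
      unfolding sT ..
    finally have 1: "(1 - ?z) * ((1 - tc * ?z) * ?s (?T F)) = \<dots>" .
    have 2: "(1 - ?z) * ((1 - ?z) * ((tc - 1) * ?T F + tc * F)) = (1 - ?z) * (tc - 1) * ((1 - ?z) * ?T F) + (1 - ?z) * (1 - ?z) * tc * F"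
      "(1 - ?z) * ((tc - 1) * ?T F + (1 - tc * ?z) * ?s (?T F)) = (tc - 1) * ((1 - ?z) * ?T F) + (1 - ?z) * ((1 - tc * ?z) * ?s (?T F))"
      by (simp_all add: algebra_simps)
    show ?thesis
      unfolding 2 1 DL_mult[OF assms] by (simp add: algebra_simps)
  qed
  then have "(1 - ?z) * ((tc - 1) * ?T F + tc * F) = (tc - 1) * ?T F + (1 - tc * ?z) * ?s (?T F)"
    using one_minus_zq_nonzero[OF assms] mult_left_cancel by metis
  then show "app (DL m i * DL m i) F = app (mul (tc - 1) * DL m i + mul tc) F"
    using DL_eqI[OF assms] by simp
qed

text \<open>Covers both the translation of all indices and, for distant indices, the reflection s_j
  itself.\<close>

lemma DL_intertwine:
  assumes "m \<ge> 2" "periodic m f" "sub m f (zq m i) = zq m j" "\<And>k. f (arefl m i k) = arefl m j (f k)"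
  shows "sub m f (app (DL m i) F) = app (DL m j) (sub m f F)"
proof (rule DL_eqI[OF assms(1), symmetric])
  have "(1 - zq m j) * sub m f (app (DL m i) F) = sub m f ((1 - zq m i) * app (DL m i) F)"
    by (simp add: sub_simps assms)
  also have "\<dots> = (tc - 1) * sub m f F + (1 - tc * zq m j) * sub m f (sub m (arefl m i) F)"
    unfolding DL_mult[OF assms(1)] by (simp add: sub_simps assms)
  also have "sub m f (sub m (arefl m i) F) = sub m (arefl m j) (sub m f F)"
    by (simp add: sub_comp assms)
  finally show "(1 - zq m j) * sub m f (app (DL m i) F)
      = (tc - 1) * sub m f F + (1 - tc * zq m j) * sub m (arefl m j) (sub m f F)" .
qed

lemma DL_shift: "m \<ge> 2 \<Longrightarrow> sub m (\<lambda>k. k + c) (app (DL m i) F) = app (DL m (i + c)) (sub m (\<lambda>k. k + c) F)"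
  by (rule DL_intertwine) (simp_all add: sub_zq arefl_shift, simp add: zq_def add_ac)

lemma arefl_commute:
  assumes "m \<ge> 2" "\<not> int m dvd j - i" "\<not> int m dvd j - i - 1" "\<not> int m dvd j - i + 1"
  shows "arefl m j (arefl m i k) = arefl m i (arefl m j k)"
proof -
  have *: "\<not> (int m dvd a \<and> int m dvd b)" if "b - a = j - i \<or> b - a = j - i - 1 \<or> b - a = j - i + 1" for a b
    using that assms(2-4) dvd_diff[of "int m" b a] by metis
  have "\<not> (int m dvd k - j \<and> int m dvd k - i)" "\<not> (int m dvd k - j \<and> int m dvd k - i - 1)"
    "\<not> (int m dvd k - j - 1 \<and> int m dvd k - i)" "\<not> (int m dvd k - j - 1 \<and> int m dvd k - i - 1)"
    "\<not> (int m dvd k - j + 1 \<and> int m dvd k - i)" "\<not> (int m dvd k - j - 2 \<and> int m dvd k - i - 1)"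
    "\<not> (int m dvd k - j \<and> int m dvd k - i + 1)" "\<not> (int m dvd k - j - 1 \<and> int m dvd k - i - 2)"
    by (rule *; simp)+
  then show ?thesis by (auto simp: arefl_def algebra_simps)
qed

lemma DL_commute:
  assumes "m \<ge> 2" "\<not> int m dvd j - i" "\<not> int m dvd j - i - 1" "\<not> int m dvd j - i + 1"
  shows "DL m i * DL m j = DL m j * DL m i"
proof (rule endo_eqI)
  fix F
  have nd: "arefl m i j = j" "arefl m i (j + 1) = j + 1" "arefl m j i = i" "arefl m j (i + 1) = i + 1"
    using assms dvd_minus_iff[of "int m" "j - i"] dvd_minus_iff[of "int m" "j - i - 1"] dvd_minus_iff[of "int m" "j - i + 1"]
    by (auto simp: arefl_def algebra_simps)
  have z: "sub m (arefl m i) (zq m j) = zq m j" "sub m (arefl m j) (zq m i) = zq m i"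
    using assms(1) nd by (simp_all add: sub_zq) (simp_all add: zq_def)
  have inv: "sub m (arefl m i) (1 - zq m j) = 1 - zq m j" "sub m (arefl m i) (tc - 1) = tc - 1"
    "sub m (arefl m i) (1 - tc * zq m j) = 1 - tc * zq m j"
    by (simp_all add: sub_simps z)
  have s: "sub m (arefl m j) (app (DL m i) F) = app (DL m i) (sub m (arefl m j) F)"
    by (rule DL_intertwine) (use assms in \<open>simp_all add: z arefl_commute\<close>)
  have "(1 - zq m j) * app (DL m i) (app (DL m j) F)
      = (tc - 1) * app (DL m i) F + (1 - tc * zq m j) * sub m (arefl m j) (app (DL m i) F)"
    unfolding DL_invariant_mult[OF assms(1) inv(1), symmetric] DL_mult[OF assms(1)] s
    by (simp add: app_add DL_invariant_mult[OF assms(1) inv(2)] DL_invariant_mult[OF assms(1) inv(3)])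
  then show "app (DL m i * DL m j) F = app (DL m j * DL m i) F"
    using DL_eqI[OF assms(1)] by simp
qed

text \<open>\<open>B\<close> is the defect of the braid relation. Moving X_i, X_{i+1}, X_{i+2}
  through it by the Bernstein and quadratic relations permutes them by the longest element of the
  symmetric group, and all terms of lower length cancel.\<close>

lemma DL_braid_X:
  fixes m :: nat and i :: int
  assumes "m \<ge> 3"
  defines "B \<equiv> DL m i * DL m (i + 1) * DL m i - DL m (i + 1) * DL m i * DL m (i + 1)"
  shows "app B (Xpow m i 1 * F) = Xpow m (i + 2) 1 * app B F"
    "app B (Xpow m (i + 1) 1 * F) = Xpow m (i + 1) 1 * app B F"
    "app B (Xpow m (i + 2) 1 * F) = Xpow m i 1 * app B F"
proof -
  have m: "m \<ge> 2" using assms(1) by simp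
  define h where "h = 1 - tc"
  have nd: "\<not> int m dvd 2" "\<not> int m dvd 1" "\<not> int m dvd - 1" "\<not> int m dvd -2"
    using assms(1) by (auto dest: zdvd_imp_le)
  let ?S = "app (DL m i)" and ?T = "app (DL m (i + 1))"
  let ?x = "Xpow m i 1" and ?y = "Xpow m (i + 1) 1" and ?w = "Xpow m (i + 2) 1"
  have S: "?S (?x * F) = ?y * ?S F + h * (?y * F)" "?S (?y * F) = ?x * ?S F - h * (?y * F)"
    "?S (?w * F) = ?w * ?S F" for F
    using DL_X[OF m, of i F] DL_X_Suc[OF m, of i F] DL_X_other[OF m, of "i + 2" i F] nd
    by (simp_all add: h_def algebra_simps)
  have T: "?T (?y * F) = ?w * ?T F + h * (?w * F)" "?T (?w * F) = ?y * ?T F - h * (?w * F)"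
    "?T (?x * F) = ?x * ?T F" for F
    using DL_X[OF m, of "i + 1" F] DL_X_Suc[OF m, of "i + 1" F] DL_X_other[OF m, of i "i + 1" F] nd
    by (simp_all add: h_def algebra_simps)
  have hS: "?S (h * F) = h * ?S F" and hT: "?T (h * F) = h * ?T F" for F
    using DL_const[OF m, of i "1 - tvar" F] DL_const[OF m, of "i + 1" "1 - tvar" F]
    by (simp_all add: h_def const_simps)
  have q: "?S (?S F) = tc * F - h * ?S F" "?T (?T F) = tc * F - h * ?T F" for F
    using arg_cong[OF DL_quadratic[OF m, of i], of "\<lambda>A. app A F"]
      arg_cong[OF DL_quadratic[OF m, of "i + 1"], of "\<lambda>A. app A F"]
    by (simp_all add: h_def algebra_simps)
  note rules = S T hS hT q app_add app_diff
  show "app B (?x * F) = ?w * app B F" "app B (?y * F) = ?y * app B F" "app B (?w * F) = ?x * app B F"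
    unfolding B_def by (simp_all add: rules) (simp_all add: algebra_simps)
qed

text \<open>The defect \<open>B\<close> kills 1, and each variable passes through it at the cost of
  a nonzero factor: B(X_j F) = v B(F). Hence it vanishes on everything generated from 1 by variables
  and, since v can be cancelled, by their inverses.\<close>

lemma DL_braid:
  assumes "m \<ge> 3"
  shows "DL m i * DL m (i + 1) * DL m i = DL m (i + 1) * DL m i * DL m (i + 1)"
proof -
  define B where "B = DL m i * DL m (i + 1) * DL m i - DL m (i + 1) * DL m i * DL m (i + 1)"
  have m: "m \<ge> 2" using assms(1) by simp
  have const: "app B (const c * F) = const c * app B F" for c F
    using m by (simp add: B_def DL_const right_diff_distrib)
  \<comment> \<open>Up to a power of q, a variable with index congruent to i, i + 1 or i + 2 is one
    of those in \<open>DL_braid_X\<close>; every other variable is fixed by both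
    reflections.\<close>
  have var: "\<exists>v. v \<noteq> 0 \<and> (\<forall>F. app B (var j * F) = v * app B F)" for j
  proof (cases "1 \<le> j \<and> j \<le> m \<and> (\<exists>a\<in>{0,1,2}. int m dvd int j - (i + a))")
    case True
    then obtain a where "a \<in> {0,1,2}" "int m dvd int j - (i + a)" by blast
    then obtain l where a: "a \<in> {0,1,2}" "int j - (i + a) = int m * l" by (auto elim: dvdE)
    have "var j = Xpow m (int j) 1" using True by (simp add: Xpow_vpow vpow_1)
    also have "int j = (i + a) + int m * l" using a by simp
    finally have v: "var j = const (qvar powi - l) * Xpow m (i + a) 1"
      using m by (simp add: Xpow_shift)
    have c: "const (qvar powi - l) \<noteq> 0"
      using const_inverse(1)[of "qvar powi - l"] by (metis mult_zero_left power_int_eq_0_iff qvar_nonzero zero_neq_one)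
    have "\<exists>b. \<forall>F. app B (Xpow m (i + a) 1 * F) = Xpow m b 1 * app B F"
      using a(1) DL_braid_X[OF assms, of i] unfolding B_def[symmetric] by auto
    then obtain b where "\<forall>F. app B (Xpow m (i + a) 1 * F) = Xpow m b 1 * app B F" ..
    then show ?thesis
      unfolding v using c by (intro exI[of _ "const (qvar powi - l) * Xpow m b 1"]) (simp add: const mult.assoc)
  next
    case False
    have inv: "sub m (arefl m i) (var j) = var j" "sub m (arefl m (i + 1)) (var j) = var j"
      using False by (auto simp: sub_var xp_def Xpow_vpow vpow_1 arefl_def algebra_simps)
    have "app B (var j * F) = var j * app B F" for F
      by (simp add: B_def DL_invariant_mult[OF m inv(1)] DL_invariant_mult[OF m inv(2)] right_diff_distrib)
    moreover have "var j \<noteq> 0"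
      using vpow_inverse(1)[of j] by (metis mult_zero_left zero_neq_one)
    ultimately show ?thesis by blast
  qed
  have "app B F = 0" for F
  proof (induction F rule: lpoly_var_induct)
    case one
    have "app (DL m k) tc = tc * tc" for k
      using DL_const[OF m, of k tvar 1] by (simp add: DL_one[OF m])
    moreover have "app (DL m k) (tc * tc) = tc * (tc * tc)" for k
      using DL_const[OF m, of k tvar tc] calculation by simp
    ultimately show ?case by (simp add: B_def DL_one[OF m])
  next
    case (inv j F)
    obtain v where v: "v \<noteq> 0" "\<forall>F. app B (var j * F) = v * app B F" using var by blast
    then have "v * app B (vpow j (-1) * F) = app B (var j * (vpow j (-1) * F))" by simp
    also have "var j * (vpow j (-1) * F) = F"
      by (simp add: mult.assoc[symmetric] vpow_inverse)
    finally show ?case using inv v by simp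
  qed (use var in \<open>auto simp: app_add const\<close>, metis mult_zero_right)
  then have "B = 0" by (intro endo_eqI) simp
  then show ?thesis by (simp add: B_def)
qed

lemma small_dvd: "a \<in> {- int m<..<int m} \<Longrightarrow> int m dvd a \<longleftrightarrow> a = 0"
  using zdvd_not_zless[of a "int m"] zdvd_not_zless[of "- a" "int m"]
  by (cases a "0::int" rule: linorder_cases) auto

lemma mul_const_DL: "m \<ge> 2 \<Longrightarrow> DL m i * mul (const c) = mul (const c) * DL m i"
  by (rule endo_eqI) (simp add: DL_const)

lemma
  fixes i m :: nat
  assumes "1 \<le> i" "i < m"
  shows DL_var: "app (DL m (int i)) (var i * F) = var (i + 1) * (app (DL m (int i)) F + (1 - tc) * F)"
    and DL_var_Suc: "app (DL m (int i)) (var (i + 1) * F) = var i * app (DL m (int i)) F + (tc - 1) * (var (i + 1) * F)"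
    and DL_vpow_other: "j \<noteq> i \<Longrightarrow> j \<noteq> i + 1 \<Longrightarrow> app (DL m (int i)) (vpow j e * F) = vpow j e * app (DL m (int i)) F"
    and DL_inv: "app (DL m (int i)) (vpow i (-1) * F) = vpow (i + 1) (-1) * app (DL m (int i)) F - (1 - tc) * (vpow i (-1) * F)"
    and DL_inv_Suc: "app (DL m (int i)) (vpow (i + 1) (-1) * F) = vpow i (-1) * (app (DL m (int i)) F + (1 - tc) * F)"
proof -
  have m: "m \<ge> 2" using assms by simp
  have v: "var i = Xpow m (int i) 1" "var (i + 1) = Xpow m (int i + 1) 1"
    using assms Xpow_vpow[of i m 1] Xpow_vpow[of "i + 1" m 1] by (simp_all add: vpow_1 add.commute)
  show 1: "app (DL m (int i)) (var i * F) = var (i + 1) * (app (DL m (int i)) F + (1 - tc) * F)" for F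
    unfolding v by (rule DL_X[OF m])
  show 2: "app (DL m (int i)) (var (i + 1) * F) = var i * app (DL m (int i)) F + (tc - 1) * (var (i + 1) * F)" for F
    unfolding v by (rule DL_X_Suc[OF m])
  show "j \<noteq> i \<Longrightarrow> j \<noteq> i + 1 \<Longrightarrow> app (DL m (int i)) (vpow j e * F) = vpow j e * app (DL m (int i)) F"
  proof (rule DL_invariant_mult[OF m])
    assume j: "j \<noteq> i" "j \<noteq> i + 1"
    show "sub m (arefl m (int i)) (vpow j e) = vpow j e"
    proof (cases "1 \<le> j \<and> j \<le> m")
      case True
      then have "\<not> int m dvd int j - int i" "\<not> int m dvd int j - int i - 1"
        using small_dvd[of "int j - int i" m] small_dvd[of "int j - int i - 1" m] assms j by auto
      then show ?thesis using True by (simp add: sub_vpow xp_def arefl_other Xpow_vpow)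
    qed (auto simp: sub_vpow xp_def)
  qed
  show "app (DL m (int i)) (vpow i (-1) * F) = vpow (i + 1) (-1) * app (DL m (int i)) F - (1 - tc) * (vpow i (-1) * F)"
  proof -
    have "app (DL m (int i)) F = app (DL m (int i)) (var i * (vpow i (-1) * F))"
      by (simp add: mult.assoc[symmetric] vpow_inverse)
    then have "vpow (i + 1) (-1) * app (DL m (int i)) F = (vpow (i + 1) (-1) * var (i + 1)) * (app (DL m (int i)) (vpow i (-1) * F) + (1 - tc) * (vpow i (-1) * F))"
      unfolding 1 by (simp add: mult.assoc)
    then show ?thesis by (simp add: vpow_inverse[of "i + 1", simplified] algebra_simps)
  qed
  show "app (DL m (int i)) (vpow (i + 1) (-1) * F) = vpow i (-1) * (app (DL m (int i)) F + (1 - tc) * F)"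
  proof -
    have c: "var (i + 1) * (vpow (i + 1) (-1) * F) = F"
      by (simp add: mult.assoc[symmetric] vpow_inverse[of "i + 1", simplified])
    have "app (DL m (int i)) F = var i * app (DL m (int i)) (vpow (i + 1) (-1) * F) + (tc - 1) * F"
      using 2[of "vpow (i + 1) (-1) * F"] unfolding c .
    then have "vpow i (-1) * (app (DL m (int i)) F + (1 - tc) * F) = (vpow i (-1) * var i) * app (DL m (int i)) (vpow (i + 1) (-1) * F)"
      by (simp add: algebra_simps)
    then show ?thesis by (simp add: vpow_inverse)
  qed
qed

lemma DL_var_other:
  "1 \<le> i \<Longrightarrow> i < m \<Longrightarrow> j \<noteq> i \<Longrightarrow> j \<noteq> i + 1 \<Longrightarrow> app (DL m (int i)) (var j * F) = var j * app (DL m (int i)) F"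
  using DL_vpow_other[of i m j 1 F] by (simp add: vpow_1)

lemma DL_polys:
  assumes "F \<in> polys m" "1 \<le> i" "i < m" shows "app (DL m (int i)) F \<in> polys m"
  using assms(1)
proof (induction F rule: polys_induct)
  case one
  show ?case using assms by (simp add: DL_one)
next
  case (scale c F)
  then show ?case using assms by (simp add: DL_const)
next
  case (var j F)
  then show ?case
    using assms DL_var[of i m F] DL_var_Suc[of i m F] DL_var_other[of i m j F]
    by (cases "j = i"; cases "j = i + 1") auto
qed (simp add: app_add)

lemma DL_laurent:
  assumes "F \<in> laurent m" "1 \<le> i" "i < m" shows "app (DL m (int i)) F \<in> laurent m"
  using assms(1)
proof (induction F rule: laurent_induct)
  case one
  show ?case using assms by (simp add: DL_one)
next
  case (scale c F)
  then show ?case using assms by (simp add: DL_const)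
next
  case (var j F)
  then show ?case
    using assms DL_var[of i m F] DL_var_Suc[of i m F] DL_var_other[of i m j F]
    by (cases "j = i"; cases "j = i + 1") auto
next
  case (inv j F)
  then show ?case
    using assms DL_inv[of i m F] DL_inv_Suc[of i m F] DL_vpow_other[of i m j "-1" F]
    by (cases "j = i"; cases "j = i + 1") auto
qed (simp add: app_add)


section \<open>The operators Pi and T_i for all residues i, and their relations\<close>

subsection \<open>The operators of the affine Hecke algebra\<close>

definition PiE :: "nat \<Rightarrow> lp endo" where
  "PiE m = mul (Xpow m 1 1) * Sub m (\<lambda>k. k + 1)"

definition PiI :: "nat \<Rightarrow> lp endo" where
  "PiI m = Sub m (\<lambda>k. k - 1) * mul (Xpow m 1 (-1))"

text \<open>At residue 0 the operator is defined as Pi T_{-1} Pi^{-1}, which the relation Pi T_{-1}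
  = T_0 Pi forces. That it agrees with the formula involving the factor X_1 / X_0 is part of
  \<open>T_op_eq\<close>.\<close>

definition TT :: "nat \<Rightarrow> int \<Rightarrow> lp endo" where
  "TT m i = (if int m dvd i then PiE m * DL m (-1) * PiI m else DL m i)"

definition TTinv :: "nat \<Rightarrow> int \<Rightarrow> lp endo" where
  "TTinv m i = mul (const (inverse tvar)) * (TT m i + 1 - mul tc)"

lemma Pi_inverse: "PiE m * PiI m = 1" "PiI m * PiE m = 1"
proof -
  show "PiE m * PiI m = 1"
    by (rule endo_eqI) (simp add: PiE_def PiI_def sub_comp mult.assoc[symmetric] Xpow_inverse)
  show "PiI m * PiE m = 1"
    by (rule endo_eqI) (simp add: PiE_def PiI_def mult.assoc[symmetric] Xpow_inverse, simp add: sub_comp)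
qed

lemma DL_eq_TT: "1 \<le> i \<Longrightarrow> i < m \<Longrightarrow> TT m (int i) = DL m (int i)"
  by (auto simp: TT_def dest: zdvd_imp_le)

lemma TT_cong: "m \<ge> 1 \<Longrightarrow> int m dvd i - j \<Longrightarrow> TT m i = TT m j"
  using DL_cong[of m i j] dvd_add_right_iff[of "int m" "i - j" j] by (auto simp: TT_def)

text \<open>Away from residue 0 the prefactor X_1 of Pi is fixed by s_{i+1}, and the shift does the
  rest. The step into residue 0 is the definition of \<open>TT\<close>. The step out of it needs
  Pi^2 T_{-1} = T_1 Pi^2, which holds since Pi^2 is a shift by 2 followed by multiplication by X_1
  X_2, and s_1 fixes X_1 X_2.\<close>

lemma Pi_TT:
  assumes "m \<ge> 2" shows "PiE m * TT m i = TT m (i + 1) * PiE m"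
proof -
  consider "\<not> int m dvd i" "\<not> int m dvd i + 1" | "int m dvd i + 1" "\<not> int m dvd i" | "int m dvd i" "\<not> int m dvd i + 1"
    using not_dvd_diff_one[OF assms] by auto
  then show ?thesis
  proof cases
    case 1
    then have nd: "\<not> int m dvd 1 - (i + 1)" "\<not> int m dvd 1 - (i + 1) - 1"
      using dvd_minus_iff[of "int m" i] dvd_minus_iff[of "int m" "i + 1"] by simp_all
    show ?thesis
      by (rule endo_eqI) (use 1 in \<open>simp add: TT_def PiE_def DL_X_other[OF assms nd] DL_shift[OF assms]\<close>)
  next
    case 2
    then have "DL m i = DL m (-1)" using assms by (intro DL_cong) auto
    then show ?thesis using 2 by (simp add: TT_def mult.assoc Pi_inverse)
  next
    case 3
    then have D: "DL m (i + 1) = DL m 1" using assms by (intro DL_cong) auto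
    have PP: "app (PiE m * PiE m) F = (Xpow m 1 1 * Xpow m 2 1) * sub m (\<lambda>k. k + 2) F" for F
      using assms by (simp add: PiE_def sub_simps sub_Xpow sub_comp mult.assoc add.assoc)
    have inv: "sub m (arefl m 1) (Xpow m 1 1 * Xpow m 2 1) = Xpow m 1 1 * Xpow m 2 1"
      using assms arefl_self[of m 1] by (simp add: sub_simps sub_Xpow mult.commute)
    have "PiE m * PiE m * DL m (-1) = DL m 1 * (PiE m * PiE m)"
    proof (rule endo_eqI)
      fix F
      show "app (PiE m * PiE m * DL m (-1)) F = app (DL m 1 * (PiE m * PiE m)) F"
        using DL_shift[OF assms, of 2 "-1" F] DL_invariant_mult[OF assms inv, of "sub m (\<lambda>k. k + 2) F"]
          PP[of F] PP[of "app (DL m (-1)) F"] by simp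
    qed
    then have "PiE m * PiE m * DL m (-1) * PiI m = DL m 1 * PiE m * (PiE m * PiI m)"
      by (simp add: mult.assoc)
    then show ?thesis using 3 D by (simp add: TT_def mult.assoc Pi_inverse)
  qed
qed

lemma TT_conj:
  assumes "m \<ge> 2"
  shows "PiE m * TT m i * PiI m = TT m (i + 1)" "PiI m * TT m i * PiE m = TT m (i - 1)"
proof -
  show "PiE m * TT m i * PiI m = TT m (i + 1)"
    by (simp add: Pi_TT[OF assms] mult.assoc Pi_inverse)
  have "PiI m * TT m i * PiE m = PiI m * (PiE m * TT m (i - 1))"
    by (simp add: Pi_TT[OF assms] mult.assoc)
  then show "PiI m * TT m i * PiE m = TT m (i - 1)"
    by (simp add: mult.assoc[symmetric] Pi_inverse)
qed

text \<open>Conjugation by $\Pi$ reduces the relations among the $T_i$ to a single residue $i$.\<close>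

lemma conj_mult:
  "PiE m * (A * B) * PiI m = (PiE m * A * PiI m) * (PiE m * B * PiI m)"
  "PiI m * (A * B) * PiE m = (PiI m * A * PiE m) * (PiI m * B * PiE m)"
  by (metis (no_types, opaque_lifting) Pi_inverse mult.assoc mult_1_right)+

lemma TT_shift_induct:
  assumes "m \<ge> 2" "P 1"
    and "\<And>i. P i \<Longrightarrow> P (i + 1)" "\<And>i. P i \<Longrightarrow> P (i - 1)"
  shows "P (i :: int)"
  by (induction i rule: int_induct[where k = 1]) (use assms in auto)

lemma mul_const_TT: 
  assumes "m \<ge> 2" shows "TT m i * mul (const c) = mul (const c) * TT m i"
proof -
  have P: "PiE m * mul (const c) = mul (const c) * PiE m" "PiI m * mul (const c) = mul (const c) * PiI m"
    by (rule endo_eqI; simp add: PiE_def PiI_def sub_simps mult.left_commute)+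
  have "PiE m * DL m (-1) * PiI m * mul (const c) = PiE m * (DL m (-1) * mul (const c)) * PiI m"
    by (simp add: P mult.assoc)
  also have "\<dots> = mul (const c) * (PiE m * DL m (-1) * PiI m)"
    unfolding mul_const_DL[OF assms] by (simp add: P flip: mult.assoc)
  finally show ?thesis by (simp add: TT_def mul_const_DL[OF assms])
qed

lemma mul_const_Pi: "PiE m * mul (const c) = mul (const c) * PiE m"
  by (rule endo_eqI; simp add: PiE_def PiI_def sub_simps mult.left_commute)

lemma TT_quadratic:
  assumes "m \<ge> 2" shows "TT m i * TT m i = mul (tc - 1) * TT m i + mul tc"
proof (cases "int m dvd i")
  case True
  then have T: "TT m i = PiE m * DL m (-1) * PiI m" by (simp add: TT_def)
  have P: "PiE m * mul (const c) = mul (const c) * PiE m" for c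
    by (rule mul_const_Pi)
  have "TT m i * TT m i = PiE m * (DL m (-1) * DL m (-1)) * PiI m"
    unfolding T conj_mult ..
  also have "\<dots> = PiE m * (mul (const (tvar - 1)) * DL m (-1) + mul tc) * PiI m"
    unfolding DL_quadratic[OF assms] by (simp add: const_simps)
  also have "\<dots> = mul (const (tvar - 1)) * TT m i + mul tc"
    unfolding T by (simp add: distrib_left distrib_right mult.assoc[symmetric] P) (simp add: mult.assoc Pi_inverse)
  finally show ?thesis by (simp add: const_simps)
qed (simp add: TT_def DL_quadratic assms)

lemma TT_braid:
  assumes "m \<ge> 3"
  shows "TT m i * TT m (i + 1) * TT m i = TT m (i + 1) * TT m i * TT m (i + 1)"
proof -
  have m: "m \<ge> 2" using assms by simp
  show ?thesis
  proof (rule TT_shift_induct[OF m, of "\<lambda>i. TT m i * TT m (i + 1) * TT m i = TT m (i + 1) * TT m i * TT m (i + 1)"])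
    \<comment> \<open>For m >= 3 neither 1 nor 2 is divisible by m, so at i = 1 the operators are
      plain Demazure-Lusztig operators.\<close>
    have "\<not> int m dvd 1" "\<not> int m dvd 2" using assms by (auto dest: zdvd_imp_le)
    then show "TT m 1 * TT m (1 + 1) * TT m 1 = TT m (1 + 1) * TT m 1 * TT m (1 + 1)"
      using DL_braid[OF assms, of 1] by (simp add: TT_def)
  next
    fix i assume IH: "TT m i * TT m (i + 1) * TT m i = TT m (i + 1) * TT m i * TT m (i + 1)"
    from arg_cong[OF IH, of "\<lambda>A. PiE m * A * PiI m"]
    show "TT m (i + 1) * TT m (i + 1 + 1) * TT m (i + 1) = TT m (i + 1 + 1) * TT m (i + 1) * TT m (i + 1 + 1)"
      unfolding conj_mult TT_conj[OF m] .
    from arg_cong[OF IH, of "\<lambda>A. PiI m * A * PiE m"]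
    show "TT m (i - 1) * TT m (i - 1 + 1) * TT m (i - 1) = TT m (i - 1 + 1) * TT m (i - 1) * TT m (i - 1 + 1)"
      unfolding conj_mult TT_conj[OF m] by simp
  qed
qed

lemma TT_commute:
  assumes "m \<ge> 2" "\<not> int m dvd j - i - 1" "\<not> int m dvd j - i + 1"
  shows "TT m i * TT m j = TT m j * TT m i"
proof -
  define d where "d = j - i"
  have "TT m i * TT m (i + d) = TT m (i + d) * TT m i"
  proof (rule TT_shift_induct[OF assms(1), of "\<lambda>i. TT m i * TT m (i + d) = TT m (i + d) * TT m i"])
    show "TT m 1 * TT m (1 + d) = TT m (1 + d) * TT m 1"
    proof (cases "int m dvd d")
      case True
      then have "TT m (1 + d) = TT m 1" using assms(1) by (intro TT_cong) auto
      then show ?thesis by simp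
    next
      case False
      then have "DL m 1 * DL m (1 + d) = DL m (1 + d) * DL m 1"
        using assms by (intro DL_commute) (auto simp: d_def algebra_simps)
      moreover have "\<not> int m dvd 1" "\<not> int m dvd 1 + d"
        using assms by (auto dest: zdvd_imp_le simp: d_def algebra_simps)
      ultimately show ?thesis by (simp add: TT_def)
    qed
  next
    fix i assume IH: "TT m i * TT m (i + d) = TT m (i + d) * TT m i"
    from arg_cong[OF IH, of "\<lambda>A. PiE m * A * PiI m"]
    show "TT m (i + 1) * TT m (i + 1 + d) = TT m (i + 1 + d) * TT m (i + 1)"
      unfolding conj_mult TT_conj[OF assms(1)] by (simp add: algebra_simps)
    from arg_cong[OF IH, of "\<lambda>A. PiI m * A * PiE m"]
    show "TT m (i - 1) * TT m (i - 1 + d) = TT m (i - 1 + d) * TT m (i - 1)"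
      unfolding conj_mult TT_conj[OF assms(1)] by (simp add: algebra_simps)
  qed
  then show ?thesis by (simp add: d_def)
qed

lemma TT_inverse:
  assumes "m \<ge> 2" shows "TT m i * TTinv m i = 1" "TTinv m i * TT m i = 1"
proof -
  have c: "mul (const (inverse tvar)) * mul tc = 1"
    by (simp add: const_inverse mul_one flip: mul_mult)
  have "TT m i * (TT m i + 1 - mul tc) = mul tc" "(TT m i + 1 - mul tc) * TT m i = mul tc"
    using mul_const_TT[OF assms, of i tvar]
    by (simp_all add: distrib_left distrib_right right_diff_distrib left_diff_distrib TT_quadratic[OF assms] mul_diff mul_one)
  then show "TT m i * TTinv m i = 1" "TTinv m i * TT m i = 1"
    unfolding TTinv_def mult.assoc[symmetric] mul_const_TT[OF assms] by (simp_all add: mult.assoc c)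
qed


section \<open>Agreement with the given operators on Laurent polynomials in m variables\<close>

subsection \<open>Comparison with the defining formulas\<close>

lemma PiE_laurent: "m \<ge> 1 \<Longrightarrow> F \<in> laurent m \<Longrightarrow> app (PiE m) F \<in> laurent m"
  and PiI_laurent: "m \<ge> 1 \<Longrightarrow> F \<in> laurent m \<Longrightarrow> app (PiI m) F \<in> laurent m"
  by (simp_all add: PiE_def PiI_def)

lemma Pi_op_eq:
  assumes "F \<in> laurent m" shows "Pi_op m F = app (PiE m) F"
  using subst_eq_sub[OF assms, of "\<lambda>j. int j + 1" "\<lambda>k. k + 1"] by (simp add: Pi_op_def PiE_def)

lemma Pi_op_inverse:
  assumes "m \<ge> 1" "F \<in> laurent m" shows "inv_into (laurent m) (Pi_op m) F = app (PiI m) F"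
proof (rule inv_into_f_eq)
  have PI: "app (PiI m) (app (PiE m) G) = G" "app (PiE m) (app (PiI m) G) = G" for G
    using arg_cong[OF Pi_inverse(2)[of m], of "\<lambda>A. app A G"] arg_cong[OF Pi_inverse(1)[of m], of "\<lambda>A. app A G"]
    by simp_all
  show "inj_on (Pi_op m) (laurent m)"
    by (rule inj_on_inverseI[of _ "app (PiI m)"]) (simp add: Pi_op_eq PI)
  show "app (PiI m) F \<in> laurent m" using assms by (rule PiI_laurent)
  then show "Pi_op m (app (PiI m) F) = F" by (simp add: Pi_op_eq PI)
qed

lemma DL_minus_one: "m \<ge> 2 \<Longrightarrow> DL m (-1) = DL m (int (m - 1))"
  by (rule DL_cong) auto

lemma TT_laurent:
  assumes "m \<ge> 2" "i < m" "F \<in> laurent m" shows "app (TT m (int i)) F \<in> laurent m"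
proof (cases "i = 0")
  case True
  have "app (DL m (-1)) (app (PiI m) F) \<in> laurent m"
    unfolding DL_minus_one[OF assms(1)] using assms by (intro DL_laurent PiI_laurent) auto
  then show ?thesis using True assms by (simp add: TT_def PiE_laurent)
qed (use assms DL_laurent in \<open>simp add: DL_eq_TT\<close>)

lemma T_op_eq:
  assumes "m \<ge> 2" "i < m" "F \<in> laurent m" shows "T_op m i F = app (TT m (int i)) F"
proof (cases "i = 0")
  case False
  have "arefl m (int i) (int j) = (if j = i then int i + 1 else if j = i + 1 then int i else int j)"
    if "1 \<le> j" "j \<le> m" for j
  proof -
    have "int m dvd int j - int i \<longleftrightarrow> j = i" "int m dvd int j - int i - 1 \<longleftrightarrow> j = i + 1"
      using that assms False small_dvd[of "int j - int i" m] small_dvd[of "int j - int i - 1" m] by auto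
    then show ?thesis by (simp add: arefl_def)
  qed
  then have "s_op m i F = sub m (arefl m (int i)) F"
    using False assms by (simp add: s_op_def) (rule subst_eq_sub, auto)
  moreover have "TT m (int i) = DL m (int i)" using False assms by (intro DL_eq_TT) auto
  ultimately show ?thesis
    using assms by (simp add: T_op_def app_DL delta_def zq_def const_simps)
next
  case True
  let ?r = "sub m (arefl m 0)" and ?s = "sub m (arefl m (-1))"
  have 0: "arefl m 0 (int j) = (if j = 1 then 0 else if j = m then int m + 1 else int j)"
    if "1 \<le> j" "j \<le> m" for j
  proof -
    have "int m dvd int j \<longleftrightarrow> j = m" "int m dvd int j - 1 \<longleftrightarrow> j = 1"
      using that assms small_dvd[of "int j - int m" m] small_dvd[of "int j - 1" m]
        dvd_diff_left_iff[of "int m" "int m" "int j"] by (auto simp: dvd_diff_left_iff)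
    then show ?thesis using that assms by (auto simp: arefl_def)
  qed
  have s0: "s_op m 0 F = Xpow m 1 1 * Xpow m 0 (-1) * ?r F"
    unfolding s_op_def using assms 0 by (simp add: subst_eq_sub)
  \<comment> \<open>With F = Pi H, the twisted reflection s_0 F is Pi applied to s_{-1} H: the
    prefactor X_1 of Pi accounts for the factor X_1 / X_0. The same transport applies to the divided
    difference.\<close>
  define H where "H = app (PiI m) F"
  have H: "Xpow m 1 1 * sub m (\<lambda>k. k + 1) H = F"
    using arg_cong[OF Pi_inverse(1)[of m], of "\<lambda>A. app A F"] by (simp add: H_def PiE_def)
  have H': "sub m (\<lambda>k. k + 1) H = Xpow m 1 (-1) * F"
    by (subst H[symmetric]) (simp add: mult.assoc[symmetric] Xpow_inverse)
  have sH: "Xpow m 1 1 * sub m (\<lambda>k. k + 1) (?s H) = s_op m 0 F"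
  proof -
    have "sub m (\<lambda>k. k + 1) (?s H) = ?r (sub m (\<lambda>k. k + 1) H)"
      using arefl_shift[of m "-1" 1] by (simp add: sub_comp)
    also have "\<dots> = Xpow m 0 (-1) * ?r F"
      unfolding H' using arefl_self(2)[of m 0] assms by (simp add: sub_simps sub_Xpow)
    finally show ?thesis by (simp add: s0 mult.assoc)
  qed
  have z: "sub m (\<lambda>k. k + 1) (zq m (-1)) = zq m 0"
    using assms by (simp add: zq_def sub_simps sub_Xpow)
  define G where "G = Xpow m 1 1 * sub m (\<lambda>k. k + 1) (delta m (-1) H)"
  have "G * (1 - zq m 0) = Xpow m 1 1 * sub m (\<lambda>k. k + 1) (delta m (-1) H * (1 - zq m (-1)))"
    by (simp add: G_def sub_simps z mult.assoc)
  also have "\<dots> = F - s_op m 0 F"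
    unfolding delta_mult[OF assms(1)] by (simp add: sub_simps right_diff_distrib H sH)
  finally have "(THE G. G * (1 - zq m 0) = F - s_op m 0 F) = G"
    using assms the_quotient by blast
  then have "T_op m 0 F = tc * s_op m 0 F + (tc - 1) * G"
    by (simp add: T_op_def zq_def const_simps)
  also have "\<dots> = app (TT m 0) F"
    using assms unfolding sH[symmetric] G_def
    by (simp add: TT_def app_DL PiE_def sub_simps H_def algebra_simps)
  finally show ?thesis using True by simp
qed

section \<open>Commutativity of the Y_i in an abstract monoid\<close>

section \<open>The commuting elements\<close>

lemma inverse_commute:
  fixes a b c :: "'a::monoid_mult"
  assumes "a * b = 1" "b * a = 1" "a * c = d * a"
  shows "b * d = c * b"
proof -
  have "b * d = b * (d * a) * b" using assms by (simp add: mult.assoc)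
  also have "\<dots> = b * (a * c) * b" using assms by simp
  also have "\<dots> = (b * a) * (c * b)" by (simp only: mult.assoc)
  also have "\<dots> = c * b" using assms by simp
  finally show ?thesis .
qed

lemma mult_left_eq:
  fixes a b c d z :: "'a::monoid_mult"
  shows "a * b = c * d \<Longrightarrow> a * (b * z) = c * (d * z)" "a * b = 1 \<Longrightarrow> a * (b * z) = z"
  by (metis mult.assoc, metis mult.assoc mult_1_left)

lemma inverse_intertwine:
  fixes a b c :: "'a::monoid_mult"
  assumes "a' * a = 1" "b * b' = 1" "c * b = a * c"
  shows "a' * c = c * b'"
proof -
  have "a' * c = (a' * c) * (b * b')" using assms by simp
  also have "\<dots> = a' * (c * b) * b'" by (simp only: mult.assoc)
  also have "\<dots> = (a' * a) * (c * b')" unfolding assms(3) by (simp only: mult.assoc)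
  finally show ?thesis using assms by simp
qed

text \<open>A braid-group setting: the T_i are merely invertible and there are no scalars, so the
  powers of t in Y_i are supplied only in \<open>YE\<close>. The generator T_0 is eliminated; what
  remains of it is \<open>P_P_T\<close>, which comes from passing T_{m-1} through T_0 to T_1 by two
  conjugations with Pi.\<close>

locale affine_hecke =
  fixes m :: nat and T Ti :: "nat \<Rightarrow> 'r::monoid_mult" and P Pinv :: 'r
  assumes T_inv: "1 \<le> i \<Longrightarrow> i < m \<Longrightarrow> T i * Ti i = 1" "1 \<le> i \<Longrightarrow> i < m \<Longrightarrow> Ti i * T i = 1"
    and P_inv: "P * Pinv = 1" "Pinv * P = 1"
    and braid: "1 \<le> i \<Longrightarrow> i + 1 < m \<Longrightarrow> T i * T (i + 1) * T i = T (i + 1) * T i * T (i + 1)"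
    and comm: "1 \<le> i \<Longrightarrow> i + 1 < j \<Longrightarrow> j < m \<Longrightarrow> T i * T j = T j * T i"
    and P_T: "1 \<le> i \<Longrightarrow> i + 1 < m \<Longrightarrow> P * T i = T (i + 1) * P"
    and P_P_T: "2 \<le> m \<Longrightarrow> P * P * T (m - 1) = T 1 * P * P"
begin

definition up :: "nat \<Rightarrow> nat \<Rightarrow> 'r" where
  "up a b = prod_list (map T [a..<b])"

definition down :: "nat \<Rightarrow> nat \<Rightarrow> 'r" where
  "down a b = prod_list (map Ti (rev [a..<b]))"

definition Y :: "nat \<Rightarrow> 'r" where
  "Y i = prod_list (map T (rev [1..<i])) * P * down i m"

lemma up_rec: "a < b \<Longrightarrow> up a b = T a * up (a + 1) b" "a \<le> b \<Longrightarrow> up a (b + 1) = up a b * T b"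
  and down_rec: "a < b \<Longrightarrow> down a b = down (a + 1) b * Ti a" "a \<le> b \<Longrightarrow> down a (b + 1) = Ti b * down a b"
  and up_refl: "up a a = 1" and down_refl: "down a a = 1"
  by (simp_all add: up_def down_def upt_rec[of a b])

lemma up_split: "a \<le> b \<Longrightarrow> b \<le> c \<Longrightarrow> up a c = up a b * up b c"
proof -
  assume "a \<le> b" "b \<le> c"
  then have "[a..<c] = [a..<b] @ [b..<c]"
    using upt_add_eq_append[of a b "c - b"] by simp
  then show ?thesis by (simp add: up_def)
qed

lemma up_down:
  assumes "1 \<le> a" "a \<le> b" "b \<le> m" shows "up a b * down a b = 1" "down a b * up a b = 1"
proof -
  have "up a b * down a b = 1 \<and> down a b * up a b = 1"
    using assms(2,3)
  proof (induction b rule: dec_induct)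
    case (step b)
    then have T: "T b * Ti b = 1" "Ti b * T b = 1" using T_inv assms(1) by auto
    have "up a (b + 1) * down a (b + 1) = up a b * (T b * Ti b) * down a b"
      "down a (b + 1) * up a (b + 1) = Ti b * (down a b * up a b) * T b"
      using step.hyps by (simp_all only: up_rec(2) down_rec(2) mult.assoc)
    then show ?case using step T by simp
  qed (simp add: up_refl down_refl)
  then show "up a b * down a b = 1" "down a b * up a b = 1" by auto
qed

lemma T_commute: "1 \<le> i \<Longrightarrow> i < m \<Longrightarrow> 1 \<le> j \<Longrightarrow> j < m \<Longrightarrow> i + 1 < j \<or> j + 1 < i \<Longrightarrow> T i * T j = T j * T i"
  using comm[of i j] comm[of j i] by auto

lemma T_up_commute:
  assumes "1 \<le> j" "j < m" "1 \<le> a" "b \<le> m" "b < j \<or> j + 1 < a"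
  shows "T j * up a b = up a b * T j"
proof (cases "a \<le> b")
  case True
  then show ?thesis using assms(4,5)
  proof (induction b rule: dec_induct)
    case (step b)
    then have e: "T j * up a b = up a b * T j" "T j * T b = T b * T j"
      using assms by (auto intro!: T_commute)
    then show ?case using step.hyps
      by (simp add: up_rec(2)[simplified] mult.assoc mult_left_eq(1)[OF e(1)])
  qed (simp add: up_refl)
qed (simp add: up_def)

text \<open>A single braid move at the factors T_j T_{j+1} of the Coxeter element T_1 ... T_{m-1};
  the other factors commute with what passes them.\<close>

lemma up_T:
  assumes "1 \<le> j" "j + 1 < m"
  shows "up 1 m * T j = T (j + 1) * up 1 m"
proof -
  have W: "up 1 m = up 1 j * (T j * (T (j + 1) * up (j + 2) m))"
    using assms up_split[of 1 j m] up_rec(1)[of j m] up_rec(1)[of "j + 1" m] by simp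
  have c: "up (j + 2) m * T j = T j * up (j + 2) m" "T (j + 1) * up 1 j = up 1 j * T (j + 1)"
    using assms T_up_commute[of j "j + 2" m] T_up_commute[of "j + 1" 1 j] by auto
  have "up 1 m * T j = up 1 j * (T j * (T (j + 1) * (up (j + 2) m * T j)))"
    by (simp only: W mult.assoc)
  also have "\<dots> = up 1 j * ((T j * T (j + 1) * T j) * up (j + 2) m)"
    unfolding c by (simp only: mult.assoc)
  also have "\<dots> = up 1 j * T (j + 1) * (T j * (T (j + 1) * up (j + 2) m))"
    unfolding braid[OF assms] by (simp only: mult.assoc)
  also have "\<dots> = T (j + 1) * up 1 m"
    unfolding c(2)[symmetric] W by (simp only: mult.assoc)
  finally show ?thesis .
qed

lemma up_up: "b + 1 \<le> m \<Longrightarrow> 1 \<le> a \<Longrightarrow> up 1 m * up a b = up (a + 1) (b + 1) * up 1 m"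
proof (induction b)
  case (Suc b)
  show ?case
  proof (cases "a \<le> b")
    case True
    have "up 1 m * up a (Suc b) = (up 1 m * up a b) * T b"
      using True by (simp add: up_rec(2)[simplified] mult.assoc)
    also have "\<dots> = up (a + 1) (b + 1) * (up 1 m * T b)"
      using Suc by (simp add: mult.assoc)
    also have "\<dots> = up (a + 1) (b + 1) * T (b + 1) * up 1 m"
      using up_T[of b] True Suc.prems by (simp add: mult.assoc)
    finally show ?thesis using True up_rec(2)[of "a + 1" "b + 1"] by simp
  qed (use Suc in \<open>simp add: up_def\<close>)
qed (simp add: up_def)

lemma Y_Suc:
  assumes "1 \<le> i" "i < m" shows "Y (i + 1) = T i * Y i * T i"
proof -
  have "down i m * T i = down (i + 1) m"
    using assms T_inv[of i] by (simp add: down_rec mult.assoc)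
  then show ?thesis using assms by (simp add: Y_def mult.assoc)
qed

lemma T_Y_one:
  assumes "2 \<le> j" "j < m" shows "T j * Y 1 = Y 1 * T j"
proof -
  have "down 1 m * T j = T (j - 1) * down 1 m"
    using inverse_commute[OF up_down, of 1 m "T (j - 1)" "T j"] up_T[of "j - 1"] assms by auto
  moreover have "P * T (j - 1) = T j * P" using P_T[of "j - 1"] assms by auto
  ultimately show ?thesis by (simp add: Y_def mult.assoc) (simp add: mult.assoc[symmetric])
qed

lemma T_Y:
  assumes "1 \<le> i" "i \<le> m" "1 \<le> j" "j < m" "j \<noteq> i" "j + 1 \<noteq> i" shows "T j * Y i = Y i * T j"
  using assms
proof (induction i arbitrary: j rule: less_induct)
  case (less i)
  show ?case
  proof (cases "i = 1")
    case True
    then show ?thesis using T_Y_one[of j] less.prems by simp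
  next
    case False
    define k where "k = i - 1"
    have k: "1 \<le> k" "k < m" "i = k + 1" using less.prems False by (auto simp: k_def)
    show ?thesis
    proof (cases "j + 1 = k")
      case False
      have e: "T j * Y k = Y k * T j" "T j * T k = T k * T j"
        using less.IH[of k j] T_commute[of j k] less.prems k False by (auto simp: neq_iff)
      then show ?thesis
        unfolding k(3) Y_Suc[OF k(1,2)] by (simp add: mult.assoc e e[THEN mult_left_eq(1)])
    next
      \<comment> \<open>The case j = i - 2, where T_j does not commute with T_k for k = i - 1:
        expanding Y_i = T_k T_j Y_j T_j T_k exposes a braid word on either side of Y_j.\<close>
      case True
      then have j: "1 \<le> j" "j < m" "k = j + 1" using less.prems by auto
      have Yk: "T k * Y j = Y j * T k" using less.IH[of j k] less.prems k j by auto
      have b: "T j * T k * T j = T k * T j * T k" using braid[of j] j k by simp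
      have "Y i = T k * T j * Y j * T j * T k"
        unfolding k(3) Y_Suc[OF k(1,2)] by (simp add: j(3) Y_Suc[OF j(1,2), simplified] mult.assoc)
      then have "T j * Y i = (T j * T k * T j) * Y j * T j * T k" "Y i * T j = T k * T j * Y j * (T j * T k * T j)"
        by (simp_all add: mult.assoc)
      then show ?thesis unfolding b by (simp add: mult.assoc mult_left_eq(1)[OF Yk])
    qed
  qed
qed

text \<open>With A = Pi T_{m-1}^{-1} ... T_2^{-1} one has Y_1 = A T_1^{-1} and Y_2 = T_1 A, so the
  claim is that T_1 commutes with A^2. Collecting the factors Pi gives A^2 = Pi^2 Q, where Q T_1 =
  T_{m-1} Q by sliding along the Coxeter element and Pi^2 T_{m-1} = T_1 Pi^2 by
  \<open>P_P_T\<close>.\<close>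

lemma Y_one_two:
  assumes "2 \<le> m" shows "Y 1 * Y 2 = Y 2 * Y 1"
proof -
  define A where "A = P * down 2 m"
  have "down a b * P = P * down (a - 1) (b - 1)" if "2 \<le> a" "a \<le> b" "b \<le> m" for a b
    using that(2,3)
  proof (induction b rule: dec_induct)
    case (step b)
    have "P * T (b - 1) = T b * P" using P_T[of "b - 1"] step.hyps step.prems that(1) by auto
    then have TiP: "Ti b * P = P * Ti (b - 1)"
      using inverse_intertwine[of "Ti b" "T b" "T (b - 1)" "Ti (b - 1)" P] T_inv[of b] T_inv[of "b - 1"]
        step.hyps step.prems that(1) by auto
    have "down a (b + 1) = Ti b * down a b" "down (a - 1) (b - 1 + 1) = Ti (b - 1) * down (a - 1) (b - 1)"
      using step.hyps that(1) down_rec(2)[of a b] down_rec(2)[of "a - 1" "b - 1"] by auto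
    moreover have "b - 1 + 1 = Suc b - 1" using step.hyps that(1) by simp
    ultimately have r: "down a (Suc b) = Ti b * down a b" "down (a - 1) (Suc b - 1) = Ti (b - 1) * down (a - 1) (b - 1)"
      by simp_all
    have "down a b * P = P * down (a - 1) (b - 1)" using step by simp
    then show ?case unfolding r by (simp add: mult.assoc mult_left_eq(1)[OF TiP])
  qed (simp add: down_refl)
  from this[of 2 m] have D: "down 2 m * P = P * down 1 (m - 1)" using assms by simp
  define R where "R = up 2 m * up 1 (m - 1)"
  define Q where "Q = down 1 (m - 1) * down 2 m"
  have RQ: "R * Q = 1" "Q * R = 1"
  proof -
    have "up 1 (m - 1) * down 1 (m - 1) = 1" "up 2 m * down 2 m = 1"
      "down 1 (m - 1) * up 1 (m - 1) = 1" "down 2 m * up 2 m = 1"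
      using assms by (auto intro!: up_down)
    then show "R * Q = 1" "Q * R = 1" by (simp_all add: Q_def R_def mult.assoc mult_left_eq(2))
  qed
  have "R * T (m - 1) = T 1 * R"
  proof -
    have "T 1 * R = up 1 m * up 1 (m - 1)"
      using assms up_rec(1)[of 1 m] by (simp add: R_def mult.assoc numeral_2_eq_2)
    also have "\<dots> = up 2 m * up 1 m"
      using assms up_up[of "m - 1" 1] by (simp add: numeral_2_eq_2)
    also have "up 1 m = up 1 (m - 1) * T (m - 1)"
      using assms up_rec(2)[of 1 "m - 1"] by simp
    finally show ?thesis by (simp add: R_def mult.assoc)
  qed
  from inverse_commute[OF RQ this] have Q: "Q * T 1 = T (m - 1) * Q" .
  have AA: "A * A = P * P * Q" by (simp add: A_def Q_def mult.assoc mult_left_eq(1)[OF D])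
  have TAA: "T 1 * (A * A) = A * A * T 1"
    unfolding AA using P_P_T[OF assms] Q by (simp add: mult.assoc) (simp add: mult.assoc[symmetric])
  have T1: "T 1 * Ti 1 = 1" "Ti 1 * T 1 = 1" using T_inv[of 1] assms by auto
  have Y1: "Y 1 = A * Ti 1" 
    using assms down_rec(1)[of 1 m] by (simp add: Y_def A_def mult.assoc numeral_2_eq_2)
  have Y2: "Y 2 = T 1 * A" using Y_Suc[of 1] assms Y1 T1 by (simp add: mult.assoc numeral_2_eq_2)
  have "Y 1 * Y 2 = A * A" unfolding Y1 Y2 by (simp add: mult.assoc mult_left_eq(2)[OF T1(2), simplified])
  moreover have "Y 2 * Y 1 = T 1 * (A * A) * Ti 1" unfolding Y1 Y2 by (simp add: mult.assoc)
  then have "Y 2 * Y 1 = A * A" unfolding TAA using T1 by (simp add: mult.assoc)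
  ultimately show ?thesis by simp
qed

text \<open>The pair (1, 2) is propagated by Y_{j+1} = T_j Y_j T_j, first in the second index and
  then in the first, since T_j commutes with every Y_i with i different from j and j + 1.\<close>

lemma Y_commute:
  assumes "1 \<le> i" "i \<le> m" "1 \<le> j" "j \<le> m" shows "Y i * Y j = Y j * Y i"
proof -
  have one: "Y 1 * Y j = Y j * Y 1" if "1 \<le> j" "j \<le> m" for j
    using that
  proof (induction j rule: dec_induct)
    case (step j)
    show ?case
    proof (cases "j = 1")
      case True
      then show ?thesis using Y_one_two step by (simp add: numeral_2_eq_2)
    next
      case False
      then have e: "T j * Y 1 = Y 1 * T j" "Y j * Y 1 = Y 1 * Y j" using T_Y_one[of j] step by simp_all
      then show ?thesis using step.hyps step.prems Y_Suc[of j]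
        by (simp add: mult.assoc e[THEN mult_left_eq(1), simplified])
    qed
  qed simp
  have less: "Y i * Y j = Y j * Y i" if "1 \<le> i" "i < j" "j \<le> m" for i j
    using that(1,2)
  proof (induction i rule: dec_induct)
    case (step i)
    then have e: "T i * Y j = Y j * T i" "Y i * Y j = Y j * Y i" using T_Y[of j i] that by simp_all
    then show ?case using step.hyps step.prems that Y_Suc[of i]
      by (simp add: mult.assoc e(1) e[THEN mult_left_eq(1)])
  qed (use one that in simp)
  consider "i < j" | "i = j" | "j < i" by linarith
  then show ?thesis
  proof cases
    case 1
    then show ?thesis using assms by (intro less)
  next
    case 3
    then show ?thesis using assms by (intro less[symmetric])
  qed simp
qed

definition Yinv :: "nat \<Rightarrow> 'r" where
  "Yinv i = up i m * Pinv * prod_list (map Ti [1..<i])"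

lemma Y_Yinv:
  assumes "1 \<le> i" "i \<le> m" shows "Y i * Yinv i = 1" "Yinv i * Y i = 1"
proof -
  have r: "prod_list (map T (rev [1..<i])) * prod_list (map Ti [1..<i]) = 1 \<and>
      prod_list (map Ti [1..<i]) * prod_list (map T (rev [1..<i])) = 1"
    using assms
  proof (induction i rule: dec_induct)
    case (step i)
    then show ?case using T_inv[of i]
      by (simp add: mult.assoc mult_left_eq(2))
  qed simp
  have u: "up i m * down i m = 1" "down i m * up i m = 1" using up_down assms by auto
  show "Y i * Yinv i = 1" "Yinv i * Y i = 1"
    unfolding Y_def Yinv_def using r u P_inv by (simp_all add: mult.assoc mult_left_eq(2))
qed

end

section \<open>The presented algebra acts through these operators\<close>

section \<open>The action of the affine Hecke algebra\<close>

fun gen_endo :: "nat \<Rightarrow> hgen \<Rightarrow> lp endo" where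
  "gen_endo m (Gen_T i) = TT m (int i)"
| "gen_endo m Gen_Pi = PiE m"
| "gen_endo m Gen_Pi_inv = PiI m"

definition word_endo :: "nat \<Rightarrow> hword \<Rightarrow> lp endo" where
  "word_endo m u = prod_list (map (gen_endo m) (letters u))"

text \<open>The representation of the free algebra by endomorphisms of the ring of all Laurent
  polynomials; \<open>free_act_eq\<close> identifies it with \<open>free_act\<close> on
  \<open>laurent m\<close>.\<close>

definition free_endo :: "nat \<Rightarrow> free_elt \<Rightarrow> lp endo" where
  "free_endo m w = (\<Sum>u\<in>Poly_Mapping.keys w. mul (const (Poly_Mapping.lookup w u)) * word_endo m u)"

lemma word_endo_plus: "word_endo m (u + v) = word_endo m u * word_endo m v"
  by (simp add: word_endo_def plus_hword_def)

lemma mul_const_simps: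
  "mul (const (c + d)) = mul (const c) + (mul (const d) :: lp endo)"
  "mul (const (c * d)) = mul (const c) * (mul (const d) :: lp endo)"
  "mul (const 0) = (0 :: lp endo)" "mul (const 1) = (1 :: lp endo)"
  by (simp_all add: const_simps mul_add mul_mult mul_zero mul_one)

lemma free_endo_superset:
  assumes "finite A" "Poly_Mapping.keys w \<subseteq> A"
  shows "free_endo m w = (\<Sum>u\<in>A. mul (const (Poly_Mapping.lookup w u)) * word_endo m u)"
  unfolding free_endo_def
  by (rule sum.mono_neutral_left) (use assms in \<open>auto simp: in_keys_iff mul_const_simps\<close>)

lemma free_endo_add: "free_endo m (v + w) = free_endo m v + free_endo m w"
proof -
  let ?A = "Poly_Mapping.keys v \<union> Poly_Mapping.keys w"
  have "free_endo m x = (\<Sum>u\<in>?A. mul (const (Poly_Mapping.lookup x u)) * word_endo m u)"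
    if "Poly_Mapping.keys x \<subseteq> ?A" for x
    by (rule free_endo_superset) (use that in auto)
  note eq = this[OF keys_add] this[OF Un_upper1] this[OF Un_upper2]
  show ?thesis
    unfolding eq by (simp add: lookup_add mul_const_simps distrib_right sum.distrib)
qed

lemma free_endo_zero [simp]: "free_endo m 0 = 0"
  by (simp add: free_endo_def)

lemma free_endo_minus: "free_endo m (- w) = - free_endo m w"
  using free_endo_add[of m "- w" w] by (simp add: eq_neg_iff_add_eq_0)

lemma free_endo_diff: "free_endo m (v - w) = free_endo m v - free_endo m w"
  using free_endo_add[of m v "- w"] by (simp add: free_endo_minus)

lemma free_endo_single: "free_endo m (Poly_Mapping.single u c) = mul (const c) * word_endo m u"
  by (simp add: free_endo_def mul_const_simps)

lemma free_endo_const: "free_endo m (free_const c) = mul (const c)"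
  by (simp add: free_const_def free_endo_single word_endo_def zero_hword_def)

lemma free_endo_one: "free_endo m 1 = 1"
  using free_endo_const[of m 1] by (simp add: free_const_def mul_const_simps)

lemma free_endo_gen: "free_endo m (free_gen g) = gen_endo m g"
  by (simp add: free_gen_def free_endo_single word_endo_def mul_const_simps)

definition FA :: "nat \<Rightarrow> free_elt set" where
  "FA m = {w. \<forall>u\<in>Poly_Mapping.keys w. set (letters u) \<subseteq> hgens m}"

lemma FA_closed [simp]:
  "0 \<in> FA m" "1 \<in> FA m" "free_const c \<in> FA m" "g \<in> hgens m \<Longrightarrow> free_gen g \<in> FA m"
  "v \<in> FA m \<Longrightarrow> w \<in> FA m \<Longrightarrow> v + w \<in> FA m" "v \<in> FA m \<Longrightarrow> - v \<in> FA m"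
  "v \<in> FA m \<Longrightarrow> w \<in> FA m \<Longrightarrow> v - w \<in> FA m" "v \<in> FA m \<Longrightarrow> w \<in> FA m \<Longrightarrow> v * w \<in> FA m"
proof -
  show add: "v \<in> FA m \<Longrightarrow> w \<in> FA m \<Longrightarrow> v + w \<in> FA m" for v w
    by (auto simp: FA_def dest!: keys_add[THEN subsetD])
  show minus: "v \<in> FA m \<Longrightarrow> - v \<in> FA m" for v
    by (auto simp: FA_def in_keys_iff)
  show "v \<in> FA m \<Longrightarrow> w \<in> FA m \<Longrightarrow> v - w \<in> FA m"
    using add[OF _ minus] by simp
  show "v \<in> FA m \<Longrightarrow> w \<in> FA m \<Longrightarrow> v * w \<in> FA m"
    by (fastforce simp: FA_def plus_hword_def dest!: keys_mult[THEN subsetD])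
qed (auto simp: FA_def free_const_def free_gen_def zero_hword_def one_poly_mapping.rep_eq in_keys_iff lookup_one when_def)

lemma free_alg_simps:
  "carrier (free_alg m) = FA m" "mult (free_alg m) = (*)" "one (free_alg m) = 1"
  "zero (free_alg m) = 0" "add (free_alg m) = (+)"
  by (simp_all add: free_alg_def FA_def)

lemma ring_free_alg: "ring (free_alg m)"
proof (rule ringI)
  show "abelian_group (free_alg m)"
  proof (rule abelian_groupI)
    fix x assume "x \<in> carrier (free_alg m)"
    then show "\<exists>y\<in>carrier (free_alg m). y \<oplus>\<^bsub>free_alg m\<^esub> x = \<zero>\<^bsub>free_alg m\<^esub>"
      by (intro bexI[of _ "- x"]) (simp_all add: free_alg_simps)
  qed (simp_all add: free_alg_simps add_ac)
  show "monoid (free_alg m)"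
    by unfold_locales (simp_all add: free_alg_simps mult.assoc)
qed (simp_all add: free_alg_simps distrib_left distrib_right)

lemma gen_endo_const:
  assumes "m \<ge> 1" "g \<in> hgens m" shows "gen_endo m g * mul (const c) = mul (const c) * gen_endo m g"
proof (cases g)
  case (Gen_T i)
  then have "m \<ge> 2" using assms(2) by (auto simp: hgens_def split: if_splits)
  then show ?thesis using Gen_T by (simp add: mul_const_TT)
next
  case Gen_Pi_inv
  have "PiI m * mul (const c) = mul (const c) * PiI m"
    by (rule endo_eqI) (simp add: PiI_def sub_simps mult.left_commute)
  then show ?thesis using Gen_Pi_inv by simp
qed (simp add: mul_const_Pi)

lemma word_endo_const:
  assumes "m \<ge> 1" "set (letters u) \<subseteq> hgens m"
  shows "word_endo m u * mul (const c) = mul (const c) * word_endo m u"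
proof -
  have "prod_list (map (gen_endo m) gs) * mul (const c) = mul (const c) * prod_list (map (gen_endo m) gs)"
    if "set gs \<subseteq> hgens m" for gs
    using that
  proof (induction gs)
    case (Cons g gs)
    then show ?case
      using gen_endo_const[OF assms(1), of g c] mult_left_eq(1)[OF gen_endo_const[OF assms(1), of g c]]
      by (simp add: mult.assoc)
  qed simp
  then show ?thesis using assms(2) by (simp add: word_endo_def)
qed

lemma poly_mapping_sum_single: "w = (\<Sum>u\<in>Poly_Mapping.keys w. Poly_Mapping.single u (Poly_Mapping.lookup w u))"
proof (rule poly_mapping_eqI)
  fix v
  have "Poly_Mapping.lookup (\<Sum>u\<in>Poly_Mapping.keys w. Poly_Mapping.single u (Poly_Mapping.lookup w u)) v
      = (\<Sum>u\<in>Poly_Mapping.keys w. if u = v then Poly_Mapping.lookup w u else 0)"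
    unfolding lookup_sum by (rule sum.cong) (auto simp: lookup_single when_def)
  then show "Poly_Mapping.lookup w v = Poly_Mapping.lookup (\<Sum>u\<in>Poly_Mapping.keys w. Poly_Mapping.single u (Poly_Mapping.lookup w u)) v"
    by (auto simp: sum.delta in_keys_iff)
qed

lemma free_endo_sum: "free_endo m (sum f S) = (\<Sum>x\<in>S. free_endo m (f x))"
  by (induction S rule: infinite_finite_induct) (simp_all add: free_endo_add)

lemma free_endo_mult:
  assumes "m \<ge> 1" "v \<in> FA m" "w \<in> FA m"
  shows "free_endo m (v * w) = free_endo m v * free_endo m w"
proof -
  have single: "free_endo m (Poly_Mapping.single a c * Poly_Mapping.single b d)
      = free_endo m (Poly_Mapping.single a c) * free_endo m (Poly_Mapping.single b d)"
    if "a \<in> Poly_Mapping.keys v" for a b c d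
  proof -
    have "set (letters a) \<subseteq> hgens m" using assms(2) that by (auto simp: FA_def)
    from mult_left_eq(1)[OF word_endo_const[OF assms(1) this, of d]] show ?thesis
      by (simp add: mult_single free_endo_single word_endo_plus mul_const_simps mult.assoc)
  qed
  have "free_endo m (v * w) = free_endo m ((\<Sum>a\<in>Poly_Mapping.keys v. Poly_Mapping.single a (Poly_Mapping.lookup v a)) *
      (\<Sum>b\<in>Poly_Mapping.keys w. Poly_Mapping.single b (Poly_Mapping.lookup w b)))"
    by (simp flip: poly_mapping_sum_single)
  also have "\<dots> = (\<Sum>a\<in>Poly_Mapping.keys v. \<Sum>b\<in>Poly_Mapping.keys w.
      free_endo m (Poly_Mapping.single a (Poly_Mapping.lookup v a)) * free_endo m (Poly_Mapping.single b (Poly_Mapping.lookup w b)))"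
    by (simp add: sum_product free_endo_sum single)
  also have "\<dots> = free_endo m (\<Sum>a\<in>Poly_Mapping.keys v. Poly_Mapping.single a (Poly_Mapping.lookup v a)) *
      free_endo m (\<Sum>b\<in>Poly_Mapping.keys w. Poly_Mapping.single b (Poly_Mapping.lookup w b))"
    by (simp add: sum_product free_endo_sum)
  finally show ?thesis by (simp flip: poly_mapping_sum_single)
qed

lemma free_T_FA:
  assumes "m \<ge> 2" shows "free_T m i \<in> FA m" "free_endo m (free_T m i) = TT m i"
proof -
  have 0: "0 \<le> i mod int m" "i mod int m < int m" using assms by simp_all
  then have "nat (i mod int m) < m" by linarith
  then have "Gen_T (nat (i mod int m)) \<in> hgens m" using assms by (auto simp: hgens_def)
  then show "free_T m i \<in> FA m" by (simp add: free_T_def)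
  have "int m dvd i mod int m - i" by (metis mod_eq_dvd_iff mod_mod_trivial)
  then have "TT m (i mod int m) = TT m i" using assms by (intro TT_cong) auto
  then show "free_endo m (free_T m i) = TT m i" using 0 by (simp add: free_T_def free_endo_gen)
qed

lemma free_Pi_FA [simp]: "free_Pi \<in> FA m" "free_Pi_inv \<in> FA m"
  by (simp_all add: hgens_def)

lemma hecke_rels_kernel:
  assumes "m \<ge> 1" shows "hecke_rels m \<subseteq> {w \<in> FA m. free_endo m w = 0}"
proof
  fix w assume w: "w \<in> hecke_rels m"
  show "w \<in> {w \<in> FA m. free_endo m w = 0}"
  proof (cases "m \<ge> 2")
    case False
    then show ?thesis using w assms
      by (auto simp: hecke_rels_def free_endo_diff free_endo_mult free_endo_gen free_endo_one Pi_inverse)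
  next
    case True
    note T = free_T_FA[OF True]
    note E = free_endo_diff free_endo_mult free_endo_add free_endo_gen free_endo_one free_endo_const T(2)
    have quad: "(TT m i - mul tc) * (TT m i + 1) = 0" for i
      using mul_const_TT[OF True, of i tvar]
      by (simp add: distrib_left left_diff_distrib TT_quadratic[OF True] mul_diff mul_one algebra_simps)
    have comm: "TT m i * TT m j = TT m j * TT m i"
      if "j mod int m \<noteq> (i + 1) mod int m" "j mod int m \<noteq> (i - 1) mod int m" for i j
      using that by (intro TT_commute[OF True]) (auto simp: mod_eq_dvd_iff algebra_simps)
    consider "w = free_Pi * free_Pi_inv - 1" | "w = free_Pi_inv * free_Pi - 1"
      | i where "w = (free_T m i - free_const tvar) * (free_T m i + 1)"
      | i where "w = free_T m i * free_T m (i + 1) * free_T m i - free_T m (i + 1) * free_T m i * free_T m (i + 1)" "m > 2"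
      | i j where "w = free_T m i * free_T m j - free_T m j * free_T m i"
          "j mod int m \<noteq> (i + 1) mod int m" "j mod int m \<noteq> (i - 1) mod int m"
      | i where "w = free_Pi * free_T m i - free_T m (i + 1) * free_Pi"
      using w True unfolding hecke_rels_def by auto
    then show ?thesis
    proof cases
      case (4 i)
      then show ?thesis using assms TT_braid[of m i] by (simp add: T(1) E)
    next
      case (5 i j)
      show ?thesis using assms comm[OF 5(2,3)] by (simp add: 5(1) T(1) E)
    qed (use assms in \<open>simp_all add: E T(1) Pi_inverse quad Pi_TT[OF True]\<close>)
  qed
qed

lemma hecke_rels_FA: "m \<ge> 1 \<Longrightarrow> hecke_rels m \<subseteq> carrier (free_alg m)"
  using hecke_rels_kernel by (auto simp: free_alg_simps)

lemma ideal_hecke_ideal: "m \<ge> 1 \<Longrightarrow> ideal (hecke_ideal m) (free_alg m)"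
  unfolding hecke_ideal_def by (rule ring.genideal_ideal[OF ring_free_alg hecke_rels_FA])

text \<open>The elements acting by zero form an ideal that contains the defining relations, hence
  the ideal generated by them.\<close>

lemma hecke_ideal_kernel:
  assumes "m \<ge> 1" "w \<in> hecke_ideal m" shows "w \<in> FA m" "free_endo m w = 0"
proof -
  interpret ring "free_alg m" by (rule ring_free_alg)
  have "ideal {w \<in> FA m. free_endo m w = 0} (free_alg m)"
  proof (rule idealI)
    have inv: "inv\<^bsub>add_monoid (free_alg m)\<^esub> a = - a" if "a \<in> FA m" for a
      using that minus_equality[of "- a" a] by (simp add: free_alg_simps a_inv_def)
    show "subgroup {w \<in> FA m. free_endo m w = 0} (add_monoid (free_alg m))"
    proof (rule subgroup.intro)
      fix a assume "a \<in> {w \<in> FA m. free_endo m w = 0}"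
      then show "inv\<^bsub>add_monoid (free_alg m)\<^esub> a \<in> {w \<in> FA m. free_endo m w = 0}"
        by (simp only: mem_Collect_eq inv free_endo_minus FA_closed group_add_class.minus_zero simp_thms)
    qed (auto simp: free_alg_simps free_endo_add)
  qed (use assms(1) in \<open>auto simp: ring_free_alg free_alg_simps free_endo_mult\<close>)
  then have "hecke_ideal m \<subseteq> {w \<in> FA m. free_endo m w = 0}"
    unfolding hecke_ideal_def by (rule genideal_minimal) (rule hecke_rels_kernel[OF assms(1)])
  then show "w \<in> FA m" "free_endo m w = 0" using assms(2) by auto
qed

lemma free_act_eq:
  assumes "m \<ge> 1" "w \<in> FA m" "F \<in> laurent m"
  shows "free_act m w F = app (free_endo m w) F"
proof -
  have word: "foldr (gen_act m) gs F = app (prod_list (map (gen_endo m) gs)) F \<and>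
      app (prod_list (map (gen_endo m) gs)) F \<in> laurent m" if "set gs \<subseteq> hgens m" for gs
    using that
  proof (induction gs)
    case (Cons g gs)
    then show ?case
      using assms(1)
      by (cases g) (auto simp: hgens_def T_op_eq TT_laurent Pi_op_eq PiE_laurent Pi_op_inverse PiI_laurent split: if_splits)
  qed (use assms in simp)
  show ?thesis
    unfolding free_act_def free_endo_def app_sum_left
    by (rule sum.cong) (use word assms(2) in \<open>auto simp: FA_def word_endo_def\<close>)
qed


section \<open>Transfer of computations from the quotient ring to operators\<close>

subsection \<open>Operators represented by elements of the quotient\<close>

text \<open>The dictionary between classes and operators. It is compatible with sums and products,
  and \<open>hact_eq\<close> then evaluates \<open>hact\<close> as an operator.\<close>

definition acts :: "nat \<Rightarrow> free_elt set \<Rightarrow> lp endo \<Rightarrow> bool" where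
  "acts m h E \<longleftrightarrow> (\<exists>w\<in>FA m. h = hclass m w \<and> free_endo m w = E)"

lemma hact_eq:
  assumes "m \<ge> 1" "acts m h E" "F \<in> laurent m" shows "hact m h F = app E F"
proof -
  interpret I: ideal "hecke_ideal m" "free_alg m" by (rule ideal_hecke_ideal[OF assms(1)])
  obtain w where w: "w \<in> FA m" "h = hclass m w" "free_endo m w = E"
    using assms(2) by (auto simp: acts_def)
  have "free_act m v F = app E F" if "v \<in> h" for v
  proof -
    from that obtain x where x: "x \<in> hecke_ideal m" "v = x + w"
      by (auto simp: w(2) hclass_def a_r_coset_def r_coset_def free_alg_simps)
    then show ?thesis
      using hecke_ideal_kernel[OF assms(1) x(1)] w assms by (simp add: free_act_eq free_endo_add)
  qed
  moreover have "w \<in> h"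
    using I.a_rcos_self[of w] w by (simp add: hclass_def free_alg_simps)
  ultimately have "(\<lambda>w. free_act m w F) ` h = {app E F}" by auto
  then show ?thesis by (simp add: hact_def)
qed

lemma hclass_hom:
  assumes "m \<ge> 1" "v \<in> FA m" "w \<in> FA m"
  shows "hclass m v \<in> carrier (hecke m)" "hclass m v \<otimes>\<^bsub>hecke m\<^esub> hclass m w = hclass m (v * w)"
    "hclass m v \<oplus>\<^bsub>hecke m\<^esub> hclass m w = hclass m (v + w)" "hclass m 1 = \<one>\<^bsub>hecke m\<^esub>"
    "hclass m 0 = \<zero>\<^bsub>hecke m\<^esub>"
proof -
  interpret I: ideal "hecke_ideal m" "free_alg m" by (rule ideal_hecke_ideal[OF assms(1)])
  note hom = I.rcos_ring_hom[folded hecke_def]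
  show "hclass m v \<in> carrier (hecke m)" "hclass m v \<otimes>\<^bsub>hecke m\<^esub> hclass m w = hclass m (v * w)"
    "hclass m v \<oplus>\<^bsub>hecke m\<^esub> hclass m w = hclass m (v + w)" "hclass m 1 = \<one>\<^bsub>hecke m\<^esub>"
    using ring_hom_closed[OF hom, of v] ring_hom_mult[OF hom, of v w] ring_hom_add[OF hom, of v w]
      ring_hom_one[OF hom] assms by (simp_all add: hclass_def free_alg_simps)
  have "ring (hecke m)" unfolding hecke_def by (rule I.quotient_is_ring)
  from ring_hom_zero[OF hom I.ring_axioms this]
  show "hclass m 0 = \<zero>\<^bsub>hecke m\<^esub>" by (simp add: hclass_def free_alg_simps)
qed

lemma ring_hecke: "m \<ge> 1 \<Longrightarrow> ring (hecke m)"
  unfolding hecke_def by (rule ideal.quotient_is_ring[OF ideal_hecke_ideal])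

lemma hclass_eqI:
  assumes "m \<ge> 1" "v \<in> FA m" "w \<in> FA m" "v - w \<in> hecke_ideal m" shows "hclass m v = hclass m w"
proof -
  interpret I: ideal "hecke_ideal m" "free_alg m" by (rule ideal_hecke_ideal[OF assms(1)])
  have "v \<in> hecke_ideal m +>\<^bsub>free_alg m\<^esub> w"
    using assms(4) by (force simp: a_r_coset_def r_coset_def free_alg_simps)
  then show ?thesis
    unfolding hclass_def using I.a_repr_independence[of v "hecke_ideal m" w] assms I.a_subgroup by (simp add: free_alg_simps)
qed

lemma acts_carrier: "m \<ge> 1 \<Longrightarrow> acts m h E \<Longrightarrow> h \<in> carrier (hecke m)"
  using hclass_hom(1) by (auto simp: acts_def)

lemma acts_mult: "m \<ge> 1 \<Longrightarrow> acts m g D \<Longrightarrow> acts m h E \<Longrightarrow> acts m (g \<otimes>\<^bsub>hecke m\<^esub> h) (D * E)"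
  unfolding acts_def using hclass_hom(2) free_endo_mult by (metis FA_closed(8))

lemma acts_add: "m \<ge> 1 \<Longrightarrow> acts m g D \<Longrightarrow> acts m h E \<Longrightarrow> acts m (g \<oplus>\<^bsub>hecke m\<^esub> h) (D + E)"
  unfolding acts_def using hclass_hom(3) free_endo_add by (metis FA_closed(5))

lemma acts_one: "m \<ge> 1 \<Longrightarrow> acts m \<one>\<^bsub>hecke m\<^esub> 1"
  unfolding acts_def using hclass_hom(4)[of m 1 1] free_endo_one by (metis FA_closed(2))

lemma acts_zero: "m \<ge> 1 \<Longrightarrow> acts m \<zero>\<^bsub>hecke m\<^esub> 0"
  unfolding acts_def using hclass_hom(5)[of m 1 1] free_endo_zero by (metis FA_closed(1,2))

lemma acts_const: "acts m (hconst m c) (mul (const c))"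
  unfolding acts_def hconst_def using free_endo_const by (metis FA_closed(3))

lemma acts_T: "m \<ge> 2 \<Longrightarrow> acts m (hT m i) (TT m i)"
  unfolding acts_def hT_def using free_T_FA by metis

lemma acts_Pi: "acts m (hPi m) (PiE m)"
  unfolding acts_def hPi_def using free_endo_gen[of m Gen_Pi] by (metis free_Pi_FA(1) gen_endo.simps(2))

lemma acts_finsum:
  assumes "m \<ge> 1" "finite A" "\<And>a. a \<in> A \<Longrightarrow> acts m (f a) (E a)"
  shows "acts m (\<Oplus>\<^bsub>hecke m\<^esub>a\<in>A. f a) (\<Sum>a\<in>A. E a)"
proof -
  interpret ring "hecke m" by (rule ring_hecke[OF assms(1)])
  show ?thesis
    using assms(2,3)
  proof (induction A rule: finite_induct)
    case (insert a A)
    then show ?case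
      using assms(1) acts_carrier by (subst finsum_insert) (auto intro!: acts_add)
  qed (simp add: acts_zero[OF assms(1)])
qed

lemma acts_hprod:
  assumes "m \<ge> 1" "list_all2 (acts m) hs Es" shows "acts m (hprod m hs) (prod_list Es)"
  using assms(2)
  by (induction rule: list_all2_induct) (simp_all add: hprod_def acts_one[OF assms(1)] acts_mult[OF assms(1)])

text \<open>The abstract inverse in \<open>hecke m\<close> is meaningful only for units; carrying an
  explicit inverse along both proves invertibility and records the operator \<open>E'\<close> by
  which the inverse acts.\<close>

definition acts_unit :: "nat \<Rightarrow> free_elt set \<Rightarrow> lp endo \<Rightarrow> lp endo \<Rightarrow> bool" where
  "acts_unit m h E E' \<longleftrightarrow> acts m h E \<and>
     (\<exists>h'. acts m h' E' \<and> h \<otimes>\<^bsub>hecke m\<^esub> h' = \<one>\<^bsub>hecke m\<^esub> \<and> h' \<otimes>\<^bsub>hecke m\<^esub> h = \<one>\<^bsub>hecke m\<^esub>)"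

lemma acts_unit_inv:
  assumes "m \<ge> 1" "acts_unit m h E E'" shows "acts_unit m (inv\<^bsub>hecke m\<^esub> h) E' E"
proof -
  interpret ring "hecke m" by (rule ring_hecke[OF assms(1)])
  obtain h' where h: "acts m h E" "acts m h' E'" "h \<otimes>\<^bsub>hecke m\<^esub> h' = \<one>\<^bsub>hecke m\<^esub>" "h' \<otimes>\<^bsub>hecke m\<^esub> h = \<one>\<^bsub>hecke m\<^esub>"
    using assms(2) by (auto simp: acts_unit_def)
  then have "inv\<^bsub>hecke m\<^esub> h = h'"
    using acts_carrier[OF assms(1)] by (intro inv_char) auto
  then show ?thesis using h by (auto simp: acts_unit_def)
qed

lemma acts_unit_mult:
  assumes "m \<ge> 1" "acts_unit m g D D'" "acts_unit m h E E'"
  shows "acts_unit m (g \<otimes>\<^bsub>hecke m\<^esub> h) (D * E) (E' * D')"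
proof -
  interpret ring "hecke m" by (rule ring_hecke[OF assms(1)])
  obtain g' h' where h: "acts m g D" "acts m h E" "acts m g' D'" "acts m h' E'"
    and *: "g \<otimes>\<^bsub>hecke m\<^esub> g' = \<one>\<^bsub>hecke m\<^esub>" "g' \<otimes>\<^bsub>hecke m\<^esub> g = \<one>\<^bsub>hecke m\<^esub>"
      "h \<otimes>\<^bsub>hecke m\<^esub> h' = \<one>\<^bsub>hecke m\<^esub>" "h' \<otimes>\<^bsub>hecke m\<^esub> h = \<one>\<^bsub>hecke m\<^esub>"
    using assms(2,3) by (auto simp: acts_unit_def)
  note c = h[THEN acts_carrier[OF assms(1)]]
  have "(g \<otimes>\<^bsub>hecke m\<^esub> h) \<otimes>\<^bsub>hecke m\<^esub> (h' \<otimes>\<^bsub>hecke m\<^esub> g') = g \<otimes>\<^bsub>hecke m\<^esub> ((h \<otimes>\<^bsub>hecke m\<^esub> h') \<otimes>\<^bsub>hecke m\<^esub> g')"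
    "(h' \<otimes>\<^bsub>hecke m\<^esub> g') \<otimes>\<^bsub>hecke m\<^esub> (g \<otimes>\<^bsub>hecke m\<^esub> h) = h' \<otimes>\<^bsub>hecke m\<^esub> ((g' \<otimes>\<^bsub>hecke m\<^esub> g) \<otimes>\<^bsub>hecke m\<^esub> h)"
    using c by (simp_all add: m_assoc)
  then show ?thesis
    using h c * unfolding acts_unit_def
    by (intro conjI exI[of _ "h' \<otimes>\<^bsub>hecke m\<^esub> g'"] acts_mult[OF assms(1)]) simp_all
qed

lemma acts_unit_one: "m \<ge> 1 \<Longrightarrow> acts_unit m \<one>\<^bsub>hecke m\<^esub> 1 1"
proof -
  assume m: "m \<ge> 1"
  interpret ring "hecke m" by (rule ring_hecke[OF m])
  show ?thesis unfolding acts_unit_def using acts_one[OF m] by auto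
qed

lemma acts_unit_hprod:
  assumes "m \<ge> 1" "\<And>x. x \<in> set xs \<Longrightarrow> acts_unit m (f x) (E x) (E' x)"
  shows "acts_unit m (hprod m (map f xs)) (prod_list (map E xs)) (prod_list (map E' (rev xs)))"
  using assms(2)
  by (induction xs) (simp_all add: hprod_def acts_unit_one[OF assms(1)] acts_unit_mult[OF assms(1)])

lemma acts_unit_hprod_append:
  assumes "m \<ge> 1" "acts_unit m (hprod m xs) E E'" "acts_unit m (hprod m ys) D D'"
    "\<And>x. x \<in> set xs \<union> set ys \<Longrightarrow> x \<in> carrier (hecke m)"
  shows "acts_unit m (hprod m (xs @ ys)) (E * D) (D' * E')"
proof -
  interpret ring "hecke m" by (rule ring_hecke[OF assms(1)])
  have c: "hprod m zs \<in> carrier (hecke m)" if "set zs \<subseteq> carrier (hecke m)" for zs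
    using that by (induction zs) (auto simp: hprod_def)
  have "hprod m (xs @ ys) = hprod m xs \<otimes>\<^bsub>hecke m\<^esub> hprod m ys"
    using assms(4)
  proof (induction xs)
    case Nil
    then have "hprod m ys \<in> carrier (hecke m)" by (intro c) auto
    then show ?case by (simp add: hprod_def)
  next
    case (Cons x xs)
    then have "x \<in> carrier (hecke m)" "hprod m xs \<in> carrier (hecke m)" "hprod m ys \<in> carrier (hecke m)"
      by (auto intro!: c)
    moreover have "hprod m (xs @ ys) = hprod m xs \<otimes>\<^bsub>hecke m\<^esub> hprod m ys" using Cons by auto
    ultimately show ?case by (simp add: hprod_def m_assoc)
  qed
  then show ?thesis using acts_unit_mult[OF assms(1-3)] by simp
qed

lemma acts_unit_pow:
  assumes "m \<ge> 1" "acts_unit m h E E'"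
  shows "acts m (h [^]\<^bsub>hecke m\<^esub> (k::int)) (if k < 0 then E' ^ nat (- k) else E ^ nat k)"
proof -
  interpret ring "hecke m" by (rule ring_hecke[OF assms(1)])
  have p: "acts_unit m (h [^]\<^bsub>hecke m\<^esub> (n::nat)) (E ^ n) (E' ^ n)" for n
  proof (induction n)
    case (Suc n)
    then show ?case
      using acts_unit_mult[OF assms(1) Suc assms(2)] by (simp add: power_commutes)
  qed (simp add: acts_unit_one[OF assms(1)])
  have "acts m (inv\<^bsub>hecke m\<^esub> (h [^]\<^bsub>hecke m\<^esub> nat (- k))) (E' ^ nat (- k))"
    using acts_unit_inv[OF assms(1) p[of "nat (- k)"]] unfolding acts_unit_def by (rule conjunct1)
  moreover have "acts m (h [^]\<^bsub>hecke m\<^esub> nat k) (E ^ nat k)"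
    using p[of "nat k"] unfolding acts_unit_def by (rule conjunct1)
  ultimately show ?thesis unfolding int_pow_def2 by (cases "k < 0") (simp_all only: if_True if_False)
qed

section \<open>Invertible generators, the operators Y_i and their cross relations\<close>

subsection \<open>The generators are units\<close>

lemma hecke_rel_mem: "m \<ge> 1 \<Longrightarrow> w \<in> hecke_rels m \<Longrightarrow> w \<in> hecke_ideal m"
  unfolding hecke_ideal_def using ring.genideal_self[OF ring_free_alg hecke_rels_FA] by blast

lemma hecke_ideal_mult:
  assumes "m \<ge> 1" "w \<in> hecke_ideal m" "v \<in> FA m" shows "v * w \<in> hecke_ideal m"
proof -
  interpret I: ideal "hecke_ideal m" "free_alg m" by (rule ideal_hecke_ideal[OF assms(1)])
  show ?thesis using I.I_l_closed[of w v] assms by (simp add: free_alg_simps)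
qed

lemma free_const_central: "w * free_const c = free_const c * w"
proof -
  have "Poly_Mapping.single u d * free_const c = free_const c * Poly_Mapping.single u d" for u d
    by (simp add: free_const_def mult_single mult.commute)
  then have "(\<Sum>u\<in>Poly_Mapping.keys w. Poly_Mapping.single u (Poly_Mapping.lookup w u)) * free_const c
      = free_const c * (\<Sum>u\<in>Poly_Mapping.keys w. Poly_Mapping.single u (Poly_Mapping.lookup w u))"
    by (simp add: sum_distrib_left sum_distrib_right)
  then show ?thesis by (simp flip: poly_mapping_sum_single)
qed

lemma free_const_inverse: "c \<noteq> 0 \<Longrightarrow> free_const (inverse c) * free_const c = 1"
  by (simp add: free_const_def mult_single single_one)

lemma acts_unitI:
  assumes "m \<ge> 1" "v \<in> FA m" "w \<in> FA m" "v * w - 1 \<in> hecke_ideal m" "w * v - 1 \<in> hecke_ideal m"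
  shows "acts_unit m (hclass m v) (free_endo m v) (free_endo m w)"
proof -
  have "hclass m (v * w) = hclass m 1" "hclass m (w * v) = hclass m 1"
    by (intro hclass_eqI FA_closed assms)+
  moreover have "acts m (hclass m v) (free_endo m v)" "acts m (hclass m w) (free_endo m w)"
    using assms(2,3) by (auto simp: acts_def)
  ultimately show ?thesis
    unfolding acts_unit_def using hclass_hom[OF assms(1)] assms(2,3) by metis
qed

lemma hecke_ideal_zero: "m \<ge> 1 \<Longrightarrow> 0 \<in> hecke_ideal m"
  using additive_subgroup.zero_closed[OF ideal.axioms(1)[OF ideal_hecke_ideal], of m] by (simp add: free_alg_simps)

lemma acts_unit_const:
  assumes "m \<ge> 1" "c \<noteq> 0"
  shows "acts_unit m (hconst m c) (mul (const c)) (mul (const (inverse c)))"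
  using acts_unitI[of m "free_const c" "free_const (inverse c)"] assms
    free_const_inverse[of c] free_const_central[of "free_const c" "inverse c"] hecke_ideal_zero[OF assms(1)]
  by (simp add: hconst_def free_endo_const)

lemma acts_unit_Pi: "m \<ge> 1 \<Longrightarrow> acts_unit m (hPi m) (PiE m) (PiI m)"
  using acts_unitI[of m free_Pi free_Pi_inv]
  by (simp add: hPi_def free_endo_gen hecke_rel_mem hecke_rels_def)

text \<open>The quadratic relation exhibits t^{-1} (T_i + 1 - t) as a two-sided inverse already in
  the quotient.\<close>

lemma acts_unit_T:
  assumes "m \<ge> 2" shows "acts_unit m (hT m i) (TT m i) (TTinv m i)"
proof -
  have m: "m \<ge> 1" using assms by simp
  define A where "A = free_T m i"
  define R where "R = (A - free_const tvar) * (A + 1)"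
  define V where "V = free_const (inverse tvar) * (A + 1 - free_const tvar)"
  have A: "A \<in> FA m" "free_endo m A = TT m i" using free_T_FA[OF assms] by (simp_all add: A_def)
  have "R \<in> hecke_rels m" using assms by (auto simp: R_def A_def hecke_rels_def)
  then have R: "free_const (inverse tvar) * R \<in> hecke_ideal m"
    using m by (intro hecke_ideal_mult hecke_rel_mem) auto
  have "R + free_const tvar = (A + 1 - free_const tvar) * A" "R + free_const tvar = A * (A + 1 - free_const tvar)"
    using free_const_central[of A tvar] by (simp_all add: R_def algebra_simps)
  then have "V * A = free_const (inverse tvar) * (R + free_const tvar)" "A * V = free_const (inverse tvar) * (R + free_const tvar)"
    using mult_left_eq(1)[OF free_const_central[of A "inverse tvar"]] by (simp_all add: V_def mult.assoc)
  then have "V * A - 1 = free_const (inverse tvar) * R" "A * V - 1 = free_const (inverse tvar) * R"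
    by (simp_all add: distrib_left free_const_inverse)
  then have "acts_unit m (hclass m A) (free_endo m A) (free_endo m V)"
    using R A(1) m by (intro acts_unitI) (auto simp: V_def)
  moreover have "free_endo m V = TTinv m i"
    using A m by (simp add: V_def TTinv_def free_endo_mult free_endo_const free_endo_diff free_endo_add free_endo_one)
  ultimately show ?thesis unfolding A(2) by (simp add: hT_def A_def)
qed

lemma acts_unit_T_inv: "m \<ge> 2 \<Longrightarrow> acts_unit m (hT_inv m i) (TTinv m i) (TT m i)"
  unfolding hT_inv_def using acts_unit_inv[OF _ acts_unit_T] by simp

lemma acts_unit_acts: "acts_unit m h E E' \<Longrightarrow> acts m h E"
  by (simp add: acts_unit_def)

definition Td :: "nat \<Rightarrow> nat \<Rightarrow> lp endo" where
  "Td m i = DL m (int i)"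

definition Tdinv :: "nat \<Rightarrow> nat \<Rightarrow> lp endo" where
  "Tdinv m i = TTinv m (int i)"

lemma TT_Td: "1 \<le> i \<Longrightarrow> i < m \<Longrightarrow> TT m (int i) = Td m i"
  by (simp add: Td_def DL_eq_TT)

lemma affine_hecke_endo:
  assumes "m \<ge> 1" shows "affine_hecke m (Td m) (Tdinv m) (PiE m) (PiI m)"
proof
  fix i j :: nat
  show "Td m i * Tdinv m i = 1" "Tdinv m i * Td m i = 1" if "1 \<le> i" "i < m"
    using TT_inverse[of m "int i"] that by (simp_all add: Tdinv_def flip: TT_Td)
  show "Td m i * Td m (i + 1) * Td m i = Td m (i + 1) * Td m i * Td m (i + 1)" if "1 \<le> i" "i + 1 < m"
    using DL_braid[of m "int i"] that by (simp add: Td_def add.commute)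
  show "Td m i * Td m j = Td m j * Td m i" if "1 \<le> i" "i + 1 < j" "j < m"
  proof -
    have "\<not> int m dvd int j - int i" "\<not> int m dvd int j - int i - 1" "\<not> int m dvd int j - int i + 1"
      using that small_dvd[of "int j - int i" m] small_dvd[of "int j - int i - 1" m] small_dvd[of "int j - int i + 1" m] by auto
    then show ?thesis using that unfolding Td_def by (intro DL_commute) auto
  qed
  show "PiE m * Td m i = Td m (i + 1) * PiE m" if "1 \<le> i" "i + 1 < m"
    using Pi_TT[of m "int i"] TT_Td[of i m] TT_Td[of "i + 1" m] that by (simp add: add.commute)
  show "PiE m * PiE m * Td m (m - 1) = Td m 1 * PiE m * PiE m" if m: "2 \<le> m"
  proof -
    have "PiE m * (PiE m * TT m (int (m - 1))) = TT m (int (m - 1) + 2) * (PiE m * PiE m)"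
      by (simp add: Pi_TT[OF m] mult.assoc mult_left_eq(1)[OF Pi_TT[OF m]] add.assoc)
    moreover have "TT m (int (m - 1) + 2) = TT m 1"
      using m by (intro TT_cong) (auto simp: of_nat_diff)
    ultimately show ?thesis using m TT_Td[of "m - 1" m] TT_Td[of 1 m] by (simp add: mult.assoc)
  qed
qed (rule Pi_inverse)+

text \<open>The operator of Y_i: the factor t^(m - i), absent from the scalar-free
  \<open>affine_hecke.Y\<close>, is restored here.\<close>

definition YE :: "nat \<Rightarrow> nat \<Rightarrow> lp endo" where
  "YE m i = mul (const (tvar ^ (m - i))) * affine_hecke.Y m (Td m) (Tdinv m) (PiE m) i"

definition YI :: "nat \<Rightarrow> nat \<Rightarrow> lp endo" where
  "YI m i = affine_hecke.Yinv m (Td m) (Tdinv m) (PiI m) i * mul (const (inverse (tvar ^ (m - i))))"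

lemma acts_unit_hY:
  assumes "1 \<le> i" "i \<le> m" shows "acts_unit m (hY m i) (YE m i) (YI m i)"
proof -
  have m: "m \<ge> 1" using assms by simp
  interpret affine_hecke m "Td m" "Tdinv m" "PiE m" "PiI m" by (rule affine_hecke_endo[OF m])
  interpret H: ring "hecke m" by (rule ring_hecke[OF m])
  have single: "acts_unit m (hprod m [h]) E E'" if "acts_unit m h E E'" for h E E'
    using that acts_carrier[OF m acts_unit_acts[OF that]] by (simp add: hprod_def)
  have T: "acts_unit m (hT m (int j)) (Td m j) (Tdinv m j)" if "j \<in> set (rev [1..<i])" for j
    using that assms acts_unit_T[of m "int j"] TT_Td[of j m] by (simp add: Tdinv_def)
  have Ti: "acts_unit m (hT_inv m (int j)) (Tdinv m j) (Td m j)" if "j \<in> set (rev [i..<m])" for j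
    using that assms acts_unit_T_inv[of m "int j"] TT_Td[of j m] by (simp add: Tdinv_def)
  note cs = acts_carrier[OF m acts_unit_acts]
  note u1 = single[OF acts_unit_const[OF m, of "tvar ^ (m - i)"]]
  note u2 = acts_unit_hprod[where xs = "rev [1..<i]" and f = "\<lambda>j. hT m (int j)" and E = "Td m" and E' = "Tdinv m", OF m T]
  note u3 = single[OF acts_unit_Pi[OF m]]
  note u4 = acts_unit_hprod[where xs = "rev [i..<m]" and f = "\<lambda>j. hT_inv m (int j)" and E = "Tdinv m" and E' = "Td m", OF m Ti]
  have "acts_unit m (hY m i)
    (mul (const (tvar ^ (m - i))) * (prod_list (map (Td m) (rev [1..<i])) * (PiE m * prod_list (map (Tdinv m) (rev [i..<m])))))
    (((prod_list (map (Td m) (rev (rev [i..<m]))) * PiI m) * prod_list (map (Tdinv m) (rev (rev [1..<i])))) * mul (const (inverse (tvar ^ (m - i)))))"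
    unfolding hY_def
    by (intro acts_unit_hprod_append[OF m] u1 u2 u3 u4)
      (auto intro: cs[OF T] cs[OF Ti] cs[OF acts_unit_Pi[OF m]] acts_carrier[OF m acts_const])
  then show ?thesis
    by (simp add: YE_def YI_def Y_def Yinv_def down_def up_def mult.assoc)
qed

lemma mul_const_inverse: "c \<noteq> 0 \<Longrightarrow> mul (const c) * mul (const (inverse c)) = (1 :: lp endo)"
  "c \<noteq> 0 \<Longrightarrow> mul (const (inverse c)) * mul (const c) = (1 :: lp endo)"
  by (simp_all add: const_inverse mul_one flip: mul_mult)

lemma mul_const_Td: "1 \<le> i \<Longrightarrow> i < m \<Longrightarrow> Td m i * mul (const c) = mul (const c) * Td m i"
  unfolding Td_def by (rule mul_const_DL) auto

lemma mul_const_Tdinv: "1 \<le> i \<Longrightarrow> i < m \<Longrightarrow> Tdinv m i * mul (const c) = mul (const c) * Tdinv m i"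
proof -
  assume i: "1 \<le> i" "i < m"
  interpret affine_hecke m "Td m" "Tdinv m" "PiE m" "PiI m" using i by (intro affine_hecke_endo) auto
  show ?thesis
    by (rule inverse_intertwine[OF T_inv(2)[OF i] T_inv(1)[OF i] mul_const_Td[OF i, symmetric]])
qed

lemma mul_const_Y0:
  assumes "1 \<le> i" "i \<le> m"
  shows "affine_hecke.Y m (Td m) (Tdinv m) (PiE m) i * mul (const c) = mul (const c) * affine_hecke.Y m (Td m) (Tdinv m) (PiE m) i"
proof -
  interpret affine_hecke m "Td m" "Tdinv m" "PiE m" "PiI m" using assms by (intro affine_hecke_endo) auto
  have pl: "prod_list (map E xs) * mul (const c) = mul (const c) * prod_list (map E xs)"
    if "\<And>x. x \<in> set xs \<Longrightarrow> E x * mul (const c) = mul (const c) * E x" for E :: "nat \<Rightarrow> lp endo" and xs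
    using that
  proof (induction xs)
    case (Cons x xs)
    have e: "E x * mul (const c) = mul (const c) * E x" using Cons.prems by simp
    show ?case using Cons by (simp add: mult.assoc mult_left_eq(1)[OF e])
  qed simp
  have 1: "prod_list (map (Td m) (rev [1..<i])) * mul (const c) = mul (const c) * prod_list (map (Td m) (rev [1..<i]))"
    using assms by (intro pl mul_const_Td) auto
  have 2: "prod_list (map (Tdinv m) (rev [i..<m])) * mul (const c) = mul (const c) * prod_list (map (Tdinv m) (rev [i..<m]))"
    using assms by (intro pl mul_const_Tdinv) auto
  show ?thesis
    unfolding Y_def down_def
    by (simp only: mult.assoc 2 mult_left_eq(1)[OF mul_const_Pi] mult_left_eq(1)[OF 1])
qed

lemma YE_const: "1 \<le> i \<Longrightarrow> i \<le> m \<Longrightarrow> YE m i * mul (const c) = mul (const c) * YE m i"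
proof -
  assume i: "1 \<le> i" "i \<le> m"
  have "mul (const d) * mul (const c) = mul (const c) * (mul (const d) :: lp endo)" for d
    by (simp add: mult.commute flip: mul_mult)
  then show ?thesis
    unfolding YE_def by (simp only: mult.assoc mul_const_Y0[OF i]) (simp only: mult.assoc[symmetric])
qed

lemma YE_inverse: "1 \<le> i \<Longrightarrow> i \<le> m \<Longrightarrow> YE m i * YI m i = 1" "1 \<le> i \<Longrightarrow> i \<le> m \<Longrightarrow> YI m i * YE m i = 1"
proof -
  assume i: "1 \<le> i" "i \<le> m"
  interpret affine_hecke m "Td m" "Tdinv m" "PiE m" "PiI m" using i by (intro affine_hecke_endo) auto
  have c: "mul (const (tvar ^ (m - i))) * mul (const (inverse (tvar ^ (m - i)))) = (1 :: lp endo)"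
    "mul (const (inverse (tvar ^ (m - i)))) * mul (const (tvar ^ (m - i))) = (1 :: lp endo)"
    by (rule mul_const_inverse; simp)+
  show "YE m i * YI m i = 1" "YI m i * YE m i = 1"
    unfolding YE_def YI_def
    by (simp_all only: mult.assoc mult_left_eq(2)[OF Y_Yinv(1)[OF i]] mult_left_eq(2)[OF c(2)] c Y_Yinv[OF i])
qed

lemma YE_commute:
  assumes "1 \<le> i" "i \<le> m" "1 \<le> j" "j \<le> m" shows "YE m i * YE m j = YE m j * YE m i"
proof -
  interpret affine_hecke m "Td m" "Tdinv m" "PiE m" "PiI m" using assms by (intro affine_hecke_endo) auto
  have "YE m i * YE m j = mul (const (tvar ^ (m - i))) * mul (const (tvar ^ (m - j))) * (Y i * Y j)"
    "YE m j * YE m i = mul (const (tvar ^ (m - j))) * mul (const (tvar ^ (m - i))) * (Y j * Y i)"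
    unfolding YE_def by (simp_all only: mult.assoc mult_left_eq(1)[OF mul_const_Y0] assms)
  then show ?thesis
    using Y_commute[OF assms] by (simp add: mult.commute flip: mul_mult)
qed

lemma Td_YE_other:
  assumes "1 \<le> i" "i \<le> m" "1 \<le> j" "j < m" "j \<noteq> i" "j + 1 \<noteq> i" shows "Td m j * YE m i = YE m i * Td m j"
proof -
  interpret affine_hecke m "Td m" "Tdinv m" "PiE m" "PiI m" using assms by (intro affine_hecke_endo) auto
  show ?thesis
    unfolding YE_def using T_Y[OF assms]
    by (simp only: mult.assoc mult_left_eq(1)[OF mul_const_Td] assms)
qed

lemma Td_YE_Td:
  assumes "1 \<le> i" "i < m" shows "Td m i * YE m i * Td m i = mul tc * YE m (i + 1)"
proof -
  interpret affine_hecke m "Td m" "Tdinv m" "PiE m" "PiI m" using assms by (intro affine_hecke_endo) auto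
  have "m - i = Suc (m - (i + 1))" using assms by simp
  then have "const (tvar ^ (m - i)) = tc * const (tvar ^ (m - (i + 1)))"
    by (simp add: const_simps)
  then show ?thesis
    unfolding YE_def Y_Suc[OF assms]
    by (simp only: mult.assoc mult_left_eq(1)[OF mul_const_Td] assms mul_mult)
qed

lemma Td_quadratic: "1 \<le> i \<Longrightarrow> i < m \<Longrightarrow> Td m i * Td m i = mul (tc - 1) * Td m i + mul tc"
  unfolding Td_def by (rule DL_quadratic) auto

lemma Td_inv_formula:
  "1 \<le> i \<Longrightarrow> i < m \<Longrightarrow> mul tc * Tdinv m i = Td m i + mul (1 - tc)"
  by (simp add: Tdinv_def TTinv_def TT_Td mult.assoc[symmetric] mul_const_inverse mul_diff mul_one)

text \<open>These are the relations satisfied by the multiplication operators $X_i$.\<close>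

lemma
  assumes "1 \<le> i" "i < m"
  shows Td_YE: "Td m i * YE m i = YE m (i + 1) * (Td m i + mul (1 - tc))"
    and Td_YE_Suc: "Td m i * YE m (i + 1) = YE m i * Td m i + mul (tc - 1) * YE m (i + 1)"
proof -
  interpret affine_hecke m "Td m" "Tdinv m" "PiE m" "PiI m" using assms by (intro affine_hecke_endo) auto
  note T = T_inv[OF assms]
  have "Td m i * YE m i = (Td m i * YE m i * Td m i) * Tdinv m i"
    using T by (simp add: mult.assoc)
  also have "\<dots> = YE m (i + 1) * (mul tc * Tdinv m i)"
    unfolding Td_YE_Td[OF assms] using assms YE_const[of "i + 1" m tvar] by (simp add: mult.assoc[symmetric])
  finally show 1: "Td m i * YE m i = YE m (i + 1) * (Td m i + mul (1 - tc))"
    unfolding Td_inv_formula[OF assms] .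
  have c: "mul (tc - 1) = mul (const (tvar - 1))" by (simp add: const_simps)
  have "mul tc * (Td m i * YE m (i + 1)) = Td m i * (mul tc * YE m (i + 1))"
    by (simp add: mult.assoc[symmetric] mul_const_Td[OF assms])
  also have "\<dots> = (Td m i * Td m i) * YE m i * Td m i"
    unfolding Td_YE_Td[OF assms, symmetric] by (simp only: mult.assoc)
  also have "\<dots> = mul (tc - 1) * (Td m i * YE m i * Td m i) + mul tc * (YE m i * Td m i)"
    unfolding Td_quadratic[OF assms] by (simp add: distrib_right mult.assoc)
  also have "\<dots> = mul tc * (YE m i * Td m i + mul (tc - 1) * YE m (i + 1))"
    unfolding Td_YE_Td[OF assms] by (simp add: distrib_left mult.assoc[symmetric] mult.commute add.commute flip: mul_mult)
  finally have "mul (const (inverse tvar)) * (mul tc * (Td m i * YE m (i + 1)))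
      = mul (const (inverse tvar)) * (mul tc * (YE m i * Td m i + mul (tc - 1) * YE m (i + 1)))"
    by simp
  then show "Td m i * YE m (i + 1) = YE m i * Td m i + mul (tc - 1) * YE m (i + 1)"
    by (simp only: mult_left_eq(2)[OF mul_const_inverse(2)[OF tvar_nonzero]])
qed


section \<open>The evaluation map q and its intertwining property\<close>

subsection \<open>The evaluation map\<close>

definition ypow :: "nat \<Rightarrow> nat \<Rightarrow> int \<Rightarrow> lp endo" where
  "ypow m i k = (if k < 0 then YI m i ^ nat (- k) else YE m i ^ nat k)"

definition ymono :: "nat \<Rightarrow> mono \<Rightarrow> lp endo" where
  "ymono m a = prod_list (map (\<lambda>i. ypow m i (Poly_Mapping.lookup a i)) [1..<Suc m])"

text \<open>Removes the presented algebra from \<open>q_map\<close>: it becomes the linear extension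
  of Y^a applied to 1, and its further properties rest on this formula.\<close>

lemma q_map_eq:
  assumes "m \<ge> 1" shows "q_map m F = lin (\<lambda>a. app (ymono m a) 1) F"
proof -
  have "acts m (hprod m (map (\<lambda>i. hY m i [^]\<^bsub>hecke m\<^esub> (Poly_Mapping.lookup a i)) [1..<Suc m])) (ymono m a)" for a
    unfolding ymono_def
  proof (rule acts_hprod[OF assms], unfold list_all2_map1 list_all2_map2, rule list.rel_refl_strong)
    fix i assume "i \<in> set [1..<Suc m]"
    then show "acts m (hY m i [^]\<^bsub>hecke m\<^esub> (Poly_Mapping.lookup a i)) (ypow m i (Poly_Mapping.lookup a i))"
      unfolding ypow_def by (intro acts_unit_pow[OF assms] acts_unit_hY) auto
  qed
  then have "acts m (eval_Y m F) (\<Sum>a\<in>Poly_Mapping.keys F. mul (const (Poly_Mapping.lookup F a)) * ymono m a)"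
    unfolding eval_Y_def by (intro acts_finsum acts_mult acts_const assms) auto
  then have "q_map m F = app (\<Sum>a\<in>Poly_Mapping.keys F. mul (const (Poly_Mapping.lookup F a)) * ymono m a) 1"
    unfolding q_map_def by (intro hact_eq[OF assms]) auto
  then show ?thesis by (simp add: lin_def app_sum_left)
qed

lemma q_linear:
  assumes "m \<ge> 1"
  shows q_add: "q_map m (F + G) = q_map m F + q_map m G"
    and q_diff: "q_map m (F - G) = q_map m F - q_map m G"
    and q_scale: "q_map m (const c * F) = const c * q_map m F"
    and q_zero: "q_map m 0 = 0"
    and q_sum: "q_map m (sum f S) = (\<Sum>x\<in>S. q_map m (f x))"
  by (simp_all add: q_map_eq[OF assms] lin_add lin_diff lin_const_mult lin_sum)

lemma q_one: "m \<ge> 1 \<Longrightarrow> q_map m 1 = 1"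
  unfolding q_map_eq by (rule lin_one) (simp add: ymono_def ypow_def map_replicate_const)

lemma q_const: "m \<ge> 1 \<Longrightarrow> q_map m (const c) = const c"
  using q_scale[of m c 1] q_one by simp

lemma prod_list_update_commute:
  fixes f :: "'b \<Rightarrow> 'a::monoid_mult"
  assumes "distinct xs" "i \<in> set xs" "\<And>j. j \<in> set xs \<Longrightarrow> E * f j = f j * E"
  shows "prod_list (map (\<lambda>j. if j = i then E * f j else f j) xs) = E * prod_list (map f xs)"
  using assms
proof (induction xs)
  case (Cons x xs)
  have e: "E * f x = f x * E" using Cons.prems by simp
  show ?case
  proof (cases "x = i")
    case True
    then have "prod_list (map (\<lambda>j. if j = i then E * f j else f j) xs) = prod_list (map f xs)"
      using Cons.prems by (intro arg_cong[of _ _ prod_list] map_cong) auto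
    then show ?thesis using True by (simp add: mult.assoc)
  next
    case False
    then have "prod_list (map (\<lambda>j. if j = i then E * f j else f j) xs) = E * prod_list (map f xs)"
      using Cons by auto
    then show ?thesis using False by (simp add: mult_left_eq(1)[OF e])
  qed
qed simp

lemma YE_ypow_commute:
  assumes "1 \<le> i" "i \<le> m" "1 \<le> j" "j \<le> m" shows "YE m i * ypow m j k = ypow m j k * YE m i"
proof -
  have "YE m i * A ^ n = A ^ n * YE m i" if "YE m i * A = A * YE m i" for A n
  proof (induction n)
    case (Suc n)
    then show ?case by (simp add: mult.assoc mult_left_eq(1)[OF that])
  qed simp
  moreover have "YE m i * YI m j = YI m j * YE m i"
    by (rule sym, rule inverse_intertwine[OF YE_inverse(2) YE_inverse(1) YE_commute]) (use assms in auto)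
  ultimately show ?thesis using YE_commute assms by (simp add: ypow_def)
qed

lemma ypow_Suc: "1 \<le> i \<Longrightarrow> i \<le> m \<Longrightarrow> ypow m i (1 + k) = YE m i * ypow m i k"
proof (cases "k < 0")
  case True
  assume i: "1 \<le> i" "i \<le> m"
  have "nat (- k) = Suc (nat (- (1 + k)))" using True by simp
  then have "YE m i * ypow m i k = YI m i ^ nat (- (1 + k))"
    using True mult_left_eq(2)[OF YE_inverse(1)[OF i]] by (simp add: ypow_def)
  then show ?thesis using True by (cases "k = -1") (auto simp: ypow_def)
next
  case False
  then have "nat (1 + k) = Suc (nat k)" by simp
  then show ?thesis using False by (simp add: ypow_def)
qed

lemma ymono_single:
  assumes "1 \<le> i" "i \<le> m" shows "ymono m (Poly_Mapping.single i 1 + a) = YE m i * ymono m a"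
proof -
  have "ymono m (Poly_Mapping.single i 1 + a)
      = prod_list (map (\<lambda>j. if j = i then YE m i * ypow m j (Poly_Mapping.lookup a j) else ypow m j (Poly_Mapping.lookup a j)) [1..<Suc m])"
    unfolding ymono_def
    by (rule arg_cong[of _ _ prod_list], rule map_cong) (use assms ypow_Suc in \<open>auto simp: lookup_add lookup_single when_def\<close>)
  also have "\<dots> = YE m i * ymono m a"
    unfolding ymono_def by (rule prod_list_update_commute) (use assms YE_ypow_commute in auto)
  finally show ?thesis .
qed

lemma YE_app_const:
  "1 \<le> i \<Longrightarrow> i \<le> m \<Longrightarrow> app (YE m i) (const c * F) = const c * app (YE m i) F"
  using arg_cong[OF YE_const[of i m c], of "\<lambda>A. app A F"] by simp

text \<open>Together with linearity and q(1) = 1 this determines q on polynomials; it drives the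
  inductions on \<open>q_map\<close>.\<close>

lemma q_var:
  assumes "1 \<le> i" "i \<le> m" shows "q_map m (var i * F) = app (YE m i) (q_map m F)"
proof -
  have m: "m \<ge> 1" using assms by simp
  show ?thesis
  proof (induction F rule: lpoly_induct)
    case (mono a)
    show ?case
      using ymono_single[OF assms, of a]
      by (simp add: var_def mult_single q_map_eq[OF m] lin_single const_simps)
  next
    case (scale c F)
    then show ?case using assms by (simp add: mult.left_commute q_scale[OF m] YE_app_const)
  qed (simp_all add: q_linear[OF m] distrib_left app_add)
qed

lemma q_inv:
  assumes "1 \<le> i" "i \<le> m" shows "q_map m (vpow i (-1) * F) = app (YI m i) (q_map m F)"
proof -
  have c: "var i * (vpow i (-1) * F) = F" by (simp add: mult.assoc[symmetric] vpow_inverse)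
  have "app (YI m i) (q_map m F) = app (YI m i * YE m i) (q_map m (vpow i (-1) * F))"
    using q_var[OF assms, of "vpow i (-1) * F"] unfolding c by simp
  then show ?thesis unfolding YE_inverse(2)[OF assms] by simp
qed

lemma Td_app:
  assumes "1 \<le> i" "i < m"
  shows "app (Td m i) 1 = tc" "app (Td m i) (const c * F) = const c * app (Td m i) F"
    "app (Td m i) (var i * F) = var (i + 1) * (app (Td m i) F + (1 - tc) * F)"
    "app (Td m i) (var (i + 1) * F) = var i * app (Td m i) F + (tc - 1) * (var (i + 1) * F)"
    "j \<noteq> i \<Longrightarrow> j \<noteq> i + 1 \<Longrightarrow> app (Td m i) (var j * F) = var j * app (Td m i) F"
  using assms DL_one[of m] DL_const[of m] DL_var[of i m] DL_var_Suc[of i m] DL_var_other[of i m]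
  by (simp_all add: Td_def)

text \<open>Since the $Y_i$ satisfy the same relations with the $T_j$ as the $X_i$, and $T_j$ acts on $1$
  by $t$, evaluation at the $Y_i$ intertwines the action of $T_j$ on the $Y$-polynomials by the very
  same formula with the action on the $X$-polynomials.\<close>

lemma q_Td:
  assumes "1 \<le> i" "i < m" "F \<in> laurent m"
  shows "q_map m (app (Td m i) F) = app (Td m i) (q_map m F)"
proof -
  have m: "m \<ge> 1" using assms by simp
  \<comment> \<open>The defect of the intertwining property. The matching relations turn
    multiplication by X_j inside \<open>N\<close> into Y_k outside, where k = s_i(j). So
    \<open>N\<close> vanishes on polynomials once it vanishes at 1, and invertibility of Y_k extends
    this to inverse variables.\<close>
  define N where "N F = q_map m (app (Td m i) F) - app (Td m i) (q_map m F)" for F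
  have sc: "q_map m ((1 - tc) * F) = (1 - tc) * q_map m F" "q_map m ((tc - 1) * F) = (tc - 1) * q_map m F" for F
    using q_scale[OF m, of "1 - tvar" F] q_scale[OF m, of "tvar - 1" F] by (simp_all add: const_simps)
  have step: "\<exists>k. 1 \<le> k \<and> k \<le> m \<and> (\<forall>F. N (var j * F) = app (YE m k) (N F))" if j: "1 \<le> j" "j \<le> m" for j
  proof -
    consider "j = i" | "j = i + 1" | "j \<noteq> i" "j \<noteq> i + 1" by auto
    then show ?thesis
    proof cases
      case 1
      have "N (var i * F) = app (YE m (i + 1)) (N F)" for F
        using assms arg_cong[OF Td_YE[OF assms(1,2)], of "\<lambda>A. app A (q_map m F)"]
        by (simp add: N_def Td_app q_var q_add[OF m] sc app_add app_diff)
      then show ?thesis using 1 assms by (intro exI[of _ "i + 1"]) auto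
    next
      case 2
      have "N (var (i + 1) * F) = app (YE m i) (N F)" for F
        using assms arg_cong[OF Td_YE_Suc[OF assms(1,2)], of "\<lambda>A. app A (q_map m F)"]
          Td_app(4)[OF assms(1,2), of F]
        by (simp add: N_def q_var q_add[OF m] sc app_diff)
      then show ?thesis using 2 assms by (intro exI[of _ i]) auto
    next
      case 3
      have "N (var j * F) = app (YE m j) (N F)" for F
        using assms j 3 arg_cong[where f = "\<lambda>A. app A (q_map m F)", OF Td_YE_other[of j m i]]
        by (simp add: N_def Td_app(5) q_var app_diff)
      then show ?thesis using j by (intro exI[of _ j]) auto
    qed
  qed
  have "N F = 0"
    using assms(3)
  proof (induction F rule: laurent_induct)
    case one
    show ?case using assms by (simp add: N_def q_one[OF m] Td_app q_const[OF m])
  next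
    case (add F G)
    then show ?case by (simp add: N_def app_add q_add[OF m])
  next
    case (scale c F)
    then show ?case using assms by (simp add: N_def Td_app q_scale[OF m])
  next
    case (var j F)
    then show ?case using step[of j] by auto
  next
    case (inv j F)
    then obtain k where k: "1 \<le> k" "k \<le> m" "N (var j * (vpow j (-1) * F)) = app (YE m k) (N (vpow j (-1) * F))"
      using step[of j] by blast
    have c: "var j * (vpow j (-1) * F) = F" by (simp add: mult.assoc[symmetric] vpow_inverse)
    have "app (YE m k) (N (vpow j (-1) * F)) = 0"
      using k(3) inv.IH unfolding c by simp
    then have "app (YI m k * YE m k) (N (vpow j (-1) * F)) = 0" by simp
    then show ?case unfolding YE_inverse(2)[OF k(1,2)] by simp
  qed
  then show ?thesis by (simp add: N_def)
qed

section \<open>The operators and q preserve polynomials and are graded\<close>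

subsection \<open>Preservation of polynomials and of the degree\<close>

lemma Xpow_polys [simp]: "m \<ge> 1 \<Longrightarrow> 0 \<le> e \<Longrightarrow> Xpow m k e \<in> polys m"
  using residue_range[of m k]
  by (auto simp: Xpow_def polys_def laurent_def lookup_single when_def)

lemma sub_polys:
  assumes "m \<ge> 1" "F \<in> polys m" shows "sub m f F \<in> polys m"
  using assms(2)
  by (induction F rule: polys_induct) (use assms(1) in \<open>auto simp: sub_simps sub_var xp_def\<close>)

lemma PiE_polys: "m \<ge> 1 \<Longrightarrow> F \<in> polys m \<Longrightarrow> app (PiE m) F \<in> polys m"
  by (simp add: PiE_def sub_polys)

lemma Td_polys: "F \<in> polys m \<Longrightarrow> 1 \<le> i \<Longrightarrow> i < m \<Longrightarrow> app (Td m i) F \<in> polys m"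
  unfolding Td_def by (rule DL_polys)

lemma Td_laurent: "F \<in> laurent m \<Longrightarrow> 1 \<le> i \<Longrightarrow> i < m \<Longrightarrow> app (Td m i) F \<in> laurent m"
  unfolding Td_def by (rule DL_laurent)

lemma Tdinv_app: "1 \<le> i \<Longrightarrow> i < m \<Longrightarrow> app (Tdinv m i) F = const (inverse tvar) * (app (Td m i) F + (1 - tc) * F)"
  by (simp add: Tdinv_def TTinv_def TT_Td algebra_simps)

lemma Tdinv_polys: "F \<in> polys m \<Longrightarrow> 1 \<le> i \<Longrightarrow> i < m \<Longrightarrow> app (Tdinv m i) F \<in> polys m"
  by (simp add: Tdinv_app Td_polys)

lemma Tdinv_laurent: "F \<in> laurent m \<Longrightarrow> 1 \<le> i \<Longrightarrow> i < m \<Longrightarrow> app (Tdinv m i) F \<in> laurent m"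
  by (simp add: Tdinv_app Td_laurent)

lemma prod_list_closed:
  "(\<And>x F. x \<in> set xs \<Longrightarrow> F \<in> S \<Longrightarrow> app (E x) F \<in> S) \<Longrightarrow> F \<in> S \<Longrightarrow> app (prod_list (map E xs)) F \<in> S"
  by (induction xs) auto

lemma YE_expand:
  assumes "1 \<le> i" "i \<le> m"
  shows "app (YE m i) F = const (tvar ^ (m - i)) *
    app (prod_list (map (Td m) (rev [1..<i]))) (app (PiE m) (app (prod_list (map (Tdinv m) (rev [i..<m]))) F))"
proof -
  interpret affine_hecke m "Td m" "Tdinv m" "PiE m" "PiI m" using assms by (intro affine_hecke_endo) auto
  show ?thesis by (simp add: YE_def Y_def down_def)
qed

text \<open>A principle for submodules stable under all the operators.\<close>

lemma YE_closed:
  assumes "1 \<le> i" "i \<le> m" "F \<in> S"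
    and "\<And>j F. 1 \<le> j \<Longrightarrow> j < m \<Longrightarrow> F \<in> S \<Longrightarrow> app (Td m j) F \<in> S"
    and "\<And>j F. 1 \<le> j \<Longrightarrow> j < m \<Longrightarrow> F \<in> S \<Longrightarrow> app (Tdinv m j) F \<in> S"
    and "\<And>F. F \<in> S \<Longrightarrow> app (PiE m) F \<in> S"
    and "\<And>F. F \<in> S \<Longrightarrow> tc * F \<in> S"
  shows "app (YE m i) F \<in> S"
proof -
  have t: "const (tvar ^ n) * F \<in> S" if "F \<in> S" for n F
    using that by (induction n) (auto simp: const_simps assms(7) mult.assoc)
  show ?thesis
    unfolding YE_expand[OF assms(1,2)]
    by (intro t prod_list_closed[where S = S] assms(3-6)) (use assms(1,2) in auto)
qed

lemma YE_polys: "1 \<le> i \<Longrightarrow> i \<le> m \<Longrightarrow> F \<in> polys m \<Longrightarrow> app (YE m i) F \<in> polys m"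
  by (rule YE_closed) (auto intro: Td_polys Tdinv_polys PiE_polys)

lemma PiI_laurent': "1 \<le> m \<Longrightarrow> F \<in> laurent m \<Longrightarrow> app (PiI m) F \<in> laurent m"
  by (rule PiI_laurent)

lemma YE_laurent: "1 \<le> i \<Longrightarrow> i \<le> m \<Longrightarrow> F \<in> laurent m \<Longrightarrow> app (YE m i) F \<in> laurent m"
  by (rule YE_closed) (auto intro: Td_laurent Tdinv_laurent PiE_laurent)

lemma YI_laurent:
  assumes "1 \<le> i" "i \<le> m" "F \<in> laurent m" shows "app (YI m i) F \<in> laurent m"
proof -
  interpret affine_hecke m "Td m" "Tdinv m" "PiE m" "PiI m" using assms by (intro affine_hecke_endo) auto
  have "app (YI m i) F = app (prod_list (map (Td m) [i..<m])) (app (PiI m) (app (prod_list (map (Tdinv m) [1..<i])) (const (inverse (tvar ^ (m - i))) * F)))"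
    by (simp add: YI_def Yinv_def up_def)
  then show ?thesis
    using assms by (auto intro!: prod_list_closed[where S = "laurent m"] Td_laurent Tdinv_laurent PiI_laurent)
qed

lemma q_polys:
  assumes "m \<ge> 1" "F \<in> polys m" shows "q_map m F \<in> polys m"
  using assms(2)
  by (induction F rule: polys_induct) (use q_linear[OF assms(1)] q_one[OF assms(1)] in \<open>auto simp: q_var YE_polys\<close>)

lemma q_laurent:
  assumes "m \<ge> 1" "F \<in> laurent m" shows "q_map m F \<in> laurent m"
  using assms(2)
  by (induction F rule: laurent_induct) (use q_linear[OF assms(1)] q_one[OF assms(1)] in \<open>auto simp: q_var q_inv YE_laurent YI_laurent\<close>)

text \<open>The homogeneous component, with an integer as degree so that \<open>hc_var\<close> and
  \<open>hc_YE\<close> can lower the degree by 1 without exception.\<close>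

definition hc :: "nat \<Rightarrow> int \<Rightarrow> lp \<Rightarrow> lp" where
  "hc m d = lin (\<lambda>a. if (\<Sum>i = 1..m. Poly_Mapping.lookup a i) = d then Poly_Mapping.single a 1 else 0)"

lemma hc_simps:
  "hc m d (F + G) = hc m d F + hc m d G" "hc m d (F - G) = hc m d F - hc m d G"
  "hc m d (const c * F) = const c * hc m d F" "hc m d 0 = 0" "hc m d (sum f S) = (\<Sum>x\<in>S. hc m d (f x))"
  by (simp_all add: hc_def lin_add lin_diff lin_const_mult lin_sum)

lemma hc_one: "hc m d 1 = (if d = 0 then 1 else 0)"
  using lin_single[of _ 0 1] by (simp add: hc_def const_simps)

lemma hc_var:
  assumes "1 \<le> i" "i \<le> m" shows "hc m d (var i * F) = var i * hc m (d - 1) F"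
proof (induction F rule: lpoly_induct)
  case (mono a)
  have "(\<Sum>j = 1..m. Poly_Mapping.lookup (Poly_Mapping.single i 1 + a) j) = 1 + (\<Sum>j = 1..m. Poly_Mapping.lookup a j)"
    using assms by (simp add: lookup_add sum.distrib lookup_single when_def)
  then show ?case
    by (auto simp: hc_def var_def mult_single lin_single const_simps)
next
  case (scale c F)
  then show ?case by (simp add: hc_simps mult.left_commute)
qed (simp_all add: hc_simps distrib_left)

lemma lookup_hc: "Poly_Mapping.lookup (hc m d F) a = (if (\<Sum>i = 1..m. Poly_Mapping.lookup a i) = d then Poly_Mapping.lookup F a else 0)"
proof (induction F rule: lpoly_induct)
  case (mono b)
  show ?case by (auto simp: hc_def lin_single const_simps lookup_single when_def)
qed (simp_all add: hc_simps lookup_add)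

lemma homogeneous_hc: "homogeneous m d F \<longleftrightarrow> hc m (int d) F = F"
  by (auto simp: homogeneous_def poly_mapping_eq_iff fun_eq_iff lookup_hc in_keys_iff)

lemma homogeneous_hc_self: "homogeneous m d (hc m (int d) F)"
  by (auto simp: homogeneous_def lookup_hc in_keys_iff split: if_splits)

lemma keys_hc: "Poly_Mapping.keys (hc m d F) \<subseteq> Poly_Mapping.keys F"
  by (auto simp: in_keys_iff lookup_hc split: if_splits)

lemma hc_polys: "F \<in> polys m \<Longrightarrow> hc m d F \<in> polys m"
  using keys_hc by (fastforce simp: polys_def laurent_def)

lemma polys_eq_zeroI:
  assumes "F \<in> polys m" "\<And>d. hc m (int d) F = 0" shows "F = 0"
proof (rule poly_mapping_eqI)
  fix a
  show "Poly_Mapping.lookup F a = Poly_Mapping.lookup 0 a"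
  proof (cases "a \<in> Poly_Mapping.keys F")
    case True
    then have "0 \<le> (\<Sum>i = 1..m. Poly_Mapping.lookup a i)"
      using assms(1) by (auto simp: polys_def intro!: sum_nonneg)
    then obtain d where "(\<Sum>i = 1..m. Poly_Mapping.lookup a i) = int d"
      by (metis nonneg_int_cases)
    then show ?thesis using arg_cong[OF assms(2)[of d], of "\<lambda>G. Poly_Mapping.lookup G a"]
      by (simp add: lookup_hc)
  qed (simp add: in_keys_iff)
qed

lemma hc_commute_polys:
  assumes "F \<in> polys m"
    and "\<And>d. hc m d (\<phi> 1) = \<phi> (hc m d 1)"
    and "\<And>F G. \<phi> (F + G) = \<phi> F + \<phi> G" "\<And>c F. \<phi> (const c * F) = const c * \<phi> F"
    and "\<And>i F. 1 \<le> i \<Longrightarrow> i \<le> m \<Longrightarrow> F \<in> polys m \<Longrightarrow> (\<And>d. hc m d (\<phi> F) = \<phi> (hc m d F)) \<Longrightarrow> (\<And>d. hc m d (\<phi> (var i * F)) = \<phi> (hc m d (var i * F)))"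
  shows "hc m d (\<phi> F) = \<phi> (hc m d F)"
proof -
  have "\<forall>d. hc m d (\<phi> F) = \<phi> (hc m d F)"
    using assms(1) by (induction F rule: polys_induct) (use assms(2-) in \<open>auto simp: hc_simps\<close>)
  then show ?thesis by simp
qed

lemma hc_Td:
  assumes "F \<in> polys m" "1 \<le> i" "i < m" shows "hc m d (app (Td m i) F) = app (Td m i) (hc m d F)"
proof (rule hc_commute_polys[OF assms(1)])
  have "hc m d tc = const tvar * hc m d 1" for d using hc_simps(3)[of m d tvar 1] by simp
  then show "hc m d (app (Td m i) 1) = app (Td m i) (hc m d 1)" for d
    using assms(2,3) by (simp add: Td_app hc_one)
  fix j F assume j: "1 \<le> j" "j \<le> m" and IH: "\<And>d. hc m d (app (Td m i) F) = app (Td m i) (hc m d F)"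
  have t: "hc m d ((1 - tc) * G) = (1 - tc) * hc m d G" "hc m d ((tc - 1) * G) = (tc - 1) * hc m d G" for d G
    using hc_simps(3)[of m d "1 - tvar" G] hc_simps(3)[of m d "tvar - 1" G] by (simp_all add: const_simps)
  show "hc m d (app (Td m i) (var j * F)) = app (Td m i) (hc m d (var j * F))" for d
  proof -
    consider "j = i" | "j = i + 1" | "j \<noteq> i" "j \<noteq> i + 1" by auto
    then show ?thesis
    proof cases
      case 2
      then show ?thesis
        using j assms(2,3) IH t Td_app(4)[OF assms(2,3), of F] Td_app(4)[OF assms(2,3), of "hc m (d - 1) F"]
          hc_var[of "i + 1" m d F] hc_var[of i m d "app (Td m i) F"]
        by (simp add: hc_simps)
    qed (use j assms(2,3) IH t Td_app[OF assms(2,3)] in \<open>simp_all add: hc_simps hc_var\<close>)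
  qed
qed (use assms(2,3) in \<open>simp_all add: app_add Td_app\<close>)

lemma Xpow_var:
  assumes "m \<ge> 1"
  obtains c i where "1 \<le> i" "i \<le> m" "c \<noteq> 0" "Xpow m k 1 = const c * var i"
proof -
  let ?i = "nat ((k - 1) mod int m + 1)"
  have "Xpow m k 1 = const (qvar powi (- ((k - 1) div int m) * 1)) * var ?i"
    unfolding Xpow_def var_def const_def by (simp add: mult_single)
  then show ?thesis
    using that[of ?i "qvar powi (- ((k - 1) div int m) * 1)"] residue_range[OF assms, of k] by auto
qed

lemma hc_Xpow: "m \<ge> 1 \<Longrightarrow> hc m d (Xpow m k 1 * F) = Xpow m k 1 * hc m (d - 1) F"
  by (rule Xpow_var[of m k]) (auto simp: mult.assoc hc_simps hc_var)

lemma hc_sub: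
  assumes "m \<ge> 1" "F \<in> polys m" shows "hc m d (sub m f F) = sub m f (hc m d F)"
  by (rule hc_commute_polys[OF assms(2)])
    (use assms(1) in \<open>auto simp: hc_one sub_simps sub_var xp_def hc_Xpow hc_var\<close>)

lemma hc_PiE:
  assumes "m \<ge> 1" "F \<in> polys m" shows "hc m d (app (PiE m) F) = app (PiE m) (hc m (d - 1) F)"
  using assms by (simp add: PiE_def hc_Xpow hc_sub)

lemma hc_prod_list:
  assumes "\<And>x F. x \<in> set xs \<Longrightarrow> F \<in> polys m \<Longrightarrow> app (E x) F \<in> polys m"
    and "\<And>x F. x \<in> set xs \<Longrightarrow> F \<in> polys m \<Longrightarrow> hc m d (app (E x) F) = app (E x) (hc m d F)" "F \<in> polys m"
  shows "hc m d (app (prod_list (map E xs)) F) = app (prod_list (map E xs)) (hc m d F)"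
  using assms(1,2)
proof (induction xs)
  case (Cons x xs)
  have "app (prod_list (map E xs)) F \<in> polys m"
    using Cons.prems(1) assms(3) by (intro prod_list_closed) auto
  then show ?case using Cons by simp
qed simp

lemma hc_Tdinv:
  assumes "F \<in> polys m" "1 \<le> i" "i < m" shows "hc m d (app (Tdinv m i) F) = app (Tdinv m i) (hc m d F)"
  using assms hc_simps(3)[of m d "1 - tvar" F] hc_simps(3)[of m d tvar F]
  by (simp add: Tdinv_app hc_simps hc_Td const_simps left_diff_distrib)

lemma hc_YE:
  assumes "1 \<le> i" "i \<le> m" "F \<in> polys m" shows "hc m d (app (YE m i) F) = app (YE m i) (hc m (d - 1) F)"
proof -
  have m: "m \<ge> 1" using assms by simp
  let ?A = "prod_list (map (Td m) (rev [1..<i]))" and ?B = "prod_list (map (Tdinv m) (rev [i..<m]))"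
  have B: "app ?B F \<in> polys m" "app (PiE m) (app ?B F) \<in> polys m"
    using assms m by (auto intro!: prod_list_closed Tdinv_polys PiE_polys)
  have "hc m d (app ?A (app (PiE m) (app ?B F))) = app ?A (hc m d (app (PiE m) (app ?B F)))"
    by (rule hc_prod_list) (use assms B in \<open>auto intro!: Td_polys hc_Td\<close>)
  also have "hc m d (app (PiE m) (app ?B F)) = app (PiE m) (hc m (d - 1) (app ?B F))"
    by (rule hc_PiE[OF m B(1)])
  also have "hc m (d - 1) (app ?B F) = app ?B (hc m (d - 1) F)"
    by (rule hc_prod_list) (use assms in \<open>auto intro!: Tdinv_polys hc_Tdinv\<close>)
  finally show ?thesis by (simp add: YE_expand[OF assms(1,2)] hc_simps)
qed

lemma hc_q:
  assumes "m \<ge> 1" "F \<in> polys m" shows "hc m d (q_map m F) = q_map m (hc m d F)"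
  by (rule hc_commute_polys[OF assms(2)])
    (use assms(1) q_linear[OF assms(1)] q_one[OF assms(1)] in \<open>auto simp: hc_one q_var hc_YE hc_var q_polys\<close>)

section \<open>Comparison of the operators in n + 1 and in n variables\<close>

section \<open>Compatibility with truncation\<close>

lemma trunc_lin: "trunc m F = lin (\<lambda>a. if Poly_Mapping.keys a \<subseteq> {1..m} then Poly_Mapping.single a 1 else 0) F"
  unfolding trunc_def lin_def
  by (subst sum.inter_filter[OF finite_keys]) (rule sum.cong, auto simp: const_def mult_single)

lemma trunc_simps:
  "trunc m (F + G) = trunc m F + trunc m G" "trunc m (F - G) = trunc m F - trunc m G"
  "trunc m (const c * F) = const c * trunc m F" "trunc m 0 = 0" "trunc m (sum f S) = (\<Sum>x\<in>S. trunc m (f x))"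
  "trunc m 1 = 1"
  unfolding trunc_lin by (simp_all add: lin_add lin_diff lin_const_mult lin_sum lin_one)

lemma trunc_const: "trunc m (const c) = const c"
  using trunc_simps(3)[of m c 1] by (simp add: trunc_simps(6))

lemma lookup_trunc: "Poly_Mapping.lookup (trunc m F) a = (if Poly_Mapping.keys a \<subseteq> {1..m} then Poly_Mapping.lookup F a else 0)"
proof (induction F rule: lpoly_induct)
  case (mono b)
  show ?case by (auto simp: trunc_lin lin_single const_simps lookup_single when_def)
qed (simp_all add: trunc_simps lookup_add)

lemma keys_trunc: "Poly_Mapping.keys (trunc m F) = {a \<in> Poly_Mapping.keys F. Poly_Mapping.keys a \<subseteq> {1..m}}"
  by (rule Set.set_eqI) (simp add: in_keys_iff[of _ "trunc m F"] in_keys_iff[of _ F] lookup_trunc)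

lemma trunc_polys: "F \<in> polys m \<Longrightarrow> trunc k F \<in> polys k"
  by (auto simp: polys_def laurent_def keys_trunc)

lemma trunc_id: "F \<in> polys m \<Longrightarrow> m \<le> k \<Longrightarrow> trunc k F = F"
proof (rule poly_mapping_eqI)
  fix a assume "F \<in> polys m" "m \<le> k"
  then have "a \<in> Poly_Mapping.keys F \<Longrightarrow> Poly_Mapping.keys a \<subseteq> {1..k}"
    by (fastforce simp: polys_def laurent_def)
  then show "Poly_Mapping.lookup (trunc k F) a = Poly_Mapping.lookup F a"
    by (auto simp: lookup_trunc in_keys_iff[of _ F])
qed

lemma trunc_trunc: "k \<le> m \<Longrightarrow> trunc k (trunc m F) = trunc k F"
  by (rule poly_mapping_eqI) (auto simp: lookup_trunc)

lemma trunc_var: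
  assumes "F \<in> polys m" "1 \<le> i" shows "trunc k (var i * F) = (if i \<le> k then var i * trunc k F else 0)"
proof (induction F rule: lpoly_induct)
  case (mono a)
  have "Poly_Mapping.keys (Poly_Mapping.single i 1 + a) = insert i (Poly_Mapping.keys a)"
  proof -
    have "Poly_Mapping.lookup (Poly_Mapping.single i 1 + a) j \<noteq> 0 \<longleftrightarrow> j = i \<or> Poly_Mapping.lookup a j \<noteq> 0" for j
    proof -
      have "0 \<le> Poly_Mapping.lookup a j" using mono assms(1) by (auto simp: polys_def)
      then show ?thesis by (auto simp: lookup_add lookup_single when_def)
    qed
    then show ?thesis by (auto simp: in_keys_iff simp del: lookup_not_eq_zero_eq_in_keys)
  qed
  then show ?case using assms(2)
    by (auto simp: trunc_lin var_def mult_single lin_single const_simps)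
next
  case (scale c F)
  then show ?case by (simp add: trunc_simps mult.left_commute)
qed (simp_all add: trunc_simps distrib_left split: if_splits)

lemma trunc_mult:
  assumes "F \<in> polys m" "G \<in> polys m" shows "trunc k (F * G) = trunc k F * trunc k G"
  using assms(1)
proof (induction F rule: polys_induct)
  case (var i F)
  then show ?case
    using trunc_var[of "F * G" m i k] trunc_var[of F m i k] assms(2) by (simp add: mult.assoc)
qed (simp_all add: trunc_simps distrib_right mult.assoc)

lemma PiE_var:
  "1 \<le> i \<Longrightarrow> i \<le> m \<Longrightarrow> app (PiE m) (var i * F) = Xpow m (int i + 1) 1 * app (PiE m) F"
  by (simp add: PiE_def sub_simps sub_var xp_def mult_ac)

lemma PiE_const: "app (PiE m) (const c * F) = const c * app (PiE m) F"
  by (simp add: PiE_def sub_simps mult_ac)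

lemma PiE_one: "m \<ge> 1 \<Longrightarrow> app (PiE m) 1 = var 1"
  using Xpow_vpow[of 1 m 1] by (simp add: PiE_def sub_simps vpow_1)

lemma Xpow_next: "i < m \<Longrightarrow> Xpow m (int i + 1) 1 = var (i + 1)"
  using Xpow_vpow[of "i + 1" m 1] by (simp add: vpow_1 add.commute)

lemma Xpow_wrap: "m \<ge> 1 \<Longrightarrow> Xpow m (int m + 1) 1 = const (inverse qvar) * var 1"
  using Xpow_shift[of m 1 1 1] Xpow_vpow[of 1 m 1] by (simp add: vpow_1 add.commute power_int_minus)

context
  fixes n :: nat assumes n: "n \<ge> 1"
begin

lemma trunc_Td:
  assumes "F \<in> polys (Suc n)" "1 \<le> i" "i < n"
  shows "trunc n (app (Td (Suc n) i) F) = app (Td n i) (trunc n F)"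
  using assms(1)
proof (induction F rule: polys_induct)
  case one
  then show ?case using assms by (simp add: Td_app trunc_simps trunc_const)
next
  case (scale c F)
  then show ?case using assms by (simp add: Td_app trunc_simps)
next
  case (var j F)
  let ?T = "Td (Suc n) i"
  have i: "i < Suc n" using assms by simp
  have T: "app ?T F \<in> polys (Suc n)" using var.hyps assms by (intro Td_polys) auto
  have t: "trunc n ((1 - tc) * G) = (1 - tc) * trunc n G" "trunc n ((tc - 1) * G) = (tc - 1) * trunc n G" for G
    using trunc_simps(3)[of n "1 - tvar" G] trunc_simps(3)[of n "tvar - 1" G] by (simp_all add: const_simps)
  consider "j = i" | "j = i + 1" | "j \<noteq> i" "j \<noteq> i + 1" by auto
  then show ?case
  proof cases
    case 1
    have "trunc n (app ?T (var i * F)) = var (i + 1) * (trunc n (app ?T F) + (1 - tc) * trunc n F)"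
      using assms var.hyps T by (simp add: Td_app(3)[OF assms(2) i, simplified] trunc_var[where m = "Suc n"] trunc_simps t)
    then show ?thesis
      using 1 assms var by (simp add: trunc_var[where m = "Suc n"] Td_app(3)[OF assms(2,3), simplified])
  next
    case 2
    have "trunc n (app ?T (var (i + 1) * F)) = var i * trunc n (app ?T F) + (tc - 1) * (var (i + 1) * trunc n F)"
      using assms var.hyps T
      by (simp add: Td_app(4)[OF assms(2) i, simplified] trunc_var[where m = "Suc n"] trunc_simps t)
    then show ?thesis
      using 2 assms var by (simp add: trunc_var[where m = "Suc n"] Td_app(4)[OF assms(2,3), simplified])
  next
    case 3
    then show ?thesis
      using assms var T by (simp add: Td_app(5)[OF assms(2) i] Td_app(5)[OF assms(2,3)] trunc_var[where m = "Suc n"])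
  qed
qed (simp add: app_add trunc_simps)

lemma trunc_Tdinv:
  assumes "F \<in> polys (Suc n)" "1 \<le> i" "i < n"
  shows "trunc n (app (Tdinv (Suc n) i) F) = app (Tdinv n i) (trunc n F)"
proof -
  have "trunc n ((1 - tc) * F) = (1 - tc) * trunc n F"
    using trunc_simps(3)[of n "1 - tvar" F] by (simp add: const_simps)
  then show ?thesis using assms by (simp add: Tdinv_app trunc_Td trunc_simps)
qed

lemma trunc_prod_list:
  assumes "\<And>x F. x \<in> set xs \<Longrightarrow> F \<in> polys (Suc n) \<Longrightarrow> app (D x) F \<in> polys (Suc n)"
    and "\<And>x F. x \<in> set xs \<Longrightarrow> F \<in> polys (Suc n) \<Longrightarrow> trunc n (app (D x) F) = app (E x) (trunc n F)" "F \<in> polys (Suc n)"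
  shows "trunc n (app (prod_list (map D xs)) F) = app (prod_list (map E xs)) (trunc n F)"
  using assms(1,2)
proof (induction xs)
  case (Cons x xs)
  have "app (prod_list (map D xs)) F \<in> polys (Suc n)"
    using Cons.prems(1) assms(3) by (intro prod_list_closed) auto
  then show ?case using Cons by simp
qed simp

text \<open>In n + 1 variables Y_i contains the extra factor t T_n^{-1} next to Pi. It replaces X_n
  by X_{n+1}, which Pi wraps around to q^{-1} X_1 exactly as Pi in n variables does with X_n. The
  correction term, and everything coming from X_{n+1}, acquires the factor X_n, which Pi sends to
  X_{n+1}, and so disappears under truncation.\<close>

lemma trunc_Pi:
  assumes "F \<in> polys (Suc n)"
  shows "trunc n (app (PiE (Suc n)) (tc * app (Tdinv (Suc n) n) F)) = app (PiE n) (trunc n F)"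
proof -
  let ?T = "app (Td (Suc n) n)" and ?P = "app (PiE (Suc n))"
  define B where "B F = ?T F + (1 - tc) * F" for F
  have BT: "tc * app (Tdinv (Suc n) n) F = B F" for F
    using n by (simp add: Tdinv_app B_def mult.assoc[symmetric] const_inverse)
  have nn: "1 \<le> n" "n < Suc n" using n by auto
  note T = Td_app[OF nn, simplified]
  have Bp: "B F \<in> polys (Suc n)" if "F \<in> polys (Suc n)" for F
    using that n by (simp add: B_def Td_polys)
  have Pp: "?P F \<in> polys (Suc n)" if "F \<in> polys (Suc n)" for F
    using that by (simp add: PiE_polys)
  have "trunc n (?P (B F)) = app (PiE n) (trunc n F)"
    using assms
  proof (induction F rule: polys_induct)
    case one
    have "B 1 = 1" by (simp add: B_def T)
    then show ?case using n PiE_one[of "Suc n"] PiE_one[of n] trunc_var[of 1 "Suc n" 1 n] by (simp add: trunc_simps)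
  next
    case (add F G)
    have "B (F + G) = B F + B G" by (simp add: B_def app_add algebra_simps)
    then show ?case using add by (simp add: app_add trunc_simps)
  next
    case (scale c F)
    have "B (const c * F) = const c * B F" by (simp add: B_def T distrib_left mult.left_commute)
    then show ?case using scale by (simp add: PiE_const trunc_simps)
  next
    case (var j F)
    consider "j = n" | "j = Suc n" | "j < n" using var.hyps by force
    then show ?case
    proof cases
      case 1
      have B: "B (var n * F) = var (Suc n) * B F + const (1 - tvar) * (var n * F)"
        by (simp add: B_def T const_simps)
      have "?P (B (var n * F)) = const (inverse qvar) * (var 1 * ?P (B F)) + const (1 - tvar) * (var (Suc n) * ?P F)"
        unfolding B using n Xpow_wrap[of "Suc n"] Xpow_next[of n "Suc n"]
        by (simp add: app_add PiE_var PiE_const add.commute mult.assoc)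
      then have "trunc n (?P (B (var n * F))) = const (inverse qvar) * (var 1 * trunc n (?P (B F)))"
        using var.hyps Bp Pp n by (simp add: trunc_simps trunc_var[where m = "Suc n"])
      also have "\<dots> = app (PiE n) (trunc n (var n * F))"
        using var n Xpow_wrap[of n] by (simp add: trunc_var[where m = "Suc n"] PiE_var mult.assoc)
      finally show ?thesis using 1 by simp
    next
      case 2
      have "B (var (Suc n) * F) = var n * ?T F"
        unfolding B_def T by (simp add: left_diff_distrib)
      then have "?P (B (var (Suc n) * F)) = var (Suc n) * ?P (?T F)"
        using n Xpow_next[of n "Suc n"] by (simp add: PiE_var add.commute)
      then show ?thesis
        using 2 var.hyps n Pp[OF Td_polys[OF var.hyps(3) nn]] by (simp add: trunc_var[where m = "Suc n"])
    next
      case 3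
      have "B (var j * F) = var j * B F"
        unfolding B_def using 3 by (simp add: T distrib_left mult.left_commute)
      then have "?P (B (var j * F)) = var (j + 1) * ?P (B F)"
        using 3 var.hyps Xpow_next[of j "Suc n"] by (simp add: PiE_var add.commute)
      then show ?thesis
        using 3 var n Pp[OF Bp[OF var.hyps(3)]] Xpow_next[of j n]
        by (simp add: trunc_var[where m = "Suc n"] PiE_var add.commute)
    qed
  qed
  then show ?thesis unfolding BT .
qed

lemma trunc_YE:
  assumes "F \<in> polys (Suc n)" "1 \<le> i" "i \<le> n"
  shows "trunc n (app (YE (Suc n) i) F) = app (YE n i) (trunc n F)"
proof -
  define G where "G = app (prod_list (map (Tdinv (Suc n)) (rev [i..<n]))) F"
  have G: "G \<in> polys (Suc n)"
    unfolding G_def using assms by (intro prod_list_closed[where S = "polys (Suc n)"]) (auto intro!: Tdinv_polys)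
  define H where "H = app (PiE (Suc n)) (tc * app (Tdinv (Suc n) n) G)"
  have H: "H \<in> polys (Suc n)" "trunc n H = app (PiE n) (trunc n G)"
    using G n trunc_Pi by (simp_all add: H_def PiE_polys Tdinv_polys)
  have "[i..<Suc n] = [i..<n] @ [n]" using assms by simp
  \<comment> \<open>The normalisations of Y_i differ by one factor t, which is the factor paired
    with T_n^{-1} in \<open>trunc_Pi\<close>.\<close>
  moreover have "const (tvar ^ (Suc n - i)) = const (tvar ^ (n - i)) * tc"
    using assms by (simp add: Suc_diff_le const_simps mult.commute)
  ultimately have "app (YE (Suc n) i) F = const (tvar ^ (n - i)) * (tc *
      app (prod_list (map (Td (Suc n)) (rev [1..<i]))) (app (PiE (Suc n)) (app (Tdinv (Suc n) n) G)))"
    using assms YE_expand[of i "Suc n" F] by (simp add: G_def mult.assoc)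
  also have "tc * app (prod_list (map (Td (Suc n)) (rev [1..<i]))) K = app (prod_list (map (Td (Suc n)) (rev [1..<i]))) (tc * K)" for K
  proof -
    have "app (prod_list (map (Td (Suc n)) xs)) (tc * K) = tc * app (prod_list (map (Td (Suc n)) xs)) K"
      if "set xs \<subseteq> {1..<Suc n}" for xs
      using that by (induction xs) (auto simp: Td_app)
    then show ?thesis using assms by auto
  qed
  finally have Y: "app (YE (Suc n) i) F = const (tvar ^ (n - i)) * app (prod_list (map (Td (Suc n)) (rev [1..<i]))) H"
    by (simp add: H_def PiE_const)
  have "trunc n (app (prod_list (map (Td (Suc n)) (rev [1..<i]))) H) = app (prod_list (map (Td n) (rev [1..<i]))) (trunc n H)"
    by (rule trunc_prod_list) (use assms H in \<open>auto intro!: Td_polys trunc_Td\<close>)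
  moreover have "trunc n G = app (prod_list (map (Tdinv n) (rev [i..<n]))) (trunc n F)"
    unfolding G_def by (rule trunc_prod_list) (use assms in \<open>auto intro!: Tdinv_polys trunc_Tdinv\<close>)
  ultimately show ?thesis
    using assms by (simp add: Y trunc_simps YE_expand H(2))
qed

text \<open>Y_{n+1} is T_n ... T_1 Pi. The image of Pi is divisible by X_1, and each T_i turns a
  multiple of X_i into a multiple of X_{i+1}, so that the result is divisible by X_{n+1}.\<close>

lemma trunc_YE_last:
  assumes "F \<in> polys (Suc n)" shows "trunc n (app (YE (Suc n) (Suc n)) F) = 0"
proof -
  have ex: "\<exists>G\<in>polys (Suc n). app (prod_list (map (Td (Suc n)) (rev [1..<i]))) (var 1 * F) = var i * G"
    if "1 \<le> i" "i \<le> Suc n" "F \<in> polys (Suc n)" for i F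
    using that(1,2)
  proof (induction i rule: dec_induct)
    case base
    then show ?case using that by auto
  next
    case (step i)
    then obtain G where G: "G \<in> polys (Suc n)" "app (prod_list (map (Td (Suc n)) (rev [1..<i]))) (var 1 * F) = var i * G"
      by auto
    have "app (prod_list (map (Td (Suc n)) (rev [1..<Suc i]))) (var 1 * F) = var (Suc i) * (app (Td (Suc n) i) G + (1 - tc) * G)"
      using G(2) step Td_app(3)[of i "Suc n" G] by simp
    moreover have "app (Td (Suc n) i) G + (1 - tc) * G \<in> polys (Suc n)"
      using G(1) step by (simp add: Td_polys)
    ultimately show ?case by blast
  qed
  define H where "H = sub (Suc n) (\<lambda>k. k + 1) F"
  have H: "H \<in> polys (Suc n)" "app (PiE (Suc n)) F = var 1 * H"
    using Xpow_vpow[of 1 "Suc n" 1] sub_polys[OF _ assms, of "\<lambda>k. k + 1"] by (simp_all add: H_def PiE_def vpow_1)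
  obtain G where G: "G \<in> polys (Suc n)"
      "app (prod_list (map (Td (Suc n)) (rev [1..<Suc n]))) (var 1 * H) = var (Suc n) * G"
    using ex[OF _ le_refl H(1)] by auto
  have "app (YE (Suc n) (Suc n)) F = var (Suc n) * G"
    unfolding G(2)[symmetric] H(2)[symmetric] using YE_expand[of "Suc n" "Suc n" F] by (simp add: const_simps del: upt_Suc)
  with G(1) show ?thesis by (simp add: trunc_var[where m = "Suc n"])
qed

lemma trunc_q_Suc:
  assumes "F \<in> polys (Suc n)" shows "trunc n (q_map (Suc n) F) = q_map n (trunc n F)"
proof -
  have m: "Suc n \<ge> 1" by simp
  show ?thesis
    using assms
  proof (induction F rule: polys_induct)
    case one
    show ?case using n by (simp add: q_one trunc_simps)
  next
    case (add F G)
    then show ?case by (simp add: q_add[OF m] q_add[OF n] trunc_simps)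
  next
    case (scale c F)
    then show ?case by (simp add: q_scale[OF m] q_scale[OF n] trunc_simps)
  next
    case (var i F)
    have qF: "q_map (Suc n) F \<in> polys (Suc n)" using var.hyps by (intro q_polys) auto
    show ?case
    proof (cases "i \<le> n")
      case True
      then show ?thesis using var n qF
        by (simp add: q_var trunc_YE trunc_var[where m = "Suc n"])
    next
      case False
      then have "i = Suc n" using var.hyps by simp
      then show ?thesis using var.hyps qF
        by (simp add: q_var trunc_YE_last trunc_var[where m = "Suc n"] q_zero[OF n])
    qed
  qed
qed

end

lemma trunc_q:
  assumes "0 < k" "k \<le> m" "F \<in> polys m" shows "trunc k (q_map m F) = q_map k (trunc k F)"
  using assms(2,3)
proof (induction m arbitrary: F rule: dec_induct)
  case base
  then show ?case using assms(1) trunc_id[of _ k k] q_polys[of k F] by simp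
next
  case (step m)
  have "trunc k (q_map (Suc m) F) = trunc k (trunc m (q_map (Suc m) F))"
    using step.hyps by (simp add: trunc_trunc)
  also have "\<dots> = trunc k (q_map m (trunc m F))"
    using step assms(1) by (simp add: trunc_q_Suc)
  also have "\<dots> = q_map k (trunc k (trunc m F))"
    using step.prems by (intro step.IH trunc_polys)
  finally show ?case using step.hyps by (simp add: trunc_trunc)
qed

section \<open>Bijectivity on polynomials, with control of regularity at q = 1\<close>

section \<open>Bijectivity of the evaluation map\<close>

lemma regular_add: "regular_at_q1 x \<Longrightarrow> regular_at_q1 y \<Longrightarrow> regular_at_q1 (x + y)"
  and regular_mult: "regular_at_q1 x \<Longrightarrow> regular_at_q1 y \<Longrightarrow> regular_at_q1 (x * y)"
proof -
  assume "regular_at_q1 x" "regular_at_q1 y"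
  then obtain f g f' g' where *: "poly g 1 \<noteq> 0" "x = Fract f g" "poly g' 1 \<noteq> 0" "y = Fract f' g'"
    by (auto simp: regular_at_q1_def)
  then have "g \<noteq> 0" "g' \<noteq> 0" by auto
  then have "x + y = Fract (f * g' + f' * g) (g * g')" "x * y = Fract (f * f') (g * g')"
    using * by (simp_all add: add_fract)
  then show "regular_at_q1 (x + y)" "regular_at_q1 (x * y)"
    unfolding regular_at_q1_def using * poly_mult by (metis no_zero_divisors)+
qed

lemma regular_Fract: "poly g 1 \<noteq> 0 \<Longrightarrow> regular_at_q1 (Fract f g)"
  by (auto simp: regular_at_q1_def)

lemma regular_simps [simp]:
  "regular_at_q1 0" "regular_at_q1 1" "regular_at_q1 tvar" "regular_at_q1 (inverse tvar)"
  "regular_at_q1 qvar" "regular_at_q1 (inverse qvar)"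
proof -
  have t: "Fract [:0, 1:] 1 \<noteq> (0 :: Qt)" by (simp add: Fract_eq_0_iff)
  show "regular_at_q1 0" "regular_at_q1 1"
    unfolding Zero_fract_def One_fract_def by (rule regular_Fract; simp)+
  show "regular_at_q1 tvar" "regular_at_q1 (inverse tvar)" "regular_at_q1 qvar" "regular_at_q1 (inverse qvar)"
    unfolding tvar_def qvar_def inverse_fract by (rule regular_Fract; simp add: t)+
qed

lemma regular_power: "regular_at_q1 x \<Longrightarrow> regular_at_q1 (x ^ n)"
  by (induction n) (auto intro: regular_mult)

lemma regular_powi: "regular_at_q1 (qvar powi k)"
  by (simp add: power_int_def regular_power)

lemma regular_minus: "regular_at_q1 x \<Longrightarrow> regular_at_q1 (- x)"
proof -
  have "regular_at_q1 (- 1)"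
    unfolding One_fract_def minus_fract by (rule regular_Fract) simp
  then show "regular_at_q1 x \<Longrightarrow> regular_at_q1 (- x)"
    using regular_mult[of "- 1" x] by simp
qed

lemma regular_diff: "regular_at_q1 x \<Longrightarrow> regular_at_q1 y \<Longrightarrow> regular_at_q1 (x - y)"
  using regular_add[OF _ regular_minus, of x y] by simp

definition regc :: "lp \<Rightarrow> bool" where
  "regc F \<longleftrightarrow> (\<forall>a. regular_at_q1 (Poly_Mapping.lookup F a))"

lemma lookup_mono_mult:
  fixes F :: "'k::comm_ring_1 lpoly" and a b :: mono
  shows "Poly_Mapping.lookup (Poly_Mapping.single b 1 * F) a = Poly_Mapping.lookup F (a - b)"
proof (induction F rule: lpoly_induct)
  case (mono c)
  have "b + c = a \<longleftrightarrow> c = a - b" by (auto simp: algebra_simps)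
  then show ?case by (simp add: mult_single lookup_single when_def)
next
  case (scale c F)
  then show ?case by (simp add: mult.left_commute)
qed (simp_all add: distrib_left lookup_add)

lemma regc_add: "regc F \<Longrightarrow> regc G \<Longrightarrow> regc (F + G)"
  and regc_diff: "regc F \<Longrightarrow> regc G \<Longrightarrow> regc (F - G)"
  and regc_scale: "regular_at_q1 c \<Longrightarrow> regc F \<Longrightarrow> regc (const c * F)"
  and regc_mono: "regc F \<Longrightarrow> regc (Poly_Mapping.single b 1 * F)"
  by (simp_all add: regc_def lookup_add lookup_minus lookup_mono_mult regular_add regular_diff regular_mult)

lemma regc_zero [simp]: "regc 0" and regc_one [simp]: "regc 1"
  by (simp_all add: regc_def lookup_one when_def)

lemma regc_const: "regular_at_q1 c \<Longrightarrow> regc (const c)"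
  using regc_scale[OF _ regc_one, of c] by simp

lemma regc_var: "regc F \<Longrightarrow> regc (var i * F)"
  unfolding var_def by (rule regc_mono)

lemma regc_sum: "(\<And>x. x \<in> A \<Longrightarrow> regc (f x)) \<Longrightarrow> regc (sum f A)"
  by (induction A rule: infinite_finite_induct) (auto intro: regc_add)

lemma regc_mult:
  assumes "regc F" "regc G" shows "regc (F * G)"
proof -
  have eq: "F * G = (\<Sum>a\<in>Poly_Mapping.keys F. const (Poly_Mapping.lookup F a) * (Poly_Mapping.single a 1 * G))"
    by (subst lpoly_expansion[of "Poly_Mapping.keys F" F]) (simp_all add: sum_distrib_right mult.assoc)
  show ?thesis
    unfolding eq using assms by (intro regc_sum regc_scale regc_mono) (auto simp: regc_def)
qed

text \<open>Polynomials over the local ring at q = 1. The inductive construction of preimages is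
  carried out over this ring, so that it also provides the regular preimages needed for the
  specialisation of the star product.\<close>

definition regp :: "nat \<Rightarrow> lp set" where
  "regp m = {F \<in> polys m. regc F}"

lemma monomial_induct:
  assumes "Poly_Mapping.keys a \<subseteq> V" "\<And>i. 0 \<le> Poly_Mapping.lookup a i"
    and "P 1" and "\<And>i F. i \<in> V \<Longrightarrow> P F \<Longrightarrow> P (var i * F)"
  shows "P (Poly_Mapping.single a 1)"
proof -
  have "P (\<Prod>i\<in>A. vpow i (Poly_Mapping.lookup a i))" if "finite A" "A \<subseteq> Poly_Mapping.keys a" for A
    using that
  proof (induction A rule: finite_induct)
    case (insert i A)
    then show ?case
      using vpow_induct[of P "\<Prod>i\<in>A. vpow i (Poly_Mapping.lookup a i)" i "Poly_Mapping.lookup a i"]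
        assms(4)[of i] assms(1) assms(2)[of i] by auto
  qed (simp add: assms(3))
  from this[of "Poly_Mapping.keys a"] show ?thesis
    by (simp add: mono_eq_prod[of "Poly_Mapping.keys a"])
qed

lemma monomial_polys:
  "Poly_Mapping.keys a \<subseteq> {1..m} \<Longrightarrow> (\<And>i. 0 \<le> Poly_Mapping.lookup a i) \<Longrightarrow> Poly_Mapping.single a 1 \<in> polys m"
  by (simp add: polys_def laurent_def)

lemma polys_sum_monomials:
  assumes "F \<in> polys m"
    and "\<And>a. a \<in> Poly_Mapping.keys F \<Longrightarrow> Poly_Mapping.keys a \<subseteq> {1..m} \<Longrightarrow> (\<And>i. 0 \<le> Poly_Mapping.lookup a i) \<Longrightarrow> P (const (Poly_Mapping.lookup F a) * Poly_Mapping.single a 1)"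
    and "P 0" "\<And>F G. P F \<Longrightarrow> P G \<Longrightarrow> P (F + G)"
  shows "P F"
proof -
  have "P (\<Sum>a\<in>A. const (Poly_Mapping.lookup F a) * Poly_Mapping.single a 1)" if "finite A" "A \<subseteq> Poly_Mapping.keys F" for A
    using that by (induction A rule: finite_induct) (use assms in \<open>auto simp: polys_def laurent_def\<close>)
  from this[of "Poly_Mapping.keys F"] show ?thesis
    using lpoly_expansion[of "Poly_Mapping.keys F" F] by simp
qed

lemma regp_closed:
  "0 \<in> regp m" "1 \<in> regp m" "F \<in> regp m \<Longrightarrow> G \<in> regp m \<Longrightarrow> F + G \<in> regp m"
  "F \<in> regp m \<Longrightarrow> G \<in> regp m \<Longrightarrow> F - G \<in> regp m"
  "regular_at_q1 c \<Longrightarrow> F \<in> regp m \<Longrightarrow> const c * F \<in> regp m"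
  "1 \<le> i \<Longrightarrow> i \<le> m \<Longrightarrow> F \<in> regp m \<Longrightarrow> var i * F \<in> regp m"
  by (simp_all add: regp_def regc_add regc_diff regc_scale regc_var)

lemma regp_induct [consumes 1, case_names one add scale var]:
  assumes "F \<in> regp m" "P 1"
    and "\<And>F G. F \<in> regp m \<Longrightarrow> G \<in> regp m \<Longrightarrow> P F \<Longrightarrow> P G \<Longrightarrow> P (F + G)"
    and "\<And>c F. regular_at_q1 c \<Longrightarrow> F \<in> regp m \<Longrightarrow> P F \<Longrightarrow> P (const c * F)"
    and "\<And>i F. 1 \<le> i \<Longrightarrow> i \<le> m \<Longrightarrow> F \<in> regp m \<Longrightarrow> P F \<Longrightarrow> P (var i * F)"
  shows "P F"
proof -
  have mono: "Poly_Mapping.single a 1 \<in> regp m \<and> P (Poly_Mapping.single a 1)"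
    if "Poly_Mapping.keys a \<subseteq> {1..m}" "\<And>i. 0 \<le> Poly_Mapping.lookup a i" for a :: mono
    by (rule monomial_induct[OF that]) (use assms(2,5) in \<open>auto simp: regp_closed\<close>)
  have "F \<in> polys m" using assms(1) by (simp add: regp_def)
  then have "F \<in> regp m \<and> P F"
  proof (rule polys_sum_monomials)
    fix a :: mono assume "Poly_Mapping.keys a \<subseteq> {1..m}" "\<And>i. 0 \<le> Poly_Mapping.lookup a i"
    moreover have "regular_at_q1 (Poly_Mapping.lookup F a)" using assms(1) by (simp add: regp_def regc_def)
    ultimately show "const (Poly_Mapping.lookup F a) * Poly_Mapping.single a 1 \<in> regp m \<and> P (const (Poly_Mapping.lookup F a) * Poly_Mapping.single a 1)"
      using mono[of a] assms(4)[of "Poly_Mapping.lookup F a"] by (simp add: regp_closed)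
  next
    show "0 \<in> regp m \<and> P 0"
      using assms(4)[of 0 1] assms(2) by (simp add: regp_closed const_simps)
  qed (use assms(3) in \<open>auto simp: regp_closed\<close>)
  then show ?thesis ..
qed

lemma Td_regp:
  assumes "F \<in> regp m" "1 \<le> i" "i < m" shows "app (Td m i) F \<in> regp m"
  using assms(1)
proof (induction F rule: regp_induct)
  case one
  show ?case using assms by (simp add: Td_app regp_def regc_const)
next
  case (add F G)
  then show ?case by (simp add: app_add regp_closed)
next
  case (scale c F)
  then show ?case using assms by (simp add: Td_app regp_closed)
next
  case (var j F)
  have t: "(1 - tc) * G = const (1 - tvar) * G" "(tc - 1) * G = const (tvar - 1) * G" for G by (simp_all add: const_simps)
  have r: "regular_at_q1 (1 - tvar)" "regular_at_q1 (tvar - 1)" by (simp_all add: regular_diff)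
  consider "j = i" | "j = i + 1" | "j \<noteq> i" "j \<noteq> i + 1" by auto
  then show ?case
  proof cases
    case 1
    then show ?thesis
      using assms var r unfolding 1 Td_app(3)[OF assms(2,3)] t by (intro regp_closed) auto
  next
    case 2
    then show ?thesis
      using assms var r unfolding 2 Td_app(4)[OF assms(2,3)] t by (intro regp_closed) auto
  next
    case 3
    then show ?thesis using assms var by (simp add: Td_app(5) regp_closed)
  qed
qed

lemma Xpow_regp:
  assumes "m \<ge> 1" "F \<in> regp m" shows "Xpow m k 1 * F \<in> regp m"
proof -
  have "Xpow m k 1 = const (qvar powi (- ((k - 1) div int m))) * var (nat ((k - 1) mod int m + 1))"
    unfolding Xpow_def var_def const_def by (simp add: mult_single)
  then show ?thesis
    using residue_range[OF assms(1), of k] assms(2) regular_powi by (auto simp: mult.assoc intro!: regp_closed)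
qed

lemma sub_regp:
  assumes "m \<ge> 1" "F \<in> regp m" shows "sub m f F \<in> regp m"
  using assms(2)
  by (induction F rule: regp_induct) (use assms(1) in \<open>auto simp: sub_simps sub_var xp_def regp_closed Xpow_regp\<close>)

definition q_image :: "nat \<Rightarrow> lp set" where
  "q_image m = q_map m ` regp m"

lemma q_image_closed:
  assumes "m \<ge> 1"
  shows "0 \<in> q_image m" "1 \<in> q_image m" "F \<in> q_image m \<Longrightarrow> G \<in> q_image m \<Longrightarrow> F + G \<in> q_image m"
    "regular_at_q1 c \<Longrightarrow> F \<in> q_image m \<Longrightarrow> const c * F \<in> q_image m"
    "1 \<le> i \<Longrightarrow> i < m \<Longrightarrow> F \<in> q_image m \<Longrightarrow> app (Td m i) F \<in> q_image m"
proof -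
  show "0 \<in> q_image m" "1 \<in> q_image m"
    unfolding q_image_def using q_zero[OF assms] q_one[OF assms] regp_closed(1,2) by (metis imageI)+
  show "F \<in> q_image m \<Longrightarrow> G \<in> q_image m \<Longrightarrow> F + G \<in> q_image m"
    by (auto simp: q_image_def q_add[OF assms, symmetric] intro!: imageI regp_closed)
  show "regular_at_q1 c \<Longrightarrow> F \<in> q_image m \<Longrightarrow> const c * F \<in> q_image m"
    by (auto simp: q_image_def q_scale[OF assms, symmetric] intro!: imageI regp_closed)
  assume i: "1 \<le> i" "i < m" and "F \<in> q_image m"
  then obtain G where G: "G \<in> regp m" "F = q_map m G" by (auto simp: q_image_def)
  then have "app (Td m i) F = q_map m (app (Td m i) G)"
    using i by (simp add: q_Td regp_def polys_laurent)
  then show "app (Td m i) F \<in> q_image m"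
    unfolding q_image_def using Td_regp[OF G(1) i] by simp
qed

text \<open>The definition of Y_1, namely t^(m-1) Pi T_{m-1}^{-1} ... T_1^{-1}, solved for
  Pi.\<close>

lemma PiE_via_Y:
  assumes "m \<ge> 1"
  shows "PiE m = mul (const (inverse (tvar ^ (m - 1)))) * YE m 1 * prod_list (map (Td m) [1..<m])"
proof -
  interpret affine_hecke m "Td m" "Tdinv m" "PiE m" "PiI m" by (rule affine_hecke_endo[OF assms])
  have ud: "down 1 m * up 1 m = 1" using up_down[of 1 m] assms by simp
  have "mul (const (inverse (tvar ^ (m - 1)))) * YE m 1 = PiE m * down 1 m"
    unfolding YE_def by (simp add: mult_left_eq(2)[OF mul_const_inverse(2)] Y_def)
  then show ?thesis using ud by (simp add: up_def[symmetric] mult.assoc)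
qed

lemma q_Td_list:
  assumes "F \<in> laurent m" "set xs \<subseteq> {1..<m}"
  shows "q_map m (app (prod_list (map (Td m) xs)) F) = app (prod_list (map (Td m) xs)) (q_map m F)"
  using assms(2)
proof (induction xs)
  case (Cons x xs)
  have "app (prod_list (map (Td m) xs)) F \<in> laurent m"
    using Cons.prems assms(1) by (intro prod_list_closed) (auto intro!: Td_laurent)
  then show ?case using Cons by (auto simp: q_Td)
qed simp

text \<open>Lifts Pi to preimages: on them it is an operator built from X_1, the T_i and powers of t
  only, so the lift keeps polynomials polynomial and regular coefficients regular.\<close>

lemma PiE_q:
  assumes "m \<ge> 1" "F \<in> laurent m"
  shows "app (PiE m) (q_map m F) = q_map m (const (inverse (tvar ^ (m - 1))) * (var 1 * app (prod_list (map (Td m) [1..<m])) F))"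
proof -
  have "q_map m (app (prod_list (map (Td m) [1..<m])) F) = app (prod_list (map (Td m) [1..<m])) (q_map m F)"
    by (rule q_Td_list[OF assms(2)]) auto
  then show ?thesis
    unfolding PiE_via_Y[OF assms(1)]
    by (simp only: q_scale[OF assms(1)] q_var[OF order_refl assms(1)] app_simps app_mul)
qed

lemma PiE_q_image:
  assumes "m \<ge> 1" "F \<in> q_image m" shows "app (PiE m) F \<in> q_image m"
proof -
  obtain G where G: "G \<in> regp m" "F = q_map m G" using assms(2) by (auto simp: q_image_def)
  have L: "G \<in> laurent m" using G(1) by (auto simp: regp_def intro: polys_laurent)
  have "app (prod_list (map (Td m) [1..<m])) G \<in> regp m"
    using G(1) by (intro prod_list_closed) (auto intro!: Td_regp)
  moreover have "regular_at_q1 (inverse (tvar ^ (m - 1)))"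
    by (simp add: power_inverse[symmetric] regular_power)
  ultimately show ?thesis
    unfolding G(2) PiE_q[OF assms(1) L] q_image_def using assms(1) by (intro imageI regp_closed) auto
qed

text \<open>The multiples of $X_1$ are reached from lower degree by $\Pi$, and the identity
  $X_{i+1} = T_i X_i (t^{-1} T_i)$ moves on to the multiples of the other variables.\<close>

lemma monomial_q_image:
  assumes "m \<ge> 1" "Poly_Mapping.keys a \<subseteq> {1..m}" "\<And>i. 0 \<le> Poly_Mapping.lookup a i"
    "(\<Sum>i = 1..m. Poly_Mapping.lookup a i) = int d"
  shows "Poly_Mapping.single a 1 \<in> q_image m"
  using assms(2-4)
proof (induction d arbitrary: a)
  case 0
  have "Poly_Mapping.lookup a i = 0" for i
  proof (cases "i \<in> {1..m}")
    case True
    then show ?thesis using 0 sum_nonneg_eq_0_iff[of "{1..m}" "Poly_Mapping.lookup a"] by auto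
  next
    case False
    then show ?thesis using 0(1) by (auto simp: in_keys_iff)
  qed
  then have "a = 0" by (intro poly_mapping_eqI) simp
  then show ?case using q_image_closed(2)[OF assms(1)] by simp
next
  case (Suc d)
  \<comment> \<open>The induction hypothesis concerns monomials; it extends to homogeneous
    polynomials with coefficients regular at q = 1.\<close>
  have homog: "F \<in> q_image m" if "F \<in> regp m" "hc m (int d) F = F" for F
  proof -
    have "F \<in> polys m" using that(1) by (simp add: regp_def)
    then show ?thesis
    proof (rule polys_sum_monomials)
      fix b assume b: "b \<in> Poly_Mapping.keys F" "Poly_Mapping.keys b \<subseteq> {1..m}" "\<And>i. 0 \<le> Poly_Mapping.lookup b i"
      have "homogeneous m d F" using that(2) by (simp add: homogeneous_hc)
      then have "Poly_Mapping.single b 1 \<in> q_image m"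
        using Suc.IH[of b] b by (simp add: homogeneous_def)
      then show "const (Poly_Mapping.lookup F b) * Poly_Mapping.single b 1 \<in> q_image m"
        using that(1) q_image_closed(4)[OF assms(1)] by (simp add: regp_def regc_def)
    qed (use q_image_closed[OF assms(1)] in auto)
  qed
  have var: "var i * F \<in> q_image m" if "1 \<le> i" "i \<le> m" "F \<in> regp m" "hc m (int d) F = F" for i F
    using that(1,2) that(3,4)
  proof (induction i arbitrary: F rule: dec_induct)
    case base
    \<comment> \<open>X_1 F = Pi G for the backward shift G of F, which has the same degree
      d.\<close>
    let ?G = "sub m (\<lambda>k. k - 1) F"
    have F: "F \<in> polys m" using base by (simp add: regp_def)
    have "?G \<in> q_image m"
      using homog[of ?G] base sub_regp[OF assms(1), of F] hc_sub[OF assms(1) F] by simp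
    then have "app (PiE m) ?G \<in> q_image m" by (rule PiE_q_image[OF assms(1)])
    also have "app (PiE m) ?G = var 1 * F"
      using Xpow_vpow[of 1 m 1] assms(1) by (simp add: PiE_def sub_comp vpow_1)
    finally show ?case .
  next
    case (step i)
    then have i: "1 \<le> i" "i < m" by auto
    \<comment> \<open>Chosen so that (T_i + 1 - t) G = F by the quadratic relation; the Bernstein
      relation then gives T_i (X_i G) = X_{i+1} F.\<close>
    let ?G = "const (inverse tvar) * app (Td m i) F"
    have F: "F \<in> polys m" using step by (simp add: regp_def)
    have G: "?G \<in> regp m" "hc m (int d) ?G = ?G"
      using step i F by (auto intro!: regp_closed Td_regp simp: hc_simps hc_Td)
    have "app (Td m i) ?G + (1 - tc) * ?G = const (inverse tvar) * (app (Td m i * Td m i) F + (1 - tc) * app (Td m i) F)"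
      using i by (simp add: Td_app algebra_simps)
    also have "\<dots> = const (inverse tvar) * (tc * F)"
      unfolding Td_quadratic[OF i] by (simp add: algebra_simps)
    also have "\<dots> = F" by (simp add: mult.assoc[symmetric] const_inverse)
    finally have eq: "app (Td m i) (var i * ?G) = var (Suc i) * F"
      using i Td_app(3)[OF i, of ?G] by simp
    have "var i * ?G \<in> q_image m" using step.IH[OF _ G] i by simp
    then show ?case using q_image_closed(5)[OF assms(1) i, of "var i * ?G"] unfolding eq by simp
  qed
  have "\<exists>i\<in>{1..m}. Poly_Mapping.lookup a i > 0"
  proof (rule ccontr)
    assume "\<not> (\<exists>i\<in>{1..m}. Poly_Mapping.lookup a i > 0)"
    then have "(\<Sum>i = 1..m. Poly_Mapping.lookup a i) \<le> 0" by (intro sum_nonpos) (auto simp: not_less)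
    then show False using Suc.prems(3) by simp
  qed
  then obtain i where i: "1 \<le> i" "i \<le> m" "Poly_Mapping.lookup a i > 0" by auto
  define b where "b = a - Poly_Mapping.single i 1"
  have b: "Poly_Mapping.keys b \<subseteq> {1..m}" "0 \<le> Poly_Mapping.lookup b j" for j
    using Suc.prems(1) Suc.prems(2)[of j] i
    by (auto simp: b_def lookup_minus lookup_single when_def in_keys_iff subset_iff split: if_splits)
  have "(\<Sum>j = 1..m. Poly_Mapping.lookup b j) = (\<Sum>j = 1..m. Poly_Mapping.lookup a j) - 1"
    using i by (simp add: b_def lookup_minus sum_subtractf lookup_single when_def)
  then have "hc m (int d) (Poly_Mapping.single b 1) = Poly_Mapping.single b 1"
    using Suc.prems(3) by (simp add: hc_def lin_single const_simps)
  moreover have "Poly_Mapping.single b 1 \<in> regp m"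
    using monomial_polys[OF b] by (simp add: regp_def regc_def lookup_single when_def)
  ultimately have "var i * Poly_Mapping.single b 1 \<in> q_image m"
    using i by (intro var)
  moreover have "var i * Poly_Mapping.single b 1 = Poly_Mapping.single a 1"
    by (simp add: var_def mult_single b_def)
  ultimately show ?case by simp
qed

lemma monomial_q_image':
  assumes "m \<ge> 1" "Poly_Mapping.keys a \<subseteq> {1..m}" "\<And>i. 0 \<le> Poly_Mapping.lookup a i"
  shows "Poly_Mapping.single a 1 \<in> q_image m"
proof -
  have "0 \<le> (\<Sum>i = 1..m. Poly_Mapping.lookup a i)" by (intro sum_nonneg assms(3))
  then show ?thesis
    using monomial_q_image[OF assms, of "nat (\<Sum>i = 1..m. Poly_Mapping.lookup a i)"] by simp
qed

lemma q_surj_regular: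
  assumes "m \<ge> 1" "F \<in> regp m" shows "\<exists>G\<in>regp m. q_map m G = F"
proof -
  have "F \<in> polys m" using assms(2) by (simp add: regp_def)
  then have "F \<in> q_image m"
    by (rule polys_sum_monomials)
      (use assms monomial_q_image' q_image_closed[OF assms(1)] in \<open>auto simp: regp_def regc_def\<close>)
  then show ?thesis by (auto simp: q_image_def)
qed

lemma q_surj_polys:
  assumes "m \<ge> 1" "F \<in> polys m" shows "\<exists>G\<in>polys m. q_map m G = F"
  using assms(2)
proof (rule polys_sum_monomials)
  fix a :: mono assume a: "Poly_Mapping.keys a \<subseteq> {1..m}" "\<And>i. 0 \<le> Poly_Mapping.lookup a i"
  from monomial_q_image'[OF assms(1) a]
  obtain G where "Poly_Mapping.single a 1 = q_map m G" "G \<in> regp m"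
    unfolding q_image_def by (rule imageE)
  then have "G \<in> polys m" "q_map m G = Poly_Mapping.single a 1" by (simp_all add: regp_def)
  then show "\<exists>G\<in>polys m. q_map m G = const (Poly_Mapping.lookup F a) * Poly_Mapping.single a 1"
    by (intro bexI[of _ "const (Poly_Mapping.lookup F a) * G"]) (simp_all add: q_scale[OF assms(1)])
next
  show "\<exists>G\<in>polys m. q_map m G = 0" by (intro bexI[of _ 0]) (simp_all add: q_zero[OF assms(1)])
  show "\<exists>G\<in>polys m. q_map m G = F + F'" if "\<exists>G\<in>polys m. q_map m G = F" "\<exists>G\<in>polys m. q_map m G = F'" for F F'
  proof -
    from that obtain G H where "G \<in> polys m" "q_map m G = F" "H \<in> polys m" "q_map m H = F'" by auto
    then show ?thesis by (intro bexI[of _ "G + H"]) (simp_all add: q_add[OF assms(1)])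
  qed
qed

text \<open>Dimension count: the span of f(B) contains the independent set B, so f(B) contains at
  least as many independent vectors as B has elements. Hence f is injective on B with independent
  image, and a vanishing combination has vanishing coefficients.\<close>

lemma (in vector_space) surjective_on_span_imp_kernel_trivial:
  assumes "finite B" "independent B" "B \<subseteq> span (f ` B)" "x \<in> span B" "f x = 0"
    and add: "\<And>x y. f (x + y) = f x + f y" and scale: "\<And>c x. f (c *s x) = c *s f x"
  shows "x = 0"
proof -
  obtain C where C: "C \<subseteq> f ` B" "independent C" "f ` B \<subseteq> span C"
    using maximal_independent_subset by blast
  have finC: "finite C" using C(1) assms(1) finite_surj by blast
  have "span (f ` B) \<subseteq> span C" using C(3) subspace_span by (rule span_minimal)
  then have "card B \<le> card C"
    using independent_span_bound[OF finC assms(2)] assms(3) by auto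
  moreover have "card C \<le> card (f ` B)" "card (f ` B) \<le> card B"
    using C(1) assms(1) by (auto intro: card_mono card_image_le)
  ultimately have card: "card C = card (f ` B)" "card (f ` B) = card B" by simp_all
  have Ceq: "C = f ` B" using card_subset_eq[OF _ C(1) card(1)] assms(1) by simp
  have inj: "inj_on f B" using eq_card_imp_inj_on[OF assms(1) card(2)] .
  obtain u where u: "x = (\<Sum>b\<in>B. u b *s b)" using assms(4) span_finite[OF assms(1)] by auto
  have f0: "f 0 = 0" using add[of 0 0] by simp
  have "f (\<Sum>b\<in>A. u b *s b) = (\<Sum>b\<in>A. u b *s f b)" for A
    by (induction A rule: infinite_finite_induct) (simp_all add: f0 add scale)
  then have "(\<Sum>b\<in>B. u b *s f b) = 0" using assms(5) u by metis
  also have "(\<Sum>b\<in>B. u b *s f b) = (\<Sum>v\<in>C. u (inv_into B f v) *s v)"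
    unfolding Ceq by (subst sum.reindex[OF inj]) (simp add: inj)
  finally have "u (inv_into B f v) = 0" if "v \<in> C" for v
    using independentD[OF C(2) finC order_refl, of "\<lambda>v. u (inv_into B f v)" v] that by simp
  then have "u b = 0" if "b \<in> B" for b using that Ceq inj by (metis imageI inv_into_f_f)
  then show ?thesis by (simp add: u)
qed

interpretation lp_space: vector_space "\<lambda>c (F::lp). const c * F"
  by unfold_locales (simp_all add: const_simps algebra_simps)

lemma finite_exponents: "finite {a :: mono. Poly_Mapping.keys a \<subseteq> {1..m} \<and> (\<forall>i. 0 \<le> Poly_Mapping.lookup a i) \<and> (\<Sum>i = 1..m. Poly_Mapping.lookup a i) = int d}"
proof (rule inj_on_finite)
  let ?A = "{a :: mono. Poly_Mapping.keys a \<subseteq> {1..m} \<and> (\<forall>i. 0 \<le> Poly_Mapping.lookup a i) \<and> (\<Sum>i = 1..m. Poly_Mapping.lookup a i) = int d}"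
  let ?r = "\<lambda>a :: mono. restrict (Poly_Mapping.lookup a) {1..m}"
  show "inj_on ?r ?A"
  proof (rule inj_onI, rule poly_mapping_eqI)
    fix a b k assume ab: "a \<in> ?A" "b \<in> ?A" "?r a = ?r b"
    show "Poly_Mapping.lookup a k = Poly_Mapping.lookup b k"
    proof (cases "k \<in> {1..m}")
      case True
      then show ?thesis using fun_cong[OF ab(3), of k] by simp
    next
      case False
      then have "k \<notin> Poly_Mapping.keys a" "k \<notin> Poly_Mapping.keys b" using ab by auto
      then show ?thesis by (simp add: in_keys_iff)
    qed
  qed
  show "?r ` ?A \<subseteq> {1..m} \<rightarrow>\<^sub>E {0..int d}"
  proof
    fix g assume "g \<in> ?r ` ?A"
    then obtain a where a: "a \<in> ?A" "g = ?r a" by auto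
    have "Poly_Mapping.lookup a i \<le> int d" if "i \<in> {1..m}" for i
      using a(1) member_le_sum[of i "{1..m}" "Poly_Mapping.lookup a"] that by auto
    then show "g \<in> {1..m} \<rightarrow>\<^sub>E {0..int d}" using a by auto
  qed
  show "finite ({1..m} \<rightarrow>\<^sub>E {0..int d})" by (intro finite_PiE) auto
qed

text \<open>The monomials of degree d in m variables span a finite-dimensional space, which q maps
  onto itself because it is surjective and graded.\<close>

lemma q_inj_homogeneous:
  assumes "m \<ge> 1" "F \<in> polys m" "hc m (int d) F = F" "q_map m F = 0" shows "F = 0"
proof -
  define E where "E = {a :: mono. Poly_Mapping.keys a \<subseteq> {1..m} \<and> (\<forall>i. 0 \<le> Poly_Mapping.lookup a i) \<and> (\<Sum>i = 1..m. Poly_Mapping.lookup a i) = int d}"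
  define B where "B = (\<lambda>a. Poly_Mapping.single a 1 :: lp) ` E"
  have finE: "finite E" unfolding E_def by (rule finite_exponents)
  then have finB: "finite B" by (simp add: B_def)
  have inj: "inj_on (\<lambda>a. Poly_Mapping.single a 1 :: lp) E"
    by (auto intro!: inj_onI simp: poly_mapping_eq_iff fun_eq_iff lookup_single when_def) (metis zero_neq_one)
  have span: "G \<in> lp_space.span B" if "G \<in> polys m" "hc m (int d) G = G" for G
    using that(1)
  proof (rule polys_sum_monomials)
    fix a assume a: "a \<in> Poly_Mapping.keys G" "Poly_Mapping.keys a \<subseteq> {1..m}" "\<And>i. 0 \<le> Poly_Mapping.lookup a i"
    have "homogeneous m d G" using that(2) by (simp add: homogeneous_hc)
    then have "a \<in> E" using a by (simp add: E_def homogeneous_def)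
    then show "const (Poly_Mapping.lookup G a) * Poly_Mapping.single a 1 \<in> lp_space.span B"
      by (intro lp_space.span_scale lp_space.span_base) (simp add: B_def)
  qed (auto intro: lp_space.span_zero lp_space.span_add)
  have indep: "lp_space.independent B"
  proof (rule ccontr)
    assume "\<not> lp_space.independent B"
    then obtain u where u: "\<exists>v\<in>B. u v \<noteq> 0" "(\<Sum>v\<in>B. const (u v) * v) = 0"
      using lp_space.dependent_finite[OF finB] by auto
    have "u (Poly_Mapping.single b 1) = 0" if "b \<in> E" for b
    proof -
      have s: "(\<Sum>v\<in>B. const (u v) * v) = (\<Sum>a\<in>E. const (u (Poly_Mapping.single a 1)) * Poly_Mapping.single a 1)"
        unfolding B_def by (subst sum.reindex[OF inj]) simp
      have "(\<Sum>a\<in>E. Poly_Mapping.lookup (const (u (Poly_Mapping.single a 1)) * Poly_Mapping.single a 1) b) = 0"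
        using arg_cong[OF u(2)[unfolded s], of "\<lambda>G. Poly_Mapping.lookup G b"]
        by (simp only: lookup_sum lookup_zero)
      moreover have "(\<Sum>a\<in>E. Poly_Mapping.lookup (const (u (Poly_Mapping.single a 1)) * Poly_Mapping.single a 1) b)
          = (\<Sum>a\<in>E. if a = b then u (Poly_Mapping.single a 1) else 0)"
        by (rule sum.cong) (auto simp: lookup_single when_def)
      ultimately show ?thesis using that finE by simp
    qed
    then show False using u(1) by (auto simp: B_def)
  qed
  have surj: "B \<subseteq> lp_space.span (q_map m ` B)"
  proof
    fix b assume "b \<in> B"
    then obtain a where a: "a \<in> E" "b = Poly_Mapping.single a 1" by (auto simp: B_def)
    then have b: "b \<in> polys m" "hc m (int d) b = b"
      using monomial_polys[of a m] by (auto simp: E_def hc_def lin_single const_simps)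
    obtain G where G: "G \<in> polys m" "q_map m G = b" using q_surj_polys[OF assms(1) b(1)] by auto
    \<comment> \<open>The degree d part of a preimage of a homogeneous element is again a
      preimage.\<close>
    define H where "H = hc m (int d) G"
    have H: "q_map m H = b" using hc_q[OF assms(1) G(1), of "int d"] G(2) b(2) by (simp add: H_def)
    have "hc m (int d) H = H" by (rule poly_mapping_eqI) (simp add: H_def lookup_hc)
    then have "H \<in> lp_space.span B" using span[of H] hc_polys[OF G(1)] by (simp add: H_def)
    then have "q_map m H \<in> q_map m ` lp_space.span B" by simp
    also have "\<dots> \<subseteq> lp_space.span (q_map m ` B)"
    proof
      fix y assume "y \<in> q_map m ` lp_space.span B"
      then obtain u where "y = q_map m (\<Sum>v\<in>B. const (u v) * v)"
        using lp_space.span_finite[OF finB] by auto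
      then have y: "y = (\<Sum>v\<in>B. const (u v) * q_map m v)"
        by (simp add: q_sum[OF assms(1)] q_scale[OF assms(1)])
      show "y \<in> lp_space.span (q_map m ` B)"
        unfolding y by (intro lp_space.span_sum lp_space.span_scale lp_space.span_base) auto
    qed
    finally show "b \<in> lp_space.span (q_map m ` B)" using H by simp
  qed
  show ?thesis
    using lp_space.surjective_on_span_imp_kernel_trivial[OF finB indep surj span[OF assms(2,3)] assms(4)]
      q_add[OF assms(1)] q_scale[OF assms(1)] by blast
qed

lemma q_inj_polys:
  assumes "m \<ge> 1" "F \<in> polys m" "q_map m F = 0" shows "F = 0"
proof (rule polys_eq_zeroI[OF assms(2)])
  fix d
  have "hc m (int d) (hc m (int d) F) = hc m (int d) F" by (rule poly_mapping_eqI) (simp add: lookup_hc)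
  moreover have "q_map m (hc m (int d) F) = 0"
    using hc_q[OF assms(1,2), of "int d"] assms(3) by (simp add: hc_simps)
  ultimately show "hc m (int d) F = 0"
    using q_inj_homogeneous[OF assms(1) hc_polys[OF assms(2)]] by blast
qed

section \<open>Extension of bijectivity to Laurent polynomials\<close>

subsection \<open>Laurent polynomials\<close>

lemma var_nonzero [simp]: "var i \<noteq> 0"
  using vpow_inverse(1)[of i] by (metis mult_zero_left zero_neq_one)

definition var_prod :: "nat \<Rightarrow> lp" where
  "var_prod m = (\<Prod>i = 1..m. var i)"

lemma var_prod_nonzero: "var_prod m \<noteq> 0"
  by (simp add: var_prod_def)

lemma var_prod_polys: "var_prod m ^ N \<in> polys m"
proof (induction N)
  case (Suc N)
  have "var_prod m \<in> polys m" unfolding var_prod_def by (rule polys_prod) auto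
  then show ?case using Suc by simp
qed simp

lemma laurent_clear_denominators:
  assumes "F \<in> laurent m" shows "\<exists>N. var_prod m ^ N * F \<in> polys m"
  using assms
proof (induction F rule: laurent_induct)
  case one
  show ?case by (intro exI[of _ 0]) simp
next
  case (add F G)
  then obtain M N where "var_prod m ^ M * F \<in> polys m" "var_prod m ^ N * G \<in> polys m" by auto
  then have "var_prod m ^ N * (var_prod m ^ M * F) + var_prod m ^ M * (var_prod m ^ N * G) \<in> polys m"
    using var_prod_polys by simp
  then show ?case by (intro exI[of _ "M + N"]) (simp add: power_add algebra_simps)
next
  case (scale c F)
  then obtain N where "var_prod m ^ N * F \<in> polys m" by auto
  then have "const c * (var_prod m ^ N * F) \<in> polys m" by simp
  then show ?case by (intro exI[of _ N]) (simp add: mult.left_commute)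
next
  case (var i F)
  then obtain N where "var_prod m ^ N * F \<in> polys m" by auto
  then have "var i * (var_prod m ^ N * F) \<in> polys m" using var.hyps by simp
  then show ?case by (intro exI[of _ N]) (simp add: mult.left_commute)
next
  case (inv i F)
  then obtain N where N: "var_prod m ^ N * F \<in> polys m" by auto
  have v: "var_prod m = var i * (\<Prod>j\<in>{1..m} - {i}. var j)"
    unfolding var_prod_def using inv.hyps by (subst prod.remove[of _ i]) auto
  have "(\<Prod>j\<in>{1..m} - {i}. var j) \<in> polys m" by (rule polys_prod) auto
  then have "(\<Prod>j\<in>{1..m} - {i}. var j) * (var_prod m ^ N * F) \<in> polys m" using N by simp
  also have "(\<Prod>j\<in>{1..m} - {i}. var j) * (var_prod m ^ N * F) = (var i * vpow i (-1)) * ((\<Prod>j\<in>{1..m} - {i}. var j) * (var_prod m ^ N * F))"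
    by (simp add: vpow_inverse)
  also have "\<dots> = var_prod m ^ Suc N * (vpow i (-1) * F)"
    by (simp only: power_Suc mult_ac v)
  finally show ?case by blast
qed

text \<open>Since q(X_i F) = Y_i q(F), the kernel is stable under multiplication by variables;
  denominators can be cleared within it, which reduces the claim to polynomials.\<close>

lemma q_inj_laurent:
  assumes "m \<ge> 1" "F \<in> laurent m" "q_map m F = 0" shows "F = 0"
proof -
  obtain N where N: "var_prod m ^ N * F \<in> polys m" using laurent_clear_denominators[OF assms(2)] by auto
  have step: "q_map m ((\<Prod>i\<in>A. var i) * G) = 0" if "finite A" "A \<subseteq> {1..m}" "q_map m G = 0" for A G
    using that by (induction A rule: finite_induct) (auto simp: mult.assoc q_var)
  have "q_map m (var_prod m ^ n * F) = 0" for n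
  proof (induction n)
    case (Suc n)
    then show ?case using step[of "{1..m}" "var_prod m ^ n * F"] by (simp add: var_prod_def mult.assoc)
  qed (simp add: assms(3))
  then have "var_prod m ^ N * F = 0" by (intro q_inj_polys[OF assms(1) N])
  then show ?thesis using var_prod_nonzero by simp
qed

lemma PiE_Xpow: "m \<ge> 1 \<Longrightarrow> app (PiE m) (Xpow m k e * F) = Xpow m (k + 1) e * app (PiE m) F"
  by (simp add: PiE_def sub_simps sub_Xpow mult_ac)

lemma PiE_power_Xpow: "m \<ge> 1 \<Longrightarrow> app (PiE m ^ n) (Xpow m k e * F) = Xpow m (k + int n) e * app (PiE m ^ n) F"
  by (induction n) (simp_all add: PiE_Xpow add_ac)

lemma PiE_power_polys: "m \<ge> 1 \<Longrightarrow> F \<in> polys m \<Longrightarrow> app (PiE m ^ n) F \<in> polys m"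
  by (induction n) (simp_all add: PiE_polys)

lemma PiE_power_const: "app (PiE m ^ n) (const c * F) = const c * app (PiE m ^ n) F"
  by (induction n) (simp_all add: PiE_const)

text \<open>Repeated application of Pi moves all variables cyclically and each time contributes a
  factor X_1, by which negative exponents are cancelled one after the other.\<close>

lemma laurent_PiE_power:
  assumes "m \<ge> 1" "F \<in> laurent m" shows "\<exists>n. app (PiE m ^ n) F \<in> polys m"
  using assms(2)
proof (induction F rule: laurent_induct)
  case one
  show ?case by (intro exI[of _ 0]) simp
next
  case (add F G)
  then obtain k n where "app (PiE m ^ k) F \<in> polys m" "app (PiE m ^ n) G \<in> polys m" by auto
  then have "app (PiE m ^ n) (app (PiE m ^ k) F) + app (PiE m ^ k) (app (PiE m ^ n) G) \<in> polys m"
    using PiE_power_polys[OF assms(1)] by simp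
  moreover have "app (PiE m ^ n) (app (PiE m ^ k) F) = app (PiE m ^ (k + n)) F"
    "app (PiE m ^ k) (app (PiE m ^ n) G) = app (PiE m ^ (k + n)) G"
    by (simp_all add: add.commute flip: app_simps(6) power_add)
  ultimately show ?case by (intro exI[of _ "k + n"]) (simp add: app_add)
next
  case (scale c F)
  then obtain n where n: "app (PiE m ^ n) F \<in> polys m" by auto
  show ?case by (rule exI[of _ n]) (simp only: PiE_power_const polys_closed n)
next
  case (var i F)
  then obtain n where "app (PiE m ^ n) F \<in> polys m" by auto
  moreover have v: "var i = Xpow m (int i) 1" using var.hyps by (simp add: Xpow_vpow vpow_1)
  have "app (PiE m ^ n) (var i * F) = Xpow m (int i + int n) 1 * app (PiE m ^ n) F"
    unfolding v by (rule PiE_power_Xpow[OF assms(1)])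
  ultimately show ?case using assms(1) by (intro exI[of _ n]) simp
next
  case (inv i F)
  then obtain n where n: "app (PiE m ^ n) F \<in> polys m" by auto
  have v: "vpow i (-1) = Xpow m (int i) (-1)" using inv.hyps by (simp add: Xpow_vpow)
  \<comment> \<open>After \<open>s\<close> further applications of Pi the index i + n has become a
    multiple of m. One more makes it congruent to 1, and the factor X_1 of Pi then cancels the
    inverse variable up to a power of q.\<close>
  define s where "s = nat (- (int i + int n) mod int m)"
  have "int s = - (int i + int n) mod int m" using assms(1) by (simp add: s_def)
  then have "int m dvd int i + int n + int s"
    by (simp add: dvd_eq_mod_eq_0 mod_simps)
  then obtain l where l: "int i + int n + int s = int m * l" by (auto simp: dvd_def)
  define G where "G = app (PiE m ^ s) (app (PiE m ^ n) F)"
  have G: "G \<in> polys m" unfolding G_def by (rule PiE_power_polys[OF assms(1) n])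
  have "app (PiE m ^ (s + n)) (vpow i (-1) * F) = Xpow m (int m * l) (-1) * G"
    using assms(1) l by (simp add: v power_add PiE_power_Xpow G_def add.assoc)
  then have "app (PiE m ^ Suc (s + n)) (vpow i (-1) * F) = Xpow m (1 + int m * l) (-1) * (Xpow m 1 1 * sub m (\<lambda>k. k + 1) G)"
    using assms(1) by (simp add: PiE_Xpow add.commute) (simp add: PiE_def)
  also have "\<dots> = const (qvar powi l) * sub m (\<lambda>k. k + 1) G"
    using assms(1) by (simp add: Xpow_shift mult.assoc) (simp add: mult.assoc[symmetric] Xpow_inverse)
  finally show ?case using sub_polys[OF assms(1) G] by (intro exI[of _ "Suc (s + n)"]) simp
qed

lemma PiI_q:
  assumes "m \<ge> 1" "F \<in> q_map m ` laurent m" shows "app (PiI m) F \<in> q_map m ` laurent m"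
proof -
  interpret affine_hecke m "Td m" "Tdinv m" "PiE m" "PiI m" by (rule affine_hecke_endo[OF assms(1)])
  have ud: "up 1 m * down 1 m = 1" using up_down[of 1 m] assms by simp
  obtain G where G: "G \<in> laurent m" "F = q_map m G" using assms(2) by auto
  \<comment> \<open>The lift of Pi from \<open>PiE_q\<close> is inverted: \<open>K\<close> removes
    X_1 and the power of t, \<open>H\<close> removes T_1 ... T_{m-1}.\<close>
  define K where "K = vpow 1 (-1) * (const (tvar ^ (m - 1)) * G)"
  define H where "H = app (down 1 m) K"
  have K: "K \<in> laurent m" using G assms(1) by (simp add: K_def)
  then have H: "H \<in> laurent m"
    unfolding H_def down_def by (intro prod_list_closed[where S = "laurent m"]) (auto intro!: Tdinv_laurent)
  have "app (up 1 m) H = K" using arg_cong[OF ud, of "\<lambda>A. app A K"] by (simp add: H_def)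
  then have "app (PiE m) (q_map m H) = q_map m (const (inverse (tvar ^ (m - 1))) * (var 1 * K))"
    using PiE_q[OF assms(1) H] by (simp add: up_def)
  also have "const (inverse (tvar ^ (m - 1))) * (var 1 * K)
      = (const (inverse (tvar ^ (m - 1))) * const (tvar ^ (m - 1))) * ((var 1 * vpow 1 (-1)) * G)"
    unfolding K_def by (simp only: mult_ac)
  also have "\<dots> = G" by (simp add: vpow_inverse const_inverse)
  finally have "app (PiI m * PiE m) (q_map m H) = app (PiI m) F" by (simp add: G(2))
  then have "q_map m H = app (PiI m) F" unfolding Pi_inverse(2) by simp
  then show ?thesis using H by (metis imageI)
qed

text \<open>Some Pi^n F is a polynomial and hence in the image, and the image is stable under
  Pi^{-1} by \<open>PiI_q\<close>.\<close>

lemma q_surj_laurent: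
  assumes "m \<ge> 1" "F \<in> laurent m" shows "F \<in> q_map m ` laurent m"
proof -
  obtain n where n: "app (PiE m ^ n) F \<in> polys m" using laurent_PiE_power[OF assms] by auto
  then obtain G where "G \<in> polys m" "q_map m G = app (PiE m ^ n) F" using q_surj_polys[OF assms(1)] by auto
  then have "app (PiE m ^ n) F \<in> q_map m ` laurent m" using polys_laurent by (metis imageI)
  then show ?thesis
  proof (induction n)
    case (Suc n)
    have "app (PiI m) (app (PiE m ^ Suc n) F) = app (PiE m ^ n) F"
      using arg_cong[OF Pi_inverse(2)[of m], of "\<lambda>A. app A (app (PiE m ^ n) F)"] by simp
    then show ?case using PiI_q[OF assms(1) Suc.prems] Suc.IH by simp
  qed simp
qed

lemma inj_on_q_laurent:
  assumes "m \<ge> 1" shows "inj_on (q_map m) (laurent m)"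
proof (rule inj_onI)
  fix F G assume "F \<in> laurent m" "G \<in> laurent m" "q_map m F = q_map m G"
  then show "F = G" using q_inj_laurent[OF assms, of "F - G"] by (simp add: q_diff[OF assms])
qed

lemma q_laurent_iso:
  assumes "m \<ge> 1" shows "linear_iso scale (laurent m) (laurent m) (q_map m)"
  unfolding linear_iso_def bij_betw_def scale_def
  using q_add[OF assms] q_scale[OF assms] inj_on_q_laurent[OF assms] q_surj_laurent[OF assms] q_laurent[OF assms]
  by auto


section \<open>Symmetric polynomials as eigenvectors of the T_i\<close>

section \<open>Symmetric polynomials\<close>

lemma lookup_zq_0: "m \<ge> 2 \<Longrightarrow> Poly_Mapping.lookup (zq m i) 0 = 0"
proof -
  assume m: "m \<ge> 2"
  define p r where "p = nat ((i - 1) mod int m + 1)" and "r = nat (i mod int m + 1)"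
  have "\<not> int m dvd i - (i - 1)" using m by auto
  then have "i mod int m \<noteq> (i - 1) mod int m"
    unfolding mod_eq_dvd_iff .
  then have "p \<noteq> r" using m by (auto simp: p_def r_def nat_eq_iff)
  have "\<exists>c. zq m i = Poly_Mapping.single (Poly_Mapping.single p 1 + Poly_Mapping.single r (-1)) c"
    by (auto simp: zq_def Xpow_def mult_single p_def r_def)
  moreover have "Poly_Mapping.single p 1 + Poly_Mapping.single r (-1) \<noteq> (0::mono)"
  proof
    assume "Poly_Mapping.single p 1 + Poly_Mapping.single r (-1) = (0::mono)"
    from arg_cong[OF this, of "\<lambda>a. Poly_Mapping.lookup a p"] \<open>p \<noteq> r\<close> show False
      by (simp add: lookup_add lookup_single)
  qed
  ultimately show ?thesis by (auto simp: lookup_single when_def)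
qed

text \<open>By \<open>DL_mult\<close>, T_i F = t F amounts to (1 - t z)(F - s_i F) = 0, and 1 - t z
  is nonzero because its constant coefficient is 1.\<close>

lemma Td_invariant_iff:
  assumes "1 \<le> i" "i < m"
  shows "app (Td m i) F = tc * F \<longleftrightarrow> sub m (arefl m (int i)) F = F"
proof
  have m: "m \<ge> 2" using assms by simp
  note eq = DL_mult[OF m, of "int i" F, folded Td_def]
  show "app (Td m i) F = tc * F" if "sub m (arefl m (int i)) F = F"
    unfolding Td_def by (rule DL_eqI[OF m]) (simp add: that algebra_simps)
  assume "app (Td m i) F = tc * F"
  then have "(1 - tc * zq m (int i)) * F = (1 - tc * zq m (int i)) * sub m (arefl m (int i)) F"
    using eq by (simp add: algebra_simps)
  moreover have "1 - tc * zq m (int i) \<noteq> 0"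
  proof
    assume "1 - tc * zq m (int i) = 0"
    from arg_cong[OF this, of "\<lambda>G. Poly_Mapping.lookup G 0"] show False
      using lookup_zq_0[OF m] by (simp add: lookup_minus)
  qed
  ultimately show "sub m (arefl m (int i)) F = F" by simp
qed

definition psub :: "nat \<Rightarrow> (nat \<Rightarrow> nat) \<Rightarrow> lp \<Rightarrow> lp" where
  "psub m \<sigma> = sub m (\<lambda>k. int (\<sigma> (nat k)))"

lemma psub_comp:
  assumes "\<And>i. i \<in> {1..m} \<Longrightarrow> \<tau> i \<in> {1..m}"
  shows "psub m \<sigma> (psub m \<tau> F) = psub m (\<sigma> \<circ> \<tau>) F"
proof -
  have v: "psub m \<sigma> (psub m \<tau> (vpow i e)) = psub m (\<sigma> \<circ> \<tau>) (vpow i e)" for i e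
  proof (cases "i \<in> {1..m}")
    case True
    then show ?thesis using assms[OF True]
      by (simp add: psub_def sub_vpow xp_def Xpow_vpow)
  next
    case False
    then show ?thesis by (auto simp: psub_def sub_vpow xp_def)
  qed
  show ?thesis
    by (induction F rule: lpoly_var_induct) (use v in \<open>simp_all add: psub_def sub_simps flip: vpow_1\<close>)
qed

lemma psub_transpose:
  assumes "1 \<le> i" "i < m" shows "psub m (Transposition.transpose i (i + 1)) = sub m (arefl m (int i))"
proof
  fix F
  have "arefl m (int i) (int j) = int (Transposition.transpose i (i + 1) j)" if "1 \<le> j" "j \<le> m" for j
  proof -
    have "int m dvd int j - int i \<longleftrightarrow> j = i" "int m dvd int j - int i - 1 \<longleftrightarrow> j = i + 1"
      using that assms small_dvd[of "int j - int i" m] small_dvd[of "int j - int i - 1" m] by auto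
    then show ?thesis by (auto simp: arefl_def transpose_def)
  qed
  then show "psub m (Transposition.transpose i (i + 1)) F = sub m (arefl m (int i)) F"
    unfolding psub_def by (intro sub_cong) simp
qed

lemma transpose_maps: "a \<in> S \<Longrightarrow> b \<in> S \<Longrightarrow> i \<in> S \<Longrightarrow> Transposition.transpose a b i \<in> S"
  by (auto simp: transpose_def)

lemma psub_invariant:
  assumes "\<And>i. 1 \<le> i \<Longrightarrow> i < m \<Longrightarrow> sub m (arefl m (int i)) F = F" "\<sigma> permutes {1..m}"
  shows "psub m \<sigma> F = F"
proof -
  have tr: "psub m (Transposition.transpose a b) F = F" if "1 \<le> a" "a < b" "b \<le> m" for a b
  proof -
    have "Suc a \<le> b" using that by simp
    then show ?thesis using that(3)
    proof (induction b rule: dec_induct)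
      case base
      then show ?case using psub_transpose[of a m] assms(1)[of a] that by simp
    next
      case (step b)
      let ?s = "Transposition.transpose b (b + 1)" and ?t = "Transposition.transpose a b"
      have s: "psub m ?s F = F" using psub_transpose[of b m] assms(1)[of b] step that by simp
      have t: "psub m ?t F = F" using step by simp
      \<comment> \<open>A transposition is conjugated from adjacent ones, so invariance under the
        s_i spreads to all transpositions.\<close>
      have "Transposition.transpose a (Suc b) = ?s \<circ> (?t \<circ> ?s)"
        using step that by (auto simp: fun_eq_iff transpose_def)
      moreover have "(?t \<circ> ?s) i \<in> {1..m}" if "i \<in> {1..m}" for i
        unfolding o_apply using step \<open>1 \<le> a\<close> that by (intro transpose_maps) auto
      then have "psub m ?s (psub m (?t \<circ> ?s) F) = psub m (?s \<circ> (?t \<circ> ?s)) F"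
        by (rule psub_comp)
      moreover have "psub m ?t (psub m ?s F) = psub m (?t \<circ> ?s) F"
        using step that by (intro psub_comp transpose_maps) auto
      ultimately show ?case using s t by metis
    qed
  qed
  have pid: "psub m id F = F"
    by (simp add: psub_def) (subst sub_cong[where g = "\<lambda>k. k"], auto)
  have tr': "psub m (Transposition.transpose a b) F = F" if "a \<in> {1..m}" "b \<in> {1..m}" for a b
  proof (cases a b rule: linorder_cases)
    case greater
    then show ?thesis using tr[of b a] that by (simp add: transpose_commute)
  qed (use tr[of a b] that pid in simp_all)
  have "psub m \<sigma> F = F"
    using finite_atLeastAtMost assms(2)
  proof (induction rule: permutes_rev_induct)
    case id
    show ?case by (rule pid)
  next
    case (swap a b p)
    have "psub m p (psub m (Transposition.transpose a b) F) = psub m (p \<circ> Transposition.transpose a b) F"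
      using swap by (intro psub_comp transpose_maps) auto
    then show ?case using swap.IH tr'[OF swap.hyps(1,2)] by metis
  qed
  then show ?thesis .
qed

lemma subst_psub: "F \<in> laurent m \<Longrightarrow> subst m (\<lambda>i. int (\<sigma> i)) F = psub m \<sigma> F"
  unfolding psub_def by (rule subst_eq_sub) simp_all

text \<open>Adjacent transpositions generate the symmetric group, and invariance under each is an
  eigenvector equation. In this form symmetry can be carried through q.\<close>

lemma sym_polys_iff:
  "F \<in> sym_polys m \<longleftrightarrow> F \<in> polys m \<and> (\<forall>i. 1 \<le> i \<and> i < m \<longrightarrow> app (Td m i) F = tc * F)"
proof
  assume F: "F \<in> sym_polys m"
  then have P: "F \<in> polys m" by (simp add: sym_polys_def)
  have "sub m (arefl m (int i)) F = F" if "1 \<le> i" "i < m" for i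
  proof -
    have "Transposition.transpose i (i + 1) permutes {1..m}" using that by (intro permutes_swap_id) auto
    then have "subst m (\<lambda>j. int (Transposition.transpose i (i + 1) j)) F = F"
      using F unfolding sym_polys_def by blast
    then show ?thesis using subst_psub[OF polys_laurent[OF P]] psub_transpose[OF that] by simp
  qed
  then show "F \<in> polys m \<and> (\<forall>i. 1 \<le> i \<and> i < m \<longrightarrow> app (Td m i) F = tc * F)"
    using P Td_invariant_iff by blast
next
  assume F: "F \<in> polys m \<and> (\<forall>i. 1 \<le> i \<and> i < m \<longrightarrow> app (Td m i) F = tc * F)"
  then have "sub m (arefl m (int i)) F = F" if "1 \<le> i" "i < m" for i
    using that Td_invariant_iff by blast
  then have "psub m \<sigma> F = F" if "\<sigma> permutes {1..m}" for \<sigma> using psub_invariant that by blast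
  then show "F \<in> sym_polys m"
    using F subst_psub[OF polys_laurent] by (simp add: sym_polys_def)
qed

lemma sym_polys_polys: "F \<in> sym_polys m \<Longrightarrow> F \<in> polys m"
  by (simp add: sym_polys_iff)

lemma sym_polys_psub: "F \<in> sym_polys m \<Longrightarrow> \<sigma> permutes {1..m} \<Longrightarrow> psub m \<sigma> F = F"
proof -
  assume F: "F \<in> sym_polys m" and "\<sigma> permutes {1..m}"
  then have "subst m (\<lambda>i. int (\<sigma> i)) F = F" unfolding sym_polys_def by blast
  then show "psub m \<sigma> F = F"
    unfolding subst_psub[OF polys_laurent[OF sym_polys_polys[OF F]]] .
qed

lemma sym_polys_mult: "F \<in> sym_polys m \<Longrightarrow> G \<in> sym_polys m \<Longrightarrow> F * G \<in> sym_polys m"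
proof -
  assume F: "F \<in> sym_polys m" and G: "G \<in> sym_polys m"
  have "sub m (arefl m (int i)) (F * G) = F * G" if "1 \<le> i" "i < m" for i
  proof -
    have "sub m (arefl m (int i)) F = F" "sub m (arefl m (int i)) G = G"
      using F G that unfolding Td_invariant_iff[OF that, symmetric] by (auto simp: sym_polys_iff)
    then show ?thesis by (simp add: sub_simps)
  qed
  then show ?thesis using F G Td_invariant_iff by (auto simp: sym_polys_iff)
qed

lemma sym_polys_add: "F \<in> sym_polys m \<Longrightarrow> G \<in> sym_polys m \<Longrightarrow> F + G \<in> sym_polys m"
  by (simp add: sym_polys_iff app_add distrib_left)

lemma sym_polys_zero: "0 \<in> sym_polys m"
  by (simp add: sym_polys_iff)

lemma sym_polys_hc: "F \<in> sym_polys m \<Longrightarrow> hc m d F \<in> sym_polys m"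
  using hc_simps(3)[of m d tvar F] by (auto simp: sym_polys_iff hc_polys hc_Td[symmetric])

text \<open>Symmetry is the eigenvector equation for the $T_i$, which \<open>q_map\<close> intertwines.\<close>

lemma q_sym_iff:
  assumes "m \<ge> 1" "F \<in> polys m" shows "q_map m F \<in> sym_polys m \<longleftrightarrow> F \<in> sym_polys m"
proof -
  have "app (Td m i) (q_map m F) = tc * q_map m F \<longleftrightarrow> app (Td m i) F = tc * F" if "1 \<le> i" "i < m" for i
  proof -
    have L: "F \<in> laurent m" using assms(2) by (rule polys_laurent)
    have "app (Td m i) (q_map m F) = tc * q_map m F \<longleftrightarrow> q_map m (app (Td m i) F) = q_map m (tc * F)"
      by (simp add: q_Td[OF that L] q_scale[OF assms(1)])
    also have "\<dots> \<longleftrightarrow> app (Td m i) F = tc * F"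
      using L that by (intro inj_on_eq_iff[OF inj_on_q_laurent[OF assms(1)]]) (auto intro: Td_laurent)
    finally show ?thesis .
  qed
  then show ?thesis using assms q_polys by (auto simp: sym_polys_iff)
qed

section \<open>Graded inverse limits and the isomorphism q in infinitely many variables\<close>

section \<open>Graded inverse limits\<close>

lemma degree_bound_iff:
  assumes "F \<in> polys m"
  shows "(\<forall>a\<in>Poly_Mapping.keys F. (\<Sum>i = 1..m. Poly_Mapping.lookup a i) \<le> int D) \<longleftrightarrow> F = (\<Sum>d\<le>D. hc m (int d) F)"
proof -
  have l: "Poly_Mapping.lookup (\<Sum>d\<le>D. hc m (int d) F) a
      = (if (\<Sum>i = 1..m. Poly_Mapping.lookup a i) \<le> int D then Poly_Mapping.lookup F a else 0)" for a
  proof (cases "a \<in> Poly_Mapping.keys F")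
    case False
    then have 0: "Poly_Mapping.lookup F a = 0" by (simp add: in_keys_iff)
    show ?thesis by (simp add: lookup_sum lookup_hc 0 cong: if_cong)
  next
    case True
    then have "0 \<le> (\<Sum>i = 1..m. Poly_Mapping.lookup a i)"
      using assms by (auto simp: polys_def intro!: sum_nonneg)
    then obtain e where e: "(\<Sum>i = 1..m. Poly_Mapping.lookup a i) = int e"
      by (metis nonneg_int_cases)
    show ?thesis by (simp add: lookup_sum lookup_hc e[simplified])
  qed
  show ?thesis
  proof
    assume "\<forall>a\<in>Poly_Mapping.keys F. (\<Sum>i = 1..m. Poly_Mapping.lookup a i) \<le> int D"
    then show "F = (\<Sum>d\<le>D. hc m (int d) F)"
      by (intro poly_mapping_eqI) (auto simp: l in_keys_iff)
  next
    assume eq: "F = (\<Sum>d\<le>D. hc m (int d) F)"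
    show "\<forall>a\<in>Poly_Mapping.keys F. (\<Sum>i = 1..m. Poly_Mapping.lookup a i) \<le> int D"
      using l arg_cong[OF eq, of "\<lambda>G. Poly_Mapping.lookup G"] by (auto simp: in_keys_iff split: if_splits) metis
  qed
qed

text \<open>A degree bound uniform in m, which is the finiteness contained in the direct sum over
  degrees. Stated as equality with a sum of components, it is linear and transfers through
  q.\<close>

definition bounded_family :: "nat \<Rightarrow> Qqt family \<Rightarrow> bool" where
  "bounded_family D F \<longleftrightarrow> (\<forall>m\<ge>1. F m = (\<Sum>d\<le>D. hc m (int d) (F m)))"

lemma bounded_family_iff:
  assumes "\<And>m. m \<ge> 1 \<Longrightarrow> F m \<in> polys m"
  shows "bounded_family D F \<longleftrightarrow> (\<forall>m\<ge>1. \<forall>a\<in>Poly_Mapping.keys (F m). (\<Sum>i = 1..m. Poly_Mapping.lookup a i) \<le> int D)"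
  unfolding bounded_family_def using degree_bound_iff[OF assms] by blast

lemma sum_family_apply: "sum f A m = (\<Sum>x\<in>A. f x m)" for f :: "'b \<Rightarrow> 'a \<Rightarrow> 'c::comm_monoid_add"
  by (induction A rule: infinite_finite_induct) auto

lemma hc_hc: "hc m d (hc m e F) = (if d = e then hc m d F else 0)"
  by (rule poly_mapping_eqI) (auto simp: lookup_hc)

lemma trunc_hc: "1 \<le> k \<Longrightarrow> k \<le> m \<Longrightarrow> trunc k (hc m d F) = hc k d (trunc k F)"
proof (rule poly_mapping_eqI)
  fix a :: mono assume "1 \<le> k" "k \<le> m"
  then have "(\<Sum>i = 1..m. Poly_Mapping.lookup a i) = (\<Sum>i = 1..k. Poly_Mapping.lookup a i)"
    if "Poly_Mapping.keys a \<subseteq> {1..k}"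
    using that by (intro sum.mono_neutral_right) (auto simp: in_keys_iff subset_iff)
  then show "Poly_Mapping.lookup (trunc k (hc m d F)) a = Poly_Mapping.lookup (hc k d (trunc k F)) a"
    by (simp add: lookup_trunc lookup_hc)
qed

text \<open>Replaces the decomposition into homogeneous families by conditions at each level: when
  \<open>R\<close> is closed under components, the components of \<open>F\<close> themselves form
  such a decomposition.\<close>

lemma graded_limit_iff:
  assumes R: "\<And>m. R m \<subseteq> polys m" "\<And>m. 0 \<in> R m" "\<And>m F G. F \<in> R m \<Longrightarrow> G \<in> R m \<Longrightarrow> F + G \<in> R m"
    "\<And>m d F. F \<in> R m \<Longrightarrow> hc m d F \<in> R m"
  shows "F \<in> graded_limit R \<longleftrightarrow> F 0 = 0 \<and> (\<forall>m\<ge>1. F m \<in> R m) \<and>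
    (\<forall>m k. 0 < k \<and> k < m \<longrightarrow> trunc k (F m) = F k) \<and> (\<exists>D. bounded_family D F)"
proof
  assume "F \<in> graded_limit R"
  then obtain D f where f: "\<And>d. d \<le> D \<Longrightarrow> f d \<in> inv_limit R d" "F = (\<Sum>d\<le>D. f d)"
    by (auto simp: graded_limit_def)
  have Fm: "F m = (\<Sum>d\<le>D. f d m)" for m by (simp add: f(2) sum_family_apply)
  have sumR: "(\<Sum>d\<in>A. f d m) \<in> R m" if "finite A" "A \<subseteq> {..D}" "m \<ge> 1" for A m
    using that by (induction A rule: finite_induct) (use R f in \<open>auto simp: inv_limit_def\<close>)
  have "trunc k (F m) = F k" if "0 < k" "k < m" for m k
    unfolding Fm trunc_simps using f(1) that by (intro sum.cong) (auto simp: inv_limit_def)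
  moreover have "bounded_family D F"
    unfolding bounded_family_def
  proof (intro allI impI)
    fix m :: nat assume m: "m \<ge> 1"
    have "hc m (int e) (f d m) = (if d = e then f d m else 0)" if "d \<le> D" for d e
    proof -
      have "hc m (int d) (f d m) = f d m" using f(1)[OF that] m by (simp add: inv_limit_def homogeneous_hc)
      then show ?thesis using hc_hc[of m "int e" "int d" "f d m"] by (auto simp: hc_simps)
    qed
    then have "hc m (int e) (F m) = (\<Sum>d\<le>D. if d = e then f d m else 0)" for e
      unfolding Fm hc_simps by (intro sum.cong) auto
    then show "F m = (\<Sum>d\<le>D. hc m (int d) (F m))"
      by (simp add: Fm)
  qed
  ultimately show "F 0 = 0 \<and> (\<forall>m\<ge>1. F m \<in> R m) \<and>
    (\<forall>m k. 0 < k \<and> k < m \<longrightarrow> trunc k (F m) = F k) \<and> (\<exists>D. bounded_family D F)"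
    using Fm sumR f(1) by (auto simp: inv_limit_def)
next
  assume F: "F 0 = 0 \<and> (\<forall>m\<ge>1. F m \<in> R m) \<and>
    (\<forall>m k. 0 < k \<and> k < m \<longrightarrow> trunc k (F m) = F k) \<and> (\<exists>D. bounded_family D F)"
  then obtain D where D: "bounded_family D F" by auto
  define f where "f d m = (if m = 0 then 0 else hc m (int d) (F m))" for d m
  have "f d \<in> inv_limit R d" for d
    using F R(4) by (auto simp: inv_limit_def f_def homogeneous_hc_self trunc_hc)
  moreover have "F = (\<Sum>d\<le>D. f d)"
  proof
    fix m
    show "F m = (\<Sum>d\<le>D. f d) m"
      using D F by (cases "m = 0") (auto simp: sum_family_apply f_def bounded_family_def)
  qed
  ultimately show "F \<in> graded_limit R" by (auto simp: graded_limit_def)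
qed

lemma polys_inf_iff:
  "F \<in> polys_inf \<longleftrightarrow> F 0 = 0 \<and> (\<forall>m\<ge>1. F m \<in> polys m) \<and>
    (\<forall>m k. 0 < k \<and> k < m \<longrightarrow> trunc k (F m) = F k) \<and> (\<exists>D. bounded_family D F)"
  unfolding polys_inf_def by (rule graded_limit_iff) (simp_all add: hc_polys)

lemma Lambda_iff: "F \<in> Lambda_qt \<longleftrightarrow> F \<in> polys_inf \<and> (\<forall>m\<ge>1. F m \<in> sym_polys m)"
proof -
  have "F \<in> Lambda_qt \<longleftrightarrow> F 0 = 0 \<and> (\<forall>m\<ge>1. F m \<in> sym_polys m) \<and>
    (\<forall>m k. 0 < k \<and> k < m \<longrightarrow> trunc k (F m) = F k) \<and> (\<exists>D. bounded_family D F)"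
    unfolding Lambda_qt_def
    by (rule graded_limit_iff) (auto simp: sym_polys_polys sym_polys_zero sym_polys_add sym_polys_hc)
  then show ?thesis unfolding polys_inf_iff using sym_polys_polys by blast
qed

lemma polys_inf_add: "F \<in> polys_inf \<Longrightarrow> G \<in> polys_inf \<Longrightarrow> F + G \<in> polys_inf"
proof -
  assume F: "F \<in> polys_inf" and G: "G \<in> polys_inf"
  then obtain D E where "bounded_family D F" "bounded_family E G" by (auto simp: polys_inf_iff)
  moreover have "bounded_family (max D E) H" if "bounded_family D H \<or> bounded_family E H" "H \<in> polys_inf" for H
  proof -
    have iff: "bounded_family n H \<longleftrightarrow> (\<forall>m\<ge>1. \<forall>a\<in>Poly_Mapping.keys (H m). (\<Sum>i = 1..m. Poly_Mapping.lookup a i) \<le> int n)" for n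
      by (rule bounded_family_iff) (use that(2) in \<open>simp add: polys_inf_iff\<close>)
    have "int D \<le> int (max D E)" "int E \<le> int (max D E)" by simp_all
    then show ?thesis using that(1) unfolding iff by (meson order_trans)
  qed
  ultimately have "bounded_family (max D E) F" "bounded_family (max D E) G" using F G by auto
  then have "bounded_family (max D E) (F + G)"
    unfolding bounded_family_def by (simp add: hc_simps sum.distrib)
  then show ?thesis using F G by (auto simp: polys_inf_iff trunc_simps)
qed

lemma polys_inf_scale: "F \<in> polys_inf \<Longrightarrow> scale_family c F \<in> polys_inf"
  by (auto simp: polys_inf_iff trunc_simps scale_family_def scale_def bounded_family_def hc_simps sum_distrib_left[symmetric])

lemma polys_inf_mult:
  assumes "F \<in> polys_inf" "G \<in> polys_inf" shows "F * G \<in> polys_inf"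
proof -
  obtain D E where D: "bounded_family D F" and E: "bounded_family E G" using assms by (auto simp: polys_inf_iff)
  have "bounded_family (D + E) (F * G)"
    unfolding bounded_family_def
  proof (intro allI impI)
    fix m :: nat assume m: "m \<ge> 1"
    have P: "F m \<in> polys m" "G m \<in> polys m" "(F * G) m \<in> polys m" using assms m by (simp_all add: polys_inf_iff)
    have "(\<Sum>i = 1..m. Poly_Mapping.lookup a i) \<le> int (D + E)" if "a \<in> Poly_Mapping.keys ((F * G) m)" for a
    proof -
      obtain b c where "a = b + c" "b \<in> Poly_Mapping.keys (F m)" "c \<in> Poly_Mapping.keys (G m)"
        using \<open>a \<in> Poly_Mapping.keys ((F * G) m)\<close> keys_mult[of "F m" "G m"] by auto
      moreover have "\<forall>a\<in>Poly_Mapping.keys (F m). (\<Sum>i = 1..m. Poly_Mapping.lookup a i) \<le> int D"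
        unfolding degree_bound_iff[OF P(1)] using D m by (simp only: bounded_family_def)
      moreover have "\<forall>a\<in>Poly_Mapping.keys (G m). (\<Sum>i = 1..m. Poly_Mapping.lookup a i) \<le> int E"
        unfolding degree_bound_iff[OF P(2)] using E m by (simp only: bounded_family_def)
      ultimately show ?thesis by (auto simp: lookup_add sum.distrib intro: add_mono)
    qed
    then show "(F * G) m = (\<Sum>d\<le>D + E. hc m (int d) ((F * G) m))"
      unfolding degree_bound_iff[OF P(3), symmetric] by blast
  qed
  moreover have "trunc k ((F * G) m) = (F * G) k" if "0 < k" "k < m" for k m
    using that assms trunc_mult[of "F m" m "G m" k] by (simp add: polys_inf_iff)
  ultimately show ?thesis using assms by (auto simp: polys_inf_iff)
qed

lemma Lambda_mult: "F \<in> Lambda_qt \<Longrightarrow> G \<in> Lambda_qt \<Longrightarrow> F * G \<in> Lambda_qt"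
  by (simp add: Lambda_iff polys_inf_mult sym_polys_mult)

lemma q_inf_apply: "q_inf F m = (if m = 0 then 0 else q_map m (F m))"
  by (simp add: q_inf_def mk_family_def)

lemma q_inf_closed: "F \<in> polys_inf \<Longrightarrow> q_inf F \<in> polys_inf"
proof -
  assume F: "F \<in> polys_inf"
  then obtain D where D: "bounded_family D F" by (auto simp: polys_inf_iff)
  have "q_map m (F m) = (\<Sum>d\<le>D. hc m (int d) (q_map m (F m)))" if "m \<ge> 1" for m
  proof -
    have P: "F m \<in> polys m" using F that by (simp add: polys_inf_iff)
    have "q_map m (F m) = q_map m (\<Sum>d\<le>D. hc m (int d) (F m))"
      using D that unfolding bounded_family_def by (intro arg_cong[of _ _ "q_map m"]) blast
    also have "\<dots> = (\<Sum>d\<le>D. hc m (int d) (q_map m (F m)))"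
      by (simp add: q_sum[OF that] hc_q[OF that P])
    finally show ?thesis .
  qed
  then have "bounded_family D (q_inf F)" by (simp add: bounded_family_def q_inf_apply)
  moreover have "trunc k (q_inf F m) = q_inf F k" if "0 < k" "k < m" for k m
    using that F trunc_q[of k m "F m"] by (simp add: q_inf_apply polys_inf_iff)
  ultimately show ?thesis using F by (auto simp: polys_inf_iff q_inf_apply q_polys)
qed

lemma q_map_inj: "m \<ge> 1 \<Longrightarrow> F \<in> polys m \<Longrightarrow> G \<in> polys m \<Longrightarrow> q_map m F = q_map m G \<Longrightarrow> F = G"
  using inj_on_q_laurent[of m] polys_laurent by (auto dest: inj_onD)

lemma q_inf_inj: "inj_on q_inf polys_inf"
proof (rule inj_onI, rule ext)
  fix F G m assume FG: "F \<in> polys_inf" "G \<in> polys_inf" "q_inf F = q_inf G"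
  show "F m = G m"
  proof (cases "m = 0")
    case False
    then have m: "m \<ge> 1" by simp
    show ?thesis
    proof (rule q_map_inj[OF m])
      show "F m \<in> polys m" "G m \<in> polys m" using FG(1,2) m by (simp_all add: polys_inf_iff)
      show "q_map m (F m) = q_map m (G m)" using fun_cong[OF FG(3), of m] m by (simp add: q_inf_apply)
    qed
  qed (use FG in \<open>simp add: polys_inf_iff\<close>)
qed

text \<open>Preimages are chosen at each level separately. Their compatibility under truncation and
  their degree bound follow from injectivity of q at each level.\<close>

lemma q_inf_surj:
  assumes "F \<in> polys_inf" shows "\<exists>G\<in>polys_inf. q_inf G = F"
proof -
  have "\<forall>m. \<exists>g. m \<ge> 1 \<longrightarrow> g \<in> polys m \<and> q_map m g = F m"
    using assms q_surj_polys by (meson polys_inf_iff)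
  then obtain g where g: "\<And>m. m \<ge> 1 \<Longrightarrow> g m \<in> polys m" "\<And>m. m \<ge> 1 \<Longrightarrow> q_map m (g m) = F m" by metis
  obtain D where D: "bounded_family D F" using assms by (auto simp: polys_inf_iff)
  define G where "G = mk_family g"
  have G: "G 0 = 0" "\<And>m. m \<ge> 1 \<Longrightarrow> G m = g m" by (simp_all add: G_def mk_family_def)
  have "trunc k (g m) = g k" if k: "0 < k" "k < m" for k m
  proof (rule q_map_inj[of k])
    have "q_map k (trunc k (g m)) = trunc k (F m)"
      using k g[of m] trunc_q[of k m "g m"] by simp
    then show "q_map k (trunc k (g m)) = q_map k (g k)"
      using k g(2)[of k] assms by (simp add: polys_inf_iff)
  qed (use k g[of m] g[of k] in \<open>auto intro: trunc_polys\<close>)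
  moreover have "bounded_family D G"
    unfolding bounded_family_def
  proof (intro allI impI)
    fix m :: nat assume m: "m \<ge> 1"
    have "q_map m (\<Sum>d\<le>D. hc m (int d) (g m)) = (\<Sum>d\<le>D. hc m (int d) (F m))"
      using g[OF m] by (simp add: q_sum[OF m] hc_q[OF m, symmetric])
    also have "\<dots> = q_map m (g m)" using D m g(2)[OF m] by (simp add: bounded_family_def)
    finally have e: "q_map m (\<Sum>d\<le>D. hc m (int d) (g m)) = q_map m (g m)" .
    have "(\<Sum>d\<le>D. hc m (int d) (g m)) \<in> polys m"
      by (intro polys_sum hc_polys g(1)[OF m])
    from q_map_inj[OF m g(1)[OF m] this e[symmetric]]
    show "G m = (\<Sum>d\<le>D. hc m (int d) (G m))" unfolding G(2)[OF m] .
  qed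
  ultimately have "G \<in> polys_inf" using G g(1) by (auto simp: polys_inf_iff)
  moreover have "q_inf G = F"
  proof
    fix m show "q_inf G m = F m"
      using G g assms by (cases "m = 0") (simp_all add: q_inf_apply polys_inf_iff)
  qed
  ultimately show ?thesis by blast
qed

lemma q_inf_add: "q_inf (F + G) = q_inf F + q_inf G"
  by (rule ext) (simp add: q_inf_apply q_add)

lemma q_inf_scale: "q_inf (scale_family c F) = scale_family c (q_inf F)"
  by (rule ext) (simp add: q_inf_apply q_scale scale_family_def scale_def)

lemma q_inf_iso: "linear_iso scale_family polys_inf polys_inf q_inf"
  unfolding linear_iso_def bij_betw_def
  using q_inf_add q_inf_scale q_inf_inj q_inf_closed q_inf_surj by blast

lemma q_inf_Lambda: "F \<in> polys_inf \<Longrightarrow> q_inf F \<in> Lambda_qt \<longleftrightarrow> F \<in> Lambda_qt"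
  using q_inf_closed by (auto simp: Lambda_iff q_inf_apply q_sym_iff polys_inf_iff)

section \<open>The transported multiplication\<close>

subsection \<open>The product\<close>

text \<open>Eliminates \<open>inv_into\<close>; associativity and stability of symmetric functions
  are then read off from the ordinary product.\<close>

lemma star_q_inf: "f \<in> polys_inf \<Longrightarrow> g \<in> polys_inf \<Longrightarrow> q_inf f \<star> q_inf g = q_inf (f * g)"
  by (simp add: star_def inv_into_f_f[OF q_inf_inj])

lemma star_closed: "F \<in> polys_inf \<Longrightarrow> G \<in> polys_inf \<Longrightarrow> F \<star> G \<in> polys_inf"
  using q_inf_surj[of F] q_inf_surj[of G] by (auto simp: star_q_inf q_inf_closed polys_inf_mult)

lemma family_mult_commute: "F * G = G * (F :: 'k::comm_ring_1 family)"
  by (rule ext) (simp add: mult.commute)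

lemma star_commute: "F \<in> polys_inf \<Longrightarrow> G \<in> polys_inf \<Longrightarrow> F \<star> G = G \<star> F"
  by (simp add: star_def family_mult_commute)

lemma star_assoc:
  assumes "F \<in> polys_inf" "G \<in> polys_inf" "H \<in> polys_inf"
  shows "(F \<star> G) \<star> H = F \<star> (G \<star> H)"
proof -
  obtain f g h where "f \<in> polys_inf" "F = q_inf f" "g \<in> polys_inf" "G = q_inf g" "h \<in> polys_inf" "H = q_inf h"
    using assms q_inf_surj by metis
  then show ?thesis by (simp add: star_q_inf polys_inf_mult mult.assoc)
qed

lemma star_Lambda:
  assumes "F \<in> Lambda_qt" "G \<in> Lambda_qt" shows "F \<star> G \<in> Lambda_qt"
proof -
  have "F \<in> polys_inf" "G \<in> polys_inf" using assms by (simp_all add: Lambda_iff)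
  then obtain f g where fg: "f \<in> polys_inf" "F = q_inf f" "g \<in> polys_inf" "G = q_inf g"
    using q_inf_surj by metis
  then have "f \<in> Lambda_qt" "g \<in> Lambda_qt" using assms q_inf_Lambda by auto
  then have "f * g \<in> Lambda_qt" by (rule Lambda_mult)
  then show ?thesis using fg by (simp add: star_q_inf q_inf_Lambda polys_inf_mult)
qed

section \<open>Specialisation at q = 1 and congruence modulo q - 1\<close>

section \<open>Specialisation at $q = 1$\<close>

lemma at_q1_Fract:
  assumes "poly g 1 \<noteq> 0" shows "at_q1 (Fract f g) = poly f 1 / poly g 1"
  unfolding at_q1_def
proof (rule the_equality)
  show "\<exists>f' g'. poly g' 1 \<noteq> 0 \<and> Fract f g = Fract f' g' \<and> poly f 1 / poly g 1 = poly f' 1 / poly g' 1"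
    using assms by blast
next
  fix c assume "\<exists>f' g'. poly g' 1 \<noteq> 0 \<and> Fract f g = Fract f' g' \<and> c = poly f' 1 / poly g' 1"
  then obtain f' g' where *: "poly g' 1 \<noteq> 0" "Fract f g = Fract f' g'" "c = poly f' 1 / poly g' 1" by blast
  have "g \<noteq> 0" "g' \<noteq> 0" using assms *(1) by auto
  then have "f * g' = f' * g" using *(2) by (simp add: eq_fract)
  then have "poly f 1 * poly g' 1 = poly f' 1 * poly g 1" by (metis poly_mult)
  then show "c = poly f 1 / poly g 1" unfolding *(3) using assms *(1) by (simp add: frac_eq_eq)
qed

lemma
  assumes "regular_at_q1 x" "regular_at_q1 y"
  shows at_q1_add: "at_q1 (x + y) = at_q1 x + at_q1 y"
    and at_q1_mult: "at_q1 (x * y) = at_q1 x * at_q1 y"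
proof -
  obtain f g f' g' where *: "poly g 1 \<noteq> 0" "x = Fract f g" "poly g' 1 \<noteq> 0" "y = Fract f' g'"
    using assms by (auto simp: regular_at_q1_def)
  then have nz: "g \<noteq> 0" "g' \<noteq> 0" "poly (g * g') 1 \<noteq> 0" by auto
  have "x + y = Fract (f * g' + f' * g) (g * g')" "x * y = Fract (f * f') (g * g')"
    using * nz by (simp_all add: add_fract)
  then have "at_q1 (x + y) = poly (f * g' + f' * g) 1 / poly (g * g') 1" "at_q1 (x * y) = poly (f * f') 1 / poly (g * g') 1"
    using at_q1_Fract[OF nz(3)] by simp_all
  then show "at_q1 (x + y) = at_q1 x + at_q1 y" "at_q1 (x * y) = at_q1 x * at_q1 y"
    using * by (simp_all add: at_q1_Fract field_simps)
qed

lemma at_q1_simps [simp]: "at_q1 0 = 0" "at_q1 1 = 1" "at_q1 qvar = 1"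
proof -
  show "at_q1 0 = 0" using at_q1_Fract[of 1 0] by (simp add: Zero_fract_def[symmetric])
  show "at_q1 1 = 1" using at_q1_Fract[of 1 1] by (simp add: One_fract_def[symmetric])
  show "at_q1 qvar = 1" using at_q1_Fract[of 1 "[:0, 1:]"] by (simp add: qvar_def)
qed

lemma at_q1_diff:
  assumes "regular_at_q1 x" "regular_at_q1 y" shows "at_q1 (x - y) = at_q1 x - at_q1 y"
  using at_q1_add[OF regular_diff[OF assms] assms(2)] by simp

definition spec :: "lp \<Rightarrow> Qt lpoly" where
  "spec F = Poly_Mapping.map at_q1 F"

lemma lookup_spec: "Poly_Mapping.lookup (spec F) a = at_q1 (Poly_Mapping.lookup F a)"
  by (simp add: spec_def Poly_Mapping.map.rep_eq when_def)

lemma spec_add: "regc F \<Longrightarrow> regc G \<Longrightarrow> spec (F + G) = spec F + spec G"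
  by (rule poly_mapping_eqI) (simp add: lookup_spec lookup_add at_q1_add regc_def)

lemma spec_sum: "(\<And>x. x \<in> A \<Longrightarrow> regc (f x)) \<Longrightarrow> spec (sum f A) = (\<Sum>x\<in>A. spec (f x))"
proof (induction A rule: infinite_finite_induct)
  case (insert x A)
  then show ?case by (simp add: spec_add regc_sum)
qed (rule poly_mapping_eqI, simp add: lookup_spec)+

lemma spec_mono: "spec (const c * (Poly_Mapping.single a 1 * F)) = const (at_q1 c) * (Poly_Mapping.single a 1 * spec F)"
  if "regular_at_q1 c" "regc F"
  using that by (intro poly_mapping_eqI) (simp add: lookup_spec lookup_mono_mult at_q1_mult regc_def)

lemma spec_mult:
  assumes "regc F" "regc G" shows "spec (F * G) = spec F * spec G"
proof -
  let ?K = "Poly_Mapping.keys F"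
  have rF: "regular_at_q1 (Poly_Mapping.lookup F a)" for a using assms(1) by (simp add: regc_def)
  have eq: "F * H = (\<Sum>a\<in>?K. const (Poly_Mapping.lookup F a) * (Poly_Mapping.single a 1 * H))" for H
    by (subst lpoly_expansion[of ?K F]) (simp_all add: sum_distrib_right mult.assoc)
  have *: "spec (F * H) = (\<Sum>a\<in>?K. const (at_q1 (Poly_Mapping.lookup F a)) * (Poly_Mapping.single a 1 * spec H))" if "regc H" for H
  proof -
    have "spec (F * H) = (\<Sum>a\<in>?K. spec (const (Poly_Mapping.lookup F a) * (Poly_Mapping.single a 1 * H)))"
      unfolding eq using that rF by (intro spec_sum regc_scale regc_mono)
    then show ?thesis using that rF by (simp add: spec_mono)
  qed
  have one: "spec 1 = 1" by (rule poly_mapping_eqI) (simp add: lookup_spec lookup_one when_def)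
  have "spec F = (\<Sum>a\<in>?K. const (at_q1 (Poly_Mapping.lookup F a)) * Poly_Mapping.single a 1)"
    using *[of 1] one by simp
  then show ?thesis
    using *[OF assms(2)] by (simp add: sum_distrib_right mult.assoc)
qed

text \<open>Congruence modulo q - 1 over the local ring at q = 1. Linear operators that preserve
  \<open>regp\<close> respect it (\<open>cong_q1_app\<close>), and it yields equality after
  specialisation (\<open>cong_q1_spec\<close>).\<close>

definition cong_q1 :: "nat \<Rightarrow> lp \<Rightarrow> lp \<Rightarrow> bool" where
  "cong_q1 m F G \<longleftrightarrow> (\<exists>H\<in>regp m. F - G = const (qvar - 1) * H)"

lemma cong_q1_spec:
  assumes "cong_q1 m F G" "regc F" "regc G" shows "spec F = spec G"
proof (rule poly_mapping_eqI)
  fix a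
  obtain H where H: "H \<in> regp m" "F - G = const (qvar - 1) * H" using assms(1) by (auto simp: cong_q1_def)
  have r: "regular_at_q1 (Poly_Mapping.lookup F a)" "regular_at_q1 (Poly_Mapping.lookup G a)"
    "regular_at_q1 (Poly_Mapping.lookup H a)" "regular_at_q1 (qvar - 1)"
    using assms H(1) by (simp_all add: regc_def regp_def regular_diff)
  have "Poly_Mapping.lookup F a - Poly_Mapping.lookup G a = (qvar - 1) * Poly_Mapping.lookup H a"
    using arg_cong[OF H(2), of "\<lambda>K. Poly_Mapping.lookup K a"] by (simp add: lookup_minus)
  from arg_cong[OF this, of at_q1]
  have "at_q1 (Poly_Mapping.lookup F a) - at_q1 (Poly_Mapping.lookup G a) = 0"
    using r by (simp add: at_q1_diff at_q1_mult)
  then show "Poly_Mapping.lookup (spec F) a = Poly_Mapping.lookup (spec G) a"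
    by (simp add: lookup_spec)
qed

lemma cong_q1_refl: "cong_q1 m F F"
  unfolding cong_q1_def by (intro bexI[of _ 0]) (simp_all add: regp_closed)

lemma cong_q1_trans: "cong_q1 m F G \<Longrightarrow> cong_q1 m G K \<Longrightarrow> cong_q1 m F K"
proof -
  assume "cong_q1 m F G" "cong_q1 m G K"
  then obtain H H' where "H \<in> regp m" "F - G = const (qvar - 1) * H" "H' \<in> regp m" "G - K = const (qvar - 1) * H'"
    by (auto simp: cong_q1_def)
  moreover have "F - K = (F - G) + (G - K)" by simp
  ultimately show ?thesis
    unfolding cong_q1_def by (intro bexI[of _ "H + H'"]) (simp_all add: distrib_left regp_closed)
qed

lemma cong_q1_app:
  assumes "cong_q1 m F G" "\<And>H. H \<in> regp m \<Longrightarrow> app A H \<in> regp m" "\<And>c H. app A (const c * H) = const c * app A H"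
  shows "cong_q1 m (app A F) (app A G)"
proof -
  obtain H where "H \<in> regp m" "F - G = const (qvar - 1) * H" using assms(1) by (auto simp: cong_q1_def)
  then show ?thesis
    unfolding cong_q1_def using assms(2,3) by (intro bexI[of _ "app A H"]) (simp_all flip: app_diff)
qed

lemma regp_mult: "F \<in> regp m \<Longrightarrow> G \<in> regp m \<Longrightarrow> F * G \<in> regp m"
  by (simp add: regp_def regc_mult)

lemma cong_q1_mult: "cong_q1 m F G \<Longrightarrow> K \<in> regp m \<Longrightarrow> cong_q1 m (F * K) (G * K)"
  unfolding cong_q1_def by (auto simp: mult.assoc regp_mult simp flip: left_diff_distrib)

lemma cong_q1_add: "cong_q1 m F G \<Longrightarrow> cong_q1 m F' G' \<Longrightarrow> cong_q1 m (F + F') (G + G')"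
proof -
  assume "cong_q1 m F G" "cong_q1 m F' G'"
  then obtain H H' where "H \<in> regp m" "F - G = const (qvar - 1) * H" "H' \<in> regp m" "F' - G' = const (qvar - 1) * H'"
    by (auto simp: cong_q1_def)
  moreover have "(F + F') - (G + G') = (F - G) + (F' - G')" by simp
  ultimately show ?thesis
    unfolding cong_q1_def by (intro bexI[of _ "H + H'"]) (simp_all add: distrib_left regp_closed)
qed

lemma cong_q1_scale: "regular_at_q1 c \<Longrightarrow> cong_q1 m F G \<Longrightarrow> cong_q1 m (const c * F) (const c * G)"
  unfolding cong_q1_def
proof -
  assume c: "regular_at_q1 c" and "\<exists>H\<in>regp m. F - G = const (qvar - 1) * H"
  then obtain H where "H \<in> regp m" "F - G = const (qvar - 1) * H" by auto
  then show "\<exists>H\<in>regp m. const c * F - const c * G = const (qvar - 1) * H"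
    using c by (intro bexI[of _ "const c * H"]) (simp_all add: mult.left_commute regp_closed flip: right_diff_distrib)
qed

text \<open>The cyclic permutation to which the shift X_i -> X_{i+1} specialises at q = 1, where
  X_{m+1} = X_1.\<close>

definition rot :: "nat \<Rightarrow> nat \<Rightarrow> nat" where
  "rot m i = (if i \<in> {1..m} then (if i = m then 1 else i + 1) else i)"

lemma rot_permutes: "rot m permutes {1..m}"
proof (rule bij_imp_permutes)
  show "bij_betw (rot m) {1..m} {1..m}"
    by (rule bij_betwI[where g = "\<lambda>j. if j = 1 then m else j - 1"]) (auto simp: rot_def)
qed (auto simp: rot_def)

lemma psub_simps:
  "psub m \<sigma> (F + G) = psub m \<sigma> F + psub m \<sigma> G" "psub m \<sigma> (const c * F) = const c * psub m \<sigma> F"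
  "psub m \<sigma> (F * G) = psub m \<sigma> F * psub m \<sigma> G" "psub m \<sigma> 1 = 1" "psub m \<sigma> (const c) = const c" "psub m \<sigma> (sum f A) = (\<Sum>x\<in>A. psub m \<sigma> (f x))"
proof -
  show add: "psub m \<sigma> (F + G) = psub m \<sigma> F + psub m \<sigma> G" for F G by (simp add: psub_def sub_simps)
  show "psub m \<sigma> (sum f A) = (\<Sum>x\<in>A. psub m \<sigma> (f x))"
    by (induction A rule: infinite_finite_induct) (simp_all add: add, simp_all add: psub_def sub_simps)
qed (simp_all add: psub_def sub_simps)

lemma psub_var: "1 \<le> i \<Longrightarrow> i \<le> m \<Longrightarrow> 1 \<le> \<sigma> i \<Longrightarrow> \<sigma> i \<le> m \<Longrightarrow> psub m \<sigma> (var i) = var (\<sigma> i)"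
  by (simp add: psub_def sub_var xp_def Xpow_vpow vpow_1)

text \<open>The two substitutions differ on X_m only, which becomes q^{-1} X_1 in one and X_1 in the
  other; the difference is (q - 1) times -q^{-1} X_1, with a regular coefficient.\<close>

lemma shift_cong_rot:
  assumes "m \<ge> 1" "F \<in> regp m" shows "cong_q1 m (sub m (\<lambda>k. k + 1) F) (psub m (rot m) F)"
  using assms(2)
proof (induction F rule: regp_induct)
  case one
  show ?case by (simp add: sub_simps psub_simps cong_q1_refl)
next
  case (add F G)
  then show ?case by (simp add: sub_simps psub_simps cong_q1_add)
next
  case (scale c F)
  then show ?case by (simp add: sub_simps psub_simps cong_q1_scale)
next
  case (var i F)
  have rF: "psub m (rot m) F \<in> regp m" "sub m (\<lambda>k. k + 1) F \<in> regp m"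
    using var.hyps assms(1) by (simp_all add: psub_def sub_regp)
  have "cong_q1 m (sub m (\<lambda>k. k + 1) (var i)) (psub m (rot m) (var i))"
  proof (cases "i = m")
    case True
    have s: "sub m (\<lambda>k. k + 1) (var i) = const (inverse qvar) * var 1"
      using True assms(1) by (simp add: sub_var xp_def Xpow_wrap)
    have p: "psub m (rot m) (var i) = var 1"
      using True assms(1) by (subst psub_var) (auto simp: rot_def)
    have "const (inverse qvar) * var 1 - var 1 = const (qvar - 1) * (const (- inverse qvar) * var 1)"
    proof -
      have "(qvar - 1) * (- inverse qvar) = inverse qvar - 1"
        by (simp add: left_diff_distrib)
      then have "const (qvar - 1) * const (- inverse qvar) = const (inverse qvar) - (1 :: lp)"
        by (simp only: const_simps(1)[symmetric]) (simp only: const_simps)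
      then show ?thesis
        by (simp only: mult.assoc[symmetric] left_diff_distrib mult_1_left)
    qed
    moreover have "const (- inverse qvar) * var 1 \<in> regp m"
      using assms(1) regp_closed(6)[of 1 m 1] by (intro regp_closed(5)) (auto simp: regular_minus regp_closed)
    ultimately show ?thesis unfolding cong_q1_def s p by blast
  next
    case False
    then have "sub m (\<lambda>k. k + 1) (var i) = psub m (rot m) (var i)"
      using var.hyps by (simp add: sub_var xp_def Xpow_next psub_var rot_def)
    then show ?thesis by (simp add: cong_q1_refl)
  qed
  then have "cong_q1 m (sub m (\<lambda>k. k + 1) (var i) * sub m (\<lambda>k. k + 1) F) (psub m (rot m) (var i) * sub m (\<lambda>k. k + 1) F)"
    using rF by (intro cong_q1_mult)
  moreover have "psub m (rot m) (var i) \<in> regp m"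
    using sub_regp[OF assms(1), of "var i"] var.hyps regp_closed(6)[of i m 1] by (simp add: psub_def regp_closed)
  then have "cong_q1 m (sub m (\<lambda>k. k + 1) F * psub m (rot m) (var i)) (psub m (rot m) F * psub m (rot m) (var i))"
    using var.IH by (intro cong_q1_mult)
  ultimately show ?case
    by (simp add: sub_simps psub_simps mult.commute cong_q1_trans)
qed

lemma YE_regp:
  assumes "1 \<le> i" "i \<le> m" "F \<in> regp m" shows "app (YE m i) F \<in> regp m"
  using assms
proof (rule YE_closed)
  have m: "m \<ge> 1" using assms by simp
  show "app (PiE m) F \<in> regp m" if "F \<in> regp m" for F
    using that m by (simp add: PiE_def Xpow_regp sub_regp)
  show "app (Tdinv m j) F \<in> regp m" if "1 \<le> j" "j < m" "F \<in> regp m" for j F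
  proof -
    have "app (Tdinv m j) F = const (inverse tvar) * (app (Td m j) F + const (1 - tvar) * F)"
      using that by (simp add: Tdinv_app const_simps)
    then show ?thesis using that by (auto intro!: regp_closed Td_regp simp: regular_diff)
  qed
qed (auto intro: Td_regp regp_closed)

text \<open>At $q = 1$ multiplication by a symmetric polynomial commutes with $\Pi$, and it always commutes
  with the $T_i$; hence it commutes with the $Y_i$.\<close>

lemma YE_sym_mult:
  assumes "1 \<le> i" "i \<le> m" "\<Phi> \<in> regp m" "\<Phi> \<in> sym_polys m" "F \<in> regp m"
  shows "cong_q1 m (app (YE m i) (\<Phi> * F)) (\<Phi> * app (YE m i) F)"
proof -
  have m: "m \<ge> 1" using assms by simp
  have Tinv: "app (Td m j) (\<Phi> * G) = \<Phi> * app (Td m j) G" if "1 \<le> j" "j < m" for j G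
  proof -
    have "sub m (arefl m (int j)) \<Phi> = \<Phi>"
      using assms(4) that by (simp add: sym_polys_iff Td_invariant_iff[symmetric])
    then show ?thesis unfolding Td_def using that by (intro DL_invariant_mult) auto
  qed
  then have Tiinv: "app (Tdinv m j) (\<Phi> * G) = \<Phi> * app (Tdinv m j) G" if "1 \<le> j" "j < m" for j G
    using that by (simp add: Tdinv_app algebra_simps)
  have list: "app (prod_list (map E xs)) (\<Phi> * G) = \<Phi> * app (prod_list (map E xs)) G"
    if "\<And>x G. x \<in> set xs \<Longrightarrow> app (E x) (\<Phi> * G) = \<Phi> * app (E x) G" for E :: "nat \<Rightarrow> lp endo" and xs G
    using that by (induction xs) auto
  let ?A = "prod_list (map (Td m) (rev [1..<i]))"
  define G where "G = app (prod_list (map (Tdinv m) (rev [i..<m]))) F"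
  have G: "G \<in> regp m" unfolding G_def
  proof (rule prod_list_closed[OF _ assms(5)])
    fix j H assume j: "j \<in> set (rev [i..<m])" and H: "H \<in> regp m"
    then have "1 \<le> j" "j < m" using assms by auto
    then have "app (Tdinv m j) H = const (inverse tvar) * (app (Td m j) H + const (1 - tvar) * H)"
      by (simp add: Tdinv_app const_simps)
    then show "app (Tdinv m j) H \<in> regp m" using \<open>1 \<le> j\<close> \<open>j < m\<close> H by (auto intro!: regp_closed Td_regp simp: regular_diff)
  qed
  have P: "app (PiE m) G \<in> regp m" using G m by (simp add: PiE_def Xpow_regp sub_regp)
  have B: "app (prod_list (map (Tdinv m) (rev [i..<m]))) (\<Phi> * F) = \<Phi> * G"
    unfolding G_def by (rule list) (use assms Tiinv in auto)
  have "cong_q1 m (sub m (\<lambda>k. k + 1) \<Phi>) \<Phi>"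
    using shift_cong_rot[OF m assms(3)] sym_polys_psub[OF assms(4) rot_permutes] by simp
  then have "cong_q1 m (sub m (\<lambda>k. k + 1) \<Phi> * app (PiE m) G) (\<Phi> * app (PiE m) G)"
    using P by (rule cong_q1_mult)
  also have "sub m (\<lambda>k. k + 1) \<Phi> * app (PiE m) G = app (PiE m) (\<Phi> * G)"
    by (simp add: PiE_def sub_simps mult_ac)
  finally have "cong_q1 m (app ?A (app (PiE m) (\<Phi> * G))) (app ?A (\<Phi> * app (PiE m) G))"
  proof (rule cong_q1_app)
    show "app ?A H \<in> regp m" if "H \<in> regp m" for H
      using that assms by (intro prod_list_closed[where S = "regp m"]) (auto intro: Td_regp)
    show "app ?A (const c * H) = const c * app ?A H" for c H
    proof -
      have "app (prod_list (map (Td m) xs)) (const c * H) = const c * app (prod_list (map (Td m) xs)) H" if "set xs \<subseteq> {1..<m}" for xs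
        using that by (induction xs) (auto simp: Td_app)
      then show ?thesis using assms by auto
    qed
  qed
  also have "app ?A (\<Phi> * app (PiE m) G) = \<Phi> * app ?A (app (PiE m) G)"
    by (rule list) (use assms Tinv in auto)
  finally have "cong_q1 m (const (tvar ^ (m - i)) * app ?A (app (PiE m) (\<Phi> * G))) (const (tvar ^ (m - i)) * (\<Phi> * app ?A (app (PiE m) G)))"
    by (intro cong_q1_scale regular_power) auto
  then show ?thesis
    unfolding YE_expand[OF assms(1,2)] B by (simp add: G_def mult.left_commute)
qed

lemma q_regp: "m \<ge> 1 \<Longrightarrow> F \<in> regp m \<Longrightarrow> q_map m F \<in> regp m"
proof -
  assume m: "m \<ge> 1" and F: "F \<in> regp m"
  show ?thesis
    using F by (induction F rule: regp_induct) (use q_linear[OF m] q_one[OF m] in \<open>auto simp: q_var YE_regp regp_closed\<close>)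
qed

text \<open>Each variable of g comes out of q as some Y_i, which modulo q - 1 commutes with
  multiplication by the symmetric polynomial q(f).\<close>

lemma q_mult_cong:
  assumes "m \<ge> 1" "f \<in> regp m" "f \<in> sym_polys m" "g \<in> regp m"
  shows "cong_q1 m (q_map m (g * f)) (q_map m f * q_map m g)"
  using assms(4)
proof (induction g rule: regp_induct)
  case one
  show ?case using assms(1) by (simp add: q_one cong_q1_refl)
next
  case (add F G)
  then show ?case by (simp add: distrib_right distrib_left q_add[OF assms(1)] cong_q1_add)
next
  case (scale c F)
  then show ?case by (simp add: mult.assoc mult.left_commute[of _ "const c"] q_scale[OF assms(1)] cong_q1_scale)
next
  case (var i F)
  have s: "q_map m f \<in> regp m" "q_map m f \<in> sym_polys m" "q_map m F \<in> regp m"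
    using assms var.hyps by (simp_all add: q_regp q_sym_iff sym_polys_polys)
  have "cong_q1 m (app (YE m i) (q_map m (F * f))) (app (YE m i) (q_map m f * q_map m F))"
    using var.IH by (rule cong_q1_app) (use var.hyps YE_regp YE_app_const in auto)
  also have "cong_q1 m \<dots> (q_map m f * app (YE m i) (q_map m F))"
    using var.hyps(1,2) s by (intro YE_sym_mult)
  finally (cong_q1_trans) show ?case using var.hyps by (simp add: mult.assoc q_var)
qed

lemma star_at_q1:
  assumes F: "F \<in> Lambda_qt" "regular_family F" and G: "G \<in> polys_inf" "regular_family G"
  shows "regular_family (F \<star> G) \<and> family_at_q1 (F \<star> G) = family_at_q1 F * family_at_q1 G"
proof -
  have FP: "F \<in> polys_inf" using F(1) by (simp add: Lambda_iff)
  obtain f g where f: "f \<in> polys_inf" "F = q_inf f" and g: "g \<in> polys_inf" "G = q_inf g"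
    using q_inf_surj[OF FP] q_inf_surj[OF G(1)] by auto
  have fL: "f \<in> Lambda_qt" using F(1) f q_inf_Lambda by simp
  \<comment> \<open>A regular image has a regular preimage by \<open>q_surj_regular\<close>, and
    injectivity identifies it with the given one.\<close>
  have reg: "h m \<in> regp m" if h: "h \<in> polys_inf" "regular_family (q_inf h)" "m \<ge> 1" for h m
  proof -
    have "h m \<in> polys m" using h(1,3) by (simp add: polys_inf_iff)
    moreover have "regc (q_map m (h m))"
      using h(2,3) unfolding regc_def regular_family_def q_inf_apply by (metis not_one_le_zero)
    ultimately have P: "h m \<in> polys m" "q_map m (h m) \<in> regp m"
      using h(3) by (simp_all add: regp_def q_polys)
    then obtain k where "k \<in> regp m" "q_map m k = q_map m (h m)" using q_surj_regular[OF h(3)] by metis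
    then have "h m = k" using q_map_inj[OF h(3) P(1), of k] by (simp add: regp_def)
    then show ?thesis using \<open>k \<in> regp m\<close> by simp
  qed
  have S: "F \<star> G = q_inf (f * g)" using f g by (simp add: star_q_inf)
  have main: "regc ((F \<star> G) m) \<and> spec ((F \<star> G) m) = spec (F m) * spec (G m)" for m
  proof (cases "m = 0")
    case True
    have "spec 0 = 0" by (rule poly_mapping_eqI) (simp add: lookup_spec)
    then show ?thesis using True FP by (simp add: S q_inf_apply polys_inf_iff)
  next
    case False
    then have m: "m \<ge> 1" by simp
    have r: "f m \<in> regp m" "g m \<in> regp m" "f m \<in> sym_polys m"
      using reg f g F G fL m by (auto simp: Lambda_iff)
    have "(F \<star> G) m = q_map m (g m * f m)"
      unfolding S using m by (simp add: q_inf_apply mult.commute)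
    moreover have "F m = q_map m (f m)" "G m = q_map m (g m)"
      using m f(2) g(2) by (simp_all add: q_inf_apply)
    ultimately have e: "(F \<star> G) m = q_map m (g m * f m)" "F m = q_map m (f m)" "G m = q_map m (g m)" .
    have rc: "regc (F m)" "regc (G m)" "regc ((F \<star> G) m)"
      unfolding e using q_regp[OF m] r regp_mult by (auto simp: regp_def)
    have "cong_q1 m ((F \<star> G) m) (F m * G m)"
      unfolding e by (rule q_mult_cong[OF m r(1,3,2)])
    then have "spec ((F \<star> G) m) = spec (F m * G m)"
      using rc by (intro cong_q1_spec) (auto intro: regc_mult)
    then show ?thesis using rc by (simp add: spec_mult)
  qed
  have "family_at_q1 H = (\<lambda>m. spec (H m))" for H by (simp add: family_at_q1_def spec_def)
  then show ?thesis using main by (auto simp: regular_family_def regc_def fun_eq_iff)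
qed

section \<open>Colouring a unit interval graph vertex by vertex\<close>

section \<open>Chromatic quasisymmetric functions\<close>

text \<open>The list \<open>ks\<close> holds the in-degrees of the vertices still to be coloured, and \<open>cs\<close> the colours
  of the earlier vertices, the most recent one first; in a unit interval graph a vertex of in-degree
  \<open>k\<close> is joined to exactly the last \<open>k\<close> earlier vertices. Edges whose colours are related by \<open>r\<close> get
  the weight $t$.\<close>

fun chr :: "(nat \<Rightarrow> nat \<Rightarrow> bool) \<Rightarrow> nat \<Rightarrow> nat list \<Rightarrow> nat list \<Rightarrow> lp" where
  "chr r m [] cs = 1"
| "chr r m (k # ks) cs = (\<Sum>x\<in>{1..m} - set (take k cs).
      const (tvar ^ length (filter (\<lambda>y. r y x) (take k cs))) * (var x * chr r m ks (x # cs)))"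

text \<open>The form that monotonicity of the function defining the graph takes for the list of
  in-degrees.\<close>

fun slow :: "nat list \<Rightarrow> bool" where
  "slow (k # l # ks) \<longleftrightarrow> l \<le> k + 1 \<and> slow (l # ks)"
| "slow _ \<longleftrightarrow> True"

text \<open>The colours forbidden to the next vertex. They are the whole state of the colouring
  process, by \<open>chr_cong\<close>.\<close>

definition window :: "nat list \<Rightarrow> nat list \<Rightarrow> nat list" where
  "window ks cs = (case ks of [] \<Rightarrow> [] | k # _ \<Rightarrow> take k cs)"

lemma window_simps [simp]: "window [] cs = []" "window (k # ks) cs = take k cs"
  by (simp_all add: window_def)

lemma slow_tl: "slow (k # ks) \<Longrightarrow> slow ks"
  by (cases ks) auto

lemma window_prefix:
  assumes "slow (k # ks)" shows "\<exists>j. window ks (x # cs) = take j (x # take k cs)"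
proof (cases ks)
  case Nil
  then show ?thesis by (intro exI[of _ 0]) simp
next
  case (Cons l ks')
  then have l: "l \<le> k + 1" using assms by simp
  have "take l (x # cs) = take l (x # take k cs)"
    using l by (cases l) (simp_all add: min_def)
  then show ?thesis using Cons by (intro exI[of _ l]) simp
qed

lemma window_cong:
  assumes "slow (k # ks)" "take k cs = take k cs'" shows "window ks (x # cs) = window ks (x # cs')"
proof (cases ks)
  case (Cons l ks')
  then have l: "l \<le> k + 1" using assms(1) by simp
  have "take l (x # ds) = take l (x # take k ds)" for ds
    using l by (cases l) (simp_all add: min_def)
  then show ?thesis using Cons assms(2) by (metis window_simps(2))
qed simp

text \<open>A colour that has left the window never returns, because from one vertex to the next the
  window grows at most by the colour just used.\<close>

lemma chr_cong: "slow ks \<Longrightarrow> window ks cs = window ks cs' \<Longrightarrow> chr r m ks cs = chr r m ks cs'"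
proof (induction ks arbitrary: cs cs')
  case (Cons k ks)
  have "chr r m ks (x # cs) = chr r m ks (x # cs')" for x
    using Cons.prems by (intro Cons.IH slow_tl[OF Cons.prems(1)] window_cong[OF Cons.prems(1)]) simp
  then show ?case using Cons.prems(2) by simp
qed simp

lemma chr_polys: "chr r m ks cs \<in> polys m"
  by (induction ks arbitrary: cs) (auto intro!: polys_sum polys_closed)

lemma trunc_chr:
  assumes "k \<le> m" shows "trunc k (chr r m ks cs) = chr r k ks cs"
proof (induction ks arbitrary: cs)
  case (Cons l ks)
  let ?c = "\<lambda>x. const (tvar ^ length (filter (\<lambda>y. r y x) (take l cs)))"
  have "trunc k (chr r m (l # ks) cs) = (\<Sum>x\<in>{1..m} - set (take l cs). if x \<le> k then ?c x * (var x * chr r k ks (x # cs)) else 0)"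
    unfolding chr.simps trunc_simps
    by (rule sum.cong) (auto simp: trunc_var[OF chr_polys] Cons)
  also have "\<dots> = (\<Sum>x\<in>({1..m} - set (take l cs)) \<inter> {x. x \<le> k}. ?c x * (var x * chr r k ks (x # cs)))"
    by (subst sum.inter_restrict) auto
  also have "({1..m} - set (take l cs)) \<inter> {x. x \<le> k} = {1..k} - set (take l cs)"
    using assms by auto
  finally show ?case by simp
qed (simp add: trunc_simps)

lemma hc_chr: "hc m d (chr r m ks cs) = (if d = int (length ks) then chr r m ks cs else 0)"
proof (induction ks arbitrary: d cs)
  case (Cons k ks)
  have "hc m d (chr r m (k # ks) cs) = (\<Sum>x\<in>{1..m} - set (take k cs).
      const (tvar ^ length (filter (\<lambda>y. r y x) (take k cs))) *
        (var x * (if d = int (length (k # ks)) then chr r m ks (x # cs) else 0)))"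
    unfolding chr.simps hc_simps by (rule sum.cong) (auto simp: hc_var Cons)
  then show ?case by simp
qed (simp add: hc_one)

section \<open>T_a acts on colouring polynomials by exchanging colours\<close>

subsection \<open>The action of the finite Hecke algebra\<close>

definition swap :: "nat \<Rightarrow> nat \<Rightarrow> nat" where
  "swap a = Transposition.transpose a (a + 1)"

lemma swap_simps: "swap a a = a + 1" "swap a (a + 1) = a" "x \<noteq> a \<Longrightarrow> x \<noteq> a + 1 \<Longrightarrow> swap a x = x" "swap a (swap a x) = x"
  by (simp_all add: swap_def)

text \<open>The condition on a window under which T_a acts merely by exchanging the colours a and a
  + 1. Prefixes inherit it, and it holds whenever a + 1 is the most recent colour.\<close>

definition before :: "nat \<Rightarrow> nat list \<Rightarrow> bool" where
  "before a w \<longleftrightarrow> (a \<in> set w \<longrightarrow> a + 1 \<in> set (takeWhile (\<lambda>y. y \<noteq> a) w))"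

lemma before_take: "before a w \<Longrightarrow> before a (take j w)"
proof -
  assume b: "before a w"
  show ?thesis
    unfolding before_def
  proof
    assume a: "a \<in> set (take j w)"
    then have "a + 1 \<in> set (takeWhile (\<lambda>y. y \<noteq> a) w)"
      using b set_take_subset[of j w] by (auto simp: before_def)
    also have "takeWhile (\<lambda>y. y \<noteq> a) w = takeWhile (\<lambda>y. y \<noteq> a) (take j w)"
      using a takeWhile_append1[of a "take j w" "\<lambda>y. y \<noteq> a" "drop j w"] by simp
    finally show "a + 1 \<in> set (takeWhile (\<lambda>y. y \<noteq> a) (take j w))" .
  qed
qed

lemma before_Cons: "x \<noteq> a \<Longrightarrow> before a w \<Longrightarrow> before a (x # w)" "before a ((a + 1) # w)"
  by (auto simp: before_def)

lemma const_nonzero: "c \<noteq> 0 \<Longrightarrow> const c \<noteq> (0 :: lp)"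
  using const_inverse(1)[of c] by (metis mult_zero_left zero_neq_one)

text \<open>Recolouring by an adjacent transposition, under the action of $T_a$.\<close>

lemma Td_YE_swap:
  assumes "1 \<le> a" "a < m" "app (Td m a) f = tc * g"
  shows "app (Td m a) (app (YE m a) g) = app (YE m (a + 1)) f"
proof -
  have "tc * app (Td m a) g = app (Td m a) (app (Td m a) f)"
    using assms by (simp add: Td_app)
  also have "\<dots> = (tc - 1) * (tc * g) + tc * f"
    using arg_cong[OF Td_quadratic[OF assms(1,2)], of "\<lambda>A. app A f"] assms(3) by simp
  also have "\<dots> = tc * ((tc - 1) * g + f)" by (simp add: algebra_simps)
  finally have "app (Td m a) g = (tc - 1) * g + f"
    using const_nonzero[OF tvar_nonzero] by simp
  then have "app (Td m a) g + (1 - tc) * g = f" by (simp add: algebra_simps)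
  then show ?thesis
    using arg_cong[OF Td_YE[OF assms(1,2)], of "\<lambda>A. app A g"] by simp
qed

lemma Td_YE_pass:
  assumes "1 \<le> a" "a < m" "1 \<le> x" "x \<le> m" "x \<noteq> a" "x \<noteq> a + 1" "app (Td m a) f = tc * g"
  shows "app (Td m a) (app (YE m x) f) = tc * app (YE m x) g"
  using arg_cong[OF Td_YE_other[of x m a], of "\<lambda>A. app A f"] assms by (simp add: YE_app_const)

lemma q_chr_Cons:
  "m \<ge> 1 \<Longrightarrow> q_map m (chr r m (k # ks) cs) = (\<Sum>x\<in>{1..m} - set (take k cs).
      const (tvar ^ length (filter (\<lambda>y. r y x) (take k cs))) * app (YE m x) (q_map m (chr r m ks (x # cs))))"
  by (auto simp: q_sum q_scale q_var intro!: sum.cong)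

lemma filter_swap_length:
  assumes "\<And>y. y \<in> set w \<Longrightarrow> P (swap a y) = P y"
  shows "length (filter P (map (swap a) w)) = length (filter P w)"
  unfolding filter_map length_map using assms by (auto intro!: arg_cong[of _ _ length] filter_cong)

text \<open>Induction over the vertices. T_a passes a next colour x other than a and a + 1. The
  colours a and a + 1 are handled together, with continuations f and g such that T_a f = t g. If
  both are free, the sum Y_a g + Y_{a+1} f is an eigenvector for t. If a + 1 is in the window and a
  is not, Y_a g goes to Y_{a+1} f, and the factor t is supplied by the descent that is lost when the
  two colours are exchanged. If both are forbidden they contribute nothing.\<close>

lemma Td_chr:
  assumes "1 \<le> a" "a < m" "slow ks" "distinct (window ks cs)" "before a (window ks cs)"
  shows "app (Td m a) (q_map m (chr (\<lambda>y x. x < y) m ks cs)) = tc * q_map m (chr (\<lambda>y x. x < y) m ks (map (swap a) cs))"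
  using assms(3-5)
proof (induction ks arbitrary: cs)
  case Nil
  then show ?case using assms by (simp add: q_one Td_app)
next
  case (Cons k ks)
  let ?r = "\<lambda>y x. x < (y::nat)"
  let ?F = "\<lambda>cs. q_map m (chr ?r m ks cs)"
  let ?c = "\<lambda>x w. const (tvar ^ length (filter (?r x) w)) :: lp"
  define c where "c x w = (const (tvar ^ length (filter (\<lambda>y. x < y) w)) :: lp)" for x :: nat and w
  define w where "w = take k cs"
  have m: "m \<ge> 1" using assms by simp
  have w: "distinct w" "before a w" "window (k # ks) cs = w" using Cons.prems by (simp_all add: w_def)
  have w': "take k (map (swap a) cs) = map (swap a) w" by (simp add: w_def take_map)
  have inj: "inj (swap a)" by (metis injI swap_simps(4))
  have IH: "app (Td m a) (?F (x # ds)) = tc * ?F (map (swap a) (x # ds))"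
    if "distinct (x # take k ds)" "before a (x # take k ds)" for x ds
  proof -
    obtain j where "window ks (x # ds) = take j (x # take k ds)" using window_prefix[OF Cons.prems(1)] by blast
    then show ?thesis
      using that by (intro Cons.IH slow_tl[OF Cons.prems(1)]) (simp_all only: distinct_take before_take)
  qed
  define D D' where "D = {1..m} - set w" and "D' = {1..m} - set (map (swap a) w)"
  have q: "q_map m (chr ?r m (k # ks) cs) = (\<Sum>x\<in>D. c x w * app (YE m x) (?F (x # cs)))"
    "q_map m (chr ?r m (k # ks) (map (swap a) cs)) = (\<Sum>x\<in>D'. c x (map (swap a) w) * app (YE m x) (?F (x # map (swap a) cs)))"
    unfolding q_chr_Cons[OF m] w' by (simp_all add: D_def D'_def c_def w_def[symmetric])
  have mem: "x \<in> set (map (swap a) w) \<longleftrightarrow> swap a x \<in> set w" for x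
    using swap_simps(4)[of a] by (auto simp: image_iff) metis
  have DD: "D - {a, a + 1} = D' - {a, a + 1}"
  proof (rule Set.set_eqI)
    fix x
    show "x \<in> D - {a, a + 1} \<longleftrightarrow> x \<in> D' - {a, a + 1}"
      unfolding D_def D'_def using mem[of x] swap_simps(3)[of x a] by (auto simp del: set_map)
  qed
  have Tc: "app (Td m a) (c x v * G) = c x v * app (Td m a) G" for x v G
    using assms by (simp add: c_def Td_app)
  have generic: "app (Td m a) (c x w * app (YE m x) (?F (x # cs))) = tc * (c x (map (swap a) w) * app (YE m x) (?F (x # map (swap a) cs)))"
    if "x \<in> D - {a, a + 1}" for x
  proof -
    have x: "1 \<le> x" "x \<le> m" "x \<notin> set w" "x \<noteq> a" "x \<noteq> a + 1" using that by (auto simp: D_def)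
    have "app (Td m a) (?F (x # cs)) = tc * ?F (map (swap a) (x # cs))"
      using x w by (intro IH) (auto simp: w_def[symmetric] intro: before_Cons)
    then have "app (Td m a) (app (YE m x) (?F (x # cs))) = tc * app (YE m x) (?F (x # map (swap a) cs))"
      using x assms by (intro Td_YE_pass) (simp_all add: swap_simps)
    moreover have "c x (map (swap a) w) = c x w"
    proof -
      have "(x < swap a y) = (x < y)" for y
        using x swap_simps(1,2)[of a] swap_simps(3)[of y a] by (cases "y = a"; cases "y = a + 1") auto
      then show ?thesis unfolding c_def by (subst filter_swap_length) auto
    qed
    ultimately show ?thesis by (simp add: Tc)
  qed
  have special: "app (Td m a) (\<Sum>x\<in>D \<inter> {a, a + 1}. c x w * app (YE m x) (?F (x # cs)))
      = tc * (\<Sum>x\<in>D' \<inter> {a, a + 1}. c x (map (swap a) w) * app (YE m x) (?F (x # map (swap a) cs)))"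
  proof -
    have sa: "swap a a = a + 1" "swap a (a + 1) = a" by (simp_all only: swap_simps)
    \<comment> \<open>The remaining possibility, a in the window without a + 1, is excluded by
      \<open>before\<close>.\<close>
    consider "a \<notin> set w" "a + 1 \<notin> set w" | "a \<notin> set w" "a + 1 \<in> set w" | "a \<in> set w" "a + 1 \<in> set w"
      using w(2) set_takeWhileD by (fastforce simp: before_def)
    then show ?thesis
    proof cases
      case 1
      have mw: "map (swap a) w = w"
        using 1 by (intro map_idI swap_simps(3)) auto
      have D: "D \<inter> {a, a + 1} = {a, a + 1}" "D' \<inter> {a, a + 1} = {a, a + 1}"
        using assms 1 unfolding D_def D'_def mw by auto
      have F: "?F (x # map (swap a) cs) = ?F (x # cs)" for x
        by (rule arg_cong[of _ _ "q_map m"], rule chr_cong[OF slow_tl[OF Cons.prems(1)]], rule window_cong[OF Cons.prems(1)])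
          (simp add: w' mw, simp add: w_def)
      define f g where "f = ?F ((a + 1) # cs)" and "g = ?F (a # cs)"
      have fg: "app (Td m a) f = tc * g"
        using IH[of "a + 1" cs] 1 w F[of a] sa unfolding f_def g_def w_def[symmetric] by (simp add: before_Cons(2)[simplified])
      have s1: "app (Td m a) (app (YE m a) g) = app (YE m (a + 1)) f"
        by (rule Td_YE_swap[OF assms(1,2) fg])
      have s2: "app (Td m a) (app (YE m (a + 1)) f) = (tc - 1) * app (YE m (a + 1)) f + tc * app (YE m a) g"
        using arg_cong[OF Td_quadratic[OF assms(1,2)], of "\<lambda>A. app A (app (YE m a) g)"] by (simp add: s1)
      have cc: "c (a + 1) w = c a w"
      proof -
        have "filter (\<lambda>y. a + 1 < y) w = filter (\<lambda>y. a < y) w"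
          using 1(2) by (intro filter_cong) (auto, metis Suc_lessI)
        then show ?thesis by (simp add: c_def)
      qed
      have sum: "(\<Sum>x\<in>{a, a + 1}. h x) = h a + h (a + 1)" for h :: "nat \<Rightarrow> lp" by simp
      have "app (Td m a) (c a w * app (YE m a) g + c a w * app (YE m (a + 1)) f)
          = tc * (c a w * app (YE m a) g + c a w * app (YE m (a + 1)) f)"
        unfolding app_add Tc s1 s2 by (simp add: algebra_simps)
      then show ?thesis
        unfolding D sum mw F cc f_def g_def .
    next
      case 2
      have D: "D \<inter> {a, a + 1} = {a}" "D' \<inter> {a, a + 1} = {a + 1}"
        using assms 2 mem[of a] mem[of "a + 1"] sa unfolding D_def D'_def by auto
      \<comment> \<open>The induction hypothesis is applied to the exchanged colouring: with a + 1
        in front, \<open>before\<close> holds automatically, and exchanging once more gives back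
        \<open>a # cs\<close>.\<close>
      define f g where "f = ?F ((a + 1) # map (swap a) cs)" and "g = ?F (a # cs)"
      have dist: "distinct ((a + 1) # map (swap a) w)"
        using w(1) 2 mem[of "a + 1"] sa inj by (auto simp: distinct_map inj_on_def inj_def)
      have "map (swap a) (map (swap a) cs) = cs" by (simp add: o_def swap_simps(4))
      then have fg: "app (Td m a) f = tc * g"
        using IH[of "a + 1" "map (swap a) cs"] dist before_Cons(2)[of a "map (swap a) w"] sa
        unfolding f_def g_def w' by simp
      have s1: "app (Td m a) (app (YE m a) g) = app (YE m (a + 1)) f"
        by (rule Td_YE_swap[OF assms(1,2) fg])
      \<comment> \<open>The entry a + 1 of the window exceeds a, but after the exchange this entry
        is a and does not exceed a + 1; all other comparisons agree.\<close>
      have cc: "c a w = tc * c (a + 1) (map (swap a) w)"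
      proof -
        obtain u v where uv: "w = u @ (a + 1) # v" using 2(2) by (meson split_list)
        have nuv: "a + 1 \<notin> set u" "a + 1 \<notin> set v" "a \<notin> set u" "a \<notin> set v" using w(1) 2(1) uv by auto
        have f: "length (filter (\<lambda>y. a + 1 < y) (map (swap a) z)) = length (filter (\<lambda>y. a < y) z)"
          if "a + 1 \<notin> set z" "a \<notin> set z" for z
        proof -
          have "map (swap a) z = z" using that by (intro map_idI swap_simps(3)) auto
          moreover have "filter (\<lambda>y. a + 1 < y) z = filter (\<lambda>y. a < y) z"
            using that by (intro filter_cong) (auto, metis Suc_lessI)
          ultimately show ?thesis by simp
        qed
        have "length (filter (\<lambda>y. a < y) w) = Suc (length (filter (\<lambda>y. a + 1 < y) (map (swap a) w)))"
          using f[of u] f[of v] nuv sa by (simp add: uv)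
        then show ?thesis by (simp add: c_def const_simps)
      qed
      have "app (Td m a) (c a w * app (YE m a) g) = tc * (c (a + 1) (map (swap a) w) * app (YE m (a + 1)) f)"
      proof -
        have "app (Td m a) (c a w * app (YE m a) g) = c a w * app (YE m (a + 1)) f"
          by (simp only: Tc s1)
        then show ?thesis unfolding cc by (simp only: mult.assoc)
      qed
      then show ?thesis
        unfolding D f_def g_def by simp
    next
      case 3
      have D: "D \<inter> {a, a + 1} = {}" "D' \<inter> {a, a + 1} = {}"
        using 3 mem[of a] mem[of "a + 1"] sa unfolding D_def D'_def by auto
      show ?thesis unfolding D by simp
    qed
  qed
  have split: "(\<Sum>x\<in>E. h x) = (\<Sum>x\<in>E - {a, a + 1}. h x) + (\<Sum>x\<in>E \<inter> {a, a + 1}. h x)" if "finite E" for E and h :: "nat \<Rightarrow> lp"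
    using sum.Int_Diff[OF that, of h "{a, a + 1}"] by (simp add: add.commute)
  have fin: "finite D" "finite D'" by (simp_all add: D_def D'_def)
  have rest: "app (Td m a) (\<Sum>x\<in>D - {a, a + 1}. c x w * app (YE m x) (?F (x # cs)))
      = (\<Sum>x\<in>D - {a, a + 1}. tc * (c x (map (swap a) w) * app (YE m x) (?F (x # map (swap a) cs))))"
    unfolding app_sum using generic by (rule sum.cong[OF refl])
  have "app (Td m a) (\<Sum>x\<in>D. c x w * app (YE m x) (?F (x # cs)))
      = (\<Sum>x\<in>D - {a, a + 1}. tc * (c x (map (swap a) w) * app (YE m x) (?F (x # map (swap a) cs))))
        + tc * (\<Sum>x\<in>D' \<inter> {a, a + 1}. c x (map (swap a) w) * app (YE m x) (?F (x # map (swap a) cs)))"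
    unfolding split[OF fin(1)] app_add special rest ..
  also have "\<dots> = tc * (\<Sum>x\<in>D'. c x (map (swap a) w) * app (YE m x) (?F (x # map (swap a) cs)))"
    unfolding split[OF fin(2)] DD by (simp add: sum_distrib_left distrib_left)
  finally show ?case unfolding q .
qed

section \<open>Adding one vertex by means of S and Pi\<close>

subsection \<open>The recursion for the graph polynomials\<close>

text \<open>Auxiliary colours m, ..., 1 preceding the graph, the most recent first. With them a
  first vertex of in-degree k < m may use exactly 1, ..., m - k, and all its k edges are
  descents.\<close>

definition desc :: "nat \<Rightarrow> nat list" where
  "desc m = rev [1..<Suc m]"

text \<open>The state after colour c has been used following \<open>desc m\<close>, with the older
  occurrence of c deleted to keep the entries distinct. T_c leads from \<open>move m (c + 1)\<close>
  to \<open>move m c\<close>.\<close>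

definition move :: "nat \<Rightarrow> nat \<Rightarrow> nat list" where
  "move m c = c # filter (\<lambda>y. y \<noteq> c) (desc m)"

lemma desc_split:
  assumes "1 \<le> c" "c < m" shows "desc m = rev [c + 2..<Suc m] @ [c + 1, c] @ rev [1..<c]"
proof -
  have "[1..<Suc m] = [1..<c] @ [c..<Suc m]"
    using assms upt_add_eq_append[of 1 c "Suc m - c"] by simp
  moreover have "[c..<Suc m] = c # (c + 1) # [c + 2..<Suc m]"
    using assms by (simp add: upt_conv_Cons)
  ultimately show ?thesis by (simp add: desc_def)
qed

lemma distinct_desc: "distinct (desc m)"
  by (simp add: desc_def)

lemma set_desc: "set (desc m) = {1..m}"
  by (auto simp: desc_def)

lemma take_desc: "k \<le> m \<Longrightarrow> take k (desc m) = rev [Suc (m - k)..<Suc m]"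
  by (simp add: desc_def take_rev drop_upt del: upt_Suc)

lemma swap_move:
  assumes "1 \<le> c" "c < m" shows "map (swap c) (move m (c + 1)) = move m c"
proof -
  have A: "filter (\<lambda>y. y \<noteq> c + 1) (rev [c + 2..<Suc m]) = rev [c + 2..<Suc m]"
    "filter (\<lambda>y. y \<noteq> c) (rev [c + 2..<Suc m]) = rev [c + 2..<Suc m]"
    "map (swap c) (rev [c + 2..<Suc m]) = rev [c + 2..<Suc m]"
    by (auto simp: filter_id_conv simp del: upt_Suc intro!: map_idI swap_simps(3))
  have B: "filter (\<lambda>y. y \<noteq> c + 1) (rev [1..<c]) = rev [1..<c]" "filter (\<lambda>y. y \<noteq> c) (rev [1..<c]) = rev [1..<c]"
    "map (swap c) (rev [1..<c]) = rev [1..<c]"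
    by (auto simp: filter_id_conv simp del: upt_Suc intro!: map_idI swap_simps(3))
  have F: "filter (\<lambda>y. y \<noteq> c + 1) (desc m) = rev [c + 2..<Suc m] @ [c] @ rev [1..<c]"
    "filter (\<lambda>y. y \<noteq> c) (desc m) = rev [c + 2..<Suc m] @ [c + 1] @ rev [1..<c]"
    unfolding desc_split[OF assms] filter_append A B by simp_all
  show ?thesis
    unfolding move_def F list.map map_append A B swap_simps ..
qed

lemma move_max: "m \<ge> 1 \<Longrightarrow> move m m = desc m"
proof -
  assume "m \<ge> 1"
  then have "desc m = m # rev [1..<m]" by (simp add: desc_def)
  moreover have "filter (\<lambda>y. y \<noteq> m) (rev [1..<m]) = rev [1..<m]" by (auto simp: filter_id_conv)
  ultimately show ?thesis by (simp add: move_def)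
qed

lemma distinct_move: "distinct (move m c)"
  by (simp add: move_def distinct_desc)

lemma window_take: "\<exists>j. window ks cs = take j cs"
  by (cases ks) (auto intro: exI[of _ 0])

lemma window_map: "window ks (map f cs) = map f (window ks cs)"
  by (cases ks) (simp_all add: take_map)

abbreviation des :: "nat \<Rightarrow> nat \<Rightarrow> bool" where "des \<equiv> \<lambda>y x. x < y"

lemma Td_move:
  assumes "1 \<le> c" "c < m" "slow ks"
  shows "app (Td m c) (q_map m (chr des m ks (move m (c + 1)))) = tc * q_map m (chr des m ks (move m c))"
proof -
  obtain j where j: "window ks (move m (c + 1)) = take j (move m (c + 1))" using window_take by blast
  have "before c (take j (move m (c + 1)))"
    by (intro before_take) (simp add: move_def before_Cons(2)[simplified])
  then have "app (Td m c) (q_map m (chr des m ks (move m (c + 1)))) = tc * q_map m (chr des m ks (map (swap c) (move m (c + 1))))"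
    using assms j distinct_move by (intro Td_chr) simp_all
  then show ?thesis unfolding swap_move[OF assms(1,2)] .
qed

lemma list_Td_desc:
  assumes "1 \<le> c" "c \<le> m" "slow ks"
  shows "app (prod_list (map (Td m) [c..<m])) (q_map m (chr des m ks (desc m)))
    = const (tvar ^ (m - c)) * q_map m (chr des m ks (move m c))"
  using assms(2,1)
proof (induction c rule: inc_induct)
  case base
  then show ?case by (simp add: move_max const_simps)
next
  case (step c)
  have "app (prod_list (map (Td m) [c..<m])) (q_map m (chr des m ks (desc m)))
      = app (Td m c) (const (tvar ^ (m - Suc c)) * q_map m (chr des m ks (move m (c + 1))))"
    using step by (simp add: upt_conv_Cons)
  also have "\<dots> = const (tvar ^ (m - Suc c)) * (tc * q_map m (chr des m ks (move m c)))"
    using step.hyps step.prems Td_move[of c m ks] assms(3) by (simp add: Td_app)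
  also have "\<dots> = const (tvar ^ Suc (m - Suc c)) * q_map m (chr des m ks (move m c))"
    by (simp add: const_simps mult.left_commute)
  also have "Suc (m - Suc c) = m - c" using step.hyps by simp
  finally show ?case .
qed

lemma take_filter_desc:
  assumes "k \<le> m" "c \<le> m - k" shows "take k (filter (\<lambda>y. y \<noteq> c) (desc m)) = take k (desc m)"
proof -
  have "c \<notin> set (take k (desc m))" using assms by (auto simp: take_desc)
  then have f: "filter (\<lambda>y. y \<noteq> c) (take k (desc m)) = take k (desc m)" by (auto simp: filter_id_conv)
  have l: "length (take k (desc m)) = k" using assms by (simp add: desc_def)
  have "filter (\<lambda>y. y \<noteq> c) (desc m) = filter (\<lambda>y. y \<noteq> c) (take k (desc m) @ drop k (desc m))" by simp
  also have "\<dots> = take k (desc m) @ filter (\<lambda>y. y \<noteq> c) (drop k (desc m))"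
    unfolding filter_append f ..
  finally show ?thesis using l by simp
qed

text \<open>The window consists of at most c and the k largest colours. It contains neither a nor a
  + 1, so exchanging these two does not change it.\<close>

lemma Td_move_fixed:
  assumes "slow (k # ks)" "k \<le> m" "1 \<le> c" "c \<le> m - k" "1 \<le> a" "a + 1 \<le> m - k" "a \<noteq> c" "a + 1 \<noteq> c"
  shows "app (Td m a) (q_map m (chr des m ks (move m c))) = tc * q_map m (chr des m ks (move m c))"
proof -
  obtain j where j: "window ks (move m c) = take j (c # take k (filter (\<lambda>y. y \<noteq> c) (desc m)))"
    using window_prefix[OF assms(1)] unfolding move_def by blast
  have "set (take k (filter (\<lambda>y. y \<noteq> c) (desc m))) \<subseteq> {Suc (m - k)..m}"
    unfolding take_filter_desc[OF assms(2,4)] take_desc[OF assms(2)] by auto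
  then have "set (window ks (move m c)) \<subseteq> insert c {Suc (m - k)..m}"
    unfolding j using set_take_subset[of j "c # take k (filter (\<lambda>y. y \<noteq> c) (desc m))"] by auto
  then have ni: "a \<notin> set (window ks (move m c))" "a + 1 \<notin> set (window ks (move m c))" using assms by auto
  obtain i where "window ks (move m c) = take i (move m c)" using window_take by blast
  then have "distinct (window ks (move m c))" using distinct_move by simp
  then have "app (Td m a) (q_map m (chr des m ks (move m c))) = tc * q_map m (chr des m ks (map (swap a) (move m c)))"
    using assms ni slow_tl[OF assms(1)] by (intro Td_chr) (auto simp: before_def)
  also have "chr des m ks (map (swap a) (move m c)) = chr des m ks (move m c)"
  proof (rule chr_cong[OF slow_tl[OF assms(1)]])
    show "window ks (map (swap a) (move m c)) = window ks (move m c)"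
      unfolding window_map using ni by (intro map_idI swap_simps(3)) auto
  qed
  finally show ?thesis .
qed

lemma Tdinv_const: "1 \<le> a \<Longrightarrow> a < m \<Longrightarrow> app (Tdinv m a) (const c * F) = const c * app (Tdinv m a) F"
proof -
  assume a: "1 \<le> a" "a < m"
  show ?thesis unfolding Tdinv_app[OF a] Td_app(2)[OF a] by (simp add: algebra_simps)
qed

text \<open>Let V_j be the term T_j^{-1} ... T_1^{-1} Y_1 g_1. By induction t^j V_j = Y_{j+1}
  g_{j+1} - (t - 1)(Y_1 g_1 + ... + Y_j g_j). A second induction sums these: multiplying the partial
  sum by t is compensated by the subtracted terms, and one new summand remains.\<close>

lemma symmetrizer_sum:
  assumes "1 \<le> M" "M \<le> m"
    and H1: "\<And>c. 1 \<le> c \<Longrightarrow> c < M \<Longrightarrow> app (Td m c) (g (c + 1)) = tc * g c"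
    and H2: "\<And>a c. 1 \<le> a \<Longrightarrow> a < M \<Longrightarrow> 1 \<le> c \<Longrightarrow> c \<le> M \<Longrightarrow> a \<noteq> c \<Longrightarrow> a + 1 \<noteq> c \<Longrightarrow> app (Td m a) (g c) = tc * g c"
  shows "const (tvar ^ (M - 1)) * (\<Sum>j<M. app (prod_list (map (Tdinv m) (rev [1..<Suc j]))) (app (YE m 1) (g 1)))
    = (\<Sum>c = 1..M. app (YE m c) (g c))"
proof -
  define V where "V j = app (prod_list (map (Tdinv m) (rev [1..<Suc j]))) (app (YE m 1) (g 1))" for j
  define Z where "Z j = (\<Sum>c = 1..j. app (YE m c) (g c))" for j
  have V: "const (tvar ^ j) * V j = app (YE m (j + 1)) (g (j + 1)) - (tc - 1) * Z j" if "j < M" for j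
    using that
  proof (induction j)
    case 0
    show ?case by (simp add: V_def Z_def const_simps)
  next
    case (Suc j)
    define a where "a = j + 1"
    have a: "1 \<le> a" "a < M" "a < m" using Suc.prems assms by (auto simp: a_def)
    \<comment> \<open>\<open>B\<close> is t T_a^{-1}. It fixes Y_c g_c for c < a, these being
      eigenvectors of T_a for t, and takes Y_a g_a to Y_{a+1} g_{a+1} plus a multiple of Y_a
      g_a.\<close>
    define B where "B F = app (Td m a) F + (1 - tc) * F" for F
    have BD: "B (F - G) = B F - B G" for F G by (simp add: B_def app_diff algebra_simps)
    have BC: "B (const c * F) = const c * B F" for c F unfolding B_def Td_app(2)[OF a(1,3)] by (simp add: algebra_simps)
    have Vs: "V (Suc j) = app (Tdinv m a) (V j)" by (simp add: V_def a_def)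
    have TB: "tc * app (Tdinv m a) F = B F" for F
      using a by (simp add: Tdinv_app B_def mult.assoc[symmetric] const_inverse)
    have "const (tvar ^ Suc j) * V (Suc j) = const (tvar ^ j) * (tc * app (Tdinv m a) (V j))"
      unfolding Vs by (simp add: const_simps)
    also have "\<dots> = B (const (tvar ^ j) * V j)"
      unfolding TB BC ..
    also have "const (tvar ^ j) * V j = app (YE m a) (g a) - (tc - 1) * Z j"
      using Suc by (simp add: a_def)
    also have "B (app (YE m a) (g a) - (tc - 1) * Z j) = B (app (YE m a) (g a)) - (tc - 1) * B (Z j)"
      using BC[of "tvar - 1" "Z j"] by (simp add: BD const_simps)
    also have "B (Z j) = Z j"
    proof -
      have "B (app (YE m c) (g c)) = app (YE m c) (g c)" if "c \<in> {1..j}" for c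
      proof -
        have "app (Td m a) (app (YE m c) (g c)) = tc * app (YE m c) (g c)"
          using that a assms(2) by (intro Td_YE_pass H2) (auto simp: a_def)
        then show ?thesis by (simp add: B_def algebra_simps)
      qed
      moreover have "B (\<Sum>c\<in>A. h c) = (\<Sum>c\<in>A. B (h c))" for A and h :: "nat \<Rightarrow> lp"
        by (simp add: B_def app_sum sum.distrib sum_distrib_left)
      ultimately show ?thesis unfolding Z_def by simp
    qed
    also have "B (app (YE m a) (g a)) = app (YE m (a + 1)) (g (a + 1)) + (1 - tc) * app (YE m a) (g a)"
      unfolding B_def Td_YE_swap[OF a(1,3) H1[OF a(1,2)]] ..
    also have "app (YE m (a + 1)) (g (a + 1)) + (1 - tc) * app (YE m a) (g a) - (tc - 1) * Z j
        = app (YE m (a + 1)) (g (a + 1)) - (tc - 1) * (Z j + app (YE m a) (g a))"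
      by (simp add: algebra_simps)
    also have "Z j + app (YE m a) (g a) = Z (Suc j)" by (simp add: Z_def a_def)
    finally show ?case by (simp add: a_def)
  qed
  have "const (tvar ^ N) * (\<Sum>j<Suc N. V j) = Z (Suc N)" if "Suc N \<le> M" for N
    using that
  proof (induction N)
    case 0
    then show ?case using V[of 0] by (simp add: Z_def const_simps)
  next
    case (Suc N)
    have "const (tvar ^ Suc N) * (\<Sum>j<Suc (Suc N). V j) = tc * (const (tvar ^ N) * (\<Sum>j<Suc N. V j)) + const (tvar ^ Suc N) * V (Suc N)"
      unfolding sum.lessThan_Suc[of V "Suc N"] distrib_left power_Suc const_simps(1) mult.assoc ..
    also have "\<dots> = tc * Z (Suc N) + (app (YE m (Suc N + 1)) (g (Suc N + 1)) - (tc - 1) * Z (Suc N))"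
      using Suc V[of "Suc N"] by simp
    also have "\<dots> = Z (Suc N) + app (YE m (Suc (Suc N))) (g (Suc (Suc N)))"
      by (simp add: algebra_simps)
    finally show ?case by (simp add: Z_def)
  qed
  from this[of "M - 1"] show ?thesis using assms(1) by (simp add: V_def Z_def)
qed

definition chain :: "nat \<Rightarrow> int \<Rightarrow> nat \<Rightarrow> lp endo" where
  "chain m i k = prod_list (map (TTinv m) (rev [i..i + int k - 1]))"

definition SE :: "nat \<Rightarrow> int \<Rightarrow> int \<Rightarrow> lp endo" where
  "SE m i e = (if e \<ge> i - int m then (\<Sum>k\<in>{0..nat (int m + e - i)}. chain m i k) else 0)"

lemma chain_0: "chain m i 0 = 1"
  by (simp add: chain_def)

lemma chain_Suc: "chain m i (Suc k) = TTinv m (i + int k) * chain m i k"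
proof -
  have "[i..i + int (Suc k) - 1] = [i..i + int k - 1] @ [i + int k]"
    using upto_rec2[of i "i + int k"] by simp
  then show ?thesis by (simp add: chain_def)
qed

lemma chain_one: "chain m 1 j = prod_list (map (Tdinv m) (rev [1..<Suc j]))"
proof (induction j)
  case (Suc j)
  have "TTinv m (1 + int j) = Tdinv m (Suc j)" by (simp add: Tdinv_def)
  then show ?case using Suc by (simp add: chain_Suc)
qed (simp add: chain_0)

lemma PiE_TTinv: "m \<ge> 2 \<Longrightarrow> PiE m * TTinv m i = TTinv m (i + 1) * PiE m"
  unfolding TTinv_def
  by (simp add: mult_left_eq(1)[OF mul_const_Pi] mul_const_Pi Pi_TT mult.assoc distrib_left distrib_right right_diff_distrib left_diff_distrib)

lemma PiE_chain: "k = 0 \<or> m \<ge> 2 \<Longrightarrow> PiE m * chain m i k = chain m (i + 1) k * PiE m"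
proof (induction k)
  case (Suc k)
  then have m: "m \<ge> 2" by simp
  show ?case
    using Suc.IH m mult_left_eq(1)[OF PiE_TTinv[OF m]] by (simp add: chain_Suc mult.assoc add_ac)
qed (simp add: chain_0)

text \<open>In one variable there are no T_i, and the sum in S then consists of the term 1
  alone.\<close>

lemma SE_index:
  assumes "m \<ge> 1" "e < i" "e \<ge> i - int m" "k \<in> {0..nat (int m + e - i)}" shows "k = 0 \<or> m \<ge> 2"
  using assms by (cases "m = 1") auto

lemma PiE_SE:
  assumes "m \<ge> 1" "e < i" shows "PiE m * SE m i e = SE m (i + 1) (e + 1) * PiE m"
proof (cases "e \<ge> i - int m")
  case True
  have "PiE m * (\<Sum>k\<in>{0..nat (int m + e - i)}. chain m i k) = (\<Sum>k\<in>{0..nat (int m + e - i)}. chain m (i + 1) k * PiE m)"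
    unfolding sum_distrib_left using SE_index[OF assms True] PiE_chain by (intro sum.cong) auto
  moreover have "int m + (e + 1) - (i + 1) = int m + e - i" "e + 1 \<ge> i + 1 - int m" using True by auto
  ultimately show ?thesis unfolding SE_def using True by (simp only: if_True sum_distrib_right)
qed (simp add: SE_def)

lemma SE_power:
  assumes "m \<ge> 1" "e \<le> int i" shows "SE m (int i + 1) e * PiE m ^ i = PiE m ^ i * SE m 1 (e - int i)"
  using assms(2)
proof (induction i arbitrary: e)
  case (Suc i)
  have "SE m (int i + 1 + 1) (e - 1 + 1) * PiE m = PiE m * SE m (int i + 1) (e - 1)"
    using Suc.prems by (intro PiE_SE[OF assms(1), symmetric]) auto
  then have "SE m (int (Suc i) + 1) e * PiE m ^ Suc i = PiE m * (SE m (int i + 1) (e - 1) * PiE m ^ i)"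
    by (simp add: mult.assoc[symmetric] add_ac)
  also have "SE m (int i + 1) (e - 1) * PiE m ^ i = PiE m ^ i * SE m 1 (e - 1 - int i)"
    using Suc.prems by (intro Suc.IH) auto
  finally show ?case by (simp add: mult.assoc algebra_simps)
qed simp

text \<open>Moving i - 1 factors Pi to the left of S_{i,e(i)} lowers both indices by i - 1 and gives
  S_{1,-k}, where k = i - 1 - e(i) is the in-degree of vertex i.\<close>

lemma SE_prod:
  assumes "m \<ge> 1" "\<And>i. 1 \<le> i \<Longrightarrow> i \<le> n \<Longrightarrow> e i < int i"
  shows "prod_list (map (\<lambda>i. SE m (int i) (e i)) [1..<Suc n]) * PiE m ^ n
    = prod_list (map (\<lambda>k. SE m 1 (- int k) * PiE m) (map (\<lambda>i. nat (int i - 1 - e i)) [1..<Suc n]))"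
  using assms(2)
proof (induction n)
  case (Suc n)
  define A where "A = prod_list (map (\<lambda>i. SE m (int i) (e i)) [1..<Suc n])"
  have e: "e (Suc n) < int (Suc n)" by (rule Suc.prems) simp_all
  have "prod_list (map (\<lambda>i. SE m (int i) (e i)) [1..<Suc (Suc n)]) = A * SE m (int n + 1) (e (Suc n))"
    by (simp add: A_def add.commute)
  moreover have "(A * S) * PiE m ^ Suc n = A * (S * PiE m ^ n) * PiE m" for S
    by (simp only: mult.assoc power_Suc2)
  moreover have "SE m (int n + 1) (e (Suc n)) * PiE m ^ n = PiE m ^ n * SE m 1 (e (Suc n) - int n)"
    using e by (intro SE_power[OF assms(1)]) auto
  moreover have "A * (PiE m ^ n * S) * PiE m = (A * PiE m ^ n) * (S * PiE m)" for S
    by (simp only: mult.assoc)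
  ultimately have "prod_list (map (\<lambda>i. SE m (int i) (e i)) [1..<Suc (Suc n)]) * PiE m ^ Suc n
      = (A * PiE m ^ n) * (SE m 1 (e (Suc n) - int n) * PiE m)"
    by (simp only:)
  also have "A * PiE m ^ n = prod_list (map (\<lambda>k. SE m 1 (- int k) * PiE m) (map (\<lambda>i. nat (int i - 1 - e i)) [1..<Suc n]))"
    unfolding A_def by (rule Suc.IH) (simp add: Suc.prems)
  also have "e (Suc n) - int n = - int (nat (int (Suc n) - 1 - e (Suc n)))" using e by simp
  finally show ?case by simp
qed simp

lemma acts_SE:
  assumes "m \<ge> 1" "e < i" shows "acts m (hS m i e) (SE m i e)"
proof (cases "e \<ge> i - int m")
  case True
  have "acts m (hprod m (map (hT_inv m) (rev [i..i + int k - 1]))) (chain m i k)"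
    if "k \<in> {0..nat (int m + e - i)}" for k
  proof (cases "m \<ge> 2")
    case True
    show ?thesis
      unfolding chain_def
      by (rule acts_hprod[OF assms(1)], unfold list_all2_map1 list_all2_map2, rule list.rel_refl_strong)
        (rule acts_unit_acts[OF acts_unit_T_inv[OF True]])
  next
    case False
    then have "k = 0" using SE_index[OF assms True that] by simp
    then show ?thesis by (simp add: chain_0 hprod_def acts_one[OF assms(1)])
  qed
  then show ?thesis
    using True unfolding hS_def SE_def by (simp only: if_True) (intro acts_finsum[OF assms(1)], auto)
next
  case False
  then show ?thesis by (simp add: hS_def SE_def acts_zero[OF assms(1)])
qed

lemma X_graph_trunc_eq:
  assumes "m \<ge> 1" "\<And>i. 1 \<le> i \<Longrightarrow> i \<le> n \<Longrightarrow> e i < int i"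
  shows "X_graph_trunc n m e = const (tvar ^ (n * (m - 1))) *
    app (prod_list (map (\<lambda>k. SE m 1 (- int k) * PiE m) (map (\<lambda>i. nat (int i - 1 - e i)) [1..<Suc n]))) 1"
proof -
  have "acts m (hprod m (map (\<lambda>i. hS m (int i) (e i)) [1..<Suc n])) (prod_list (map (\<lambda>i. SE m (int i) (e i)) [1..<Suc n]))"
    by (rule acts_hprod[OF assms(1)], unfold list_all2_map1 list_all2_map2, rule list.rel_refl_strong)
      (use assms in \<open>auto intro!: acts_SE\<close>)
  moreover have "acts m (hPi m [^]\<^bsub>hecke m\<^esub> n) (PiE m ^ n)"
  proof (induction n)
    case 0
    then show ?case using acts_one[OF assms(1)] by (simp add: nat_pow_def)
  next
    case (Suc n)
    then show ?case using acts_mult[OF assms(1) Suc acts_Pi] by (simp add: nat_pow_def power_commutes)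
  qed
  ultimately have "acts m (hprod m (map (\<lambda>i. hS m (int i) (e i)) [1..<Suc n]) \<otimes>\<^bsub>hecke m\<^esub> hPi m [^]\<^bsub>hecke m\<^esub> n)
      (prod_list (map (\<lambda>i. SE m (int i) (e i)) [1..<Suc n]) * PiE m ^ n)"
    by (rule acts_mult[OF assms(1)])
  note A = hact_eq[OF assms(1) this laurent_closed(2)]
  have B: "prod_list (map (\<lambda>i. SE m (int i) (e i)) [1..<Suc n]) * PiE m ^ n
    = prod_list (map (\<lambda>k. SE m 1 (- int k) * PiE m) (map (\<lambda>i. nat (int i - 1 - e i)) [1..<Suc n]))"
    by (rule SE_prod[OF assms(1)]) (rule assms(2))
  show ?thesis unfolding X_graph_trunc_def scale_def A B ..
qed

text \<open>By \<open>PiE_via_Y\<close> and \<open>list_Td_desc\<close>, Pi produces Y_1 g_1, where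
  g_c is the image under q of the continuations after colour c. The symmetrizer spreads this over
  the colours c = 1, ..., m - k, which are those open to a vertex of in-degree k, and its k descents
  account for the rest of t^(m-1) = t^(m-k-1) t^k.\<close>

lemma chr_step:
  assumes "m \<ge> 1" "slow (k # ks)"
  shows "const (tvar ^ (m - 1)) * app (SE m 1 (- int k)) (app (PiE m) (q_map m (chr des m ks (desc m))))
    = q_map m (chr des m (k # ks) (desc m))"
proof (cases "k < m")
  case False
  \<comment> \<open>If k >= m then S is zero, and on the other side all m colours are
    forbidden.\<close>
  then have "SE m 1 (- int k) = 0" by (simp add: SE_def)
  moreover have "set (take k (desc m)) = {1..m}" using False set_desc by (simp add: desc_def)
  ultimately show ?thesis by (simp add: q_zero[OF assms(1)])
next
  case True
  define M where "M = m - k"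
  have M: "1 \<le> M" "M \<le> m" "m - 1 = (M - 1) + k" using True by (simp_all add: M_def)
  define g where "g c = q_map m (chr des m ks (move m c))" for c
  have sl: "slow ks" using assms(2) by (rule slow_tl)
  have P: "app (PiE m) (q_map m (chr des m ks (desc m))) = app (YE m 1) (g 1)"
  proof -
    have "app (PiE m) (q_map m (chr des m ks (desc m))) = const (inverse (tvar ^ (m - 1))) *
        app (YE m 1) (app (prod_list (map (Td m) [1..<m])) (q_map m (chr des m ks (desc m))))"
      unfolding PiE_via_Y[OF assms(1)] by simp
    also have "\<dots> = const (inverse (tvar ^ (m - 1))) * app (YE m 1) (const (tvar ^ (m - 1)) * g 1)"
      unfolding list_Td_desc[OF order_refl assms(1) sl] g_def ..
    also have "\<dots> = (const (inverse (tvar ^ (m - 1))) * const (tvar ^ (m - 1))) * app (YE m 1) (g 1)"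
      using assms(1) by (simp only: YE_app_const[OF order_refl assms(1)] mult.assoc)
    finally show ?thesis by (simp add: const_inverse)
  qed
  have range: "{0..nat (int m + - int k - 1)} = {..<M}" using True by (auto simp: M_def)
  have S: "app (SE m 1 (- int k)) F = (\<Sum>j<M. app (prod_list (map (Tdinv m) (rev [1..<Suc j]))) F)" for F
    using True range by (simp add: SE_def chain_one app_sum_left del: upt_Suc)
  have Z: "const (tvar ^ (M - 1)) * app (SE m 1 (- int k)) (app (YE m 1) (g 1)) = (\<Sum>c = 1..M. app (YE m c) (g c))"
    unfolding S
  proof (rule symmetrizer_sum[OF M(1,2)])
    show "app (Td m c) (g (c + 1)) = tc * g c" if "1 \<le> c" "c < M" for c
      unfolding g_def using that M by (intro Td_move sl) auto
    show "app (Td m a) (g c) = tc * g c" if "1 \<le> a" "a < M" "1 \<le> c" "c \<le> M" "a \<noteq> c" "a + 1 \<noteq> c" for a c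
      unfolding g_def using that True by (intro Td_move_fixed[OF assms(2)]) (auto simp: M_def)
  qed
  have tk: "take k (desc m) = rev [Suc M..<Suc m]" using True by (simp add: take_desc M_def)
  have "q_map m (chr des m (k # ks) (desc m)) = (\<Sum>x = 1..M. const (tvar ^ k) * app (YE m x) (g x))"
    unfolding q_chr_Cons[OF assms(1)]
  proof (rule sum.cong)
    show "{1..m} - set (take k (desc m)) = {1..M}" unfolding tk using M by auto
    fix x assume x: "x \<in> {1..M}"
    have "filter (\<lambda>y. x < y) (take k (desc m)) = take k (desc m)"
      unfolding tk using x by (auto simp: filter_id_conv simp del: upt_Suc)
    then have l: "length (filter (\<lambda>y. x < y) (take k (desc m))) = k"
      using True by (simp add: desc_def)
    have "chr des m ks (x # desc m) = chr des m ks (move m x)"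
      unfolding move_def using x True
      by (intro chr_cong[OF sl] window_cong[OF assms(2)]) (simp add: take_filter_desc M_def)
    then show "const (tvar ^ length (filter (\<lambda>y. x < y) (take k (desc m)))) * app (YE m x) (q_map m (chr des m ks (x # desc m)))
        = const (tvar ^ k) * app (YE m x) (g x)"
      unfolding l g_def by simp
  qed
  also have "\<dots> = const (tvar ^ k) * (const (tvar ^ (M - 1)) * app (SE m 1 (- int k)) (app (YE m 1) (g 1)))"
    unfolding Z by (simp add: sum_distrib_left)
  also have "\<dots> = const (tvar ^ (m - 1)) * app (SE m 1 (- int k)) (app (YE m 1) (g 1))"
    unfolding M(3) power_add by (simp only: const_simps mult_ac)
  finally show ?thesis unfolding P ..
qed

lemma app_SE_const: "m \<ge> 1 \<Longrightarrow> app (SE m 1 (- int k)) (const c * F) = const c * app (SE m 1 (- int k)) F"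
proof -
  assume m: "m \<ge> 1"
  have "app (prod_list (map (Tdinv m) (rev [1..<Suc j]))) (const c * F) = const c * app (prod_list (map (Tdinv m) (rev [1..<Suc j]))) F"
    if "j < m" for j
    using that
  proof (induction j)
    case (Suc j)
    have "app (prod_list (map (Tdinv m) (rev [1..<Suc (Suc j)]))) G
        = app (Tdinv m (Suc j)) (app (prod_list (map (Tdinv m) (rev [1..<Suc j]))) G)" for G by simp
    then show ?case using Suc Tdinv_const[of "Suc j" m] by simp
  qed simp
  moreover have "j < m" if "- int k \<ge> 1 - int m" "j \<in> {0..nat (int m + - int k - 1)}" for j
    using that m by auto
  ultimately show ?thesis
    by (auto simp: SE_def chain_one app_sum_left sum_distrib_left simp del: upt_Suc intro!: sum.cong)
qed

lemma chr_prod: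
  assumes "m \<ge> 1" "slow ks"
  shows "const (tvar ^ (length ks * (m - 1))) * app (prod_list (map (\<lambda>k. SE m 1 (- int k) * PiE m) ks)) 1
    = q_map m (chr des m ks (desc m))"
  using assms(2)
proof (induction ks)
  case Nil
  show ?case using assms(1) by (simp add: q_one const_simps)
next
  case (Cons k ks)
  define A where "A = app (prod_list (map (\<lambda>k. SE m 1 (- int k) * PiE m) ks)) 1"
  define c where "c = tvar ^ (length ks * (m - 1))"
  have A: "app (prod_list (map (\<lambda>k. SE m 1 (- int k) * PiE m) (k # ks))) 1 = app (SE m 1 (- int k)) (app (PiE m) A)"
    by (simp add: A_def)
  have c: "tvar ^ (length (k # ks) * (m - 1)) = tvar ^ (m - 1) * c"
    by (simp add: c_def power_add)
  have IH: "const c * A = q_map m (chr des m ks (desc m))"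
    using Cons.IH[OF slow_tl[OF Cons.prems]] by (simp only: A_def c_def)
  show ?case
    unfolding A c const_simps(1) mult.assoc app_SE_const[OF assms(1), symmetric] PiE_const[symmetric] IH
    unfolding PiE_const app_SE_const[OF assms(1)] by (rule chr_step[OF assms(1) Cons.prems])
qed

section \<open>From in-degree lists back to colourings of the graph\<close>

subsection \<open>Unit interval graphs\<close>

lemma slow_map:
  assumes "\<And>i. a \<le> i \<Longrightarrow> Suc i < b \<Longrightarrow> f (Suc i) \<le> f i + 1" shows "slow (map f [a..<b])"
  using assms
proof (induction "b - a" arbitrary: a)
  case (Suc l)
  have r: "[a..<b] = a # [Suc a..<b]" using Suc.hyps(2) by (simp add: upt_conv_Cons)
  have IH: "slow (map f [Suc a..<b])" using Suc.hyps(2) by (intro Suc.hyps(1) Suc.prems) auto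
  show ?case
  proof (cases "Suc a < b")
    case True
    then have "[Suc a..<b] = Suc a # [Suc (Suc a)..<b]" by (simp add: upt_conv_Cons)
    then show ?thesis using IH Suc.prems[OF order_refl True] unfolding r by simp
  qed (simp add: r)
qed simp

text \<open>The number of j with e(i) < j < i, that is, of edges ending at i.\<close>

definition indeg :: "(nat \<Rightarrow> int) \<Rightarrow> nat \<Rightarrow> nat" where
  "indeg e i = nat (int i - 1 - e i)"

lemma slow_indeg:
  assumes "e \<in> EE n" shows "slow (map (indeg e) [1..<Suc n])"
proof (rule slow_map)
  fix i assume "1 \<le> i" "Suc i < Suc n"
  then have "e i \<le> e (i + 1)" using assms by (simp add: EE_def)
  then show "indeg e (Suc i) \<le> indeg e i + 1" by (simp add: indeg_def)
qed

lemma X_graph_chr: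
  assumes "e \<in> EE n" "m \<ge> 1"
  shows "X_graph_trunc n m e = q_map m (chr des m (map (indeg e) [1..<Suc n]) [])"
proof -
  let ?ks = "map (indeg e) [1..<Suc n]"
  note sl = slow_indeg[OF assms(1)]
  have "X_graph_trunc n m e = const (tvar ^ (length ?ks * (m - 1))) * app (prod_list (map (\<lambda>k. SE m 1 (- int k) * PiE m) ?ks)) 1"
    unfolding indeg_def using assms by (subst X_graph_trunc_eq) (auto simp: EE_def simp del: upt_Suc)
  also have "\<dots> = q_map m (chr des m ?ks (desc m))" by (rule chr_prod[OF assms(2) sl])
  also have "chr des m ?ks (desc m) = chr des m ?ks []"
  proof (rule chr_cong[OF sl])
    show "window ?ks (desc m) = window ?ks []"
    proof (cases "n = 0")
      case False
      then have "0 \<le> e 1" using assms(1) by (auto simp: EE_def)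
      moreover have "?ks = indeg e 1 # map (indeg e) [2..<Suc n]"
        using False by (simp add: upt_conv_Cons numeral_2_eq_2 del: upt_Suc)
      ultimately show ?thesis by (simp add: indeg_def del: upt_Suc)
    qed simp
  qed
  finally show ?thesis .
qed

definition flip :: "nat \<Rightarrow> nat \<Rightarrow> nat" where
  "flip m x = (if x \<in> {1..m} then m + 1 - x else x)"

lemma flip_simps: "flip m (flip m x) = x" "flip m x \<in> {1..m} \<longleftrightarrow> x \<in> {1..m}"
  "x \<in> {1..m} \<Longrightarrow> y \<in> {1..m} \<Longrightarrow> flip m x < flip m y \<longleftrightarrow> y < x"
  by (auto simp: flip_def)

lemma flip_permutes: "flip m permutes {1..m}"
  unfolding permutes_def
proof (intro conjI allI impI)
  show "flip m x = x" if "x \<notin> {1..m}" for x using that unfolding flip_def by (rule if_not_P)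
  fix y
  show "\<exists>!x. flip m x = y"
  proof (rule ex1I[of _ "flip m y"])
    fix x assume "flip m x = y"
    then show "x = flip m y" using flip_simps(1)[of m x] by simp
  qed (rule flip_simps(1))
qed

lemma psub_chr:
  assumes "set cs \<subseteq> {1..m}"
  shows "psub m (flip m) (chr des m ks cs) = chr (<) m ks (map (flip m) cs)"
  using assms
proof (induction ks arbitrary: cs)
  case (Cons k ks)
  let ?w = "take k cs"
  have w: "set ?w \<subseteq> {1..m}" using Cons.prems set_take_subset by fastforce
  have mem: "flip m x \<in> set (take k (map (flip m) cs)) \<longleftrightarrow> x \<in> set ?w" for x
    unfolding take_map set_map image_iff using flip_simps(1) by metis
  have l: "length (filter (\<lambda>y. y < flip m x) (take k (map (flip m) cs))) = length (filter (\<lambda>y. x < y) ?w)"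
    if "x \<in> {1..m}" for x
    unfolding take_map filter_map length_map
    by (rule arg_cong[of _ _ length], rule filter_cong[OF refl]) (use w that flip_simps(3)[of _ m x] in auto)
  have "psub m (flip m) (chr des m (k # ks) cs) = (\<Sum>x\<in>{1..m} - set ?w.
      const (tvar ^ length (filter (\<lambda>y. x < y) ?w)) * (var (flip m x) * chr (<) m ks (flip m x # map (flip m) cs)))"
    unfolding chr.simps psub_simps
  proof (intro sum.cong refl)
    fix x assume x: "x \<in> {1..m} - set ?w"
    then have "1 \<le> flip m x" "flip m x \<le> m" by (auto simp: flip_def)
    then have v: "psub m (flip m) (var x) = var (flip m x)" using x by (intro psub_var) auto
    have IH: "psub m (flip m) (chr des m ks (x # cs)) = chr (<) m ks (flip m x # map (flip m) cs)"
      using Cons.IH[of "x # cs"] Cons.prems x by simp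
    show "const (tvar ^ length (filter (\<lambda>y. x < y) ?w)) * (psub m (flip m) (var x) * psub m (flip m) (chr des m ks (x # cs)))
        = const (tvar ^ length (filter (\<lambda>y. x < y) ?w)) * (var (flip m x) * chr (<) m ks (flip m x # map (flip m) cs))"
      unfolding v IH ..
  qed
  also have "\<dots> = chr (<) m (k # ks) (map (flip m) cs)"
    unfolding chr.simps
  proof (rule sum.reindex_bij_witness[of _ "flip m" "flip m"])
    fix x assume x: "x \<in> {1..m} - set ?w"
    then show "flip m x \<in> {1..m} - set (take k (map (flip m) cs))" using mem[of x] flip_simps(2)[of m x] by blast
    show "const (tvar ^ length (filter (\<lambda>y. y < flip m x) (take k (map (flip m) cs)))) *
        (var (flip m x) * chr (<) m ks (flip m x # map (flip m) cs))
      = const (tvar ^ length (filter (\<lambda>y. x < y) ?w)) * (var (flip m x) * chr (<) m ks (flip m x # map (flip m) cs))"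
      using x by (subst l) auto
  next
    fix x assume x: "x \<in> {1..m} - set (take k (map (flip m) cs))"
    then show "flip m x \<in> {1..m} - set ?w"
      using mem[of "flip m x"] flip_simps(1)[of m x] flip_simps(2)[of m x] by auto
  qed (rule flip_simps(1))+
  finally show ?case .
qed (simp add: psub_simps)

text \<open>With nothing coloured yet the exchange of a and a + 1 has no effect, so the image under
  q is an eigenvector of every T_a for t. It is thus symmetric, and q reflects symmetry.\<close>

lemma chr_sym:
  assumes "m \<ge> 1" "slow ks" shows "chr des m ks [] \<in> sym_polys m"
proof -
  let ?F = "chr des m ks []"
  have "window ks [] = []" by (cases ks) auto
  then have "app (Td m i) (q_map m ?F) = tc * q_map m ?F" if "1 \<le> i" "i < m" for i
    using Td_chr[OF that assms(2), of "[]"] by (simp add: before_def)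
  then have "q_map m ?F \<in> sym_polys m" using assms(1) chr_polys by (simp add: sym_polys_iff q_polys)
  then show ?thesis using q_sym_iff[OF assms(1) chr_polys] by blast
qed

text \<open>Reversing the order of the colours exchanges descents and ascents, while a symmetric
  polynomial is unchanged by it. The recursion produces descents, the chromatic function is defined
  by ascents.\<close>

lemma chr_des_eq:
  assumes "m \<ge> 1" "slow ks" shows "chr des m ks [] = chr (<) m ks []"
  using psub_chr[of "[]" m ks] sym_polys_psub[OF chr_sym[OF assms] flip_permutes] by simp

text \<open>Only edges ending at i or later are tested, matching \<open>chr\<close>, which takes the
  colours of the earlier vertices as given.\<close>

definition extensions :: "nat \<Rightarrow> nat \<Rightarrow> (nat \<times> nat) set \<Rightarrow> nat \<Rightarrow> (nat \<Rightarrow> nat) \<Rightarrow> (nat \<Rightarrow> nat) set" where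
  "extensions n m E i f = {\<kappa> \<in> {1..n} \<rightarrow>\<^sub>E {1..m}. (\<forall>j\<in>{1..<i}. \<kappa> j = f j) \<and> (\<forall>(v, w)\<in>E. i \<le> w \<longrightarrow> \<kappa> v \<noteq> \<kappa> w)}"

lemma finite_ui_edges: "finite (ui_edges n e)"
  by (rule finite_subset[of _ "{1..n} \<times> {1..n}"]) (auto simp: ui_edges_def)

lemma finite_extensions: "finite (extensions n m E i f)"
  by (rule finite_subset[of _ "{1..n} \<rightarrow>\<^sub>E {1..m}"]) (auto simp: extensions_def intro!: finite_PiE)

lemma take_indeg:
  assumes "e \<in> EE n" "1 \<le> i" "i \<le> n"
  shows "take (indeg e i) (rev (map f [1..<i])) = rev (map f [nat (e i) + 1..<i])"
proof -
  have "0 \<le> e i" "e i < int i" using assms by (auto simp: EE_def)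
  then have "i - 1 - indeg e i = nat (e i)" by (simp add: indeg_def)
  then show ?thesis by (simp add: take_rev drop_map add.commute)
qed

text \<open>Downward induction on i: the colourings are sorted by the colour of vertex i, whose
  incoming edges come from exactly the last \<open>indeg e i\<close> vertices before it.\<close>

lemma chr_extensions:
  assumes e: "e \<in> EE n" and "1 \<le> i" "i \<le> Suc n" "\<And>j. j \<in> {1..<i} \<Longrightarrow> f j \<in> {1..m}"
  shows "chr (<) m (map (indeg e) [i..<Suc n]) (rev (map f [1..<i]))
    = (\<Sum>\<kappa>\<in>extensions n m (ui_edges n e) i f.
        const (tvar ^ card {(v, w)\<in>ui_edges n e. i \<le> w \<and> \<kappa> v < \<kappa> w}) * (\<Prod>v\<in>{i..n}. var (\<kappa> v)))"
  using assms(3,2,4)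
proof (induction i arbitrary: f rule: inc_induct)
  case base
  have E: "{(v, w)\<in>ui_edges n e. Suc n \<le> w \<and> \<kappa> v < \<kappa> w} = {}" for \<kappa> by (auto simp: ui_edges_def)
  have "extensions n m (ui_edges n e) (Suc n) f = {restrict f {1..n}}"
  proof (intro Set.set_eqI iffI)
    fix \<kappa> assume "\<kappa> \<in> extensions n m (ui_edges n e) (Suc n) f"
    then have "\<kappa> x = restrict f {1..n} x" for x
      by (cases "x \<in> {1..n}") (auto simp: extensions_def PiE_def extensional_def)
    then show "\<kappa> \<in> {restrict f {1..n}}" by auto
  next
    fix \<kappa> assume "\<kappa> \<in> {restrict f {1..n}}"
    then show "\<kappa> \<in> extensions n m (ui_edges n e) (Suc n) f"
      using base by (fastforce simp: extensions_def ui_edges_def)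
  qed
  then show ?case unfolding E by (simp add: const_simps)
next
  case (step i)
  let ?E = "ui_edges n e"
  have i: "1 \<le> i" "i \<le> n" using step.hyps step.prems by auto
  have ei: "0 \<le> e i" "e i < int i" using e i by (auto simp: EE_def)
  define w where "w = rev (map f [nat (e i) + 1..<i])"
  define D where "D = {1..m} - set w"
  define W where "W \<kappa> = (const (tvar ^ card {(v, w)\<in>?E. i \<le> w \<and> \<kappa> v < \<kappa> w}) * (\<Prod>v\<in>{i..n}. var (\<kappa> v)) :: lp)" for \<kappa>
  have edge: "(v, i) \<in> ?E \<longleftrightarrow> v \<in> {nat (e i) + 1..<i}" for v
    using i ei by (auto simp: ui_edges_def)
  have sw: "set w = f ` {nat (e i) + 1..<i}" by (simp add: w_def)
  have split: "{\<kappa> \<in> extensions n m ?E i f. \<kappa> i = x} = extensions n m ?E (Suc i) (f(i := x))" if "x \<in> D" for x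
  proof (intro Set.set_eqI iffI)
    fix \<kappa> assume "\<kappa> \<in> {\<kappa> \<in> extensions n m ?E i f. \<kappa> i = x}"
    then show "\<kappa> \<in> extensions n m ?E (Suc i) (f(i := x))"
      by (auto simp: extensions_def less_Suc_eq)
  next
    fix \<kappa> assume k: "\<kappa> \<in> extensions n m ?E (Suc i) (f(i := x))"
    then have fi: "\<kappa> i = x" "\<And>j. j \<in> {1..<i} \<Longrightarrow> \<kappa> j = f j" using i by (auto simp: extensions_def)
    have "\<kappa> v \<noteq> \<kappa> u" if "(v, u) \<in> ?E" "i \<le> u" for v u
    proof (cases "u = i")
      case True
      then have v: "v \<in> {nat (e i) + 1..<i}" using edge that by blast
      then have "f v \<in> set w" unfolding sw by blast
      moreover have "\<kappa> v = f v" using v by (intro fi(2)) auto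
      ultimately show ?thesis using \<open>x \<in> D\<close> True fi(1) by (auto simp: D_def)
    next
      case False
      then show ?thesis using k that by (auto simp: extensions_def)
    qed
    then show "\<kappa> \<in> {\<kappa> \<in> extensions n m ?E i f. \<kappa> i = x}"
      using k fi by (auto simp: extensions_def)
  qed
  have range: "(\<lambda>\<kappa>. \<kappa> i) ` extensions n m ?E i f \<subseteq> D"
  proof (rule image_subsetI)
    fix \<kappa> assume k: "\<kappa> \<in> extensions n m ?E i f"
    then have "\<kappa> i \<in> {1..m}" using i by (auto simp: extensions_def)
    moreover have "\<kappa> i \<noteq> f v" if "v \<in> {nat (e i) + 1..<i}" for v
    proof -
      have "\<kappa> v \<noteq> \<kappa> i" using k that edge[of v] by (fastforce simp: extensions_def)
      moreover have "\<kappa> v = f v" using k that by (auto simp: extensions_def)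
      ultimately show ?thesis by simp
    qed
    ultimately show "\<kappa> i \<in> D" unfolding D_def sw by blast
  qed
  have weight: "W \<kappa> = const (tvar ^ length (filter (\<lambda>y. y < x) w)) *
      (var x * (const (tvar ^ card {(v, w)\<in>?E. Suc i \<le> w \<and> \<kappa> v < \<kappa> w}) * (\<Prod>v\<in>{Suc i..n}. var (\<kappa> v))))"
    if k: "\<kappa> \<in> extensions n m ?E (Suc i) (f(i := x))" for \<kappa> x
  proof -
    have fi: "\<kappa> i = x" "\<And>j. j \<in> {1..<i} \<Longrightarrow> \<kappa> j = f j" using k i by (auto simp: extensions_def)
    have "length (filter (\<lambda>y. y < x) w) = length (filter (\<lambda>v. f v < x) [nat (e i) + 1..<i])"
      by (simp add: w_def rev_filter[symmetric] filter_map o_def)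
    also have "\<dots> = card (set (filter (\<lambda>v. f v < x) [nat (e i) + 1..<i]))"
      by (rule distinct_card[symmetric]) simp
    also have "\<dots> = card ((\<lambda>v. (v, i)) ` {v \<in> {nat (e i) + 1..<i}. f v < x})"
      by (subst card_image) (auto simp: inj_on_def intro!: arg_cong[of _ _ card])
    also have "(\<lambda>v. (v, i)) ` {v \<in> {nat (e i) + 1..<i}. f v < x} = {(v, u)\<in>?E. u = i \<and> \<kappa> v < \<kappa> u}"
    proof -
      have "v \<in> {nat (e i) + 1..<i} \<and> f v < x \<longleftrightarrow> (v, i) \<in> ?E \<and> \<kappa> v < \<kappa> i" for v
        using edge[of v] fi by auto
      then show ?thesis by auto
    qed
    finally have l: "length (filter (\<lambda>y. y < x) w) = card {(v, u)\<in>?E. u = i \<and> \<kappa> v < \<kappa> u}" .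
    have "{(v, u)\<in>?E. i \<le> u \<and> \<kappa> v < \<kappa> u} = {(v, u)\<in>?E. u = i \<and> \<kappa> v < \<kappa> u} \<union> {(v, u)\<in>?E. Suc i \<le> u \<and> \<kappa> v < \<kappa> u}"
      by auto
    moreover have "finite {(v, u)\<in>?E. Q v u}" for Q
      by (rule finite_subset[OF _ finite_ui_edges[of n e]]) auto
    ultimately have c: "card {(v, u)\<in>?E. i \<le> u \<and> \<kappa> v < \<kappa> u} = length (filter (\<lambda>y. y < x) w) + card {(v, u)\<in>?E. Suc i \<le> u \<and> \<kappa> v < \<kappa> u}"
      unfolding l by (simp add: card_Un_disjoint disjoint_iff)
    have "{i..n} = insert i {Suc i..n}" using i by auto
    then have p: "(\<Prod>v\<in>{i..n}. var (\<kappa> v)) = (var x * (\<Prod>v\<in>{Suc i..n}. var (\<kappa> v)) :: lp)" using fi by simp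
    show ?thesis unfolding W_def c p power_add const_simps by (simp only: mult_ac)
  qed
  have "chr (<) m (map (indeg e) [i..<Suc n]) (rev (map f [1..<i])) = (\<Sum>x\<in>D. const (tvar ^ length (filter (\<lambda>y. y < x) w)) *
      (var x * chr (<) m (map (indeg e) [Suc i..<Suc n]) (x # rev (map f [1..<i]))))"
    using i take_indeg[OF e i, of f] by (simp add: upt_conv_Cons D_def w_def del: upt_Suc)
  also have "\<dots> = (\<Sum>x\<in>D. \<Sum>\<kappa>\<in>{\<kappa> \<in> extensions n m ?E i f. \<kappa> i = x}. W \<kappa>)"
  proof (rule sum.cong[OF refl])
    fix x assume x: "x \<in> D"
    have "x # rev (map f [1..<i]) = rev (map (f(i := x)) [1..<Suc i])"
      using i(1) by (simp add: map_fun_upd)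
    then have "chr (<) m (map (indeg e) [Suc i..<Suc n]) (x # rev (map f [1..<i]))
        = (\<Sum>\<kappa>\<in>extensions n m ?E (Suc i) (f(i := x)).
          const (tvar ^ card {(v, w)\<in>?E. Suc i \<le> w \<and> \<kappa> v < \<kappa> w}) * (\<Prod>v\<in>{Suc i..n}. var (\<kappa> v)))"
      using step.IH[of "f(i := x)"] step.prems x by (fastforce simp: D_def)
    then show "const (tvar ^ length (filter (\<lambda>y. y < x) w)) *
        (var x * chr (<) m (map (indeg e) [Suc i..<Suc n]) (x # rev (map f [1..<i])))
      = (\<Sum>\<kappa>\<in>{\<kappa> \<in> extensions n m ?E i f. \<kappa> i = x}. W \<kappa>)"
      unfolding split[OF x] by (simp only: sum_distrib_left) (rule sum.cong[OF refl], rule weight[symmetric])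
  qed
  also have "\<dots> = (\<Sum>\<kappa>\<in>extensions n m ?E i f. W \<kappa>)"
    by (rule sum.group[OF finite_extensions _ range]) (simp add: D_def)
  finally show ?case unfolding W_def .
qed

lemma chromatic_chr:
  assumes "e \<in> EE n" "m \<ge> 1"
  shows "chromatic {1..n} (ui_edges n e) m = chr (<) m (map (indeg e) [1..<Suc n]) []"
proof -
  let ?E = "ui_edges n e"
  have E: "1 \<le> w" if "(v, w) \<in> ?E" for v w using that by (auto simp: ui_edges_def)
  have x: "extensions n m ?E 1 f = proper_colorings m {1..n} ?E" for f
    using E by (fastforce simp: extensions_def proper_colorings_def)
  have a: "{(v, w) \<in> ?E. 1 \<le> w \<and> \<kappa> v < \<kappa> w} = {(v, w) \<in> ?E. \<kappa> v < \<kappa> w}" for \<kappa>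
    using E by auto
  have "chr (<) m (map (indeg e) [1..<Suc n]) (rev (map f [1..<1]))
    = (\<Sum>\<kappa>\<in>extensions n m ?E 1 f. const (tvar ^ card {(v, w)\<in>?E. 1 \<le> w \<and> \<kappa> v < \<kappa> w}) * (\<Prod>v\<in>{1..n}. var (\<kappa> v)))" for f
    by (rule chr_extensions[OF assms(1)]) auto
  then show ?thesis
    using assms(2) unfolding x a by (simp add: chromatic_def mk_family_def asc_def del: upt_Suc)
qed

lemma chromatic_polys_inf:
  assumes "e \<in> EE n" shows "chromatic {1..n} (ui_edges n e) \<in> polys_inf"
proof -
  define F where "F = chromatic {1..n} (ui_edges n e)"
  define ks where "ks = map (indeg e) [1..<Suc n]"
  have F: "F m = chr (<) m ks []" if "m \<ge> 1" for m
    using chromatic_chr[OF assms that] by (simp only: F_def ks_def)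
  have l: "length ks = n" by (simp add: ks_def)
  have "F 0 = 0" by (simp add: F_def chromatic_def mk_family_def)
  moreover have "bounded_family n F"
    unfolding bounded_family_def
  proof (intro allI impI)
    fix m :: nat assume "m \<ge> 1"
    from F[OF this] show "F m = (\<Sum>d\<le>n. hc m (int d) (F m))" by (simp add: hc_chr l)
  qed
  moreover have "trunc k (F m) = F k" if "0 < k" "k < m" for k m
    using that F[of k] F[of m] by (simp add: trunc_chr)
  moreover have "F m \<in> polys m" if "m \<ge> 1" for m
    unfolding F[OF that] by (rule chr_polys)
  ultimately show ?thesis unfolding polys_inf_iff F_def[symmetric] by blast
qed

lemma X_graph_eq:
  assumes "e \<in> EE n" shows "X_graph n e = q_inf (chromatic {1..n} (ui_edges n e))"
proof
  fix m
  show "X_graph n e m = q_inf (chromatic {1..n} (ui_edges n e)) m"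
  proof (cases "m = 0")
    case False
    then have m: "m \<ge> 1" by simp
    show ?thesis
      unfolding q_inf_apply chromatic_chr[OF assms m] chr_des_eq[OF m slow_indeg[OF assms], symmetric]
        X_graph_chr[OF assms m, symmetric]
      using False by (simp add: X_graph_def mk_family_def)
  qed (simp add: X_graph_def mk_family_def q_inf_apply)
qed

section \<open>Squarefree monomials and elementary symmetric functions\<close>

section \<open>Elementary symmetric functions\<close>

definition sqfree :: "nat set \<Rightarrow> lp" where
  "sqfree S = (\<Prod>i\<in>S. var i)"

lemma sqfree_insert: "finite S \<Longrightarrow> i \<notin> S \<Longrightarrow> sqfree (insert i S) = var i * sqfree S"
  by (simp add: sqfree_def)

lemma sqfree_polys: "S \<subseteq> {1..m} \<Longrightarrow> sqfree S \<in> polys m"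
  unfolding sqfree_def by (induction S rule: infinite_finite_induct) auto

lemma psub_sqfree:
  assumes "S \<subseteq> {1..m}" "\<sigma> permutes {1..m}" shows "psub m \<sigma> (sqfree S) = sqfree (\<sigma> ` S)"
proof -
  have "finite S" using assms(1) finite_subset by blast
  then have "psub m \<sigma> (sqfree S) = (\<Prod>i\<in>S. var (\<sigma> i))"
    using assms(1)
  proof (induction S rule: finite_induct)
    case (insert i S)
    have "\<sigma> i \<in> {1..m}" using insert.prems permutes_in_image[OF assms(2), of i] by blast
    then show ?case using insert psub_var[of i m \<sigma>] by (simp add: sqfree_insert psub_simps)
  qed (simp add: sqfree_def psub_simps)
  then show ?thesis
    unfolding sqfree_def prod.reindex[OF permutes_inj_on[OF assms(2)]] by simp
qed

lemma Td_sqfree_eigen: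
  assumes "S \<subseteq> {1..m}" "1 \<le> i" "i < m" "i \<in> S \<longleftrightarrow> i + 1 \<in> S"
  shows "app (Td m i) (sqfree S) = tc * sqfree S"
proof -
  let ?s = "Transposition.transpose i (i + 1)"
  have "?s permutes {1..m}" using assms by (intro permutes_swap_id) auto
  moreover have "?s ` S = S"
  proof -
    have "x \<in> ?s ` S \<longleftrightarrow> x \<in> S" for x
      using assms(4) by (auto simp: image_iff transpose_def split: if_splits) 
    then show ?thesis by blast
  qed
  ultimately show ?thesis
    using psub_sqfree[OF assms(1)] unfolding Td_invariant_iff[OF assms(2,3)] psub_transpose[OF assms(2,3), symmetric] by simp
qed

lemma Td_sqfree_shift:
  assumes "S \<subseteq> {1..m}" "1 \<le> i" "i < m" "i \<in> S" "i + 1 \<notin> S"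
  shows "app (Td m i) (sqfree S) = sqfree (insert (i + 1) (S - {i}))"
proof -
  have f: "finite S" using assms(1) finite_subset by blast
  have S: "sqfree S = var i * sqfree (S - {i})"
    using sqfree_insert[of "S - {i}" i] f assms(4) by (simp add: insert_absorb)
  have "app (Td m i) (sqfree (S - {i})) = tc * sqfree (S - {i})"
    using assms by (intro Td_sqfree_eigen) auto
  then have "app (Td m i) (sqfree S) = var (i + 1) * sqfree (S - {i})"
    unfolding S Td_app(3)[OF assms(2,3)] by (simp add: algebra_simps)
  then show ?thesis using sqfree_insert[of "S - {i}" "i + 1"] f assms(5) by simp
qed

lemma prod_list_Td_eigen:
  assumes "\<And>j. j \<in> set js \<Longrightarrow> 1 \<le> j \<and> j < m \<and> app (Td m j) F = tc * F"
  shows "app (prod_list (map (Td m) js)) F = const (tvar ^ length js) * F"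
    and "app (prod_list (map (Tdinv m) js)) F = const (inverse tvar ^ length js) * F"
  using assms
proof (induction js)
  case (Cons j js)
  { case 1
    then have j: "1 \<le> j" "j < m" "app (Td m j) F = tc * F" by auto
    have "app (prod_list (map (Td m) js)) F = const (tvar ^ length js) * F" using Cons.IH(1) 1 by simp
    then have "app (prod_list (map (Td m) (j # js))) F = const (tvar ^ length js) * (tc * F)"
      by (simp only: list.map prod_list.Cons app_simps Td_app(2)[OF j(1,2)] j(3))
    then show ?case by (simp only: length_Cons power_Suc const_simps(1) mult.assoc mult.left_commute)
  next
    case 2
    then have j: "1 \<le> j" "j < m" "app (Td m j) F = tc * F" by auto
    have "app (Tdinv m j) F = const (inverse tvar) * F"
      unfolding Tdinv_app[OF j(1,2)] j(3) by (simp add: algebra_simps)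
    moreover have "app (prod_list (map (Tdinv m) js)) F = const (inverse tvar ^ length js) * F" using Cons.IH(2) 2 by simp
    ultimately have "app (prod_list (map (Tdinv m) (j # js))) F = const (inverse tvar ^ length js) * (const (inverse tvar) * F)"
      by (simp only: list.map prod_list.Cons app_simps Tdinv_const[OF j(1,2)])
    then show ?case by (simp only: length_Cons power_Suc const_simps(1) mult.assoc mult.left_commute)
  }
qed (simp_all add: const_simps)

text \<open>All T_j in Y_i meet eigenvectors for t: X_1 ... X_{i-1} is fixed by s_j for j >= i, and
  after Pi the monomial X_1 ... X_i is fixed by s_j for j < i. The inverses contribute t^{-(m-i)},
  which cancels the normalisation, and the others t^(i-1).\<close>

lemma YE_initial:
  assumes "1 \<le> i" "i \<le> m" shows "app (YE m i) (sqfree {1..<i}) = const (tvar ^ (i - 1)) * sqfree {1..i}"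
proof -
  have m: "m \<ge> 1" using assms by simp
  have Tinv: "app (prod_list (map (Tdinv m) (rev [i..<m]))) (sqfree {1..<i})
      = const (inverse tvar ^ length (rev [i..<m])) * sqfree {1..<i}"
    using assms by (intro prod_list_Td_eigen(2)) (auto intro!: Td_sqfree_eigen)
  have T: "app (prod_list (map (Td m) (rev [1..<i]))) (sqfree {1..i}) = const (tvar ^ length (rev [1..<i])) * sqfree {1..i}"
    using assms by (intro prod_list_Td_eigen(1)) (auto intro!: Td_sqfree_eigen)
  have P: "app (PiE m) (sqfree {1..<j}) = sqfree {1..j}" if "1 \<le> j" "j \<le> m" for j
    using that
  proof (induction j rule: dec_induct)
    case base
    then show ?case using PiE_one[OF m] by (simp add: sqfree_def)
  next
    case (step j)
    have "sqfree {1..<Suc j} = Xpow m (int j) 1 * sqfree {1..<j}"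
      using step sqfree_insert[of "{1..<j}" j] Xpow_vpow[of j m 1] by (simp add: atLeastLessThanSuc vpow_1)
    then have "app (PiE m) (sqfree {1..<Suc j}) = var (j + 1) * sqfree {1..j}"
      using step by (simp add: PiE_Xpow[OF m] Xpow_next)
    then show ?case using sqfree_insert[of "{1..j}" "Suc j"] by (simp add: atLeastAtMostSuc_conv)
  qed
  have c: "const (tvar ^ (m - i)) * (const (inverse tvar ^ (m - i)) * G) = (G :: lp)" for G
    using const_inverse[of "tvar ^ (m - i)"] by (simp add: mult.assoc[symmetric] power_inverse)
  have TC: "app (prod_list (map (Td m) (rev [1..<i]))) (const c * G) = const c * app (prod_list (map (Td m) (rev [1..<i]))) G" for c G
  proof -
    have "app (prod_list (map (Td m) js)) (const c * G) = const c * app (prod_list (map (Td m) js)) G"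
      if "set js \<subseteq> {1..<m}" for js
      using that by (induction js) (auto simp: Td_app(2))
    then show ?thesis using assms by (auto simp del: upt_Suc)
  qed
  show ?thesis
    unfolding YE_expand[OF assms] Tinv PiE_const P[OF assms] TC T unfolding length_rev length_upt c ..
qed

lemma q_initial:
  assumes "m \<ge> 1" "r \<le> m"
  shows "q_map m (sqfree {1..r}) = const (tvar ^ (r * (r - 1) div 2)) * sqfree {1..r}"
  using assms(2)
proof (induction r)
  case 0
  then show ?case using q_one[OF assms(1)] by (simp add: sqfree_def const_simps)
next
  case (Suc r)
  have r: "1 \<le> Suc r" "Suc r \<le> m" using Suc.prems by simp_all
  have "sqfree {1..Suc r} = var (Suc r) * sqfree {1..r}"
    using sqfree_insert[of "{1..r}" "Suc r"] by (simp add: atLeastAtMostSuc_conv)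
  then have "q_map m (sqfree {1..Suc r}) = const (tvar ^ (r * (r - 1) div 2)) * app (YE m (Suc r)) (sqfree {1..<Suc r})"
    using q_var[OF r] Suc by (simp add: YE_app_const[OF r] atLeastLessThanSuc_atLeastAtMost)
  also have "\<dots> = const (tvar ^ (r * (r - 1) div 2 + r)) * sqfree {1..Suc r}"
    unfolding YE_initial[OF r] by (simp add: power_add const_simps)
  also have "r * (r - 1) div 2 + r = Suc r * (Suc r - 1) div 2"
  proof -
    have "even (r * (r - 1))" by (cases r) auto
    moreover have "Suc r * (Suc r - 1) = r * (r - 1) + 2 * r" by (cases r) (auto simp: algebra_simps)
    ultimately show ?thesis by simp
  qed
  finally show ?case .
qed

text \<open>Both sides are moved by the operators $T_i$ in the same way, which reduces the claim to
  initial segments.\<close>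

lemma q_sqfree:
  assumes "m \<ge> 1" "S \<subseteq> {1..m}"
  shows "q_map m (sqfree S) = const (tvar ^ (card S * (card S - 1) div 2)) * sqfree S"
  using assms(2)
proof (induction "\<Sum>S" arbitrary: S rule: less_induct)
  case less
  have f: "finite S" using less.prems finite_subset by blast
  show ?case
  proof (cases "\<exists>i\<ge>1. i \<notin> S \<and> i + 1 \<in> S")
    case True
    then obtain i where i: "1 \<le> i" "i \<notin> S" "i + 1 \<in> S" by blast
    then have im: "i < m" using less.prems by auto
    define R where "R = S - {i + 1}"
    have R: "finite R" "i \<notin> R" "i + 1 \<notin> R" "S = insert (i + 1) R" using f i by (auto simp: R_def)
    \<comment> \<open>Lowering the element i + 1 to i decreases the sum of the elements. When no
      such gap exists, \<open>S\<close> is an initial segment.\<close>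
    define S' where "S' = insert i R"
    have S': "S' \<subseteq> {1..m}" using less.prems i(1) im R by (auto simp: S'_def)
    have c: "card S' = card S" using R by (simp add: S'_def)
    have eq: "app (Td m i) (sqfree S') = sqfree S"
      using Td_sqfree_shift[OF S' i(1) im] R by (simp add: S'_def)
    have "\<Sum>S' < \<Sum>S" using R by (simp add: S'_def)
    from less.hyps[OF this S'] have "q_map m (sqfree S) = app (Td m i) (const (tvar ^ (card S * (card S - 1) div 2)) * sqfree S')"
      unfolding eq[symmetric] c by (simp add: q_Td[OF i(1) im polys_laurent[OF sqfree_polys[OF S']]])
    then show ?thesis unfolding Td_app(2)[OF i(1) im] eq .
  next
    case False
    have down: "j \<in> S" if "j \<le> k" "k \<in> S" "1 \<le> j" for j k
      using that
    proof (induction k rule: dec_induct)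
      case (step n)
      then have "1 \<le> n" "n + 1 \<in> S" by auto
      then have "n \<in> S" using False by blast
      then show ?case using step by blast
    qed
    have "S = {1..card S}"
    proof (cases "S = {}")
      case False
      have "S = {1..Max S}"
      proof (intro Set.set_eqI iffI)
        show "j \<in> {1..Max S}" if "j \<in> S" for j using less.prems Max_ge[OF f that] that by auto
        show "j \<in> S" if "j \<in> {1..Max S}" for j
          using that by (intro down[of j "Max S"] Max_in f False) auto
      qed
      then have "card S = card {1..Max S}" by (rule arg_cong)
      then show ?thesis using \<open>S = {1..Max S}\<close> by simp
    qed simp
    moreover have "card S \<le> m" using card_mono[OF _ less.prems] by simp
    ultimately show ?thesis using q_initial[OF assms(1), of "card S"] by simp
  qed
qed

lemma elem_sym_apply: "m \<ge> 1 \<Longrightarrow> elem_sym r m = (\<Sum>S | S \<subseteq> {1..m} \<and> card S = r. sqfree S)"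
  by (simp add: elem_sym_def mk_family_def sqfree_def)

lemma q_inf_elem_sym: "q_inf (elem_sym r) = scale_family (tvar ^ (r * (r - 1) div 2)) (elem_sym r)"
proof
  fix m
  show "q_inf (elem_sym r) m = scale_family (tvar ^ (r * (r - 1) div 2)) (elem_sym r) m"
  proof (cases "m = 0")
    case True
    then show ?thesis by (simp add: q_inf_apply scale_family_def scale_def elem_sym_def mk_family_def)
  next
    case False
    then have m: "m \<ge> 1" by simp
    then show ?thesis
      using False by (simp add: q_inf_apply scale_family_def scale_def elem_sym_apply q_sum q_sqfree sum_distrib_left)
  qed
qed

lemma trunc_sqfree: "S \<subseteq> {1..m} \<Longrightarrow> trunc k (sqfree S) = (if S \<subseteq> {1..k} then sqfree S else 0)"
proof -
  assume S: "S \<subseteq> {1..m}"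
  then have "finite S" using finite_subset by blast
  then show ?thesis using S
  proof (induction S rule: finite_induct)
    case (insert i S)
    then show ?case using trunc_var[OF sqfree_polys[of S m], of i k] by (auto simp: sqfree_insert)
  qed (simp add: sqfree_def trunc_simps)
qed

lemma hc_sqfree: "S \<subseteq> {1..m} \<Longrightarrow> hc m d (sqfree S) = (if d = int (card S) then sqfree S else 0)"
proof -
  assume S: "S \<subseteq> {1..m}"
  then have "finite S" using finite_subset by blast
  then show ?thesis using S
  proof (induction S arbitrary: d rule: finite_induct)
    case (insert i S)
    then show ?case using hc_var[of i m d "sqfree S"] by (auto simp: sqfree_insert)
  qed (simp add: sqfree_def hc_one)
qed

lemma elem_sym_Lambda: "elem_sym r \<in> Lambda_qt"
proof -
  have fin: "finite {S. S \<subseteq> {1..m} \<and> card S = r}" for m :: nat by simp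
  have P: "elem_sym r m \<in> polys m" if "m \<ge> 1" for m
    unfolding elem_sym_apply[OF that] by (auto intro!: polys_sum sqfree_polys)
  have "trunc k (elem_sym r m) = elem_sym r k" if "0 < k" "k < m" for k m
  proof -
    have "trunc k (elem_sym r m) = (\<Sum>S | S \<subseteq> {1..m} \<and> card S = r. if S \<subseteq> {1..k} then sqfree S else 0)"
    proof -
      have m: "m \<ge> 1" using that by simp
      show ?thesis
        unfolding elem_sym_apply[OF m] trunc_simps by (intro sum.cong refl trunc_sqfree[of _ m]) blast
    qed
    also have "\<dots> = (\<Sum>S\<in>{S. S \<subseteq> {1..m} \<and> card S = r} \<inter> {S. S \<subseteq> {1..k}}. sqfree S)"
      using fin[of m] by (simp add: sum.inter_restrict)
    also have "{S. S \<subseteq> {1..m} \<and> card S = r} \<inter> {S. S \<subseteq> {1..k}} = {S. S \<subseteq> {1..k} \<and> card S = r}"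
      using that by auto
    finally show ?thesis using that by (simp add: elem_sym_apply)
  qed
  moreover have "bounded_family r (elem_sym r)"
    unfolding bounded_family_def
  proof (intro allI impI)
    fix m :: nat assume m: "m \<ge> 1"
    have "hc m (int d) (elem_sym r m) = (if d = r then elem_sym r m else 0)" for d
      unfolding elem_sym_apply[OF m] hc_simps by (cases "d = r") (auto simp: hc_sqfree)
    then show "elem_sym r m = (\<Sum>d\<le>r. hc m (int d) (elem_sym r m))" by simp
  qed
  moreover have "elem_sym r 0 = 0" by (simp add: elem_sym_def mk_family_def)
  ultimately have "elem_sym r \<in> polys_inf" using P unfolding polys_inf_iff by blast
  moreover have "elem_sym r m \<in> sym_polys m" if "m \<ge> 1" for m
  proof -
    have "psub m \<sigma> (elem_sym r m) = elem_sym r m" if \<sigma>: "\<sigma> permutes {1..m}" for \<sigma>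
    proof -
      have "psub m \<sigma> (elem_sym r m) = (\<Sum>S | S \<subseteq> {1..m} \<and> card S = r. sqfree (\<sigma> ` S))"
        using \<open>m \<ge> 1\<close> \<sigma> by (simp add: elem_sym_apply psub_simps psub_sqfree)
      also have "\<dots> = elem_sym r m"
        unfolding elem_sym_apply[OF \<open>m \<ge> 1\<close>]
      proof (rule sum.reindex_bij_witness[of _ "\<lambda>S. inv_into UNIV \<sigma> ` S" "\<lambda>S. \<sigma> ` S"])
        have inv: "inv_into UNIV \<sigma> permutes {1..m}" using \<sigma> by (rule permutes_inv)
        have c: "card (\<tau> ` S) = card S" "S \<subseteq> {1..m} \<Longrightarrow> \<tau> ` S \<subseteq> {1..m}" if "\<tau> permutes {1..m}" for \<tau> S
          using that permutes_image[OF that] by (auto intro: card_image permutes_inj_on)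
        fix S assume S: "S \<in> {S. S \<subseteq> {1..m} \<and> card S = r}"
        show "inv_into UNIV \<sigma> ` \<sigma> ` S = S" "\<sigma> ` inv_into UNIV \<sigma> ` S = S"
          using permutes_inverses[OF \<sigma>] by (simp_all add: image_image)
        show "\<sigma> ` S \<in> {S. S \<subseteq> {1..m} \<and> card S = r}" "inv_into UNIV \<sigma> ` S \<in> {S. S \<subseteq> {1..m} \<and> card S = r}"
          using S c[OF \<sigma>] c[OF inv] by auto
      qed simp
      finally show ?thesis .
    qed
    then show ?thesis using P[OF that] subst_psub[OF polys_laurent[OF P[OF that]]] by (simp add: sym_polys_def)
  qed
  ultimately show ?thesis by (simp add: Lambda_iff)
qed

lemma one_family: "one_family = elem_sym 0"
proof
  fix m :: nat
  have "S = {}" if "S \<subseteq> {1..m}" "card S = 0" for S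
    using that finite_subset[OF that(1) finite_atLeastAtMost] by simp
  then have "{S. S \<subseteq> {1..m} \<and> card S = 0} = {{}}" by auto
  then show "one_family m = elem_sym 0 m" by (simp add: one_family_def elem_sym_def mk_family_def)
qed

lemma scale_family_simps:
  "scale_family c F * G = scale_family c (F * G)" "F * scale_family c G = scale_family c (F * G)"
  "scale_family c (scale_family d F) = scale_family (c * d) F" "scale_family 1 F = F"
  unfolding scale_family_def scale_def
  by (rule ext, simp only: times_fun_def mult.assoc, rule ext, simp only: times_fun_def mult.left_commute,
    rule ext, simp only: const_simps(1) mult.assoc, simp only: const_simps mult_1_left)

lemma star_scale:
  assumes "F \<in> polys_inf" "G \<in> polys_inf"
  shows "scale_family c F \<star> scale_family d G = scale_family (c * d) (F \<star> G)"
proof -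
  obtain f g where fg: "f \<in> polys_inf" "F = q_inf f" "g \<in> polys_inf" "G = q_inf g"
    using assms q_inf_surj by metis
  then have "scale_family c F \<star> scale_family d G = q_inf (scale_family c f * scale_family d g)"
    by (simp add: star_q_inf q_inf_scale[symmetric] polys_inf_scale)
  also have "\<dots> = scale_family (c * d) (F \<star> G)"
    using fg by (simp add: star_q_inf scale_family_simps q_inf_scale mult.commute[of c d])
  finally show ?thesis .
qed

lemma elem_sym_list_simps: "elem_sym_list [] = one_family" "elem_sym_list (r # \<nu>) = elem_sym r * elem_sym_list \<nu>"
  "elem_sym_qt [] = one_family" "elem_sym_qt (r # \<nu>) = elem_sym r \<star> elem_sym_qt \<nu>"
  by (simp_all add: elem_sym_list_def elem_sym_qt_def)

lemma elem_sym_list_Lambda: "elem_sym_list \<nu> \<in> Lambda_qt" "elem_sym_qt \<nu> \<in> Lambda_qt"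
  by (induction \<nu>) (simp_all add: elem_sym_list_simps one_family elem_sym_Lambda Lambda_mult star_Lambda)

text \<open>Since q turns products into star products, the scalars from
  \<open>q_inf_elem_sym\<close> multiply factor by factor.\<close>

lemma q_inf_elem_sym_list:
  "q_inf (elem_sym_list \<nu>) = scale_family (tvar ^ (\<Sum>r\<leftarrow>\<nu>. r * (r - 1) div 2)) (elem_sym_qt \<nu>)"
proof (induction \<nu>)
  case Nil
  then show ?case using q_inf_elem_sym[of 0] by (simp add: elem_sym_list_simps one_family)
next
  case (Cons r \<nu>)
  have P: "elem_sym r \<in> polys_inf" "elem_sym_list \<nu> \<in> polys_inf" "elem_sym_qt \<nu> \<in> polys_inf"
    using elem_sym_Lambda elem_sym_list_Lambda by (simp_all add: Lambda_iff)
  have "q_inf (elem_sym_list (r # \<nu>)) = q_inf (elem_sym r) \<star> q_inf (elem_sym_list \<nu>)"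
    unfolding elem_sym_list_simps star_q_inf[OF P(1,2)] ..
  then show ?case
    unfolding Cons.IH q_inf_elem_sym star_scale[OF P(1,3)] elem_sym_list_simps
    by (simp only: list.map sum_list.Cons power_add)
qed

section \<open>The four assertions together\<close>

theorem theorem2:
  shows
    "((\<forall>m\<ge>1. linear_iso scale (laurent m) (laurent m) (q_map m)) \<and>
      (\<forall>m m' F. 0 < m' \<and> m' < m \<and> F \<in> polys m \<longrightarrow>
         q_map m F \<in> polys m \<and> q_map m' (trunc m' F) = trunc m' (q_map m F)) \<and>
      linear_iso scale_family polys_inf polys_inf q_inf)
    \<and>
     ((\<forall>F\<in>polys_inf. \<forall>G\<in>polys_inf. F \<star> G \<in> polys_inf \<and> F \<star> G = G \<star> F) \<and>
      (\<forall>F\<in>polys_inf. \<forall>G\<in>polys_inf. \<forall>H\<in>polys_inf. (F \<star> G) \<star> H = F \<star> (G \<star> H)) \<and>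
      (\<forall>F\<in>Lambda_qt. \<forall>G\<in>Lambda_qt. F \<star> G \<in> Lambda_qt) \<and>
      (\<forall>F\<in>polys_inf. \<forall>G\<in>polys_inf.
         regular_family F \<and> regular_family G \<and> (F \<in> Lambda_qt \<or> G \<in> Lambda_qt) \<longrightarrow>
         regular_family (F \<star> G) \<and>
         family_at_q1 (F \<star> G) = family_at_q1 F * family_at_q1 G))
    \<and>
     (\<forall>n. \<forall>e\<in>EE n.
        chromatic {1..n} (ui_edges n e) \<in> polys_inf \<and>
        X_graph n e = q_inf (chromatic {1..n} (ui_edges n e)))
    \<and>
     (\<forall>\<nu>. is_partition \<nu> \<longrightarrow>
        elem_sym_qt \<nu> \<in> Lambda_qt \<and>
        q_inf (elem_sym_list \<nu>) =
          scale_family (tvar ^ (\<Sum>r\<leftarrow>\<nu>. r * (r - 1) div 2)) (elem_sym_qt \<nu>))"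
proof (intro conjI allI ballI impI)
  show "linear_iso scale (laurent m) (laurent m) (q_map m)" if "m \<ge> 1" for m
    using that by (rule q_laurent_iso)
  show "q_map m F \<in> polys m" "q_map k (trunc k F) = trunc k (q_map m F)"
    if "0 < k \<and> k < m \<and> F \<in> polys m" for m k F
    using that q_polys[of m F] trunc_q[of k m F] by simp_all
  show "linear_iso scale_family polys_inf polys_inf q_inf" by (rule q_inf_iso)
  show "F \<star> G \<in> polys_inf" "F \<star> G = G \<star> F" if "F \<in> polys_inf" "G \<in> polys_inf" for F G
    by (rule star_closed[OF that], rule star_commute[OF that])
  show "(F \<star> G) \<star> H = F \<star> (G \<star> H)" if "F \<in> polys_inf" "G \<in> polys_inf" "H \<in> polys_inf" for F G H
    by (rule star_assoc[OF that])
  show "F \<star> G \<in> Lambda_qt" if "F \<in> Lambda_qt" "G \<in> Lambda_qt" for F G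
    by (rule star_Lambda[OF that])
  have at_q1: "regular_family (F \<star> G) \<and> family_at_q1 (F \<star> G) = family_at_q1 F * family_at_q1 G"
    if "F \<in> polys_inf" "G \<in> polys_inf" "regular_family F" "regular_family G" "F \<in> Lambda_qt \<or> G \<in> Lambda_qt" for F G
    using that(5)
  proof
    \<comment> \<open>The specialisation result has the symmetric factor on the left; this case
      follows by commutativity of both products.\<close>
    assume "G \<in> Lambda_qt"
    from star_at_q1[OF this that(4,1,3)] show ?thesis
      unfolding star_commute[OF that(2,1)] family_mult_commute[of "family_at_q1 G"] .
  qed (rule star_at_q1[OF _ that(3,2,4)])
  show "regular_family (F \<star> G)" "family_at_q1 (F \<star> G) = family_at_q1 F * family_at_q1 G"
    if "F \<in> polys_inf" "G \<in> polys_inf" "regular_family F \<and> regular_family G \<and> (F \<in> Lambda_qt \<or> G \<in> Lambda_qt)" for F G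
    using at_q1[OF that(1,2)] that(3) by blast+
  show "chromatic {1..n} (ui_edges n e) \<in> polys_inf" "X_graph n e = q_inf (chromatic {1..n} (ui_edges n e))"
    if "e \<in> EE n" for n e
    by (rule chromatic_polys_inf[OF that], rule X_graph_eq[OF that])
  show "elem_sym_qt \<nu> \<in> Lambda_qt"
    "q_inf (elem_sym_list \<nu>) = scale_family (tvar ^ (\<Sum>r\<leftarrow>\<nu>. r * (r - 1) div 2)) (elem_sym_qt \<nu>)" for \<nu>
    by (rule elem_sym_list_Lambda, rule q_inf_elem_sym_list)
qed

end
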